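(* There exists an $O(m^{3/2}n^{3})$-time algorithm which decides, for an input claw-free graph $G$ with $n$ vertices and $m$ edges, whether $G\in\mathbf{W_2}$.
   Context: Graphs are finite, simple, undirected. A graph is claw-free if it has no induced $K_{1,3}$. A set is independent if its vertices are pairwise nonadjacent; maximum if no independent set is larger. $G\in\mathbf{W_2}$ if every two disjoint independent sets of $G$ are contained in two disjoint maximum independent sets of $G$. *)

theory Defs
  imports Complex_Main
begin

section \<open>Graphs\<close>

text \<open>A finite simple undirected graph is given by its vertex set \<open>V\<close> and its set \<open>E\<close> of
  two-element edges.\<close>

definition simple_graph :: "'a set \<Rightarrow> 'a set set \<Rightarrow> bool" where
  "simple_graph V E \<longleftrightarrow> finite V \<and> (\<forall>e\<in>E. e \<subseteq> V \<and> card e = 2)"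

definition has_induced_copy :: "'a set \<Rightarrow> 'a set set \<Rightarrow> 'b set \<Rightarrow> 'b set set \<Rightarrow> bool" where
  "has_induced_copy V E V' E' \<longleftrightarrow>
     (\<exists>f. inj_on f V' \<and> f ` V' \<subseteq> V \<and> (\<forall>x\<in>V'. \<forall>y\<in>V'. {f x, f y} \<in> E \<longleftrightarrow> {x, y} \<in> E'))"

text \<open>The claw is the complete bipartite graph \<open>K\<^sub>1\<^sub>,\<^sub>3\<close>, here with centre \<open>0\<close>.\<close>

definition claw_free :: "'a set \<Rightarrow> 'a set set \<Rightarrow> bool" where
  "claw_free V E \<longleftrightarrow>
     \<not> has_induced_copy V E {0, 1, 2, 3 :: nat} {{0, 1}, {0, 2}, {0, 3}}"

definition independent_set :: "'a set \<Rightarrow> 'a set set \<Rightarrow> 'a set \<Rightarrow> bool" where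
  "independent_set V E S \<longleftrightarrow> S \<subseteq> V \<and> (\<forall>x\<in>S. \<forall>y\<in>S. {x, y} \<notin> E)"

definition maximum_independent_set :: "'a set \<Rightarrow> 'a set set \<Rightarrow> 'a set \<Rightarrow> bool" where
  "maximum_independent_set V E S \<longleftrightarrow>
     independent_set V E S \<and> (\<forall>T. independent_set V E T \<longrightarrow> card T \<le> card S)"

definition W2 :: "'a set \<Rightarrow> 'a set set \<Rightarrow> bool" where
  "W2 V E \<longleftrightarrow>
     (\<forall>A B. independent_set V E A \<and> independent_set V E B \<and> A \<inter> B = {} \<longrightarrow>
        (\<exists>S T. maximum_independent_set V E S \<and> maximum_independent_set V E T \<and>
               A \<subseteq> S \<and> B \<subseteq> T \<and> S \<inter> T = {}))"

section \<open>Word RAM\<close>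

text \<open>The machine model is a unit-cost random access machine with bounded words, programmed with
  structured control flow. A state consists of registers and of a random access memory. Every
  elementary instruction and every evaluation of a test takes one time unit.\<close>

type_synonym reg = nat
type_synonym state = "(reg \<Rightarrow> nat) \<times> (nat \<Rightarrow> nat)"

datatype binop = Plus | Minus | Times | Div

datatype test = Less reg reg | Equal reg reg

datatype com =
    Skip
  | SetConst reg nat
  | Arith binop reg reg reg
  | Load reg reg
  | Store reg reg
  | Seq com com
  | Cond test com com
  | While test com

text \<open>\<open>Minus\<close> is truncated subtraction, and division by \<open>0\<close> yields \<open>0\<close>.\<close>

fun eval_op :: "binop \<Rightarrow> nat \<Rightarrow> nat \<Rightarrow> nat" where
  "eval_op Plus a b = a + b"
| "eval_op Minus a b = a - b"
| "eval_op Times a b = a * b"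
| "eval_op Div a b = a div b"

fun holds :: "test \<Rightarrow> state \<Rightarrow> bool" where
  "holds (Less x y) (R, M) \<longleftrightarrow> R x < R y"
| "holds (Equal x y) (R, M) \<longleftrightarrow> R x = R y"

text \<open>\<open>exec w p s t s'\<close>: with words ranging over \<open>{..<w}\<close>, the program \<open>p\<close> started in \<open>s\<close>
  terminates in \<open>s'\<close> after exactly \<open>t\<close> time units. An instruction whose result or whose memory
  address is not a word has no transition, so a program that overflows has no terminating run at
  all; hence unbounded integers cannot be used to do unbounded work in one time unit.\<close>

inductive exec :: "nat \<Rightarrow> com \<Rightarrow> state \<Rightarrow> nat \<Rightarrow> state \<Rightarrow> bool" for w :: nat where
  Skip: "exec w Skip s 1 s"
| SetConst: "a < w \<Longrightarrow> exec w (SetConst x a) (R, M) 1 (R(x := a), M)"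
| Arith: "eval_op f (R y) (R z) < w \<Longrightarrow>
    exec w (Arith f x y z) (R, M) 1 (R(x := eval_op f (R y) (R z)), M)"
| Load: "R y < w \<Longrightarrow> M (R y) < w \<Longrightarrow> exec w (Load x y) (R, M) 1 (R(x := M (R y)), M)"
| Store: "R x < w \<Longrightarrow> R y < w \<Longrightarrow> exec w (Store x y) (R, M) 1 (R, M(R x := R y))"
| Seq: "exec w p s t s' \<Longrightarrow> exec w q s' u s'' \<Longrightarrow> exec w (Seq p q) s (t + u) s''"
| CondTrue: "holds b s \<Longrightarrow> exec w p s t s' \<Longrightarrow> exec w (Cond b p q) s (Suc t) s'"
| CondFalse: "\<not> holds b s \<Longrightarrow> exec w q s t s' \<Longrightarrow> exec w (Cond b p q) s (Suc t) s'"
| WhileFalse: "\<not> holds b s \<Longrightarrow> exec w (While b p) s 1 s"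
| WhileTrue: "holds b s \<Longrightarrow> exec w p s t s' \<Longrightarrow> exec w (While b p) s' u s'' \<Longrightarrow>
    exec w (While b p) s (Suc (t + u)) s''"

inductive_cases SkipE: "exec w Skip s t s'"
inductive_cases SetConstE: "exec w (SetConst x a) s t s'"
inductive_cases ArithE: "exec w (Arith f x y z) s t s'"
inductive_cases LoadE: "exec w (Load x y) s t s'"
inductive_cases StoreE: "exec w (Store x y) s t s'"
inductive_cases SeqE: "exec w (Seq p q) s t s'"
inductive_cases CondE: "exec w (Cond b p q) s t s'"
inductive_cases WhileE: "exec w (While b p) s t s'"

text \<open>The machine is deterministic, so a program has at most one run on a given input.\<close>

lemma exec_deterministic:
  "exec w p s t s' \<Longrightarrow> exec w p s u s'' \<Longrightarrow> u = t \<and> s'' = s'"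
proof (induction arbitrary: u s'' rule: exec.induct)
  case (Skip s)
  from Skip.prems show ?case by (rule SkipE) simp
next
  case (SetConst a x R M)
  from SetConst.prems show ?case by (rule SetConstE) simp
next
  case (Arith f R y z x M)
  from Arith.prems show ?case by (rule ArithE) simp
next
  case (Load R y M x)
  from Load.prems show ?case by (rule LoadE) simp
next
  case (Store R x y M)
  from Store.prems show ?case by (rule StoreE) simp
next
  case (Seq p s t1 s1 q t2 s2)
  from Seq.prems show ?case
    by (rule SeqE) (metis Seq.IH)
next
  case (CondTrue b s p t s' q)
  from CondTrue.prems show ?case
    by (rule CondE) (metis CondTrue.IH CondTrue.hyps(1))+
next
  case (CondFalse b s q t s' p)
  from CondFalse.prems show ?case
    by (rule CondE) (metis CondFalse.IH CondFalse.hyps(1))+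
next
  case (WhileFalse b s p)
  from WhileFalse.prems show ?case
    by (rule WhileE) (use WhileFalse.hyps in simp_all)
next
  case (WhileTrue b s p t1 s1 t2 s2)
  from WhileTrue.prems show ?case
    by (rule WhileE) (metis WhileTrue.IH WhileTrue.hyps(1))+
qed

text \<open>A graph with vertex set \<open>{..<n}\<close> is input as its adjacency matrix, stored row by row in the
  memory cells \<open>0, \<dots>, n\<^sup>2 - 1\<close>, with \<open>n\<close> in register \<open>0\<close> and \<open>0\<close> everywhere else.\<close>

definition adjacency_input :: "nat \<Rightarrow> nat set set \<Rightarrow> state" where
  "adjacency_input n E =
     ((\<lambda>_. 0)(0 := n), \<lambda>i. if i < n * n \<and> {i div n, i mod n} \<in> E then 1 else 0)"

text \<open>\<open>runs_on k p n E t a\<close>: with words of \<open>k log(n + 2)\<close> bits, \<open>p\<close> halts on the given graph after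
  \<open>t\<close> time units and leaves the answer \<open>a\<close>, coded as \<open>1\<close> for yes and \<open>0\<close> for no, in register \<open>0\<close>.\<close>

definition runs_on :: "nat \<Rightarrow> com \<Rightarrow> nat \<Rightarrow> nat set set \<Rightarrow> nat \<Rightarrow> bool \<Rightarrow> bool" where
  "runs_on k p n E t a \<longleftrightarrow>
     (\<exists>R M. exec ((n + 2) ^ k) p (adjacency_input n E) t (R, M) \<and> R 0 = of_bool a)"

text \<open>\<open>decides_in_bigo p P Q f\<close>: on every graph satisfying the promise \<open>P\<close>, the program \<open>p\<close>
  correctly answers whether \<open>Q\<close> holds, within time \<open>O(f n m)\<close> for \<open>n\<close> vertices and \<open>m\<close> edges.
  The bound holds for all inputs with at least one edge, not just for large \<open>n\<close> and \<open>m\<close>. The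
  maxima only matter for edgeless graphs, where a bound such as \<open>m n\<close> is \<open>0\<close> and cannot be met
  literally; there \<open>m\<close> (and \<open>n\<close>, if it is \<open>0\<close>) is replaced by \<open>1\<close>. Neither the constant \<open>c\<close> nor
  the word length factor \<open>k\<close> depends on the graph.\<close>

definition decides_in_bigo ::
  "com \<Rightarrow> (nat set \<Rightarrow> nat set set \<Rightarrow> bool) \<Rightarrow> (nat set \<Rightarrow> nat set set \<Rightarrow> bool) \<Rightarrow>
   (nat \<Rightarrow> nat \<Rightarrow> real) \<Rightarrow> bool" where
  "decides_in_bigo p P Q f \<longleftrightarrow>
     (\<exists>(c::real) k. \<forall>n E. simple_graph {..<n} E \<and> P {..<n} E \<longrightarrow>
        (\<exists>t. runs_on k p n E t (Q {..<n} E) \<and>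
             real t \<le> c * f (max 1 n) (max 1 (card E))))"

end

theory Submission
  imports Defs
begin

text \<open>Comparing two maximal independent sets with an extremal intersection shows that a claw-free graph is
  not in \<open>W\<^sub>2\<close> iff some independent set \<open>J\<close> avoids \<open>N[s]\<close> and dominates \<open>N(s)\<close>, for a vertex \<open>s\<close>, or avoids
  \<open>N[s, t\<^sub>1, t\<^sub>2]\<close> and dominates \<open>(N(t\<^sub>1) \<union> N(t\<^sub>2)) - N[s]\<close>, for an induced path \<open>t\<^sub>1, s, t\<^sub>2\<close>. Such a \<open>J\<close> is built
  by covering the elements one after the other. Claw-freeness lets every candidate outside the current
  independent set \<open>I\<close> have at most two neighbours in \<open>I\<close>; a further element is covered by exchanging one or two
  vertices directly or else along an augmenting path, in the graph in which every \<open>i \<in> I\<close> is split into two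
  mated nodes and the vertices with two neighbours in \<open>I\<close> are the edges. The path is found by an alternating
  search with blossoms, as in Edmonds' matching algorithm; one element takes quadratic time, one instance cubic time.
  Claw-freeness also gives \<open>deg(v)\<^sup>2 \<le> 18 m\<close>, so there are \<open>O(m\<^sup>3\<^sup>/\<^sup>2)\<close> induced paths, and \<open>n \<le> 2 m\<close> unless there
  is an isolated vertex \<open>s\<close>, in which case \<open>J = {}\<close> is a witness.\<close>

section \<open>Independent covers\<close>

text \<open>The obstacle: whether two vertices may enter the independent set together is a question
  about pairs of vertices, while an augmenting path only knows nodes and edges. The way out is to
  record how a vertex \<open>w\<close> with neighbours \<open>i\<close>, \<open>u\<close> in
  \<open>I\<close> meets \<open>A i\<close>. If two nonadjacent vertices can share
  \<open>A i\<close>, all traces \<open>A w \<inter> A i\<close> that matter are the two parts of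
  one partition of \<open>A i\<close> (\<open>same_split_mid\<close>,
  \<open>same_split_full\<close>), and these parts are the mated nodes of \<open>i\<close>. Opposite
  parts force nonadjacency (\<open>opposite_nonadj\<close>), so the edges of a path can be realised
  by vertices chosen independently of each other; only the last one needs care
  (\<open>fin_transfer\<close>).

  The converse is not drawn from a theorem on matchings: a search that is stuck is played directly
  against a hypothetical cover (\<open>no_cover\<close>).

  The quadratic bound for a search rests on blossom steps of linear cost, although each may create
  paths to linearly many nodes: all of these paths are prefixes of two sequences, which are stored
  once and shared.\<close>

locale cover_instance =
  fixes W :: "nat set" and adj :: "nat \<Rightarrow> nat \<Rightarrow> bool" and A :: "nat \<Rightarrow> nat set"
  assumes fin_W: "finite W"
    and sym: "adj v w \<Longrightarrow> adj w v"
    and irrefl: "\<not> adj v v"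
    and A_ne: "w \<in> W \<Longrightarrow> A w \<noteq> {}"
    and shared: "v \<in> W \<Longrightarrow> w \<in> W \<Longrightarrow> x \<in> A v \<Longrightarrow> x \<in> A w \<Longrightarrow> v = w \<or> adj v w"
    and split: "w \<in> W \<Longrightarrow> v \<in> W \<Longrightarrow> v' \<in> W \<Longrightarrow> adj w v \<Longrightarrow> adj w v' \<Longrightarrow> v \<noteq> v' \<Longrightarrow> \<not> adj v v'
      \<Longrightarrow> A w \<subseteq> A v \<union> A v'"
begin

definition indep :: "nat set \<Rightarrow> bool" where
  "indep I \<longleftrightarrow> I \<subseteq> W \<and> (\<forall>v\<in>I. \<forall>w\<in>I. \<not> adj v w)"

lemma indep_disjoint: "indep I \<Longrightarrow> v \<in> I \<Longrightarrow> w \<in> I \<Longrightarrow> x \<in> A v \<Longrightarrow> x \<in> A w \<Longrightarrow> v = w"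
  unfolding indep_def using shared by blast

lemma adj_sym: "adj v w \<longleftrightarrow> adj w v"
  using sym by blast

lemma miss_clique:
  "w \<in> W \<Longrightarrow> u \<in> W \<Longrightarrow> y \<in> W \<Longrightarrow> adj w u \<Longrightarrow> adj w y \<Longrightarrow> z \<in> A w \<Longrightarrow> z \<notin> A u \<Longrightarrow> z \<notin> A y
   \<Longrightarrow> u = y \<or> adj u y"
  using split by blast

text \<open>By \<open>split\<close>, every element of \<open>A w\<close> would lie in two of the
  three pairwise disjoint sets \<open>A i\<close>, \<open>A j\<close>, \<open>A k\<close>; but
  \<open>A w\<close> is nonempty.\<close>

lemma no_three:
  assumes "indep I" "w \<in> W" "i \<in> I" "j \<in> I" "k \<in> I" "adj w i" "adj w j" "adj w k"
  shows "i = j \<or> i = k \<or> j = k"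
proof (rule ccontr)
  assume ne: "\<not> ?thesis"
  have IW: "i \<in> W" "j \<in> W" "k \<in> W" and na: "\<not> adj i j" "\<not> adj i k" "\<not> adj j k"
    using assms unfolding indep_def by blast+
  obtain z where z: "z \<in> A w" using A_ne assms(2) by blast
  have "A w \<subseteq> A i \<union> A j" "A w \<subseteq> A i \<union> A k" "A w \<subseteq> A j \<union> A k"
    using split assms IW na ne by metis+
  with z show False using indep_disjoint[OF assms(1)] assms ne by blast
qed

end

section \<open>Traces of exchange candidates on a vertex of the current independent set\<close>

locale cover_phase = cover_instance +
  fixes I :: "nat set" and x0 :: nat
  assumes indep_I: "indep I" and x0_uncovered: "i \<in> I \<Longrightarrow> x0 \<notin> A i"
begin

definition single :: "nat \<Rightarrow> nat \<Rightarrow> bool" where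
  "single w i \<longleftrightarrow> w \<in> W \<and> {j \<in> I. adj w j} = {i}"

definition mid :: "nat \<Rightarrow> nat \<Rightarrow> nat \<Rightarrow> bool" where
  "mid w i u \<longleftrightarrow> w \<in> W \<and> {j \<in> I. adj w j} = {i, u} \<and> i \<noteq> u"

text \<open>By \<open>compl\<close> such \<open>w\<close> and \<open>v\<close> have complementary
  traces on \<open>A i\<close>: together they can take over the role of \<open>i\<close>, and each
  passes the conflict on to a different further vertex of \<open>I\<close>.\<close>

definition perp :: "nat \<Rightarrow> nat \<Rightarrow> nat \<Rightarrow> bool" where
  "perp i w v \<longleftrightarrow> (\<exists>u u'. mid w i u \<and> mid v i u' \<and> u \<noteq> u' \<and> w \<noteq> v \<and> \<not> adj w v)"

text \<open>A path may start with \<open>w\<close> at \<open>i\<close>: some \<open>j\<close> that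
  covers the new element and has no other neighbour in \<open>I\<close> replaces \<open>i\<close>
  together with \<open>w\<close>.\<close>

definition st :: "nat \<Rightarrow> nat \<Rightarrow> bool" where
  "st w i \<longleftrightarrow> (\<exists>j. single j i \<and> x0 \<in> A j \<and> \<not> adj j w)"

text \<open>A path may end with \<open>w\<close> at \<open>i\<close>: either \<open>w\<close> covers
  \<open>A i\<close> alone, or it shares \<open>A i\<close> with a \<open>v\<close> that has no
  other neighbour in \<open>I\<close>. Demanding \<open>x0 \<notin> A v\<close> keeps
  \<open>v\<close> nonadjacent to the start vertex at the other end of the path.\<close>

definition fin :: "nat \<Rightarrow> nat \<Rightarrow> bool" where
  "fin w i \<longleftrightarrow> A i \<subseteq> A w \<or> (\<exists>v. single v i \<and> x0 \<notin> A v \<and> \<not> adj v w)"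

abbreviation tr :: "nat \<Rightarrow> nat \<Rightarrow> nat set" where
  "tr w i \<equiv> A w \<inter> A i"

lemma I_W: "i \<in> I \<Longrightarrow> i \<in> W"
  using indep_I unfolding indep_def by blast

lemma I_nonadj: "i \<in> I \<Longrightarrow> j \<in> I \<Longrightarrow> \<not> adj i j"
  using indep_I unfolding indep_def by blast

lemma I_disjoint: "i \<in> I \<Longrightarrow> j \<in> I \<Longrightarrow> x \<in> A i \<Longrightarrow> x \<in> A j \<Longrightarrow> i = j"
  using indep_disjoint[OF indep_I] by blast

lemma singleD:
  assumes "single w i"
  shows "w \<in> W" "i \<in> I" "i \<in> W" "adj w i" "adj i w" "w \<notin> I" "w \<noteq> i" "j \<in> I \<Longrightarrow> adj w j \<Longrightarrow> j = i"
proof -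
  have *: "w \<in> W" "{j \<in> I. adj w j} = {i}" using assms unfolding single_def by auto
  then have "i \<in> I" "adj w i" by blast+
  then show "w \<in> W" "i \<in> I" "i \<in> W" "adj w i" "adj i w" "w \<notin> I" "w \<noteq> i"
    using * I_W I_nonadj sym by blast+
  show "j \<in> I \<Longrightarrow> adj w j \<Longrightarrow> j = i" using * by blast
qed

lemma mid_sym: "mid w i u \<longleftrightarrow> mid w u i"
  unfolding mid_def by (auto simp: insert_commute)

lemma midD:
  assumes "mid w i u"
  shows "w \<in> W" "i \<in> I" "i \<in> W" "u \<in> I" "u \<in> W" "adj w i" "adj i w" "adj w u" "adj u w" "w \<notin> I" "i \<noteq> u" "w \<noteq> i" "w \<noteq> u"
    "j \<in> I \<Longrightarrow> adj w j \<Longrightarrow> j = i \<or> j = u"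
proof -
  have *: "w \<in> W" "{j \<in> I. adj w j} = {i, u}" "i \<noteq> u" using assms unfolding mid_def by auto
  then have "i \<in> I" "adj w i" "u \<in> I" "adj w u" by blast+
  then show "w \<in> W" "i \<in> I" "i \<in> W" "u \<in> I" "u \<in> W" "adj w i" "adj i w" "adj w u" "adj u w" "w \<notin> I" "i \<noteq> u" "w \<noteq> i" "w \<noteq> u"
    using * I_W I_nonadj sym by blast+
  show "j \<in> I \<Longrightarrow> adj w j \<Longrightarrow> j = i \<or> j = u" using * by blast
qed

lemma mid_unique: "mid w i u \<Longrightarrow> mid w i u' \<Longrightarrow> u = u'"
  unfolding mid_def by (auto simp: doubleton_eq_iff)

lemma mid_split: "mid w i u \<Longrightarrow> A w \<subseteq> A i \<union> A u"
  using split[of w i u] midD[of w i u] I_nonadj by blast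

lemma mid_x0: "mid w i u \<Longrightarrow> x0 \<notin> A w"
  using mid_split midD(2,4) x0_uncovered by blast

text \<open>If \<open>y\<close> met neither end, \<open>split\<close> would put \<open>A w\<close>
  inside both \<open>A y \<union> A i\<close> and \<open>A y \<union> A u\<close>. As
  \<open>A w\<close> lies in the disjoint union of \<open>A i\<close> and \<open>A u\<close>, the
  set \<open>A y\<close> would share an element with one of them, and \<open>shared\<close> yields
  an adjacency after all.\<close>

lemma mid_meets: "mid w i u \<Longrightarrow> y \<in> W \<Longrightarrow> adj w y \<Longrightarrow> y = i \<or> y = u \<or> adj y i \<or> adj y u"
proof (rule ccontr)
  assume a: "mid w i u" "y \<in> W" "adj w y" and n: "\<not> (y = i \<or> y = u \<or> adj y i \<or> adj y u)"
  note m = midD[OF a(1)]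
  have 1: "A w \<subseteq> A y \<union> A i" using split[of w y i] m a n by metis
  have 2: "A w \<subseteq> A y \<union> A u" using split[of w y u] m a n by metis
  obtain z where z: "z \<in> A w" using A_ne m by blast
  have "z \<in> A i \<or> z \<in> A u" using mid_split a z by blast
  then have "z \<in> A y" using 1 2 z I_disjoint[of i u z] m by blast
  then show False using \<open>z \<in> A i \<or> z \<in> A u\<close> shared[of y i z] shared[of y u z] m a n by metis
qed

text \<open>\<open>split\<close> at \<open>i\<close> makes \<open>A w\<close> and \<open>A v\<close>
  cover \<open>A i\<close>; \<open>shared\<close> makes them disjoint.\<close>

lemma compl: "i \<in> W \<Longrightarrow> w \<in> W \<Longrightarrow> v \<in> W \<Longrightarrow> adj w i \<Longrightarrow> adj v i \<Longrightarrow> w \<noteq> v \<Longrightarrow> \<not> adj w v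
   \<Longrightarrow> tr v i = A i - tr w i"
  using split[of i w v] shared[of w v] adj_sym by blast

text \<open>Two neighbours of \<open>w\<close> that both miss an element of \<open>A w\<close> are
  equal or adjacent. Here \<open>y\<close> misses \<open>z\<close> by assumption, and
  \<open>u\<close> misses it because it would otherwise share \<open>z\<close> with
  \<open>i\<close>.\<close>

lemma inherit:
  assumes "w \<in> W" "y \<in> W" "i \<in> W" "u \<in> W" "adj w y" "z \<in> A w" "z \<in> A i" "z \<notin> A y" "adj w u" "\<not> adj u i" "u \<noteq> i"
  shows "u = y \<or> adj y u"
  using assms miss_clique[of w u y z] shared[of u i z] adj_sym by blast

lemma inherit_mid:
  assumes "mid w i u" "y \<in> W" "adj w y" "z \<in> A w" "z \<in> A i" "z \<notin> A y" "y \<notin> I"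
  shows "adj y u"
  using inherit[of w y i u z] midD[OF assms(1)] assms I_nonadj by metis

text \<open>Suppose the partitions of \<open>A i\<close> given by \<open>p\<close>, \<open>q\<close>
  and by \<open>w\<close>, \<open>v\<close> differ. Then all cross pairs are adjacent, and by
  \<open>inherit_mid\<close> a trace not contained in another one drags its outer neighbour in
  \<open>I\<close> along. Both \<open>w\<close> and \<open>v\<close> cannot see the same outer
  neighbour, nor can both \<open>p\<close> and \<open>q\<close>, so each part of the first partition
  lies in a part of the second.\<close>

lemma same_split_mid:
  assumes pq: "perp i p q" and w: "mid w i uw" and v: "v \<in> W" "adj v i" "v \<notin> I" "\<not> adj v uw"
    and wv: "w \<noteq> v" "\<not> adj w v"
  shows "tr w i = tr p i \<or> tr w i = tr q i"
proof (rule ccontr)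
  assume n: "\<not> ?thesis"
  obtain up uq where p: "mid p i up" and q: "mid q i uq" and ne: "up \<noteq> uq" "p \<noteq> q" "\<not> adj p q"
    using pq unfolding perp_def by blast
  note P = midD[OF p] and Q = midD[OF q] and Wm = midD[OF w]
  have cq: "tr q i = A i - tr p i" using compl[of i p q] P Q ne by blast
  have cv: "tr v i = A i - tr w i" using compl[of i w v] Wm v wv by blast
  have Ane: "A i \<noteq> {}" using A_ne P(3) by blast
  \<comment> \<open>A nonadjacent cross pair would have complementary traces by
    \<open>compl\<close>, an equal one the same trace; in both cases the trace of \<open>w\<close>
    would be that of \<open>p\<close> or of \<open>q\<close>.\<close>
  have cross: "x \<noteq> y \<and> adj x y" if "x \<in> {p, q}" "y \<in> {w, v}" for x y
  proof -
    have "tr x i \<noteq> tr y i" "tr y i \<noteq> A i - tr x i" using n cq cv that Ane by auto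
    moreover have "x \<in> W" "y \<in> W" "adj x i" "adj y i" using that P Q Wm v by auto
    ultimately show ?thesis using compl[of i x y] P(3) by blast
  qed
  have upw: "adj w up" if "\<not> tr p i \<subseteq> tr w i" using that inherit_mid[OF p, of w] cross[of p w] Wm by auto
  have upv: "adj v up" if "\<not> tr p i \<subseteq> tr v i" using that inherit_mid[OF p, of v] cross[of p v] v by auto
  have uqw: "adj w uq" if "\<not> tr q i \<subseteq> tr w i" using that inherit_mid[OF q, of w] cross[of q w] Wm by auto
  have uqv: "adj v uq" if "\<not> tr q i \<subseteq> tr v i" using that inherit_mid[OF q, of v] cross[of q v] v by auto
  have 1: "tr p i \<subseteq> tr w i \<or> tr p i \<subseteq> tr v i"
  proof (rule ccontr)
    assume "\<not> ?thesis"
    then have "adj w up" "adj v up" using upw upv by auto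
    then have "up = uw" using Wm(14) P by blast
    then show False using \<open>adj v up\<close> v by simp
  qed
  have 2: "tr q i \<subseteq> tr w i \<or> tr q i \<subseteq> tr v i"
  proof (rule ccontr)
    assume "\<not> ?thesis"
    then have "adj w uq" "adj v uq" using uqw uqv by auto
    then have "uq = uw" using Wm(14) Q by blast
    then show False using \<open>adj v uq\<close> v by simp
  qed
  \<comment> \<open>If both parts lie in one part of the other partition, that part is all of
    \<open>A i\<close> and the other is empty. In the remaining cases the inclusions between two
    partitions are equalities.\<close>
  consider "tr p i \<subseteq> tr w i" "tr q i \<subseteq> tr w i" | "tr p i \<subseteq> tr v i" "tr q i \<subseteq> tr v i"
    | "tr p i \<subseteq> tr w i" "tr q i \<subseteq> tr v i" | "tr p i \<subseteq> tr v i" "tr q i \<subseteq> tr w i" using 1 2 by blast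
  then show False
  proof cases
    case 1
    then have wi: "tr w i = A i" using cq by blast
    have "\<not> tr w i \<subseteq> tr p i" "\<not> tr w i \<subseteq> tr q i" using wi n by auto
    then have "adj p uw" "adj q uw"
      using inherit_mid[OF w, of p] inherit_mid[OF w, of q] cross[of p w] cross[of q w] P Q adj_sym by auto
    then show False using P(14) Q(14) Wm ne by blast
  next
    case 2
    then have "tr v i = A i" using cq by blast
    then have wi: "tr w i = {}" using cv by blast
    then have "tr p i \<noteq> {}" "tr q i \<noteq> {}" using n by auto
    then have "adj w up" "adj w uq" using upw uqw wi by auto
    then show False using Wm(14) P Q ne by blast
  next
    case 3
    then have "tr w i = tr p i" using cq cv by blast
    then show False using n by blast
  next
    case 4
    then have "tr w i = tr q i" using cq cv by blast
    then show False using n by blast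
  qed
qed

text \<open>If neither \<open>p\<close> nor \<open>q\<close> had the full trace, both traces would
  be nonempty, hence \<open>w\<close> would be adjacent to both and hand its outer neighbour to both
  by \<open>inherit_mid\<close>; but \<open>p\<close> and \<open>q\<close> have different
  ones.\<close>

lemma same_split_full:
  assumes pq: "perp i p q" and w: "mid w i uw" and full: "A i \<subseteq> A w"
  shows "tr w i = tr p i \<or> tr w i = tr q i"
proof (rule ccontr)
  assume n: "\<not> ?thesis"
  obtain up uq where p: "mid p i up" and q: "mid q i uq" and ne: "up \<noteq> uq" "p \<noteq> q" "\<not> adj p q"
    using pq unfolding perp_def by blast
  note P = midD[OF p] and Q = midD[OF q] and Wm = midD[OF w]
  have cq: "tr q i = A i - tr p i" using compl[of i p q] P Q ne by blast
  have wi: "tr w i = A i" using full by blast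
  then have *: "tr p i \<noteq> {}" "tr q i \<noteq> {}" using n cq by auto
  then have "adj w p" "adj w q" using shared[of w p] shared[of w q] full P Q Wm n by blast+
  moreover have "\<not> tr w i \<subseteq> tr p i" "\<not> tr w i \<subseteq> tr q i" using wi n by auto
  ultimately have "adj p uw" "adj q uw"
    using inherit_mid[OF w, of p] inherit_mid[OF w, of q] P Q by auto
  then show False using P(14) Q(14) Wm ne by blast
qed

text \<open>If \<open>w\<close> and \<open>v\<close> were adjacent, an element of one trace missing
  from the other would make the second vertex adjacent to the outer neighbour of the first, which is
  then a third neighbour in \<open>I\<close>. Nonadjacency along a path can therefore be read off
  the traces.\<close>

lemma opposite_nonadj:
  assumes w: "mid w i u" and v: "mid v i u'" and ne: "u \<noteq> u'" and c: "tr v i = A i - tr w i"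
  shows "w \<noteq> v \<and> \<not> adj w v"
proof -
  note Wm = midD[OF w] and V = midD[OF v]
  have Ane: "A i \<noteq> {}" using A_ne V(3) by blast
  have "w \<noteq> v" using w v ne mid_unique by blast
  moreover have False if a: "adj w v"
  proof (cases "tr w i = {}")
    case True
    then obtain z where "z \<in> A v" "z \<in> A i" "z \<notin> A w" using c Ane by blast
    then have "adj w u'" using inherit_mid[OF v, of w z] a Wm adj_sym by blast
    then show False using Wm V ne by blast
  next
    case False
    then obtain z where "z \<in> A w" "z \<in> A i" "z \<notin> A v" using c by blast
    then have "adj v u" using inherit_mid[OF w, of v z] a V by blast
    then show False using Wm V ne by blast
  qed
  ultimately show ?thesis by blast
qed

lemma single_compl: "single j i \<Longrightarrow> mid w i u \<Longrightarrow> \<not> adj j w \<Longrightarrow> tr j i = A i - tr w i"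
  using compl[of i w j] singleD[of j i] midD[of w i u] adj_sym by metis

lemma single_opposite:
  assumes j: "single j i" and w: "mid w i u" and "z \<in> A w" "z \<in> A i" "z \<notin> A j"
  shows "\<not> adj j w"
  using inherit_mid[OF w, of j z] singleD[OF j] midD[OF w] assms adj_sym by metis

end

section \<open>Classes of exchange candidates once all direct exchanges fail\<close>

locale cover_stuck = cover_phase +
  fixes has :: "nat \<Rightarrow> bool" and rp rq :: "nat \<Rightarrow> nat"
  assumes has_perp: "i \<in> I \<Longrightarrow> has i \<Longrightarrow> perp i (rp i) (rq i)"
    and perp_has: "perp i w v \<Longrightarrow> has i"
    and no_free: "w \<in> W \<Longrightarrow> x0 \<in> A w \<Longrightarrow> \<exists>i\<in>I. adj w i"
    and no_full: "single j i \<Longrightarrow> x0 \<in> A j \<Longrightarrow> \<not> A i \<subseteq> A j"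
    and no_swap: "single j i \<Longrightarrow> x0 \<in> A j \<Longrightarrow> single v i \<Longrightarrow> x0 \<notin> A v \<Longrightarrow> adj j v"
begin

text \<open>The traces on \<open>A i\<close> of the vertices with two neighbours in \<open>I\<close> that take part in exchanges at \<open>i\<close> are of two
  complementary kinds, represented by \<open>rp i\<close> and \<open>rq i\<close> when \<open>has i\<close>; class 2 marks the other vertices.\<close>

definition cls :: "nat \<Rightarrow> nat \<Rightarrow> nat" where
  "cls w i = (if has i then if tr w i = tr (rp i) i then 0 else if tr w i = tr (rq i) i then 1 else 2
     else if st w i \<or> fin w i then 1 else 2)"

lemma ref_compl: "i \<in> I \<Longrightarrow> has i \<Longrightarrow> tr (rq i) i = A i - tr (rp i) i \<and> A i \<noteq> {}"
proof -
  assume "i \<in> I" "has i"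
  then have "perp i (rp i) (rq i)" using has_perp by blast
  then obtain u u' where "mid (rp i) i u" "mid (rq i) i u'" "rp i \<noteq> rq i" "\<not> adj (rp i) (rq i)"
    unfolding perp_def by blast
  then show ?thesis using compl[of i "rp i" "rq i"] midD(1,3,6) A_ne by metis
qed

lemma cls_opposite: "i \<in> I \<Longrightarrow> cls w i < 2 \<Longrightarrow> cls v i = 1 - cls w i \<Longrightarrow> has i \<and> tr v i = A i - tr w i"
  using ref_compl[of i] unfolding cls_def by (auto split: if_splits)

lemma cls_same: "i \<in> I \<Longrightarrow> has i \<Longrightarrow> cls w i < 2 \<Longrightarrow> cls v i = cls w i \<longleftrightarrow> tr v i = tr w i"
  using ref_compl[of i] unfolding cls_def by (auto split: if_splits)

lemma cls_nonadj:
  assumes "mid w i u" "mid v i u'" "u \<noteq> u'" "cls w i < 2" "cls v i = 1 - cls w i"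
  shows "w \<noteq> v \<and> \<not> adj w v"
  using opposite_nonadj[OF assms(1,2,3)] cls_opposite[of i w v] assms midD(2) by blast

lemma cls_perp:
  assumes "perp i w v"
  shows "cls w i < 2 \<and> cls v i = 1 - cls w i"
proof -
  obtain u u' where w: "mid w i u" and v: "mid v i u'" and *: "u \<noteq> u'" "w \<noteq> v" "\<not> adj w v"
    using assms unfolding perp_def by blast
  have i: "i \<in> I" and h: "has i" using midD(2)[OF w] perp_has[OF assms] by auto
  have "\<not> adj v u" using midD[OF w] midD[OF v] * by blast
  then have "tr w i = tr (rp i) i \<or> tr w i = tr (rq i) i"
    using same_split_mid[OF has_perp[OF i h] w] midD[OF v] * by blast
  moreover have "tr v i = A i - tr w i" using compl[of i w v] midD[OF w] midD[OF v] * by blast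
  ultimately show ?thesis using ref_compl[OF i h] h unfolding cls_def by auto
qed

lemma cls_live:
  assumes w: "mid w i u" and "st w i \<or> fin w i"
  shows "cls w i < 2"
proof (cases "has i")
  case True
  have i: "i \<in> I" using midD(2)[OF w] .
  note pq = has_perp[OF i True]
  have *: "tr w i = tr (rp i) i \<or> tr w i = tr (rq i) i" if "single j i" "\<not> adj j w" for j
  proof -
    have "\<not> adj j u" "w \<noteq> j" using singleD[OF that(1)] midD[OF w] by blast+
    then show ?thesis using same_split_mid[OF pq w] singleD[OF that(1)] that adj_sym by blast
  qed
  have "tr w i = tr (rp i) i \<or> tr w i = tr (rq i) i"
    using assms(2) * same_split_full[OF pq w] unfolding st_def fin_def by blast
  then show ?thesis unfolding cls_def using True by auto
next
  case False
  then show ?thesis using assms unfolding cls_def by auto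
qed

text \<open>Otherwise \<open>j\<close> has the nonadjacent neighbours \<open>w\<close> and
  \<open>v\<close>, which both miss \<open>x0\<close>, against \<open>split\<close>.\<close>

lemma start_avoids_swap:
  assumes j: "single j i" "x0 \<in> A j" and v: "single v i" "x0 \<notin> A v" and w: "mid w i u" "\<not> adj v w"
  shows "\<not> adj j w"
proof
  assume "adj j w"
  moreover have "adj j v" using no_swap j v by blast
  moreover have "w \<noteq> v" using singleD[OF v(1)] midD[OF w(1)] by blast
  ultimately have "A j \<subseteq> A w \<union> A v"
    using split[of j w v] singleD[OF j(1)] singleD[OF v(1)] midD[OF w(1)] w adj_sym by metis
  then show False using j v mid_x0[OF w(1)] by blast
qed

lemma start_avoids_full:
  assumes j: "single j i" "x0 \<in> A j" and w: "mid w i u" "A i \<subseteq> A w"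
  shows "\<not> adj j w"
proof -
  obtain z where "z \<in> A i" "z \<notin> A j" using no_full j by blast
  then show ?thesis using single_opposite[OF j(1) w(1)] w by blast
qed

lemma start_avoids_fin:
  assumes j: "single j i" "x0 \<in> A j" and w: "mid w i u" "fin w i"
  shows "\<not> adj j w"
  using w start_avoids_swap[OF j] start_avoids_full[OF j] unfolding fin_def by blast

text \<open>Whether a path can start at \<open>i\<close> depends only on the class. With equal
  traces, an element of \<open>A i\<close> missed by \<open>j\<close>, which exists by
  \<open>no_full\<close>, lies in the trace of \<open>w1\<close> and separates \<open>j\<close> from
  \<open>w1\<close>. Without reference traces, a vertex of class 1 is \<open>st\<close> or
  \<open>fin\<close>, and start vertices avoid the latter.\<close>

lemma st_transfer:
  assumes w: "mid w i u" "cls w i < 2" "st w i" and w1: "mid w1 i u1" "cls w1 i = cls w i"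
  shows "st w1 i"
proof -
  obtain j where j: "single j i" "x0 \<in> A j" "\<not> adj j w" using w unfolding st_def by blast
  show ?thesis
  proof (cases "has i")
    case True
    then have "tr w1 i = tr w i" using cls_same[of i w w1] w w1 midD(2) by blast
    moreover have "tr j i = A i - tr w i" using single_compl j w by blast
    moreover obtain z where "z \<in> A i" "z \<notin> A j" using no_full j by blast
    ultimately have "\<not> adj j w1" using single_opposite[OF j(1) w1(1)] by blast
    then show ?thesis using j unfolding st_def by blast
  next
    case False
    then have "st w1 i \<or> fin w1 i" using w w1 unfolding cls_def by (auto split: if_splits)
    then show ?thesis using start_avoids_fin[OF j(1,2) w1(1)] j unfolding st_def by blast
  qed
qed

text \<open>The property \<open>fin\<close> itself can fail to pass from \<open>w\<close> to
  \<open>w1\<close>, namely when both have the empty trace on \<open>A i\<close>. In that case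
  \<open>w\<close> turns out to join the same two nodes as \<open>w1\<close> and is used instead.
  The last assumption supplies a vertex at \<open>u\<close> that is not adjacent to
  \<open>w1\<close>: the start of the path or the preceding edge.\<close>

lemma fin_transfer:
  assumes w: "mid w i uw" "cls w i < 2" "fin w i" and w1: "mid w1 i u" "cls w1 i = cls w i" "cls w1 u < 2"
    and pre: "st w1 u \<or> (\<exists>y u'. mid y u u' \<and> u' \<noteq> i \<and> cls y u = 1 - cls w1 u)"
  shows "\<exists>w2. mid w2 i u \<and> cls w2 i = cls w1 i \<and> cls w2 u = cls w1 u \<and> fin w2 i"
proof (cases "fin w1 i")
  case True
  then show ?thesis using w1(1) by (intro exI[of _ w1]) simp
next
  case nf: False
  note W1 = midD[OF w1(1)] and Ww = midD[OF w(1)]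
  have Ane: "A i \<noteq> {}" using A_ne W1 by blast
  show ?thesis
  proof (cases "has i")
    case True
    have trw: "tr w1 i = tr w i" using cls_same[of i w w1] w w1 True W1 by blast
    then have "\<not> A i \<subseteq> A w" using nf unfolding fin_def by blast
    then obtain v where v: "single v i" "x0 \<notin> A v" "\<not> adj v w" using w unfolding fin_def by blast
    have v1: "adj v w1" using v nf unfolding fin_def by blast
    note V = singleD[OF v(1)]
    have cv: "tr v i = A i - tr w i" using single_compl v w by blast
    \<comment> \<open>An element of the trace of \<open>w1\<close> is missed by \<open>v\<close>,
      whose trace is complementary, and would separate \<open>v\<close> from
      \<open>w1\<close>.\<close>
    have e1: "tr w1 i = {}" using single_opposite[OF v(1) w1(1)] v1 cv trw by blast
    have ww1: "w \<noteq> w1" using v v1 by blast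
    have aw: "adj w1 w" using compl[of i w1 w] e1 trw Ane W1 Ww ww1 by blast
    have "A w1 \<subseteq> A w \<union> A v" using split[of w1 w v] W1 Ww V aw v1 v adj_sym by metis
    moreover have "A w1 \<subseteq> A u" using mid_split[OF w1(1)] e1 by blast
    moreover have "A v \<inter> A u = {}" using shared[of v u] V W1 by blast
    ultimately have sub: "A w1 \<subseteq> A w" by blast
    obtain z where z: "z \<in> A w1" "z \<in> A w" "z \<in> A u" using A_ne[of w1] W1(1) sub \<open>A w1 \<subseteq> A u\<close> by blast
    then have "adj w u" using shared[of w u z] Ww W1 by blast
    then have "uw = u" using Ww(14) W1 by blast
    then have wm: "mid w i u" using w by simp
    \<comment> \<open>By \<open>split\<close> at \<open>w\<close>, such a neighbour \<open>j\<close>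
      of \<open>w\<close> would contain \<open>z\<close>, which it then shares with
      \<open>w1\<close>. So every witness for the class of \<open>w1\<close> at \<open>u\<close>
      serves for \<open>w\<close> too.\<close>
    have nonadj: "\<not> adj j w" if "j \<in> W" "\<not> adj j i" "j \<noteq> i" "\<not> adj j w1" "j \<noteq> w1" for j
    proof
      assume "adj j w"
      then have "A w \<subseteq> A i \<union> A j" using split[of w i j] that Ww adj_sym by metis
      moreover have "z \<notin> A i" using e1 z by blast
      ultimately have "z \<in> A j" using z by blast
      then show False using that z shared[of j w1 z] W1 by blast
    qed
    have "cls w u = cls w1 u"
    proof (cases "has u")
      case hu: True
      have "\<exists>j. j \<in> W \<and> adj j u \<and> \<not> adj j i \<and> j \<noteq> i \<and> j \<noteq> w1 \<and> \<not> adj j w1"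
        using pre
      proof
        assume "st w1 u"
        then obtain j where "single j u" "\<not> adj j w1" unfolding st_def by blast
        then show ?thesis using singleD[of j u] W1 by blast
      next
        assume "\<exists>y u'. mid y u u' \<and> u' \<noteq> i \<and> cls y u = 1 - cls w1 u"
        then obtain y u' where y: "mid y u u'" "u' \<noteq> i" "cls y u = 1 - cls w1 u" by blast
        have "w1 \<noteq> y \<and> \<not> adj w1 y" using cls_nonadj[of w1 u i y u'] y w1 mid_sym by metis
        then show ?thesis using midD[OF y(1)] y W1 adj_sym by metis
      qed
      then obtain j where j: "j \<in> W" "adj j u" "\<not> adj j i" "j \<noteq> i" "j \<noteq> w1" "\<not> adj j w1" by blast
      have jw: "\<not> adj j w" using nonadj j by blast
      have "tr w1 u = A u - tr j u" using compl[of u j w1] j W1 by blast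
      moreover have "j \<noteq> w" using j Ww by blast
      then have "tr w u = A u - tr j u" using compl[of u j w] j W1 Ww jw \<open>adj w u\<close> by blast
      ultimately show ?thesis using cls_same[of u w1 w] hu w1 W1 by auto
    next
      case hu: False
      then have "cls w1 u = 1" using w1 unfolding cls_def by (auto split: if_splits)
      moreover have "st w1 u"
        using pre cls_opposite[of u w1] hu w1(3) W1(4) by blast
      then obtain j where j: "single j u" "x0 \<in> A j" "\<not> adj j w1" unfolding st_def by blast
      then have "\<not> adj j w" using nonadj singleD[OF j(1)] W1 by blast
      then have "st w u" using j unfolding st_def by blast
      then have "cls w u = 1" using hu unfolding cls_def by auto
      ultimately show ?thesis by simp
    qed
    then show ?thesis using wm w(3) w1(2) by (intro exI[of _ w]) simp
  next
    case False
    then have "st w1 i" using w w1 nf unfolding cls_def by (auto split: if_splits)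
    then obtain j where j: "single j i" "x0 \<in> A j" "\<not> adj j w1" unfolding st_def by blast
    have c1: "tr j i = A i - tr w1 i" using single_compl j w1 by blast
    have "\<not> adj j w" using start_avoids_fin[OF j(1,2) w(1,3)] .
    then have cw: "tr j i = A i - tr w i" using single_compl j w by blast
    show ?thesis
    proof (cases "A i \<subseteq> A w")
      case True
      then show ?thesis using c1 cw nf unfolding fin_def by blast
    next
      case False
      then obtain v where v: "single v i" "x0 \<notin> A v" "\<not> adj v w" using w unfolding fin_def by blast
      have cv: "tr v i = A i - tr w i" using single_compl v w by blast
      obtain z where "z \<in> A i" "z \<notin> A j" using no_full j by blast
      then have "\<not> adj v w1" using single_opposite[OF v(1) w1(1)] cv cw c1 by blast
      then show ?thesis using v nf unfolding fin_def by blast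
    qed
  qed
qed

text \<open>The start vertex \<open>j\<close> is nonadjacent to both \<open>w\<close> and
  \<open>w'\<close>, so its trace is complementary to two complementary traces, and
  \<open>A i\<close> would be empty. Hence a path has at least two nodes.\<close>

lemma no_short:
  assumes w: "mid w i u" "cls w i < 2" "st w i" and w': "mid w' i u'" "cls w' i = 1 - cls w i" "fin w' i"
  shows False
proof -
  have h: "has i" and t: "tr w' i = A i - tr w i" using cls_opposite[of i w w'] w w' midD(2) by blast+
  have Ane: "A i \<noteq> {}" using A_ne midD(3)[OF w(1)] by blast
  obtain j where j: "single j i" "x0 \<in> A j" "\<not> adj j w" using w unfolding st_def by blast
  have cj: "tr j i = A i - tr w i" using single_compl j w by blast
  have "\<not> adj j w'" using start_avoids_fin[OF j(1,2) w'(1,3)] .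
  then have "tr j i = A i - tr w' i" using single_compl j w' by blast
  then show False using cj t Ane by blast
qed

end

section \<open>Alternating search\<close>

locale alternating_search =
  fixes V :: "nat set" and mate :: "nat \<Rightarrow> nat" and F :: "nat \<Rightarrow> nat \<Rightarrow> bool" and root :: nat
  assumes mate_V: "e \<in> V \<Longrightarrow> mate e \<in> V" and mate_mate: "e \<in> V \<Longrightarrow> mate (mate e) = e"
    and mate_ne: "e \<in> V \<Longrightarrow> mate e \<noteq> e"
    and root_V: "root \<notin> V" and F_sym: "F a b \<Longrightarrow> F b a"
begin

text \<open>Only the even nodes are listed: the step from \<open>r\<close> to \<open>x\<close> is
  the edge from \<open>r\<close> to \<open>mate x\<close> followed by the mate edge to
  \<open>x\<close>.\<close>

fun chain :: "nat \<Rightarrow> nat list \<Rightarrow> bool" where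
  "chain r [] \<longleftrightarrow> True"
| "chain r (x # xs) \<longleftrightarrow> F r (mate x) \<and> chain x xs"

lemma chain_append: "chain r (xs @ ys) \<longleftrightarrow> chain r xs \<and> chain (last (r # xs)) ys"
  by (induction xs arbitrary: r) auto

text \<open>Traversing a branch backwards turns its odd nodes into even ones, so the even nodes of
  the reversed branch are the mates of the old ones.\<close>

lemma chain_mate_rev:
  "set (e # xs) \<subseteq> V \<Longrightarrow> chain e xs \<Longrightarrow> F b (last (e # xs)) \<Longrightarrow> chain b (map mate (rev (e # xs)))"
proof (induction xs arbitrary: e)
  case Nil
  then show ?case using mate_mate by simp
next
  case (Cons x xs)
  have "chain b (map mate (rev (x # xs)))" using Cons by (cases xs) auto
  moreover have "last (b # map mate (rev (x # xs))) = mate x" by simp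
  moreover have "F (mate x) e" using Cons.prems F_sym by auto
  ultimately show ?case using Cons.prems mate_mate by (simp add: chain_append)
qed

definition lp :: "nat set \<Rightarrow> nat list \<Rightarrow> nat" where
  "lp Z xs = last (root # filter (\<lambda>e. mate e \<notin> Z) xs)"

definition good :: "nat set \<Rightarrow> nat list \<Rightarrow> nat \<Rightarrow> bool" where
  "good Z xs v \<longleftrightarrow> xs \<noteq> [] \<and> last xs = v \<and> set xs \<subseteq> Z - {root} \<and> distinct xs \<and>
     (\<forall>x\<in>set xs. mate x \<notin> set xs) \<and> chain root xs"

text \<open>\<open>Z\<close> is the set of even nodes, \<open>P v\<close> an alternating path to \<open>v\<close>, recorded by its even nodes, and
  \<open>base v\<close> the last node on it whose mate is not even.\<close>

definition inv :: "nat set \<Rightarrow> (nat \<Rightarrow> nat list) \<Rightarrow> (nat \<Rightarrow> nat) \<Rightarrow> bool" where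
  "inv Z P base \<longleftrightarrow> root \<in> Z \<and> Z \<subseteq> insert root V \<and> P root = [] \<and> base root = root \<and>
     (\<forall>v\<in>Z - {root}. good Z (P v) v) \<and>
     (\<forall>v\<in>Z. \<forall>e\<in>set (P v). mate e \<notin> Z \<longrightarrow> (\<exists>ys. P v = P e @ ys)) \<and>
     (\<forall>v\<in>Z. \<forall>xs e ys. P v = xs @ e # ys \<longrightarrow> base e = lp Z (xs @ [e]) \<and> (mate e \<in> Z \<longrightarrow> base (mate e) = lp Z xs))"

lemma lp_Nil: "lp Z [] = root"
  unfolding lp_def by simp

lemma lp_snoc: "lp Z (xs @ [e]) = (if mate e \<in> Z then lp Z xs else e)"
  unfolding lp_def by simp

lemma lp_append: "lp Z (xs @ ys) = (if filter (\<lambda>e. mate e \<notin> Z) ys = [] then lp Z xs else lp Z ys)"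
  unfolding lp_def by (auto simp: last_append)

lemma lp_cases: "lp Z xs = root \<or> lp Z xs \<in> set xs \<and> mate (lp Z xs) \<notin> Z"
proof (cases "filter (\<lambda>e. mate e \<notin> Z) xs = []")
  case False
  then have "lp Z xs = last (filter (\<lambda>e. mate e \<notin> Z) xs)" unfolding lp_def by simp
  then have "lp Z xs \<in> set (filter (\<lambda>e. mate e \<notin> Z) xs)" using False last_in_set by metis
  then show ?thesis by simp
qed (simp add: lp_def)

lemma lp_in: "\<exists>e\<in>set xs. mate e \<notin> Z \<Longrightarrow> lp Z xs \<in> set xs \<and> mate (lp Z xs) \<notin> Z"
proof -
  assume "\<exists>e\<in>set xs. mate e \<notin> Z"
  then have ne: "filter (\<lambda>e. mate e \<notin> Z) xs \<noteq> []" by (auto simp: filter_empty_conv)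
  then have "lp Z xs = last (filter (\<lambda>e. mate e \<notin> Z) xs)" unfolding lp_def by simp
  then have "lp Z xs \<in> set (filter (\<lambda>e. mate e \<notin> Z) xs)" using ne last_in_set by metis
  then show ?thesis by simp
qed

lemma inv_init: "inv {root} (\<lambda>_. []) (\<lambda>_. root)"
  unfolding inv_def by simp

context
  fixes Z P base
  assumes i: "inv Z P base"
begin

lemma inv_facts: "root \<in> Z" "Z \<subseteq> insert root V" "P root = []" "base root = root"
  using i unfolding inv_def by auto

lemma inv_good:
  assumes "v \<in> Z" "v \<noteq> root"
  shows "P v \<noteq> []" "last (P v) = v" "v \<in> set (P v)"
proof -
  show *: "P v \<noteq> []" "last (P v) = v" using i assms unfolding inv_def good_def by auto
  show "v \<in> set (P v)" using last_in_set[OF *(1)] *(2) by simp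
qed

lemma inv_path:
  assumes "v \<in> Z"
  shows "set (P v) \<subseteq> Z" "set (P v) \<subseteq> V" "root \<notin> set (P v)" "distinct (P v)" "x \<in> set (P v) \<Longrightarrow> mate x \<notin> set (P v)"
    "chain root (P v)" "last (root # P v) = v"
proof -
  have "set (P v) \<subseteq> Z \<and> set (P v) \<subseteq> V \<and> root \<notin> set (P v) \<and> distinct (P v) \<and> (\<forall>x \<in> set (P v). mate x \<notin> set (P v)) \<and>
    chain root (P v) \<and> last (root # P v) = v"
    using i assms unfolding inv_def good_def by (cases "v = root") auto
  then show "set (P v) \<subseteq> Z" "set (P v) \<subseteq> V" "root \<notin> set (P v)" "distinct (P v)" "x \<in> set (P v) \<Longrightarrow> mate x \<notin> set (P v)"
    "chain root (P v)" "last (root # P v) = v" by auto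
qed

lemma inv_prefix: "v \<in> Z \<Longrightarrow> e \<in> set (P v) \<Longrightarrow> mate e \<notin> Z \<Longrightarrow> \<exists>ys. P v = P e @ ys"
  using i unfolding inv_def by blast

lemma inv_base: "v \<in> Z \<Longrightarrow> P v = xs @ e # ys \<Longrightarrow> base e = lp Z (xs @ [e])"
  "v \<in> Z \<Longrightarrow> P v = xs @ e # ys \<Longrightarrow> mate e \<in> Z \<Longrightarrow> base (mate e) = lp Z xs"
  using i unfolding inv_def by blast+

lemma inv_base_lp: "v \<in> Z \<Longrightarrow> base v = lp Z (P v)"
proof (cases "v = root")
  case False
  assume v: "v \<in> Z"
  then have "P v = butlast (P v) @ [v]" using inv_good False append_butlast_last_id by metis
  then show ?thesis using inv_base(1)[OF v, of "butlast (P v)" v "[]"] by simp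
qed (simp add: inv_facts lp_Nil)

lemma inv_pure_base: "v \<in> Z \<Longrightarrow> v \<noteq> root \<Longrightarrow> mate v \<notin> Z \<Longrightarrow> base v = v"
proof -
  assume v: "v \<in> Z" "v \<noteq> root" "mate v \<notin> Z"
  then have "P v = butlast (P v) @ [v]" using inv_good append_butlast_last_id by metis
  then have "lp Z (P v) = v" using v(3) lp_snoc[of Z "butlast (P v)" v] by simp
  then show ?thesis using inv_base_lp[OF v(1)] by simp
qed

lemma inv_mate_base: "v \<in> Z \<Longrightarrow> v \<noteq> root \<Longrightarrow> mate v \<in> Z \<Longrightarrow> base (mate v) = base v"
proof -
  assume v: "v \<in> Z" "v \<noteq> root" "mate v \<in> Z"
  then have *: "P v = butlast (P v) @ v # []" using inv_good append_butlast_last_id by metis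
  then show ?thesis using inv_base[OF v(1) *] inv_base_lp[OF v(1)] v lp_snoc[of Z "butlast (P v)" v] by simp
qed

text \<open>Neither \<open>b\<close> nor \<open>mate b\<close> was even, so no old even node gains
  an even mate: all values of \<open>lp\<close> along old paths are unchanged, and the new node is
  its own base.\<close>

lemma inv_grow:
  assumes a: "a \<in> Z" and F: "F a b" and b: "b \<in> V" "b \<notin> Z" "mate b \<notin> Z"
  shows "inv (insert (mate b) Z) (P(mate b := P a @ [mate b])) (base(mate b := mate b))"
proof -
  let ?o = "mate b" let ?Z = "insert (mate b) Z" let ?P = "P(mate b := P a @ [mate b])"
  have oV: "?o \<in> V" using b mate_V by blast
  have or: "?o \<noteq> root" using oV root_V by blast
  have mo: "mate ?o = b" "b \<noteq> ?o" using b mate_mate mate_ne by metis+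
  have pe: "mate e \<in> ?Z \<longleftrightarrow> mate e \<in> Z" if "e \<in> Z" "e \<in> V" for e
    using that mo b mate_mate by (metis insert_iff)
  have PZ: "?P v = P v" if "v \<in> Z" for v using that b by auto
  have lpe: "lp ?Z xs = lp Z xs" if "set xs \<subseteq> Z" "set xs \<subseteq> V" for xs
  proof -
    have "filter (\<lambda>e. mate e \<notin> ?Z) xs = filter (\<lambda>e. mate e \<notin> Z) xs"
      using that pe by (intro filter_cong) auto
    then show ?thesis unfolding lp_def by simp
  qed
  have good: "good ?Z (?P v) v" if "v \<in> ?Z - {root}" for v
  proof (cases "v = ?o")
    case True
    have "?o \<notin> set (P a)" "b \<notin> set (P a)" using inv_path(1)[OF a] b by auto
    moreover have "mate x \<noteq> ?o" if "x \<in> set (P a)" for x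
      using that \<open>b \<notin> set (P a)\<close> inv_path(2)[OF a] mate_mate b(1) by (metis subsetD)
    ultimately show ?thesis unfolding good_def True using inv_path[OF a] mo or F mate_mate b
      by (auto simp: chain_append)
  next
    case False
    then have "good Z (P v) v" using i that unfolding inv_def by auto
    then show ?thesis using False unfolding good_def by auto
  qed
  have pre: "\<exists>ys. ?P v = ?P e @ ys" if ve: "v \<in> ?Z" "e \<in> set (?P v)" "mate e \<notin> ?Z" for v e
  proof (cases "v = ?o")
    case True
    show ?thesis
    proof (cases "e = ?o")
      case True
      then show ?thesis using \<open>v = ?o\<close> by simp
    next
      case False
      then have "e \<in> set (P a)" using that True by auto
      then obtain ys where "P a = P e @ ys" using inv_prefix[OF a, of e] ve(3) by auto
      then show ?thesis using True False by auto
    qed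
  next
    case False
    then have v: "v \<in> Z" using that by simp
    then have "e \<in> set (P v)" using that False by simp
    then have "e \<in> Z" using inv_path(1)[OF v] by blast
    then show ?thesis using inv_prefix[OF v \<open>e \<in> set (P v)\<close>] that PZ v by auto
  qed
  have base: "(base(?o := ?o)) e = lp ?Z (xs @ [e]) \<and> (mate e \<in> ?Z \<longrightarrow> (base(?o := ?o)) (mate e) = lp ?Z xs)"
    if "v \<in> ?Z" "?P v = xs @ e # ys" for v xs e ys
  proof -
    have old: ?thesis if w: "w \<in> Z" "P w = xs @ e # zs" for w zs
    proof -
      have s: "set xs \<subseteq> Z" "set xs \<subseteq> V" "e \<in> Z" "e \<in> V" using inv_path(1,2)[OF w(1)] w(2) by auto
      then have "e \<noteq> ?o" "mate e \<noteq> ?o" using b pe mate_mate by (metis, metis)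
      then show ?thesis using inv_base[OF w] lpe[of xs] lpe[of "xs @ [e]"] s by simp
    qed
    show ?thesis
    proof (cases "v = ?o")
      case False
      then show ?thesis using old[of v ys] that by simp
    next
      case True
      then have *: "P a @ [?o] = xs @ e # ys" using that by simp
      show ?thesis
      proof (cases "ys = []")
        case True
        then have "e = ?o" "xs = P a" using * by auto
        then show ?thesis using lp_snoc[of ?Z xs ?o] mo b by simp
      next
        case False
        then have "P a = xs @ e # butlast ys" using * by (metis append_butlast_last_id butlast.simps(2) butlast_append butlast_snoc list.simps(3))
        then show ?thesis using old a by blast
      qed
    qed
  qed
  have "?Z \<subseteq> insert root V" using inv_facts oV by auto
  moreover have "?P root = []" "(base(?o := ?o)) root = root" using or inv_facts by auto
  moreover have "\<forall>v\<in>?Z - {root}. good ?Z (?P v) v" by (intro ballI good)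
  moreover have "\<forall>v\<in>?Z. \<forall>e\<in>set (?P v). mate e \<notin> ?Z \<longrightarrow> (\<exists>ys. ?P v = ?P e @ ys)"
    by (intro ballI impI pre)
  moreover have "\<forall>v\<in>?Z. \<forall>xs e ys. ?P v = xs @ e # ys \<longrightarrow>
     (base(?o := ?o)) e = lp ?Z (xs @ [e]) \<and> (mate e \<in> ?Z \<longrightarrow> (base(?o := ?o)) (mate e) = lp ?Z xs)"
    by (intro ballI allI impI base)
  moreover have "root \<in> ?Z" using inv_facts(1) by simp
  ultimately show ?thesis unfolding inv_def by (intro conjI)
qed

text \<open>The pure nodes of one branch beyond the fork; their mates are the nodes that the closing
  edge makes even.\<close>

definition new where "new a b e \<longleftrightarrow> e \<in> set (P a) \<and> e \<notin> set (P b) \<and> mate e \<notin> Z"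

definition bZ where "bZ a b = Z \<union> mate ` {e. new a b e \<or> new b a e}"

text \<open>A new even node is reached the long way round the cycle: down the other branch, across
  the closing edge, and backwards up its own branch.\<close>

definition bP where
  "bP a b x = (if x \<in> Z then P x
     else if new a b (mate x) then P b @ map mate (rev (dropWhile (\<lambda>y. y \<noteq> mate x) (P a)))
     else P a @ map mate (rev (dropWhile (\<lambda>y. y \<noteq> mate x) (P b))))"

text \<open>The base of the blossom: the last pure node on both paths, or
  \<open>root\<close>.\<close>

definition common where "common a b = last (root # filter (\<lambda>e. mate e \<notin> Z \<and> e \<in> set (P b)) (P a))"

text \<open>Contraction: even nodes whose base has become impure, and all new even nodes, get the
  base of the blossom.\<close>

definition bbase where
  "bbase a b x = (if x \<in> Z \<and> \<not> new a b (base x) \<and> \<not> new b a (base x) then base x else common a b)"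

definition fork where
  "fork a b p as bs \<longleftrightarrow> a \<in> Z \<and> b \<in> Z \<and> P a = p @ as \<and> P b = p @ bs \<and>
     (\<forall>e\<in>set as. mate e \<notin> Z \<longrightarrow> e \<notin> set (P b)) \<and> (\<forall>e\<in>set bs. mate e \<notin> Z \<longrightarrow> e \<notin> set (P a))"

lemma fork_sym: "fork a b p as bs \<Longrightarrow> fork b a p bs as"
  unfolding fork_def by auto

text \<open>The paths of \<open>a\<close> and \<open>b\<close> both begin with the path of their
  last common pure node, because the invariant makes every path through a pure node extend the path
  of that node.\<close>

lemma fork_ex:
  assumes "a \<in> Z" "b \<in> Z"
  shows "\<exists>as bs. fork a b (P (common a b)) as bs \<and> (common a b = root \<or> common a b \<in> set (P a) \<inter> set (P b) \<and> mate (common a b) \<notin> Z)"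
proof -
  let ?\<pi> = "common a b" let ?C = "filter (\<lambda>e. mate e \<notin> Z \<and> e \<in> set (P b)) (P a)"
  have c: "?\<pi> = root \<and> ?C = [] \<or> ?\<pi> \<in> set ?C \<and> ?C \<noteq> [] \<and> last ?C = ?\<pi>"
  proof (cases "?C = []")
    case True
    then show ?thesis unfolding common_def by simp
  next
    case False
    then have "?\<pi> = last ?C" unfolding common_def by simp
    then show ?thesis using last_in_set[OF False] False by simp
  qed
  have c2: "?\<pi> = root \<or> ?\<pi> \<in> set (P a) \<inter> set (P b) \<and> mate ?\<pi> \<notin> Z" using c by auto
  have "\<exists>as. P a = P ?\<pi> @ as" "\<exists>bs. P b = P ?\<pi> @ bs"
    using c2 inv_facts(3) inv_prefix[OF assms(1), of ?\<pi>] inv_prefix[OF assms(2), of ?\<pi>] by auto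
  then obtain as bs where ab: "P a = P ?\<pi> @ as" "P b = P ?\<pi> @ bs" by blast
  \<comment> \<open>Otherwise the last common pure node would itself lie in \<open>as\<close>. It is
    also the end of the common beginning, so the path of \<open>a\<close> would visit it
    twice.\<close>
  have D1: "e \<notin> set (P b)" if e: "e \<in> set as" "mate e \<notin> Z" for e
  proof
    assume "e \<in> set (P b)"
    then have "e \<in> set (filter (\<lambda>e. mate e \<notin> Z \<and> e \<in> set (P b)) as)" using e by simp
    then have ne: "filter (\<lambda>e. mate e \<notin> Z \<and> e \<in> set (P b)) as \<noteq> []" by fastforce
    then have "last ?C = last (filter (\<lambda>e. mate e \<notin> Z \<and> e \<in> set (P b)) as)" unfolding ab(1) by (simp add: last_append)
    then have 1: "last ?C \<in> set as" using ne last_in_set by (metis filter_is_subset subsetD)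
    have "?C \<noteq> []" using ne unfolding ab(1) by simp
    then have pi: "?\<pi> \<in> set as" "?\<pi> \<in> Z" "?\<pi> \<noteq> root" using c 1 inv_path(1,3)[OF assms(1)] by auto
    then have "?\<pi> \<in> set (P ?\<pi>)" using inv_good(3) by blast
    then show False using pi inv_path(4)[OF assms(1)] unfolding ab(1) by auto
  qed
  have D2: "e \<notin> set (P a)" if e: "e \<in> set bs" "mate e \<notin> Z" for e
  proof
    assume "e \<in> set (P a)"
    moreover have "e \<in> set (P b)" using e ab by simp
    ultimately have "e \<in> set (P ?\<pi>)" using D1 e ab by auto
    then show False using e inv_path(4)[OF assms(2)] unfolding ab(2) by auto
  qed
  show ?thesis unfolding fork_def using assms ab D1 D2 c2 by blast
qed

lemma fork_new: "fork a b p as bs \<Longrightarrow> new a b e \<longleftrightarrow> e \<in> set as \<and> mate e \<notin> Z"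
  unfolding fork_def new_def by auto

text \<open>The bases of the nodes behind the first new node of a branch lie on that branch.\<close>

lemma fork_disjoint:
  assumes f: "fork a b p as bs" and as: "as = as1 @ e # as2" and e: "mate e \<notin> Z" and y: "y \<in> set (e # as2)"
  shows "y \<notin> set (P b) \<and> mate y \<notin> set (P b)"
proof (cases "mate y \<in> Z")
  case False
  have "y \<in> set as" using y as by auto
  then have "y \<notin> set (P b)" using f False unfolding fork_def by blast
  moreover have "set (P b) \<subseteq> Z" using f inv_path(1) unfolding fork_def by blast
  ultimately show ?thesis using False by blast
next
  case True
  have a: "a \<in> Z" and b: "b \<in> Z" and Pa: "P a = p @ as" using f unfolding fork_def by auto
  have "y \<in> set as2" using y e True by auto
  then obtain cs ds where "as2 = cs @ y # ds" by (meson split_list)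
  then have Pa': "P a = (p @ as1 @ e # cs) @ y # ds" using Pa as by simp
  let ?q = "lp Z (p @ as1 @ e # cs)"
  have q: "?q = lp Z (e # cs)" using lp_append[of Z "p @ as1" "e # cs"] e by simp
  moreover have "lp Z (e # cs) \<in> set (e # cs) \<and> mate (lp Z (e # cs)) \<notin> Z" using lp_in[of "e # cs"] e by simp
  ultimately have "?q \<in> set as" "mate ?q \<notin> Z" using as \<open>as2 = cs @ y # ds\<close> by auto
  then have qb: "?q \<notin> set (P b)" using f unfolding fork_def by blast
  have qr: "?q \<noteq> root" using \<open>?q \<in> set as\<close> inv_path(3)[OF a] Pa by auto
  have by1: "base y = ?q" using inv_base(1)[OF a Pa'] True lp_snoc[of Z "p @ as1 @ e # cs" y] by simp
  have bm: "base (mate y) = ?q" using inv_base(2)[OF a Pa' True] .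
  have "base x = root \<or> base x \<in> set (P b)" if x: "x \<in> set (P b)" for x
  proof -
    obtain xs ys where *: "P b = xs @ x # ys" using x by (meson split_list)
    have "base x = lp Z (xs @ [x])" using inv_base(1)[OF b *] .
    then show ?thesis using lp_cases[of Z "xs @ [x]"] * by auto
  qed
  then show ?thesis using by1 bm qb qr by metis
qed

lemma dropWhile_at: "distinct (xs @ e # ys) \<Longrightarrow> dropWhile (\<lambda>y. y \<noteq> e) (xs @ e # ys) = e # ys"
  by (subst dropWhile_append2) auto

lemma split_unique: "distinct (xs @ q # ys) \<Longrightarrow> xs @ q # ys = zs @ q # ws \<Longrightarrow> xs = zs"
proof (induction xs arbitrary: zs)
  case Nil
  then show ?case by (cases zs) auto
next
  case (Cons x xs)
  show ?case
  proof (cases zs)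
    case Nil
    then show ?thesis using Cons.prems by auto
  next
    case (Cons z zs')
    then have "xs @ q # ys = zs' @ q # ws" "z = x" using Cons.prems by simp_all
    then show ?thesis using Cons.IH[of zs'] Cons.prems(1) \<open>zs = z # zs'\<close> by simp
  qed
qed

lemma prefix_at: "distinct (xs @ q # ys) \<Longrightarrow> xs @ q # ys = ps @ zs \<Longrightarrow> ps \<noteq> [] \<Longrightarrow> last ps = q \<Longrightarrow> ps = xs @ [q]"
  using split_unique[of xs q ys "butlast ps" zs] append_butlast_last_id[of ps] by (metis append.assoc append_Cons append_Nil)

text \<open>The edge between two even nodes closes an odd cycle through the fork. The new paths are
  simple because a turned branch avoids the other path (\<open>fork_disjoint\<close>). For the
  bases, the point is that every new node becomes impure, so that the last pure node of any path
  into the blossom is now its base.\<close>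

lemma inv_blossom:
  assumes a: "a \<in> Z" and b: "b \<in> Z" and F: "F a b"
  shows "inv (bZ a b) (bP a b) (bbase a b)"
proof -
  let ?\<pi> = "common a b"
  define p where "p = P ?\<pi>"
  obtain as bs where f: "fork a b p as bs" and pi: "?\<pi> = root \<or> ?\<pi> \<in> set (P a) \<inter> set (P b) \<and> mate ?\<pi> \<notin> Z"
    using fork_ex[OF a b] unfolding p_def by blast
  have f': "fork b a p bs as" using fork_sym f .
  have Pa: "P a = p @ as" and Pb: "P b = p @ bs" using f unfolding fork_def by auto
  define S where "S = {e. new a b e \<or> new b a e}"
  have S_iff: "e \<in> S \<longleftrightarrow> e \<in> set as \<union> set bs \<and> mate e \<notin> Z" for e
    unfolding S_def using fork_new[OF f] fork_new[OF f'] by auto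
  have SZ: "S \<subseteq> Z" "S \<subseteq> V" "root \<notin> S"
    using inv_path(1,2,3)[OF a] inv_path(1,2,3)[OF b] Pa Pb unfolding S_iff subset_iff by auto
  let ?Z = "bZ a b"
  have Z': "x \<in> ?Z \<longleftrightarrow> x \<in> Z \<or> x \<in> V \<and> mate x \<in> S" for x
    unfolding bZ_def S_def[symmetric] using SZ mate_mate mate_V by (auto simp: image_iff) (metis subsetD)
  have ZV: "?Z \<subseteq> insert root V" using Z' inv_facts by auto
  have m': "mate e \<in> ?Z \<longleftrightarrow> mate e \<in> Z \<or> e \<in> S" if "e \<in> V" for e
    using Z'[of "mate e"] that mate_V mate_mate by auto
  have pr: "?\<pi> \<noteq> root \<Longrightarrow> ?\<pi> \<in> Z" using pi inv_path(1)[OF a] by auto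
  have piS: "?\<pi> \<notin> S" using pi SZ unfolding S_def new_def by auto
  have lp'p: "lp ?Z p = ?\<pi>"
  proof (cases "?\<pi> = root")
    case True
    then show ?thesis unfolding p_def using inv_facts lp_Nil by simp
  next
    case False
    then have "P ?\<pi> = butlast (P ?\<pi>) @ [?\<pi>]" using inv_good[OF pr[OF False] False] append_butlast_last_id by metis
    moreover have "?\<pi> \<in> V" using False pr inv_facts by auto
    then have "mate ?\<pi> \<notin> ?Z" using m' piS pi False by auto
    ultimately show ?thesis unfolding p_def using lp_snoc by metis
  qed
  have noS: "filter (\<lambda>e. mate e \<notin> ?Z) xs = []" if "set xs \<subseteq> set as \<union> set bs" for xs
  proof -
    have "mate x \<in> ?Z" if "x \<in> set as \<union> set bs" for x
      using that m'[of x] S_iff[of x] inv_path(2)[OF a] inv_path(2)[OF b] Pa Pb by auto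
    then show ?thesis using that by (auto simp: filter_empty_conv)
  qed
  \<comment> \<open>The effect of the contraction on bases.\<close>
  define g where "g q = (if q \<in> S then ?\<pi> else q)" for q
  \<comment> \<open>The path up to a node \<open>q\<close> of \<open>S\<close> is the path of
    \<open>q\<close>, hence begins with \<open>p\<close>; behind \<open>p\<close> nothing is pure
    any more, and the last pure node on \<open>p\<close> is the base of the blossom.\<close>
  have lpS: "lp ?Z (zs @ [q]) = ?\<pi>" if q: "q \<in> S" and v: "v \<in> Z" "P v = zs @ q # ys" for q v zs ys
  proof -
    have qZ: "q \<in> Z" "q \<noteq> root" "mate q \<notin> Z" using q SZ S_iff by auto
    have Pq: "P q = us @ [q]" if u: "u \<in> Z" "P u = us @ q # ws" for u us ws
    proof -
      obtain ys' where "P u = P q @ ys'" using inv_prefix[OF u(1), of q] u qZ by auto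
      then show ?thesis using prefix_at[of us q ws "P q" ys'] inv_path(4)[OF u(1)] inv_good[OF qZ(1,2)] u by simp
    qed
    have z: "zs @ [q] = P q" using Pq[OF v] by simp
    have "\<exists>cs. P q = p @ cs \<and> set cs \<subseteq> set as \<union> set bs"
    proof (cases "q \<in> set as")
      case True
      then obtain cs ds where "as = cs @ q # ds" by (meson split_list)
      then show ?thesis using Pq[OF a, of "p @ cs" ds] Pa by auto
    next
      case False
      then have "q \<in> set bs" using q S_iff by auto
      then obtain cs ds where "bs = cs @ q # ds" by (meson split_list)
      then show ?thesis using Pq[OF b, of "p @ cs" ds] Pb by auto
    qed
    then obtain cs where "P q = p @ cs" "set cs \<subseteq> set as \<union> set bs" by blast
    then show ?thesis using z noS lp'p lp_append[of ?Z p cs] by simp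
  qed
  \<comment> \<open>On an old path the last pure node either survives or lies in \<open>S\<close>;
    in the second case everything behind it is impure as before, and \<open>lpS\<close>
    applies.\<close>
  have G: "lp ?Z xs = g (lp Z xs)" if v: "v \<in> Z" "P v = xs @ ys" for v xs ys
  proof -
    let ?f = "filter (\<lambda>e. mate e \<notin> Z) xs"
    have sub: "filter (\<lambda>e. mate e \<notin> ?Z) xs = filter (\<lambda>e. mate e \<notin> ?Z) ?f"
      using Z' by (auto intro!: filter_cong)
    show ?thesis
    proof (cases "?f = []")
      case True
      then show ?thesis using sub SZ unfolding lp_def g_def by simp
    next
      case False
      define q where "q = lp Z xs"
      define h where "h = butlast ?f"
      have ql: "q = last ?f" using False unfolding q_def lp_def by simp
      have "q \<in> set ?f" using last_in_set[OF False] ql by simp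
      then have q: "q \<in> set xs" "mate q \<notin> Z" by auto
      have fh: "?f = h @ [q]" using False ql unfolding h_def by simp
      have qV: "q \<in> V" using q v inv_path(2)[OF v(1)] by auto
      show ?thesis
      proof (cases "q \<in> S")
        case False
        then have "mate q \<notin> ?Z" using m'[OF qV] q by simp
        then have "filter (\<lambda>e. mate e \<notin> ?Z) (h @ [q]) = filter (\<lambda>e. mate e \<notin> ?Z) h @ [q]" by simp
        then have "lp ?Z xs = q" unfolding lp_def sub fh by simp
        then show ?thesis using False unfolding g_def q_def by simp
      next
        case True
        have "\<exists>x\<in>set xs. mate x \<notin> Z" using q by blast
        then obtain us' x vs where xs': "xs = us' @ x # vs" "mate x \<notin> Z" "\<forall>z\<in>set vs. \<not> mate z \<notin> Z"
          using split_list_last_prop[of xs "\<lambda>e. mate e \<notin> Z"] by blast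
        then have vs: "filter (\<lambda>e. mate e \<notin> Z) vs = []" by (auto simp: filter_empty_conv)
        then have "x = q" using ql xs' by simp
        then have xs: "xs = us' @ q # vs" using xs' by simp
        have "filter (\<lambda>e. mate e \<notin> ?Z) vs = []" using vs Z' by (auto simp: filter_empty_conv)
        then have "lp ?Z xs = lp ?Z (us' @ [q])" using xs lp_append[of ?Z "us' @ [q]" vs] by simp
        also have "\<dots> = ?\<pi>" using lpS[OF True v(1), of us' "vs @ ys"] v xs by simp
        finally show ?thesis using True unfolding g_def q_def by simp
      qed
    qed
  qed
  have bb: "bbase a b x = g (base x)" if "x \<in> Z" for x
    unfolding bbase_def g_def S_def using that by auto
  have bn: "bbase a b x = ?\<pi>" if "x \<notin> Z" for x unfolding bbase_def using that by auto
  have PZ: "bP a b x = P x" if "x \<in> Z" for x unfolding bP_def using that by simp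
  \<comment> \<open>Here \<open>c\<close> is the end of the branch that contains the mate
    \<open>e\<close> of the new even node and \<open>d\<close> is the other end, so that the two
    symmetric cases are treated at once below.\<close>
  have NEW: "\<exists>c d cs cs1 e cs2. c \<in> Z \<and> d \<in> Z \<and> F c d \<and> fork c d p cs (drop (length p) (P d)) \<and> cs = cs1 @ e # cs2 \<and> mate e \<notin> Z \<and> x = mate e
      \<and> bP a b x = P d @ map mate (rev (e # cs2)) \<and> set cs \<subseteq> set as \<union> set bs \<and> lp ?Z (P d) = ?\<pi>"
    if x: "x \<in> ?Z" "x \<notin> Z" for x
  proof -
    have mx: "mate x \<in> S" "x \<in> V" "mate (mate x) = x" using x Z' mate_mate by auto
    have lpa: "lp ?Z (P a) = ?\<pi>" "lp ?Z (P b) = ?\<pi>"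
      using lp_append[of ?Z p as] lp_append[of ?Z p bs] noS lp'p Pa Pb by auto
    show ?thesis
    proof (cases "new a b (mate x)")
      case True
      then have "mate x \<in> set as" "mate (mate x) \<notin> Z" using fork_new[OF f] by auto
      then obtain cs1 cs2 where as: "as = cs1 @ mate x # cs2" by (meson split_list)
      have "dropWhile (\<lambda>y. y \<noteq> mate x) (P a) = mate x # cs2"
        using dropWhile_at[of "p @ cs1" "mate x" cs2] Pa as inv_path(4)[OF a] by simp
      then have "bP a b x = P b @ map mate (rev (mate x # cs2))" unfolding bP_def using x True by simp
      then show ?thesis using a b F f as mx x Pb lpa by (intro exI[of _ a] exI[of _ b] exI[of _ as] exI[of _ cs1] exI[of _ "mate x"] exI[of _ cs2]) auto
    next
      case False
      then have nb: "new b a (mate x)" using mx unfolding S_def by auto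
      then have "mate x \<in> set bs" "mate (mate x) \<notin> Z" using fork_new[OF f'] by auto
      then obtain cs1 cs2 where as: "bs = cs1 @ mate x # cs2" by (meson split_list)
      have "dropWhile (\<lambda>y. y \<noteq> mate x) (P b) = mate x # cs2"
        using dropWhile_at[of "p @ cs1" "mate x" cs2] Pb as inv_path(4)[OF b] by simp
      then have "bP a b x = P a @ map mate (rev (mate x # cs2))" unfolding bP_def using x False by simp
      then show ?thesis using a b F_sym[OF F] f' as mx x Pa lpa by (intro exI[of _ b] exI[of _ a] exI[of _ bs] exI[of _ cs1] exI[of _ "mate x"] exI[of _ cs2]) auto
    qed
  qed
  have good: "good ?Z (bP a b v) v" if v: "v \<in> ?Z - {root}" for v
  proof (cases "v \<in> Z")
    case True
    then have "good Z (P v) v" using i v unfolding inv_def by auto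
    then show ?thesis using PZ[OF True] Z' unfolding good_def by auto
  next
    case False
    then obtain c d cs cs1 e cs2 where *: "c \<in> Z" "d \<in> Z" "F c d" "fork c d p cs (drop (length p) (P d))" "cs = cs1 @ e # cs2" "mate e \<notin> Z" "v = mate e"
      "bP a b v = P d @ map mate (rev (e # cs2))" "set cs \<subseteq> set as \<union> set bs" using NEW[of v] v by blast
    have Pc: "P c = (p @ cs1) @ e # cs2" using *(4,5) unfolding fork_def by simp
    have dis: "y \<notin> set (P d) \<and> mate y \<notin> set (P d)" if "y \<in> set (e # cs2)" for y
      using fork_disjoint[OF *(4,5,6) that] .
    have ecV: "set (e # cs2) \<subseteq> V" using inv_path(2)[OF *(1)] Pc by auto
    have inj: "inj_on mate V" using mate_mate by (metis inj_on_inverseI)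
    have mm: "mate (mate y) = y" if "y \<in> set (e # cs2)" for y using that ecV mate_mate by auto
    have mcZ: "mate y \<in> ?Z" if "y \<in> set (e # cs2)" for y
      using that ecV m'[of y] S_iff[of y] *(5,9) by auto
    have mr: "mate y \<noteq> root" if "y \<in> set (e # cs2)" for y using that ecV mate_V root_V by auto
    have last: "last (e # cs2) = c" using inv_path(7)[OF *(1)] Pc by simp
    have ch: "chain root (bP a b v)"
      unfolding *(8) chain_append
    proof
      show "chain root (P d)" using inv_path(6)[OF *(2)] .
      have "chain e cs2" using inv_path(6)[OF *(1)] unfolding Pc by (simp add: chain_append)
      then show "chain (last (root # P d)) (map mate (rev (e # cs2)))"
        using chain_mate_rev[OF ecV] last F_sym[OF *(3)] inv_path(7)[OF *(2)] by simp
    qed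
    have dcs: "distinct (e # cs2)" using inv_path(4)[OF *(1)] Pc by simp
    have dist: "distinct (map mate (rev (e # cs2)))"
      unfolding distinct_map distinct_rev set_rev using inj_on_subset[OF inj ecV] dcs by blast
    have nm: "mate y \<notin> set (e # cs2)" if "y \<in> set (e # cs2)" for y
      using inv_path(5)[OF *(1), of y] that Pc by auto
    have sm: "set (bP a b v) = set (P d) \<union> mate ` set (e # cs2)" unfolding *(8) by auto
    show ?thesis unfolding good_def
    proof (intro conjI ballI)
      show "bP a b v \<noteq> []" "last (bP a b v) = v" using *(7,8) by auto
      show "set (bP a b v) \<subseteq> ?Z - {root}"
        unfolding sm using inv_path(1,3)[OF *(2)] Z' mcZ mr by auto
      show "distinct (bP a b v)" unfolding *(8) distinct_append
        using inv_path(4)[OF *(2)] dist dis by auto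
      show "chain root (bP a b v)" by (rule ch)
      fix x assume x: "x \<in> set (bP a b v)"
      show "mate x \<notin> set (bP a b v)"
      proof (cases "x \<in> set (P d)")
        case True
        have "mate x \<notin> mate ` set (e # cs2)"
        proof
          assume "mate x \<in> mate ` set (e # cs2)"
          then obtain y where y: "y \<in> set (e # cs2)" "mate x = mate y" by blast
          moreover have "x \<in> V" using True inv_path(2)[OF *(2)] by auto
          ultimately have "x = y" using mm mate_mate by metis
          then show False using dis y True by blast
        qed
        then show ?thesis unfolding sm using True inv_path(5)[OF *(2)] by blast
      next
        case False
        then obtain y where y: "y \<in> set (e # cs2)" "x = mate y" using x unfolding sm by blast
        have "y \<notin> mate ` set (e # cs2)" using nm mm y by (metis imageE)
        then show ?thesis unfolding sm using y mm dis by auto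
      qed
    qed
  qed
  have pre: "\<exists>ys. bP a b v = bP a b e @ ys" if v: "v \<in> ?Z" and e: "e \<in> set (bP a b v)" "mate e \<notin> ?Z" for v e
  proof -
    have old: "\<exists>ys. P u = bP a b e @ ys" if u: "u \<in> Z" "e \<in> set (P u)" for u
    proof -
      have "e \<in> Z" using inv_path(1)[OF u(1)] u by auto
      then show ?thesis using inv_prefix[OF u] e Z' PZ by auto
    qed
    show ?thesis
    proof (cases "v \<in> Z")
      case True
      then show ?thesis using old e PZ by auto
    next
      case False
      then obtain c d cs cs1 e' cs2 where *: "c \<in> Z" "d \<in> Z" "fork c d p cs (drop (length p) (P d))" "cs = cs1 @ e' # cs2"
        "bP a b v = P d @ map mate (rev (e' # cs2))" using NEW[of v] v by blast
      have "e \<in> set (P d)"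
      proof (rule ccontr)
        assume "e \<notin> set (P d)"
        then obtain y where y: "y \<in> set (e' # cs2)" "e = mate y" using e(1) unfolding *(5) by auto
        have "y \<in> set (P c)" using y *(3,4) unfolding fork_def by auto
        then have "y \<in> Z" "y \<in> V" using inv_path(1,2)[OF *(1)] by auto
        then show False using y e Z' mate_mate by auto
      qed
      then obtain ys where "P d = bP a b e @ ys" using old *(2) by blast
      then show ?thesis unfolding *(5) by simp
    qed
  qed
  have base: "bbase a b e = lp ?Z (xs @ [e]) \<and> (mate e \<in> ?Z \<longrightarrow> bbase a b (mate e) = lp ?Z xs)"
    if v: "v \<in> ?Z" "bP a b v = xs @ e # ys" for v xs e ys
  proof -
    have old: ?thesis if u: "u \<in> Z" "P u = xs @ e # zs" for u zs
    proof -
      have eZ: "e \<in> Z" "e \<in> V" using inv_path(1,2)[OF u(1)] u(2) by auto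
      have 1: "lp ?Z (xs @ [e]) = g (lp Z (xs @ [e]))" using G[OF u(1), of "xs @ [e]" zs] u(2) by simp
      have 2: "lp ?Z xs = g (lp Z xs)" using G[OF u(1), of xs "e # zs"] u(2) by simp
      have 3: "bbase a b e = lp ?Z (xs @ [e])" using bb[OF eZ(1)] inv_base(1)[OF u] 1 by simp
      moreover have "bbase a b (mate e) = lp ?Z xs" if m: "mate e \<in> ?Z"
      proof (cases "mate e \<in> Z")
        case True
        then show ?thesis using bb[OF True] inv_base(2)[OF u True] 2 by simp
      next
        case False
        then have "e \<in> S" using m m' eZ by blast
        then have "lp ?Z (xs @ [e]) = ?\<pi>" using lpS[OF _ u] by simp
        then show ?thesis using bn[OF False] lp_snoc[of ?Z xs e] m by simp
      qed
      ultimately show ?thesis by blast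
    qed
    show ?thesis
    proof (cases "v \<in> Z")
      case True
      then show ?thesis using old[OF True] v PZ by simp
    next
      case False
      then obtain c d cs cs1 e' cs2 where *: "c \<in> Z" "d \<in> Z" "fork c d p cs (drop (length p) (P d))" "cs = cs1 @ e' # cs2" "mate e' \<notin> Z"
        "bP a b v = P d @ map mate (rev (e' # cs2))" "set cs \<subseteq> set as \<union> set bs" "lp ?Z (P d) = ?\<pi>" using NEW[of v] v by blast
      have eq: "xs @ e # ys = P d @ map mate (rev (e' # cs2))" using v *(6) by simp
      \<comment> \<open>The node \<open>e\<close> lies either on the old path of \<open>d\<close> or
        on the branch traversed backwards.\<close>
      show ?thesis
      proof (cases "length xs < length (P d)")
        case True
        have "P d = take (length (P d)) (xs @ e # ys)" using eq by simp
        also have "\<dots> = xs @ e # take (length (P d) - Suc (length xs)) ys"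
          using True by (simp add: Suc_diff_Suc take_Cons')
        finally show ?thesis using old[OF *(2)] by blast
      next
        case False
        have "xs @ e # ys = (P d) @ map mate (rev (e' # cs2))" by (rule eq)
        then have "take (length (P d)) (xs @ e # ys) = P d" by simp
        then have "P d = take (length (P d)) xs" using False by simp
        then obtain us where us1: "xs = P d @ us" by (metis append_take_drop_id)
        then have us: "xs = P d @ us" "us @ e # ys = map mate (rev (e' # cs2))" using eq by simp_all
        have Pc: "P c = (p @ cs1) @ e' # cs2" using *(3,4) unfolding fork_def by simp
        have ecV: "set (e' # cs2) \<subseteq> V" "set (e' # cs2) \<subseteq> Z" using inv_path(1,2)[OF *(1)] Pc by auto
        have "e \<in> set (us @ e # ys)" by simp
        then obtain y where y: "y \<in> set (e' # cs2)" "e = mate y" unfolding us(2) by auto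
        have yV: "y \<in> V" "y \<in> Z" "mate e = y" using y ecV mate_mate by auto
        \<comment> \<open>The nodes of the turned branch are mates of old even nodes, so none of
          them is pure.\<close>
        have fm: "filter (\<lambda>e. mate e \<notin> ?Z) zs = []" if "set zs \<subseteq> set (us @ e # ys)" for zs
        proof -
          have "mate x \<in> ?Z" if x: "x \<in> set (us @ e # ys)" for x
          proof -
            obtain y where "y \<in> set (e' # cs2)" "x = mate y" using x unfolding us(2) by auto
            then have "mate x = y" "y \<in> Z" using ecV mate_mate by auto
            then show ?thesis using Z' by simp
          qed
          then show ?thesis using that by (auto simp: filter_empty_conv)
        qed
        have fu: "filter (\<lambda>e. mate e \<notin> ?Z) us = []" "filter (\<lambda>e. mate e \<notin> ?Z) (us @ [e]) = []"
          by (rule fm; auto)+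
        have xe: "xs @ [e] = P d @ (us @ [e])" using us(1) by simp
        have lx: "lp ?Z xs = ?\<pi>" "lp ?Z (xs @ [e]) = ?\<pi>"
          unfolding xe lp_append[of _ "P d" "us @ [e]"] unfolding us(1) lp_append[of _ "P d" us] fu *(8) by simp_all
        obtain us' ws' where cy: "e' # cs2 = us' @ y # ws'" using y by (meson split_list)
        have Pcy: "P c = ((p @ cs1) @ us') @ y # ws'" using Pc cy by simp
        have inS: "lp Z ((p @ cs1) @ us' @ zs) \<in> S" if "us' @ zs \<noteq> []" "hd (us' @ zs) = e'" "set zs \<subseteq> set (e' # cs2)" for zs
        proof -
          have h: "e' \<in> set (us' @ zs)" using that(1,2) hd_in_set by metis
          then have "filter (\<lambda>e. mate e \<notin> Z) (us' @ zs) \<noteq> []" using *(5) by (auto simp: filter_empty_conv)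
          then have "lp Z ((p @ cs1) @ us' @ zs) = lp Z (us' @ zs)" using lp_append[of Z "p @ cs1" "us' @ zs"] by metis
          moreover have "lp Z (us' @ zs) \<in> set (us' @ zs) \<and> mate (lp Z (us' @ zs)) \<notin> Z" using lp_in h *(5) by blast
          moreover have "set us' \<subseteq> set (e' # cs2)" using cy by (metis set_append Un_upper1)
          ultimately show ?thesis using S_iff that(3) *(4,7) by auto
        qed
        have by1: "bbase a b y = ?\<pi>"
        proof -
          have "base y = lp Z ((p @ cs1) @ us' @ [y])" using inv_base(1)[OF *(1) Pcy] by simp
          moreover have "hd (us' @ [y]) = e'" using cy by (cases us') auto
          ultimately have "base y \<in> S" using inS[of "[y]"] y by simp
          then show ?thesis using bb[OF yV(2)] unfolding g_def by simp
        qed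
        have be: "bbase a b e = ?\<pi>"
        proof (cases "e \<in> Z")
          case True
          then have "mate y \<in> Z" using y by simp
          then have "y \<noteq> e'" using *(5) by auto
          then have "us' \<noteq> []" "hd us' = e'" using cy by (cases us'; auto)+
          moreover have "base e = lp Z ((p @ cs1) @ us')" using inv_base(2)[OF *(1) Pcy] True y by simp
          ultimately have "base e \<in> S" using inS[of "[]"] by simp
          then show ?thesis using bb[OF True] unfolding g_def by simp
        qed (rule bn)
        show ?thesis using be by1 lx yV by simp
      qed
    qed
  qed
  have "root \<in> Z" "root \<in> ?Z" using inv_facts Z' by auto
  moreover have "bP a b root = []" "bbase a b root = root"
    using PZ[OF inv_facts(1)] bb[OF inv_facts(1)] inv_facts SZ unfolding g_def by auto
  moreover have "\<forall>v\<in>?Z - {root}. good ?Z (bP a b v) v" by (intro ballI good)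
  moreover have "\<forall>v\<in>?Z. \<forall>e\<in>set (bP a b v). mate e \<notin> ?Z \<longrightarrow> (\<exists>ys. bP a b v = bP a b e @ ys)"
    by (intro ballI impI pre)
  moreover have "\<forall>v\<in>?Z. \<forall>xs e ys. bP a b v = xs @ e # ys \<longrightarrow>
     bbase a b e = lp ?Z (xs @ [e]) \<and> (mate e \<in> ?Z \<longrightarrow> bbase a b (mate e) = lp ?Z xs)"
    by (intro ballI allI impI base)
  ultimately show ?thesis unfolding inv_def using ZV by (intro conjI)
qed

text \<open>Without new nodes, all pure nodes of both paths lie on the common beginning, so the two
  bases agree. Hence a blossom step between different bases enlarges the set of even nodes, which
  bounds the number of steps.\<close>

lemma blossom_progress:
  assumes a: "a \<in> Z" and b: "b \<in> Z" and ne: "base a \<noteq> base b"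
  shows "\<exists>e. new a b e \<or> new b a e"
proof (rule ccontr)
  assume n: "\<not> ?thesis"
  obtain p as bs where f: "fork a b p as bs" using fork_ex[OF a b] by blast
  have f': "fork b a p bs as" using fork_sym f .
  have "filter (\<lambda>e. mate e \<notin> Z) as = []" "filter (\<lambda>e. mate e \<notin> Z) bs = []"
    using n fork_new[OF f] fork_new[OF f'] by (auto simp: filter_empty_conv)
  then have "lp Z (P a) = lp Z p" "lp Z (P b) = lp Z p"
    using f lp_append[of Z p] unfolding fork_def by auto
  then show False using inv_base_lp a b ne by simp
qed

end

end

section \<open>The split vertices as numbers: copies \<open>i\<close> and \<open>i + n\<close> for
  the two classes, root \<open>2 * n\<close>\<close>

definition mate :: "nat \<Rightarrow> nat \<Rightarrow> nat" where "mate n e = (if e < n then e + n else e - n)"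
definition idx :: "nat \<Rightarrow> nat \<Rightarrow> nat" where "idx n e = (if e < n then e else e - n)"
definition side :: "nat \<Rightarrow> nat \<Rightarrow> nat" where "side n e = (if e < n then 0 else 1)"
definition node :: "nat \<Rightarrow> nat \<Rightarrow> nat \<Rightarrow> nat" where "node n i c = (if c = 0 then i else i + n)"

lemma node_simps:
  "i < n \<Longrightarrow> idx n (node n i c) = i"
  "i < n \<Longrightarrow> c < 2 \<Longrightarrow> side n (node n i c) = c"
  "i < n \<Longrightarrow> node n i c < 2 * n"
  "i < n \<Longrightarrow> c < 2 \<Longrightarrow> mate n (node n i c) = node n i (1 - c)"
  "e < 2 * n \<Longrightarrow> node n (idx n e) (side n e) = e"
  "e < 2 * n \<Longrightarrow> mate n (mate n e) = e"
  "e < 2 * n \<Longrightarrow> mate n e < 2 * n"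
  "e < 2 * n \<Longrightarrow> mate n e \<noteq> e"
  "e < 2 * n \<Longrightarrow> idx n (mate n e) = idx n e"
  "e < 2 * n \<Longrightarrow> side n (mate n e) = 1 - side n e"
  "e < 2 * n \<Longrightarrow> idx n e < n"
  "side n e < 2" "side n e \<le> Suc 0"
  by (auto simp: node_def idx_def side_def mate_def)

lemma idx_eq: "e < 2 * n \<Longrightarrow> e' < 2 * n \<Longrightarrow> idx n e = idx n e' \<Longrightarrow> e = e' \<or> e = mate n e'"
  by (auto simp: idx_def mate_def split: if_splits)

section \<open>Direct exchanges\<close>

context cover_phase
begin

lemma single_or_mid:
  assumes "w \<in> W" "i \<in> I" "adj w i"
  shows "single w i \<or> (\<exists>u. mid w i u)"
proof (cases "\<exists>u\<in>I. u \<noteq> i \<and> adj w u")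
  case True
  then obtain u where u: "u \<in> I" "u \<noteq> i" "adj w u" by blast
  have "{j \<in> I. adj w j} = {i, u}" using no_three[OF indep_I assms(1) assms(2) u(1)] assms u by blast
  then show ?thesis unfolding mid_def using assms u by blast
next
  case False
  then have "{j \<in> I. adj w j} = {i}" using assms by blast
  then show ?thesis unfolding single_def using assms by blast
qed

lemma indep_insert: "indep S \<Longrightarrow> w \<in> W \<Longrightarrow> (\<And>x. x \<in> S \<Longrightarrow> \<not> adj w x) \<Longrightarrow> indep (insert w S)"
  using irrefl sym unfolding indep_def by blast

lemma indep_delete: "indep (I - {i})"
  using indep_I unfolding indep_def by blast

lemma add_free: "w \<in> W \<Longrightarrow> (\<And>i. i \<in> I \<Longrightarrow> \<not> adj w i) \<Longrightarrow> indep (insert w I)"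
  using indep_insert[OF indep_I] .

lemma swap_full:
  assumes j: "single j i" and "A i \<subseteq> A j"
  shows "indep (insert j (I - {i}))" "\<Union> (A ` I) \<subseteq> \<Union> (A ` insert j (I - {i}))"
proof -
  show "indep (insert j (I - {i}))"
    using indep_insert[OF indep_delete singleD(1)[OF j]] singleD(8)[OF j] by blast
  show "\<Union> (A ` I) \<subseteq> \<Union> (A ` insert j (I - {i}))" using assms(2) by blast
qed

text \<open>\<open>split\<close> at \<open>i\<close> makes the nonadjacent \<open>j\<close> and
  \<open>v\<close> cover \<open>A i\<close>.\<close>

lemma swap_two:
  assumes j: "single j i" and v: "single v i" and "j \<noteq> v" "\<not> adj j v"
  shows "indep (insert j (insert v (I - {i})))" "\<Union> (A ` I) \<subseteq> \<Union> (A ` insert j (insert v (I - {i})))"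
proof -
  show "indep (insert j (insert v (I - {i})))"
  proof (rule indep_insert)
    show "indep (insert v (I - {i}))"
      using indep_insert[OF indep_delete singleD(1)[OF v]] singleD(8)[OF v] by blast
    show "\<not> adj j x" if "x \<in> insert v (I - {i})" for x using that singleD(8)[OF j] assms(4) by blast
  qed (rule singleD(1)[OF j])
  have "A i \<subseteq> A j \<union> A v" using split[of i j v] singleD[OF j] singleD[OF v] assms by blast
  then show "\<Union> (A ` I) \<subseteq> \<Union> (A ` insert j (insert v (I - {i})))" by blast
qed

end

section \<open>The node graph, and why a stuck search excludes a cover\<close>

locale cover_nodes = cover_stuck +
  fixes n :: nat
  assumes W_n: "W \<subseteq> {..<n}"
begin

abbreviation rt :: nat where "rt \<equiv> 2 * n"

text \<open>\<open>w\<close> realises the step between consecutive even nodes of a path, that is, an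
  edge from \<open>e\<close> to the mate of \<open>e'\<close>. Therefore the vertices entering and
  leaving a node of the path have opposite classes there.\<close>

definition link :: "nat \<Rightarrow> nat \<Rightarrow> nat \<Rightarrow> bool" where
  "link w e e' \<longleftrightarrow> mid w (idx n e) (idx n e') \<and> cls w (idx n e) = side n e \<and> cls w (idx n e') = 1 - side n e'"

definition edge :: "nat \<Rightarrow> nat \<Rightarrow> bool" where
  "edge e b \<longleftrightarrow> e < rt \<and> b < rt \<and> (\<exists>w. mid w (idx n e) (idx n b) \<and> cls w (idx n e) = side n e \<and> cls w (idx n b) = side n b)"

text \<open>\<open>b\<close> is the odd node of the first step. Its mate, the first even node, then
  carries the class of a vertex that is compatible with a start vertex.\<close>

definition rootE :: "nat \<Rightarrow> bool" where
  "rootE b \<longleftrightarrow> b < rt \<and> (\<exists>w u. mid w (idx n b) u \<and> cls w (idx n b) = 1 - side n b \<and> st w (idx n b))"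

text \<open>A vertex entering the even node \<open>e\<close> has the class opposite to
  \<open>side n e\<close>, so this is the class in which \<open>fin\<close> is asked for.\<close>

definition finE :: "nat \<Rightarrow> bool" where
  "finE e \<longleftrightarrow> e < rt \<and> (\<exists>w u. mid w (idx n e) u \<and> cls w (idx n e) = 1 - side n e \<and> fin w (idx n e))"

definition adjF :: "nat \<Rightarrow> nat \<Rightarrow> bool" where
  "adjF a b \<longleftrightarrow> a = rt \<and> rootE b \<or> b = rt \<and> rootE a \<or> edge a b"

lemma I_n: "i \<in> I \<Longrightarrow> i < n"
  using I_W W_n by blast

lemma adjF_sym: "adjF a b \<Longrightarrow> adjF b a"
  unfolding adjF_def edge_def using mid_sym by metis

text \<open>If \<open>b\<close> is even, it has the base of \<open>a\<close>, which belongs to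
  another vertex; so \<open>b\<close> is not its own base, hence not pure, and its mate is even with
  the same base. Otherwise \<open>mate n b\<close> is even and pure, and is its own base.\<close>

lemma close_step:
  assumes cl: "\<And>b. adjF a b \<Longrightarrow> b \<in> Z \<and> base a = base b \<or> b \<notin> Z \<and> mate n b \<in> Z"
    and pure: "\<And>v. v \<in> Z \<Longrightarrow> v \<noteq> rt \<Longrightarrow> mate n v \<notin> Z \<Longrightarrow> base v = v"
    and nonpure: "\<And>v. v \<in> Z \<Longrightarrow> v \<noteq> rt \<Longrightarrow> mate n v \<in> Z \<Longrightarrow> base (mate n v) = base v"
    and a: "base a \<in> B" and F: "adjF a b" and b: "b < rt" "\<And>x. x \<in> B \<Longrightarrow> x = rt \<or> idx n x \<noteq> idx n b"
  shows "mate n b \<in> Z \<and> base (mate n b) \<in> insert (mate n b) B"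
proof -
  have m: "mate n b \<noteq> rt" "mate n (mate n b) = b" "b \<noteq> rt" using node_simps(6,7)[OF b(1)] b(1) by auto
  show ?thesis
  proof (cases "b \<in> Z")
    case True
    then have "base b \<in> B" using cl[OF F] a by metis
    then have "base b \<noteq> b" using b m by metis
    then have "mate n b \<in> Z" using pure[OF True m(3)] by blast
    then show ?thesis using nonpure[OF True m(3)] \<open>base b \<in> B\<close> by simp
  next
    case False
    then have "mate n b \<in> Z" using cl[OF F] by blast
    then show ?thesis using pure[of "mate n b"] m False by simp
  qed
qed

text \<open>A walk along the symmetric difference with an independent cover \<open>J\<close> never leaves the even nodes, so it
  would have to be infinite.\<close>

definition walk :: "nat set \<Rightarrow> nat set \<Rightarrow> (nat \<Rightarrow> nat) \<Rightarrow> nat set \<Rightarrow> nat set \<Rightarrow> nat \<Rightarrow> nat \<Rightarrow> nat \<Rightarrow> bool" where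
  "walk J Z base S js i j u \<longleftrightarrow> S \<subseteq> I \<and> i \<in> S \<and> j \<in> J \<and> j \<notin> js \<and> mid j i u \<and> cls j i < 2 \<and>
     node n i (cls j i) \<in> Z \<and> base (node n i (cls j i)) \<in> {e. e = rt \<or> e < rt \<and> idx n e \<in> S} \<and>
     (\<forall>i'\<in>S - {i}. \<forall>j'\<in>J. adj j' i' \<longrightarrow> j' \<in> js) \<and> (\<forall>j'\<in>J. adj j' i \<longrightarrow> j' \<in> insert j js) \<and>
     (\<exists>j0\<in>js. j0 \<in> J \<and> x0 \<in> A j0) \<and> (\<forall>j'\<in>js. \<forall>i'\<in>I. adj j' i' \<longrightarrow> i' \<in> S)"

text \<open>From the vertex of \<open>J\<close> that covers \<open>x0\<close>, the walk alternates
  between \<open>I\<close> and \<open>J\<close>. It continues because a vertex of \<open>J\<close>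
  does not cover all of \<open>A u\<close> alone, and it visits a fresh vertex of \<open>I\<close>
  each time. The condition on the base, that it belongs to a vertex visited already, is what makes
  \<open>close_step\<close> applicable to the next fresh vertex.\<close>

lemma no_cover:
  assumes cl: "\<And>a b. a \<in> Z \<Longrightarrow> adjF a b \<Longrightarrow> b \<in> Z \<and> base a = base b \<or> b \<notin> Z \<and> mate n b \<in> Z"
    and pure: "\<And>v. v \<in> Z \<Longrightarrow> v \<noteq> rt \<Longrightarrow> mate n v \<notin> Z \<Longrightarrow> base v = v"
    and nonpure: "\<And>v. v \<in> Z \<Longrightarrow> v \<noteq> rt \<Longrightarrow> mate n v \<in> Z \<Longrightarrow> base (mate n v) = base v"
    and root: "rt \<in> Z" "base rt = rt" and nofin: "\<And>e. e \<in> Z \<Longrightarrow> \<not> finE e"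
    and J: "indep J" and cov: "\<And>i. i \<in> I \<Longrightarrow> A i \<subseteq> \<Union> (A ` J)" and x0: "x0 \<in> \<Union> (A ` J)"
  shows False
proof -
  have JW: "j \<in> W" if "j \<in> J" for j using J that unfolding indep_def by blast
  have JJ: "\<not> adj j j'" if "j \<in> J" "j' \<in> J" for j j' using J that unfolding indep_def by blast
  have Jd: "j = j'" if "j \<in> J" "j' \<in> J" "x \<in> A j" "x \<in> A j'" for j j' x using indep_disjoint[OF J that] .
  \<comment> \<open>\<open>J\<close> has to cover the part of \<open>A u\<close> missed by
    \<open>j\<close>; the vertex doing so is adjacent to \<open>u\<close> by \<open>shared\<close>,
    since \<open>u\<close> is not in \<open>J\<close>.\<close>
  have other: "\<exists>j'. j' \<in> J \<and> j' \<noteq> j \<and> adj j' u \<and> \<not> adj j j' \<and> (single j' u \<or> (\<exists>u'. mid j' u u'))"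
    if j: "j \<in> J" "u \<in> I" "adj j u" "\<not> A u \<subseteq> A j" for j u
  proof -
    obtain z where z: "z \<in> A u" "z \<notin> A j" using j by blast
    then obtain j' where j': "j' \<in> J" "z \<in> A j'" using cov[OF j(2)] by blast
    have "u \<notin> J" using JJ[of j u] j by blast
    then have "adj j' u" using shared[of j' u z] JW j' z I_W[OF j(2)] by blast
    then show ?thesis using j' z JJ[of j j'] j single_or_mid[of j' u] JW by blast
  qed
  have base_case: "\<exists>S js i j u. walk J Z base S js i j u \<and> card S = 1"
  proof -
    obtain j0 where j0: "j0 \<in> J" "x0 \<in> A j0" using x0 by blast
    obtain i where i: "i \<in> I" "adj j0 i" using no_free[OF JW[OF j0(1)] j0(2)] by blast
    have s0: "single j0 i" using single_or_mid[OF JW[OF j0(1)] i] mid_x0 j0 by blast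
    obtain j where j: "j \<in> J" "j \<noteq> j0" "adj j i" "\<not> adj j0 j" "single j i \<or> (\<exists>u'. mid j i u')"
      using other[OF j0(1) i no_full[OF s0 j0(2)]] by blast
    have "x0 \<notin> A j" using Jd[OF j(1) j0(1) _ j0(2)] j(2) by blast
    then have "\<not> single j i" using no_swap[OF s0 j0(2)] j(4) by blast
    then obtain u where u: "mid j i u" using j by blast
    have st: "st j i" unfolding st_def using s0 j0 j by blast
    then have c: "cls j i < 2" using cls_live[OF u] by blast
    have iN: "i < n" using I_n i by blast
    define e where "e = node n i (cls j i)"
    have e: "e < rt" "idx n e = i" "side n e = cls j i" unfolding e_def using node_simps iN c by auto
    define b where "b = mate n e"
    have b: "b < rt" "idx n b = i" "side n b = 1 - cls j i" "mate n b = e"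
      unfolding b_def using node_simps(6,7,9,10)[OF e(1)] e by auto
    have "mid j (idx n b) u" "cls j (idx n b) = 1 - side n b" "st j (idx n b)" using b u st c by simp_all
    then have "rootE b" unfolding rootE_def using b(1) by blast
    then have "adjF rt b" unfolding adjF_def by blast
    then have "mate n b \<in> Z \<and> base (mate n b) \<in> insert (mate n b) {rt}"
      by (intro close_step[of rt Z base] cl pure nonpure) (use root b in auto)
    then have Z: "e \<in> Z" "base e = rt \<or> base e = e" using b by auto
    have nb: "j' \<in> insert j {j0}" if "j' \<in> J" "adj j' i" for j'
      using no_three[OF J I_W[OF i(1)] that(1) j(1) j0(1)] that j i adj_sym by blast
    have j0i: "i' \<in> {i}" if "i' \<in> I" "adj j0 i'" for i' using singleD(8)[OF s0] that by blast
    have "base e \<in> {e. e = rt \<or> e < rt \<and> idx n e \<in> {i}}" using Z(2) e by auto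
    then have "walk J Z base {i} {j0} i j u" unfolding walk_def e_def[symmetric]
      using i(1) j(1,2) u c Z(1) nb j0i j0 by blast
    then show ?thesis by (metis is_singletonI is_singleton_altdef)
  qed
  have step: "\<exists>S js i j u. walk J Z base S js i j u \<and> card S = Suc r" if wk: "\<exists>S js i j u. walk J Z base S js i j u \<and> card S = r" for r
  proof -
    obtain S js i j u where w0: "walk J Z base S js i j u" "card S = r" using wk by blast
    have w: "S \<subseteq> I" "card S = r" "i \<in> S" "j \<in> J" "j \<notin> js" "mid j i u" "cls j i < 2"
      "node n i (cls j i) \<in> Z" "base (node n i (cls j i)) \<in> {e. e = rt \<or> e < rt \<and> idx n e \<in> S}"
      "\<forall>i'\<in>S - {i}. \<forall>j'\<in>J. adj j' i' \<longrightarrow> j' \<in> js" "\<forall>j'\<in>J. adj j' i \<longrightarrow> j' \<in> insert j js"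
      "\<exists>j0\<in>js. j0 \<in> J \<and> x0 \<in> A j0" "\<forall>j'\<in>js. \<forall>i'\<in>I. adj j' i' \<longrightarrow> i' \<in> S"
      using w0 unfolding walk_def by blast+
    note M = midD[OF w(6)]
    have m': "mid j u i" using w(6) mid_sym by blast
    have uS: "u \<notin> S" using w(4,5,10) M by blast
    have iN: "i < n" "u < n" using I_n M by auto
    define e where "e = node n i (cls j i)"
    have e: "e < rt" "idx n e = i" "side n e = cls j i" unfolding e_def using node_simps iN w(7) by auto
    have reach: "node n u (1 - cls j u) \<in> Z \<and> base (node n u (1 - cls j u)) \<in> insert (node n u (1 - cls j u)) {e. e = rt \<or> e < rt \<and> idx n e \<in> S}"
      if c: "cls j u < 2"
    proof -
      define b where "b = node n u (cls j u)"
      have b: "b < rt" "idx n b = u" "side n b = cls j u" "mate n b = node n u (1 - cls j u)"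
        unfolding b_def using node_simps iN c by auto
      have "mid j (idx n e) (idx n b)" "cls j (idx n e) = side n e" "cls j (idx n b) = side n b" using e b w(6) by simp_all
      then have "adjF e b" unfolding adjF_def edge_def using e(1) b(1) by blast
      then have "mate n b \<in> Z \<and> base (mate n b) \<in> insert (mate n b) {e. e = rt \<or> e < rt \<and> idx n e \<in> S}"
        by (intro close_step[of e Z base] cl pure nonpure) (use w(8,9) e_def b uS in auto)
      then show ?thesis using b by simp
    qed
    \<comment> \<open>Otherwise the even node reached through \<open>j\<close> would satisfy
      \<open>finE\<close>. So \<open>A u\<close> is not contained in \<open>A j\<close>, and the
      next vertex of \<open>J\<close> is not one with \<open>u\<close> as its only neighbour in
      \<open>I\<close>.\<close>
    have nf: "\<not> fin j u"
    proof
      assume f: "fin j u"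
      then have c: "cls j u < 2" using cls_live[OF m'] by blast
      let ?e = "node n u (1 - cls j u)"
      have "idx n ?e = u" "side n ?e = 1 - cls j u" and lt: "?e < rt" using node_simps iN c by auto
      then have "mid j (idx n ?e) i" "cls j (idx n ?e) = 1 - side n ?e" "fin j (idx n ?e)" using m' f c by simp_all
      then have "finE ?e" unfolding finE_def using lt by blast
      then show False using nofin reach[OF c] by blast
    qed
    obtain j' where j': "j' \<in> J" "j' \<noteq> j" "adj j' u" "\<not> adj j j'" "single j' u \<or> (\<exists>u'. mid j' u u')"
      using other[of j u] w(4) M nf unfolding fin_def by blast
    have js: "j' \<notin> js" using w(13) j' uS M by blast
    then have x: "x0 \<notin> A j'" using w(12) Jd j' by blast
    have ns: "\<not> single j' u" using nf x j' unfolding fin_def using adj_sym by blast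
    then obtain u' where u': "mid j' u u'" using j' by blast
    have "u' \<noteq> i" using w(11) j' js midD(8)[OF u'] by blast
    then have p: "perp u j j'" unfolding perp_def using m' u' j' by blast
    then have c: "cls j u < 2" "cls j' u = 1 - cls j u" using cls_perp by auto
    have nb: "j'' \<in> insert j' (insert j js)" if "j'' \<in> J" "adj j'' u" for j''
      using no_three[OF J M(5) that(1) j'(1) w(4)] that j' M adj_sym by blast
    have jI: "i' \<in> insert u S" if "i' \<in> I" "adj j i'" for i' using M(14) that w(3) by blast
    have "finite S" using w(1) I_W fin_W finite_subset[of S W] by blast
    then have "card (insert u S) = Suc r" using uS w(2) by simp
    moreover have "insert u S \<subseteq> I" using w(1) M by blast
    moreover have "node n u (cls j' u) \<in> Z" "base (node n u (cls j' u)) \<in> {e. e = rt \<or> e < rt \<and> idx n e \<in> insert u S}"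
      using reach[OF c(1)] c(2) node_simps(1,3) iN by auto
    moreover have "cls j' u < 2" using c by simp
    moreover have "j' \<notin> insert j js" using js j' by blast
    moreover have "\<forall>i'\<in>insert u S - {u}. \<forall>j''\<in>J. adj j'' i' \<longrightarrow> j'' \<in> insert j js" using w(10,11) by blast
    moreover have "\<forall>j''\<in>J. adj j'' u \<longrightarrow> j'' \<in> insert j' (insert j js)" using nb by blast
    moreover have "\<exists>j0\<in>insert j js. j0 \<in> J \<and> x0 \<in> A j0" using w(12) by blast
    moreover have "\<forall>j'\<in>insert j js. \<forall>i'\<in>I. adj j' i' \<longrightarrow> i' \<in> insert u S" using w(13) jI by blast
    ultimately have "walk J Z base (insert u S) (insert j js) u j' u'" "card (insert u S) = Suc r"
      unfolding walk_def using j'(1) u' by simp_all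
    then show ?thesis by blast
  qed
  \<comment> \<open>A walk with more vertices of \<open>I\<close> than \<open>I\<close> has.\<close>
  have "\<exists>S js i j u. walk J Z base S js i j u \<and> card S = Suc r" for r
    by (induction r) (use base_case step in simp_all)
  then obtain S where S: "S \<subseteq> I" "card S = Suc (card I)" unfolding walk_def by metis
  have "finite I" using I_W fin_W finite_subset[of I W] by blast
  then have "card S \<le> card I" using S(1) card_mono by blast
  then show False using S(2) by simp
qed

section \<open>Augmentation along a path of nodes\<close>

context
  fixes es :: "nat list" and r :: nat
  assumes len: "length es = r" and r0: "r > 0" and nodes: "\<And>k. k < r \<Longrightarrow> es ! k < rt"
    and dist: "\<And>k l. k < r \<Longrightarrow> l < r \<Longrightarrow> idx n (es ! k) = idx n (es ! l) \<Longrightarrow> k = l"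
    and first: "adjF rt (mate n (es ! 0))"
    and steps: "\<And>k. Suc k < r \<Longrightarrow> adjF (es ! k) (mate n (es ! Suc k))"
    and finish: "finE (es ! (r - 1))"
begin

lemma path_link: "Suc k < r \<Longrightarrow> \<exists>w. link w (es ! k) (es ! Suc k)"
proof -
  assume k: "Suc k < r"
  have *: "es ! k < rt" "es ! Suc k < rt" using nodes k by auto
  then have "edge (es ! k) (mate n (es ! Suc k))"
    using steps[OF k] node_simps(7)[OF *(2)] unfolding adjF_def by auto
  then show ?thesis unfolding edge_def link_def using node_simps(9,10)[OF *(2)] by simp
qed

lemma path_first: "\<exists>w u. mid w (idx n (es ! 0)) u \<and> cls w (idx n (es ! 0)) = side n (es ! 0) \<and> st w (idx n (es ! 0))"
proof -
  have *: "es ! 0 < rt" using nodes r0 by auto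
  then have "rootE (mate n (es ! 0))"
    using first node_simps(7)[OF *] unfolding adjF_def edge_def by auto
  moreover have "1 - (1 - side n (es ! 0)) = side n (es ! 0)" using node_simps(13)[of n "es ! 0"] by simp
  ultimately show ?thesis unfolding rootE_def using node_simps(9,10)[OF *] by simp
qed

lemma path_long: "r \<ge> 2"
proof (rule ccontr)
  assume "\<not> r \<ge> 2"
  then have r: "r = 1" using r0 by simp
  obtain w u where w: "mid w (idx n (es ! 0)) u" "cls w (idx n (es ! 0)) = side n (es ! 0)" "st w (idx n (es ! 0))"
    using path_first by blast
  obtain w' u' where "mid w' (idx n (es ! 0)) u'" "cls w' (idx n (es ! 0)) = 1 - side n (es ! 0)" "fin w' (idx n (es ! 0))"
    using finish r unfolding finE_def by auto
  then show False using no_short w node_simps(12) by metis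
qed

lemma path_start: "link w (es ! 0) (es ! 1) \<Longrightarrow> st w (idx n (es ! 0))"
  using path_first st_transfer node_simps(12) unfolding link_def by metis

text \<open>The vertex known to satisfy \<open>fin\<close> need not be the one that realises the
  last step; \<open>fin_transfer\<close> provides one that does both. The edge before it, or the
  start of the path, supplies the assumption on the preceding node.\<close>

lemma path_last: "\<exists>w. link w (es ! (r - 2)) (es ! (r - 1)) \<and> fin w (idx n (es ! (r - 1)))"
proof -
  define k where "k = r - 2"
  have k: "Suc k < r" "r - 1 = Suc k" unfolding k_def using path_long by auto
  obtain w1 where w1: "link w1 (es ! k) (es ! Suc k)" using path_link[OF k(1)] by blast
  obtain w uw where w: "mid w (idx n (es ! Suc k)) uw" "cls w (idx n (es ! Suc k)) = 1 - side n (es ! Suc k)" "fin w (idx n (es ! Suc k))"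
    using finish k unfolding finE_def by auto
  have s: "1 - side n (es ! Suc k) < 2" "side n (es ! k) < 2" by (simp, rule node_simps)
  have m1: "mid w1 (idx n (es ! Suc k)) (idx n (es ! k))" "cls w1 (idx n (es ! Suc k)) = cls w (idx n (es ! Suc k))"
    "cls w1 (idx n (es ! k)) = side n (es ! k)"
    using w1 w mid_sym unfolding link_def by auto
  have "st w1 (idx n (es ! k)) \<or> (\<exists>y u'. mid y (idx n (es ! k)) u' \<and> u' \<noteq> idx n (es ! Suc k) \<and> cls y (idx n (es ! k)) = 1 - cls w1 (idx n (es ! k)))"
  proof (cases k)
    case 0
    then show ?thesis using path_start w1 by simp
  next
    case (Suc l)
    then obtain y where y: "link y (es ! l) (es ! k)" using path_link[of l] k by auto
    have "idx n (es ! l) \<noteq> idx n (es ! Suc k)" using dist[of l "Suc k"] k Suc by auto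
    then show ?thesis using y mid_sym m1 unfolding link_def by metis
  qed
  then obtain w2 where "mid w2 (idx n (es ! Suc k)) (idx n (es ! k))" "cls w2 (idx n (es ! Suc k)) = cls w1 (idx n (es ! Suc k))"
    "cls w2 (idx n (es ! k)) = cls w1 (idx n (es ! k))" "fin w2 (idx n (es ! Suc k))"
    using fin_transfer[OF w(1) _ w(3) m1(1,2)] w(2) m1(3) s by metis
  then have "link w2 (es ! k) (es ! Suc k)" "fin w2 (idx n (es ! Suc k))" unfolding link_def using w m1 mid_sym by auto
  then show ?thesis using k k_def by metis
qed

text \<open>Nonadjacency of the new vertices reduces by \<open>mid_meets\<close> to neighbouring
  positions on the path, where opposite classes give it. Each removed vertex has two nonadjacent new
  neighbours, or one with the full trace, so its set stays covered by \<open>split\<close>.\<close>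

lemma augment:
  assumes ws: "\<And>k. Suc k < r \<Longrightarrow> link (ws k) (es ! k) (es ! Suc k)"
    and j: "single j (idx n (es ! 0))" "x0 \<in> A j" "\<not> adj j (ws 0)"
    and X: "X = {} \<and> A (idx n (es ! (r - 1))) \<subseteq> A (ws (r - 2)) \<or>
      (\<exists>v. X = {v} \<and> single v (idx n (es ! (r - 1))) \<and> x0 \<notin> A v \<and> \<not> adj v (ws (r - 2)))"
    and I': "I' = I - (\<lambda>k. idx n (es ! k)) ` {..<r} \<union> insert j (ws ` {..<r - 1} \<union> X)"
  shows "indep I' \<and> \<Union> (A ` I) \<subseteq> \<Union> (A ` I') \<and> x0 \<in> \<Union> (A ` I')"
proof -
  define q where "q k = idx n (es ! k)" for k
  have r2: "r \<ge> 2" using path_long .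
  have mid: "mid (ws k) (q k) (q (Suc k))" if "Suc k < r" for k using ws[OF that] unfolding link_def q_def by blast
  have qd: "q k = q l \<Longrightarrow> k = l" if "k < r" "l < r" for k l using dist that unfolding q_def by blast
  have js: "single j (q 0)" using j unfolding q_def by simp
  note Jd = singleD[OF js]
  have last: "Suc (r - 2) = r - 1" "Suc (r - 2) < r" using r2 by auto
  have XD: "v \<in> X \<Longrightarrow> single v (q (r - 1)) \<and> x0 \<notin> A v \<and> \<not> adj v (ws (r - 2))" for v using X unfolding q_def by auto
  \<comment> \<open>Adjacent vertices would share an end by \<open>mid_meets\<close>. The nodes of
    the path belong to distinct vertices of \<open>I\<close>, so the steps are consecutive; there
    the classes are opposite and the outer ends differ.\<close>
  have wsep: "\<not> adj (ws k) (ws l)" if "k < l" "Suc l < r" for k l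
  proof
    assume a: "adj (ws k) (ws l)"
    have k: "Suc k < r" using that by simp
    note Mk = midD[OF mid[OF k]] and Ml = midD[OF mid[OF that(2)]]
    have "ws l \<noteq> q k" "ws l \<noteq> q (Suc k)" using Ml Mk by auto
    then have "adj (ws l) (q k) \<or> adj (ws l) (q (Suc k))" using mid_meets[OF mid[OF k] Ml(1) a] by blast
    then have "q k = q l \<or> q k = q (Suc l) \<or> q (Suc k) = q l \<or> q (Suc k) = q (Suc l)" using Ml(14) Mk by blast
    then have kl: "l = Suc k" using qd[of k l] qd[of k "Suc l"] qd[of "Suc k" l] qd[of "Suc k" "Suc l"] that by auto
    have "cls (ws k) (q l) = 1 - side n (es ! l)" "cls (ws l) (q l) = side n (es ! l)"
      using ws[OF k] ws[OF that(2)] kl unfolding link_def q_def by auto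
    moreover have "mid (ws k) (q l) (q k)" using mid[OF k] mid_sym kl by blast
    moreover have "q k \<noteq> q (Suc l)" using qd[of k "Suc l"] that by auto
    ultimately have "\<not> adj (ws l) (ws k)"
      using cls_nonadj[of "ws l" "q l" "q (Suc l)" "ws k" "q k"] mid[OF that(2)] node_simps(12) by metis
    then show False using a sym by blast
  qed
  have ws_sep: "\<not> adj (ws k) (ws l)" if "Suc k < r" "Suc l < r" for k l
    using wsep[of k l] wsep[of l k] that irrefl sym by (metis linorder_neqE_nat)
  have single_sep: "\<not> adj y (ws k)" if y: "single y (q m)" "m < r" "Suc k < r" and n: "m = k \<or> m = Suc k \<Longrightarrow> \<not> adj y (ws k)" for y m k
  proof
    assume a: "adj y (ws k)"
    note Mk = midD[OF mid[OF y(3)]] and Y = singleD[OF y(1)]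
    have "y \<noteq> q k" "y \<noteq> q (Suc k)" using Mk(2,4) Y(6) by metis+
    then have "adj y (q k) \<or> adj y (q (Suc k))" using mid_meets[OF mid[OF y(3)] Y(1)] a sym by blast
    then have "q k = q m \<or> q (Suc k) = q m" using Y(8) Mk by blast
    then have "m = k \<or> m = Suc k" using qd[of k m] qd[of "Suc k" m] y by auto
    then show False using n a by blast
  qed
  have jw: "\<not> adj j (ws k)" if "Suc k < r" for k
    using single_sep[OF js _ that] j(3) r2 by auto
  have Xw: "\<not> adj v (ws k)" if "v \<in> X" "Suc k < r" for v k
  proof (rule single_sep[of v "r - 1"])
    show "single v (q (r - 1))" "r - 1 < r" "Suc k < r" using XD that r2 by auto
    assume "r - 1 = k \<or> r - 1 = Suc k"
    then have "k = r - 2" using that by auto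
    then show "\<not> adj v (ws k)" using XD that by blast
  qed
  \<comment> \<open>By \<open>split\<close> at \<open>j\<close>, one of \<open>v\<close> and the
    first removed vertex would contain \<open>x0\<close>.\<close>
  have Xj: "\<not> adj v j" if "v \<in> X" for v
  proof
    assume a: "adj v j"
    note V = singleD[OF XD[OF that, THEN conjunct1]]
    have "q 0 \<noteq> q (r - 1)" using qd[of 0 "r - 1"] r2 by auto
    then have nv: "\<not> adj v (q 0)" "v \<noteq> q 0" using V Jd by blast+
    then have "A j \<subseteq> A v \<union> A (q 0)" using split[of j v "q 0"] a Jd V sym by blast
    then show False using j(2) XD[OF that] x0_uncovered Jd by blast
  qed
  define Q where "Q = (\<lambda>k. idx n (es ! k)) ` {..<r}"
  have Q: "x \<in> Q \<longleftrightarrow> (\<exists>k<r. x = q k)" for x unfolding Q_def q_def by auto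
  have N: "y \<in> insert j (ws ` {..<r - 1} \<union> X) \<longleftrightarrow> y = j \<or> (\<exists>k. Suc k < r \<and> y = ws k) \<or> y \<in> X" for y
    by (auto simp: less_diff_conv)
  have old: "\<not> adj y x" if xy: "x \<in> I - Q" "y \<in> insert j (ws ` {..<r - 1} \<union> X)" for x y
  proof
    assume a: "adj y x"
    consider "y = j" | k where "Suc k < r" "y = ws k" | "y \<in> X" using xy(2)[unfolded N] by blast
    then show False
    proof cases
      case 1
      then have "x = q 0" using a xy Jd by blast
      moreover have "0 < r" using r0 .
      ultimately show False using xy Q by blast
    next
      case 2
      then have "x = q k \<or> x = q (Suc k)" using midD(14)[OF mid] a xy by blast
      moreover have "k < r" using 2 by simp
      ultimately show False using xy Q 2 by blast
    next
      case 3
      then have "x = q (r - 1)" using singleD(8) XD a xy by blast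
      moreover have "r - 1 < r" using r0 by simp
      ultimately show False using xy Q by blast
    qed
  qed
  have new: "\<not> adj y y'" if "y \<in> insert j (ws ` {..<r - 1} \<union> X)" "y' \<in> insert j (ws ` {..<r - 1} \<union> X)" for y y'
  proof -
    have XX: "\<not> adj v v'" if "v \<in> X" "v' \<in> X" for v v' using X that irrefl by auto
    show ?thesis using that[unfolded N] jw Xw Xj XX ws_sep irrefl sym by metis
  qed
  have W': "I' \<subseteq> W"
  proof -
    have "ws k \<in> W" if "Suc k < r" for k using midD(1)[OF mid[OF that]] .
    moreover have "v \<in> W" if "v \<in> X" for v using XD[OF that] singleD(1) by blast
    ultimately have "y \<in> W" if "y \<in> insert j (ws ` {..<r - 1} \<union> X)" for y
      using that[unfolded N] Jd(1) by blast
    then show ?thesis unfolding I' using I_W by blast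
  qed
  have "\<not> adj x y" if xy: "x \<in> I'" "y \<in> I'" for x y
  proof -
    have "x \<in> I - Q \<or> x \<in> insert j (ws ` {..<r - 1} \<union> X)" "y \<in> I - Q \<or> y \<in> insert j (ws ` {..<r - 1} \<union> X)"
      using xy unfolding I' Q_def by auto
    then show ?thesis using old new I_nonadj sym by blast
  qed
  then have 1: "indep I'" unfolding indep_def using W' by blast
  have wI: "ws k \<in> I'" if "Suc k < r" for k unfolding I' using that by auto
  have jI: "j \<in> I'" unfolding I' by simp
  \<comment> \<open>The first removed vertex is covered by \<open>j\<close> and the first step, the
    last by the last step with the help of \<open>X\<close>, every other one by the two steps that
    meet it.\<close>
  have cq: "A (q k) \<subseteq> \<Union> (A ` I')" if k: "k < r" for k
  proof (cases "Suc k < r")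
    case False
    then have k: "k = r - 1" using that by simp
    show ?thesis using X
    proof
      assume "X = {} \<and> A (idx n (es ! (r - 1))) \<subseteq> A (ws (r - 2))"
      then show ?thesis using k wI[OF last(2)] unfolding q_def by blast
    next
      assume "\<exists>v. X = {v} \<and> single v (idx n (es ! (r - 1))) \<and> x0 \<notin> A v \<and> \<not> adj v (ws (r - 2))"
      then obtain v where v: "v \<in> X" "v \<in> I'" "single v (q k)" "\<not> adj v (ws (r - 2))" unfolding q_def k I' by auto
      have m: "mid (ws (r - 2)) (q k) (q (r - 2))" using mid[OF last(2)] last k mid_sym by simp
      have "v \<noteq> ws (r - 2)" using singleD(8)[OF v(3), of "q (r - 2)"] midD(4,8,11)[OF m] by metis
      then have "A (q k) \<subseteq> A v \<union> A (ws (r - 2))" using split[of "q k" v "ws (r - 2)"] singleD[OF v(3)] midD[OF m] v by blast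
      then show ?thesis using v wI[OF last(2)] by blast
    qed
  next
    case True
    show ?thesis
    proof (cases k)
      case 0
      have "j \<noteq> ws 0" using Jd(8) midD(4,8,11)[OF mid[OF True]] 0 by metis
      then have "A (q k) \<subseteq> A j \<union> A (ws 0)" using split[of "q k" j "ws 0"] Jd midD[OF mid[OF True]] j 0 by metis
      then show ?thesis using jI wI[OF True] 0 by blast
    next
      case (Suc l)
      then have l: "Suc l < r" using True by simp
      have m: "mid (ws l) (q k) (q l)" using mid[OF l] Suc mid_sym by blast
      have "q l \<noteq> q (Suc k)" using qd[of l "Suc k"] Suc True by auto
      then have "ws l \<noteq> ws k" using m mid[OF True] mid_unique by metis
      then have "A (q k) \<subseteq> A (ws l) \<union> A (ws k)"
        using split[of "q k" "ws l" "ws k"] midD[OF m] midD[OF mid[OF True]] ws_sep[OF l True] by metis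
      then show ?thesis using wI[OF l] wI[OF True] by blast
    qed
  qed
  have "A i \<subseteq> \<Union> (A ` I')" if "i \<in> I" for i
  proof (cases "i \<in> Q")
    case True
    then obtain k where "k < r" "i = q k" using Q by blast
    then show ?thesis using cq[of k] by simp
  next
    case False
    then have "i \<in> I'" unfolding I' Q_def using that by blast
    then show ?thesis by blast
  qed
  then show ?thesis using 1 jI j(2) by blast
qed

end

end

section \<open>A bounded loop language and its compiler\<close>

text \<open>A language of bounded loops over a store of finite two-dimensional tables; variables are table
  entries with index \<open>(0, 0)\<close>. All values are at most \<open>lim n\<close>: addition saturates, so overflow cannot
  occur.\<close>

type_synonym store = "nat \<Rightarrow> nat \<Rightarrow> nat \<Rightarrow> nat"

datatype expr =
    Cst nat
  | NV
  | LimE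
  | Rd nat expr expr
  | Ad expr expr
  | Add expr expr
  | Sub expr expr
  | Eq expr expr
  | Lt expr expr
  | Ite expr expr expr
  | Lst nat expr

datatype cmd =
    Nop
  | Wr nat expr expr expr
  | Sq cmd cmd
  | Iff expr cmd cmd
  | For nat cmd

text \<open>The edge tables have \<open>4 * n\<close> entries and the search nodes go up to
  \<open>2 * n\<close>. The summand \<open>8\<close> leaves room for the constants, for every
  \<open>n\<close>, and for small offsets.\<close>

definition lim :: "nat \<Rightarrow> nat" where "lim n = 4 * n + 8"

definition put :: "store \<Rightarrow> nat \<Rightarrow> nat \<Rightarrow> nat \<Rightarrow> nat \<Rightarrow> store" where
  "put \<sigma> a x y v = \<sigma>(a := (\<sigma> a)(x := (\<sigma> a x)(y := v)))"

text \<open>The default \<open>L\<close> serves throughout as the mark for "not found": no vertex,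
  node or edge has this number.\<close>

definition least :: "nat \<Rightarrow> (nat \<Rightarrow> bool) \<Rightarrow> nat" where
  "least L P = (if \<exists>k<L. P k then LEAST k. P k else L)"

primrec iter :: "(nat \<Rightarrow> 'a \<Rightarrow> 'a) \<Rightarrow> nat \<Rightarrow> 'a \<Rightarrow> 'a" where
  "iter f 0 s = s"
| "iter f (Suc k) s = f k (iter f k s)"

lemma least_le: "least L P \<le> L"
proof (cases "\<exists>k<L. P k")
  case True
  then obtain k where "k < L" "P k" by blast
  then show ?thesis unfolding least_def using Least_le[of P k] by auto
qed (auto simp: least_def)

lemma least_eq: "k < L \<Longrightarrow> P k \<Longrightarrow> (\<And>j. j < k \<Longrightarrow> \<not> P j) \<Longrightarrow> least L P = k"
  unfolding least_def by (auto intro!: Least_equality) (meson not_le)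

lemma least_none: "(\<And>j. j < L \<Longrightarrow> \<not> P j) \<Longrightarrow> least L P = L"
  unfolding least_def by auto

lemma least_less: "least L P < L \<longleftrightarrow> (\<exists>k<L. P k)"
  unfolding least_def using Least_le by (auto intro: le_less_trans)

lemma least_prop: "least L P < L \<Longrightarrow> P (least L P)"
  unfolding least_def by (auto split: if_splits intro: LeastI)

locale prog =
  fixes n :: nat and ad :: "nat \<Rightarrow> nat \<Rightarrow> bool"
  assumes ad_less: "ad u v \<Longrightarrow> u < n \<and> v < n"
begin

abbreviation L :: nat where "L \<equiv> lim n"

fun ev :: "expr \<Rightarrow> store \<Rightarrow> nat" where
  "ev (Cst k) \<sigma> = min k 8"
| "ev NV \<sigma> = n"
| "ev LimE \<sigma> = L"
| "ev (Rd a e f) \<sigma> = \<sigma> a (ev e \<sigma>) (ev f \<sigma>)"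
| "ev (Ad e f) \<sigma> = of_bool (ad (ev e \<sigma>) (ev f \<sigma>))"
| "ev (Add e f) \<sigma> = min (ev e \<sigma> + ev f \<sigma>) L"
| "ev (Sub e f) \<sigma> = ev e \<sigma> - ev f \<sigma>"
| "ev (Eq e f) \<sigma> = of_bool (ev e \<sigma> = ev f \<sigma>)"
| "ev (Lt e f) \<sigma> = of_bool (ev e \<sigma> < ev f \<sigma>)"
| "ev (Ite b e f) \<sigma> = (if ev b \<sigma> = 0 then ev f \<sigma> else ev e \<sigma>)"
| "ev (Lst x e) \<sigma> = least L (\<lambda>k. ev e (put \<sigma> x 0 0 k) \<noteq> 0)"

fun sem :: "cmd \<Rightarrow> store \<Rightarrow> store" where
  "sem Nop \<sigma> = \<sigma>"
| "sem (Wr a e f g) \<sigma> = put \<sigma> a (ev e \<sigma>) (ev f \<sigma>) (ev g \<sigma>)"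
| "sem (Sq c d) \<sigma> = sem d (sem c \<sigma>)"
| "sem (Iff b c d) \<sigma> = (if ev b \<sigma> = 0 then sem d \<sigma> else sem c \<sigma>)"
| "sem (For x c) \<sigma> = put (iter (\<lambda>k \<tau>. sem c (put \<tau> x 0 0 k)) L \<sigma>) x 0 0 (\<sigma> x 0 0)"

definition bounded :: "store \<Rightarrow> bool" where
  "bounded \<sigma> \<longleftrightarrow> (\<forall>a x y. \<sigma> a x y \<le> L)"

lemma bounded_put: "bounded \<sigma> \<Longrightarrow> v \<le> L \<Longrightarrow> bounded (put \<sigma> a x y v)"
  unfolding bounded_def put_def by auto

lemma ev_le: "bounded \<sigma> \<Longrightarrow> ev e \<sigma> \<le> L"
proof (induction e arbitrary: \<sigma>)
  case (Sub e1 e2)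
  then show ?case by (simp add: le_diff_conv trans_le_add1)
next
  case (Rd a e f)
  then show ?case by (simp add: bounded_def)
qed (auto simp: lim_def least_le[unfolded lim_def])

text \<open>Costs are upper bounds: both branches of \<open>Ite\<close> are charged, and a search is
  charged for all \<open>L\<close> rounds.\<close>

fun ecost :: "expr \<Rightarrow> nat" where
  "ecost (Cst k) = 1"
| "ecost NV = 1"
| "ecost LimE = 1"
| "ecost (Rd a e f) = ecost e + ecost f + 10"
| "ecost (Ad e f) = ecost e + ecost f + 10"
| "ecost (Add e f) = ecost e + ecost f + 10"
| "ecost (Sub e f) = ecost e + ecost f + 10"
| "ecost (Eq e f) = ecost e + ecost f + 10"
| "ecost (Lt e f) = ecost e + ecost f + 10"
| "ecost (Ite b e f) = ecost b + ecost e + ecost f + 10"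
| "ecost (Lst x e) = L * (ecost e + 10) + 20"

fun cost :: "cmd \<Rightarrow> store \<Rightarrow> nat" where
  "cost Nop \<sigma> = 1"
| "cost (Wr a e f g) \<sigma> = ecost e + ecost f + ecost g + 10"
| "cost (Sq c d) \<sigma> = cost c \<sigma> + cost d (sem c \<sigma>)"
| "cost (Iff b c d) \<sigma> = ecost b + 10 + (if ev b \<sigma> = 0 then cost d \<sigma> else cost c \<sigma>)"
| "cost (For x c) \<sigma> = (\<Sum>k<L. cost c (put (iter (\<lambda>k \<tau>. sem c (put \<tau> x 0 0 k)) k \<sigma>) x 0 0 k) + 10) + 20"

end

fun expr_ok :: "expr \<Rightarrow> bool" where
  "expr_ok (Rd a e f) \<longleftrightarrow> a < 100 \<and> expr_ok e \<and> expr_ok f"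
| "expr_ok (Ad e f) \<longleftrightarrow> expr_ok e \<and> expr_ok f"
| "expr_ok (Add e f) \<longleftrightarrow> expr_ok e \<and> expr_ok f"
| "expr_ok (Sub e f) \<longleftrightarrow> expr_ok e \<and> expr_ok f"
| "expr_ok (Eq e f) \<longleftrightarrow> expr_ok e \<and> expr_ok f"
| "expr_ok (Lt e f) \<longleftrightarrow> expr_ok e \<and> expr_ok f"
| "expr_ok (Ite b e f) \<longleftrightarrow> expr_ok b \<and> expr_ok e \<and> expr_ok f"
| "expr_ok (Lst x e) \<longleftrightarrow> x < 100 \<and> expr_ok e"
| "expr_ok _ \<longleftrightarrow> True"

fun cmd_ok :: "cmd \<Rightarrow> bool" where
  "cmd_ok Nop \<longleftrightarrow> True"
| "cmd_ok (Wr a e f g) \<longleftrightarrow> a < 100 \<and> expr_ok e \<and> expr_ok f \<and> expr_ok g"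
| "cmd_ok (Sq c d) \<longleftrightarrow> cmd_ok c \<and> cmd_ok d"
| "cmd_ok (Iff b c d) \<longleftrightarrow> expr_ok b \<and> cmd_ok c \<and> cmd_ok d"
| "cmd_ok (For x c) \<longleftrightarrow> x < 100 \<and> cmd_ok c"

text \<open>Register conventions: \<open>0, \<dots>, 5\<close> hold \<open>n\<close>, the limit \<open>l\<close>, \<open>l + 1\<close>, \<open>1\<close>, \<open>(l + 1)\<^sup>2\<close> and \<open>0\<close>; registers
  \<open>6\<close> and \<open>7\<close> are scratch; expressions are evaluated on a stack starting at register \<open>10\<close>.\<close>

abbreviation sq (infixr ";;" 60) where "sq \<equiv> Seq"

definition addr :: "nat \<Rightarrow> nat \<Rightarrow> com" where
  "addr a d = SetConst 6 (a + 1) ;; Arith Times 6 6 4 ;; Arith Times 7 (10 + d) 2 ;; Arith Plus 6 6 7 ;;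
     Arith Plus 6 6 (11 + d)"

definition vaddr :: "nat \<Rightarrow> com" where
  "vaddr a = SetConst 6 (a + 1) ;; Arith Times 6 6 4"

text \<open>A hit saves the counter in register \<open>12 + d\<close> and then raises the counter to
  the limit, which ends the loop.\<close>

abbreviation search_body :: "nat \<Rightarrow> nat \<Rightarrow> com \<Rightarrow> com" where
  "search_body d x p \<equiv> While (Less (11 + d) 1) (vaddr x ;; Store 6 (11 + d) ;; p ;;
     Cond (Equal (13 + d) 5) (Arith Plus (11 + d) (11 + d) 3)
       (Arith Plus (12 + d) (11 + d) 5 ;; Arith Plus (11 + d) 1 5))"

abbreviation for_body :: "nat \<Rightarrow> nat \<Rightarrow> com \<Rightarrow> com" where
  "for_body d x p \<equiv> While (Less (11 + d) 1) (vaddr x ;; Store 6 (11 + d) ;; p ;; Arith Plus (11 + d) (11 + d) 3)"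

text \<open>\<open>d\<close> is the height of the stack. \<open>Ad\<close> compares both arguments
  with \<open>n\<close> first: beyond this range the row-wise address would belong to another
  entry.\<close>

fun comp_expr :: "nat \<Rightarrow> expr \<Rightarrow> com" where
  "comp_expr d (Cst k) = SetConst (10 + d) (min k 8)"
| "comp_expr d NV = Arith Plus (10 + d) 0 5"
| "comp_expr d LimE = Arith Plus (10 + d) 1 5"
| "comp_expr d (Rd a e f) = comp_expr d e ;; comp_expr (Suc d) f ;; addr a d ;; Load (10 + d) 6"
| "comp_expr d (Ad e f) = comp_expr d e ;; comp_expr (Suc d) f ;;
     Cond (Less (10 + d) 0)
       (Cond (Less (11 + d) 0) (Arith Times 6 (10 + d) 0 ;; Arith Plus 6 6 (11 + d) ;; Load (10 + d) 6)
         (SetConst (10 + d) 0))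
       (SetConst (10 + d) 0)"
| "comp_expr d (Add e f) = comp_expr d e ;; comp_expr (Suc d) f ;; Arith Plus (10 + d) (10 + d) (11 + d) ;;
     Cond (Less 1 (10 + d)) (Arith Plus (10 + d) 1 5) Skip"
| "comp_expr d (Sub e f) = comp_expr d e ;; comp_expr (Suc d) f ;; Arith Minus (10 + d) (10 + d) (11 + d)"
| "comp_expr d (Eq e f) = comp_expr d e ;; comp_expr (Suc d) f ;;
     Cond (Equal (10 + d) (11 + d)) (SetConst (10 + d) 1) (SetConst (10 + d) 0)"
| "comp_expr d (Lt e f) = comp_expr d e ;; comp_expr (Suc d) f ;;
     Cond (Less (10 + d) (11 + d)) (SetConst (10 + d) 1) (SetConst (10 + d) 0)"
| "comp_expr d (Ite b e f) = comp_expr d b ;; Cond (Equal (10 + d) 5) (comp_expr d f) (comp_expr d e)"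
| "comp_expr d (Lst x e) = vaddr x ;; Load (10 + d) 6 ;; SetConst (11 + d) 0 ;; Arith Plus (12 + d) 1 5 ;;
     search_body d x (comp_expr (d + 3) e) ;;
     vaddr x ;; Store 6 (10 + d) ;; Arith Plus (10 + d) (12 + d) 5"

fun comp :: "nat \<Rightarrow> cmd \<Rightarrow> com" where
  "comp d Nop = Skip"
| "comp d (Wr a e f g) = comp_expr d e ;; comp_expr (d + 1) f ;; comp_expr (d + 2) g ;; addr a d ;; Store 6 (12 + d)"
| "comp d (Sq p q) = comp d p ;; comp d q"
| "comp d (Iff b p q) = comp_expr d b ;; Cond (Equal (10 + d) 5) (comp d q) (comp d p)"
| "comp d (For x p) = vaddr x ;; Load (10 + d) 6 ;; SetConst (11 + d) 0 ;;
     for_body d x (comp (d + 2) p) ;;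
     vaddr x ;; Store 6 (10 + d)"

text \<open>A weakest precondition with a time bound. In \<open>halts_Seq\<close> the rest of the
  program becomes part of the postcondition, so that bounds add up along a sequence.\<close>

definition halts :: "nat \<Rightarrow> com \<Rightarrow> nat \<Rightarrow> ((nat \<Rightarrow> nat) \<Rightarrow> (nat \<Rightarrow> nat) \<Rightarrow> bool) \<Rightarrow> (nat \<Rightarrow> nat) \<Rightarrow> (nat \<Rightarrow> nat) \<Rightarrow> bool" where
  "halts w p T Q R M \<longleftrightarrow> (\<exists>t R' M'. exec w p (R, M) t (R', M') \<and> t \<le> T \<and> Q R' M')"

lemma halts_weaken: "halts w p T Q R M \<Longrightarrow> T \<le> T' \<Longrightarrow> (\<And>R' M'. Q R' M' \<Longrightarrow> Q' R' M') \<Longrightarrow> halts w p T' Q' R M"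
  unfolding halts_def by (meson order_trans)

lemma halts_mono: "halts w p T Q R M \<Longrightarrow> T \<le> T' \<Longrightarrow> halts w p T' Q R M"
  unfolding halts_def by (meson order_trans)

lemma halts_Skip: "Q R M \<Longrightarrow> halts w Skip 1 Q R M"
  unfolding halts_def using exec.Skip by blast

lemma halts_SetConst: "a < w \<Longrightarrow> Q (R(x := a)) M \<Longrightarrow> halts w (SetConst x a) 1 Q R M"
  unfolding halts_def using exec.SetConst by blast

lemma halts_Arith: "eval_op f (R y) (R z) < w \<Longrightarrow> Q (R(x := eval_op f (R y) (R z))) M \<Longrightarrow> halts w (Arith f x y z) 1 Q R M"
  unfolding halts_def using exec.Arith by blast

lemma halts_Load: "R y < w \<Longrightarrow> M (R y) < w \<Longrightarrow> Q (R(x := M (R y))) M \<Longrightarrow> halts w (Load x y) 1 Q R M"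
  unfolding halts_def using exec.Load by blast

lemma halts_Store: "R x < w \<Longrightarrow> R y < w \<Longrightarrow> Q R (M(R x := R y)) \<Longrightarrow> halts w (Store x y) 1 Q R M"
  unfolding halts_def using exec.Store by blast

lemma halts_Seq: "halts w p T1 (\<lambda>R M. halts w q T2 Q R M) R M \<Longrightarrow> halts w (Seq p q) (T1 + T2) Q R M"
  unfolding halts_def by (metis add_mono exec.Seq)

lemma halts_Cond:
  "(holds b (R, M) \<Longrightarrow> halts w p T1 Q R M) \<Longrightarrow> (\<not> holds b (R, M) \<Longrightarrow> halts w q T2 Q R M) \<Longrightarrow>
   halts w (Cond b p q) (Suc (max T1 T2)) Q R M"
proof (cases "holds b (R, M)")
  case True
  assume "holds b (R, M) \<Longrightarrow> halts w p T1 Q R M"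
  then obtain t R' M' where "exec w p (R, M) t (R', M')" "t \<le> T1" "Q R' M'" using True unfolding halts_def by blast
  moreover from this have "exec w (Cond b p q) (R, M) (Suc t) (R', M')" using exec.CondTrue[OF True] by blast
  moreover have "Suc t \<le> Suc (max T1 T2)" using \<open>t \<le> T1\<close> by simp
  ultimately show ?thesis unfolding halts_def by blast
next
  case False
  assume "\<not> holds b (R, M) \<Longrightarrow> halts w q T2 Q R M"
  then obtain t R' M' where "exec w q (R, M) t (R', M')" "t \<le> T2" "Q R' M'" using False unfolding halts_def by blast
  moreover from this have "exec w (Cond b p q) (R, M) (Suc t) (R', M')" using exec.CondFalse[OF False] by blast
  moreover have "Suc t \<le> Suc (max T1 T2)" using \<open>t \<le> T2\<close> by simp
  ultimately show ?thesis unfolding halts_def by blast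
qed

lemma halts_WhileF: "\<not> holds b (R, M) \<Longrightarrow> Q R M \<Longrightarrow> halts w (While b p) 1 Q R M"
  unfolding halts_def using exec.WhileFalse by blast

lemma halts_WhileT:
  assumes "holds b (R, M)" "halts w p T1 (\<lambda>R M. halts w (While b p) T2 Q R M) R M"
  shows "halts w (While b p) (Suc (T1 + T2)) Q R M"
proof -
  obtain t R' M' t' R'' M'' where "exec w p (R, M) t (R', M')" "t \<le> T1"
    "exec w (While b p) (R', M') t' (R'', M'')" "t' \<le> T2" "Q R'' M''"
    using assms(2) unfolding halts_def by blast
  moreover from this have "exec w (While b p) (R, M) (Suc (t + t')) (R'', M'')" using exec.WhileTrue[OF assms(1)] by blast
  moreover have "Suc (t + t') \<le> Suc (T1 + T2)" using \<open>t \<le> T1\<close> \<open>t' \<le> T2\<close> by simp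
  ultimately show ?thesis unfolding halts_def by blast
qed

lemma divmod_unique: "v < b \<Longrightarrow> (q * b + v) div b = q \<and> (q * b + v) mod b = v" for q b v :: nat
  by simp

section \<open>Correctness of the compiler\<close>

locale machine = prog +
  fixes w :: nat
  assumes w: "102 * (Suc L * Suc L) \<le> w"
begin

abbreviation B :: nat where "B \<equiv> Suc L"

text \<open>The shift by one leaves the lowest \<open>B * B\<close> cells to the adjacency matrix,
  which fits because \<open>n < B\<close>. Tables are numbered below \<open>100\<close>, so all
  cells lie below \<open>101 * (B * B)\<close>.\<close>

definition cell :: "nat \<Rightarrow> nat \<Rightarrow> nat \<Rightarrow> nat" where
  "cell a x y = (a + 1) * (B * B) + x * B + y"

definition regs :: "(nat \<Rightarrow> nat) \<Rightarrow> bool" where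
  "regs R \<longleftrightarrow> R 0 = n \<and> R 1 = L \<and> R 2 = B \<and> R 3 = 1 \<and> R 4 = B * B \<and> R 5 = 0"

definition memr :: "store \<Rightarrow> (nat \<Rightarrow> nat) \<Rightarrow> bool" where
  "memr \<sigma> M \<longleftrightarrow> bounded \<sigma> \<and> (\<forall>a x y. x < B \<longrightarrow> y < B \<longrightarrow> M (cell a x y) = \<sigma> a x y) \<and>
     (\<forall>i j. i < n \<longrightarrow> j < n \<longrightarrow> M (i * n + j) = of_bool (ad i j))"

lemma n_L: "n < L" and B_w: "B < w" and BB_w: "B * B < w" and L_w: "L < w" and big: "2 * L < w" "8 < w"
proof -
  have 1: "n < L" "8 \<le> L" by (auto simp: lim_def)
  have "B \<le> B * B" by simp
  then have "102 * B \<le> w" using w mult_le_mono2[of B "B * B" 102] by (meson order_trans)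
  then show "n < L" "B < w" "L < w" "2 * L < w" "8 < w" using 1 by auto
  have "B * B > 0" by simp
  then show "B * B < w" using w by linarith
qed

lemma cell_less: "a < 100 \<Longrightarrow> x < B \<Longrightarrow> y < B \<Longrightarrow> cell a x y < w"
proof -
  assume a: "a < 100" "x < B" "y < B"
  have "x * B + y < B * B" using a(2,3) mult_le_mono1[of "Suc x" B B] by simp
  moreover have "(a + 1) * (B * B) \<le> 100 * (B * B)" using a(1) by (intro mult_le_mono1) simp
  ultimately show ?thesis using w unfolding cell_def by linarith
qed

lemma cell_inj:
  assumes "x < B" "y < B" "x' < B" "y' < B" "cell a x y = cell a' x' y'"
  shows "a = a' \<and> x = x' \<and> y = y'"
proof -
  have q: "((c + 1) * B + u) * B + v = cell c u v" for c u v unfolding cell_def by algebra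
  have d: "(((c + 1) * B + u) * B + v) div B = (c + 1) * B + u" if "v < B" for c u v using divmod_unique[OF that] by blast
  have r: "(((c + 1) * B + u) * B + v) mod B = v" if "v < B" for c u v using divmod_unique[OF that] by blast
  have d2: "((c + 1) * B + u) div B = c + 1" "((c + 1) * B + u) mod B = u" if "u < B" for c u using divmod_unique[OF that] by blast+
  have "(a + 1) * B + x = (a' + 1) * B + x'" "y = y'" using d r q assms by metis+
  then show ?thesis using d2[OF assms(1), of a] d2[OF assms(3), of a'] by (metis add_right_cancel)
qed

lemma cell_adj: "i < n \<Longrightarrow> j < n \<Longrightarrow> i * n + j < cell a x y"
proof -
  assume "i < n" "j < n"
  then have "i * n + j < n * n" using mult_le_mono1[of "Suc i" n n] by simp
  also have "n * n \<le> B * B" using n_L by (intro mult_le_mono) auto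
  also have "B * B \<le> cell a x y" unfolding cell_def by simp
  finally show ?thesis .
qed

lemma memr_put:
  assumes m: "memr \<sigma> M" and "x < B" "y < B" "v \<le> L"
  shows "memr (put \<sigma> a x y v) (M(cell a x y := v))"
proof -
  have 1: "(M(cell a x y := v)) (cell a' x' y') = put \<sigma> a x y v a' x' y'" if "x' < B" "y' < B" for a' x' y'
    using m cell_inj[of x' y' x y a' a] that assms unfolding memr_def put_def by auto
  have 2: "(M(cell a x y := v)) (i * n + j) = of_bool (ad i j)" if "i < n" "j < n" for i j
  proof -
    have "i * n + j \<noteq> cell a x y" using cell_adj[OF that, of a x y] by simp
    then show ?thesis using m that unfolding memr_def by auto
  qed
  show ?thesis using 1 2 bounded_put m assms unfolding memr_def by auto
qed

lemma le_mult: "(k::nat) \<le> k * (B * B)"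
  by simp

lemma halts_addr:
  assumes "regs R" "a < 100" "R (10 + d) = x" "R (11 + d) = y" "x < B" "y < B"
    and Q: "\<And>R'. R' 6 = cell a x y \<Longrightarrow> (\<And>r. r \<noteq> 6 \<Longrightarrow> r \<noteq> 7 \<Longrightarrow> R' r = R r) \<Longrightarrow> Q R' M"
  shows "halts w (addr a d) 5 Q R M"
proof -
  have c: "(a + 1) * (B * B) + x * B + y < w" using cell_less[OF assms(2,5,6)] unfolding cell_def .
  have s: "a + 1 < w" "(a + 1) * (B * B) < w" "x * B < w" "(a + 1) * (B * B) + x * B < w"
    using c assms(2) big le_mult[of "a + 1"] by linarith+
  have "halts w (addr a d) (1 + (1 + (1 + (1 + 1)))) Q R M"
    unfolding addr_def
    apply (rule halts_Seq, rule halts_SetConst, use s in simp)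
    apply (rule halts_Seq, rule halts_Arith, use s assms(1) in \<open>simp add: regs_def\<close>)
    apply (rule halts_Seq, rule halts_Arith, use s assms(1,3) in \<open>simp add: regs_def\<close>)
    apply (rule halts_Seq, rule halts_Arith, use s assms(1,3) in \<open>simp add: regs_def\<close>)
    apply (rule halts_Arith, use c assms(1,3,4) in \<open>simp add: regs_def\<close>)
    apply (rule Q)
    using assms(1,3,4) by (simp_all add: regs_def cell_def)
  then show ?thesis by (simp add: numeral_eq_Suc)
qed

lemma halts_vaddr:
  assumes "regs R" "a < 100"
    and Q: "\<And>R'. R' 6 = cell a 0 0 \<Longrightarrow> (\<And>r. r \<noteq> 6 \<Longrightarrow> R' r = R r) \<Longrightarrow> Q R' M"
  shows "halts w (vaddr a) 2 Q R M"
proof -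
  have c: "(a + 1) * (B * B) < w" using cell_less[OF assms(2), of 0 0] unfolding cell_def by simp
  have s: "a + 1 < w" using assms(2) w by (simp add: less_le_trans[OF _ w])
  have "halts w (vaddr a) (1 + 1) Q R M"
    unfolding vaddr_def
    apply (rule halts_Seq, rule halts_SetConst, use s in simp)
    apply (rule halts_Arith, use c assms(1) in \<open>simp add: regs_def\<close>)
    apply (rule Q)
    using assms(1) by (simp_all add: regs_def cell_def)
  then show ?thesis by (simp add: numeral_eq_Suc)
qed

abbreviation keep :: "nat \<Rightarrow> (nat \<Rightarrow> nat) \<Rightarrow> (nat \<Rightarrow> nat) \<Rightarrow> bool" where
  "keep d R R' \<equiv> (\<forall>r. r < 10 + d \<longrightarrow> r \<noteq> 6 \<longrightarrow> r \<noteq> 7 \<longrightarrow> R' r = R r)"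

lemma keep_regs: "keep d R R' \<Longrightarrow> regs R \<Longrightarrow> regs R'"
  unfolding regs_def by simp

definition computes :: "nat \<Rightarrow> expr \<Rightarrow> bool" where
  "computes d e \<longleftrightarrow> (\<forall>\<sigma> R M. regs R \<longrightarrow> memr \<sigma> M \<longrightarrow>
     halts w (comp_expr d e) (ecost e) (\<lambda>R' M'. M' = M \<and> R' (10 + d) = ev e \<sigma> \<and> keep d R R') R M)"

lemma computesD:
  "computes d e \<Longrightarrow> regs R \<Longrightarrow> memr \<sigma> M \<Longrightarrow> (\<And>R'. R' (10 + d) = ev e \<sigma> \<Longrightarrow> keep d R R' \<Longrightarrow> regs R' \<Longrightarrow> Q R' M) \<Longrightarrow>
   halts w (comp_expr d e) (ecost e) Q R M"
proof -
  assume a: "computes d e" "regs R" "memr \<sigma> M" and Q: "\<And>R'. R' (10 + d) = ev e \<sigma> \<Longrightarrow> keep d R R' \<Longrightarrow> regs R' \<Longrightarrow> Q R' M"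
  from a have "halts w (comp_expr d e) (ecost e) (\<lambda>R' M'. M' = M \<and> R' (10 + d) = ev e \<sigma> \<and> keep d R R') R M"
    unfolding computes_def by blast
  then show ?thesis by (rule halts_weaken) (use Q keep_regs[OF _ a(2)] in auto)
qed

lemma computes2:
  assumes "computes d e" "computes (Suc d) f" "regs R" "memr \<sigma> M"
    and "\<And>R'. R' (10 + d) = ev e \<sigma> \<Longrightarrow> R' (11 + d) = ev f \<sigma> \<Longrightarrow> keep d R R' \<Longrightarrow> regs R' \<Longrightarrow> halts w p T Q R' M"
  shows "halts w (comp_expr d e ;; comp_expr (Suc d) f ;; p) (ecost e + (ecost f + T)) Q R M"
proof -
  have 1: "halts w (comp_expr (Suc d) f ;; p) (ecost f + T) Q R1 M"
    if R1: "R1 (10 + d) = ev e \<sigma>" "keep d R R1" "regs R1" for R1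
    by (rule halts_Seq, rule computesD[OF assms(2) R1(3) assms(4)], rule assms(5)) (use R1 in simp_all)
  show ?thesis by (rule halts_Seq, rule computesD[OF assms(1,3,4)], rule 1)
qed

lemma memr_read: "memr \<sigma> M \<Longrightarrow> x \<le> L \<Longrightarrow> y \<le> L \<Longrightarrow> M (cell a x y) = \<sigma> a x y \<and> \<sigma> a x y < w"
  unfolding memr_def bounded_def using L_w by (auto simp: less_Suc_eq_le intro: le_less_trans)

text \<open>The memory is tracked only up to the cell of the bound variable, whose old value is put
  back after the loop.\<close>

lemma search_loop:
  assumes e: "computes (d + 3) e" and x: "x < 100" and m: "memr \<sigma> M0"
  shows "k \<le> L \<Longrightarrow> regs R \<Longrightarrow> R (11 + d) = k \<Longrightarrow> R (12 + d) = L \<Longrightarrow> (\<And>j. j < k \<Longrightarrow> ev e (put \<sigma> x 0 0 j) = 0)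
    \<Longrightarrow> (\<exists>v. M = M0(cell x 0 0 := v)) \<Longrightarrow>
    halts w (search_body d x (comp_expr (d + 3) e))
      ((L - k) * (ecost e + 10) + 2)
      (\<lambda>R' M'. (\<exists>v. M' = M0(cell x 0 0 := v)) \<and> R' (12 + d) = ev (Lst x e) \<sigma> \<and> keep (Suc d) R R') R M"
proof (induction "L - k" arbitrary: k R M)
  case 0
  then have k: "k = L" by simp
  let ?W = "search_body d x (comp_expr (d + 3) e)"
  let ?Q = "\<lambda>R R' M'. (\<exists>v. M' = M0(cell x 0 0 := v)) \<and> R' (12 + d) = ev (Lst x e) \<sigma> \<and> keep (Suc d) R R'"
  have l: "ev (Lst x e) \<sigma> = L" using 0(6) k by (simp add: least_none)
  have "halts w ?W 1 (?Q R) R M"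
  proof (rule halts_WhileF)
    show "\<not> holds (Less (11 + d) 1) (R, M)" using 0 k by (simp add: regs_def)
    show "?Q R R M" unfolding l using 0(5,7) by blast
  qed
  then show ?case by (rule halts_mono) simp
next
  case (Suc z)
  then have k: "k < L" by simp
  let ?W = "search_body d x (comp_expr (d + 3) e)"
  let ?Q = "\<lambda>R R' M'. (\<exists>v. M' = M0(cell x 0 0 := v)) \<and> R' (12 + d) = ev (Lst x e) \<sigma> \<and> keep (Suc d) R R'"
  let ?\<sigma> = "put \<sigma> x 0 0 k"
  let ?M = "M0(cell x 0 0 := k)"
  have Mu: "M(cell x 0 0 := k) = ?M" using Suc.prems(6) by auto
  have m': "memr ?\<sigma> ?M" using memr_put[OF m, of 0 0 k x] k by simp
  have body: "halts w (Cond (Equal (13 + d) 5) (Arith Plus (11 + d) (11 + d) 3)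
         (Arith Plus (12 + d) (11 + d) 5 ;; Arith Plus (11 + d) 1 5)) (Suc (max 1 (1 + 1)))
       (\<lambda>R1 M1. halts w ?W ((L - k - 1) * (ecost e + 10) + 2) (?Q R) R1 M1) R' ?M"
    if R': "R' (13 + d) = ev e ?\<sigma>" "keep (d + 3) R R'" "regs R'" for R'
  proof (rule halts_Cond)
    have r: "R' (11 + d) = k" "R' (12 + d) = L" "R' 3 = 1" "R' 5 = 0" "R' 1 = L"
      using R' Suc.prems by (auto simp: regs_def)
    { assume "holds (Equal (13 + d) 5) (R', ?M)"
      then have z: "ev e ?\<sigma> = 0" using R' r by simp
      show "halts w (Arith Plus (11 + d) (11 + d) 3) 1 (\<lambda>R1 M1. halts w ?W ((L - k - 1) * (ecost e + 10) + 2) (?Q R) R1 M1) R' ?M"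
      proof (rule halts_Arith)
        show "eval_op Plus (R' (11 + d)) (R' 3) < w" using r k L_w by simp
        have "halts w ?W ((L - Suc k) * (ecost e + 10) + 2) (?Q (R'(11 + d := Suc k))) (R'(11 + d := Suc k)) ?M"
        proof (rule Suc.hyps(1))
          show "z = L - Suc k" "Suc k \<le> L" using Suc.hyps(2) k by auto
          show "regs (R'(11 + d := Suc k))" using R' by (simp add: regs_def)
          show "ev e (put \<sigma> x 0 0 j) = 0" if "j < Suc k" for j using that z Suc.prems(5) by (cases "j = k") auto
        qed (use r in auto)
        then show "halts w ?W ((L - k - 1) * (ecost e + 10) + 2) (?Q R) (R'(11 + d := eval_op Plus (R' (11 + d)) (R' 3))) ?M"
          using r R' Suc.prems by (auto intro: halts_weaken)
      qed
    }
    { assume "\<not> holds (Equal (13 + d) 5) (R', ?M)"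
      then have z: "ev e ?\<sigma> \<noteq> 0" using R' r by simp
      have l: "ev (Lst x e) \<sigma> = k" using z k Suc.prems(5) by (auto intro!: least_eq)
      show "halts w (Arith Plus (12 + d) (11 + d) 5 ;; Arith Plus (11 + d) 1 5) (1 + 1)
         (\<lambda>R1 M1. halts w ?W ((L - k - 1) * (ecost e + 10) + 2) (?Q R) R1 M1) R' ?M"
      proof (rule halts_Seq, rule halts_Arith, goal_cases)
        case 1
        then show ?case using r k L_w by simp
      next
        case 2
        show ?case
        proof (rule halts_Arith, goal_cases)
          case 1
          then show ?case using r L_w by simp
        next
          case 2
          \<comment> \<open>The counter is now \<open>L\<close>, so the loop ends at the next
            test.\<close>
          have "halts w ?W 1 (?Q R) (R'(12 + d := k, 11 + d := L)) ?M"
            using R' r l Suc.prems by (intro halts_WhileF) auto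
          then show ?case using r by (auto intro: halts_weaken)
        qed
      qed
    }
  qed
  have "halts w ?W (Suc ((2 + (1 + (ecost e + Suc (max 1 (1 + 1))))) + ((L - k - 1) * (ecost e + 10) + 2))) (?Q R) R M"
  proof (rule halts_WhileT, goal_cases)
    case 1
    then show ?case using k Suc.prems by (simp add: regs_def)
  next
    case 2
    show ?case
    proof (rule halts_Seq, rule halts_vaddr[OF Suc.prems(2) x], rule halts_Seq, rule halts_Store, goal_cases)
      case (1 R1)
      then show ?case using cell_less[OF x, of 0 0] by simp
    next
      case (2 R1)
      then show ?case using Suc.prems k L_w by simp
    next
      case (3 R1)
      have "M(R1 6 := R1 (11 + d)) = ?M" using 3 Suc.prems Mu by simp
      moreover have "regs R1" using 3 Suc.prems by (simp add: regs_def)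
      ultimately show ?case
        by (simp only:, intro halts_Seq computesD[OF e _ m'] body) (use 3 in \<open>auto simp: numeral_eq_Suc\<close>)
    qed
  qed
  moreover have "Suc ((2 + (1 + (ecost e + Suc (max 1 (1 + 1))))) + ((L - k - 1) * (ecost e + 10) + 2)) \<le> (L - k) * (ecost e + 10) + 2"
  proof -
    have "L - k = Suc (L - k - 1)" using k by simp
    then have "(L - k) * (ecost e + 10) = (ecost e + 10) + (L - k - 1) * (ecost e + 10)" by (metis mult_Suc)
    then show ?thesis by simp
  qed
  ultimately show ?case by (rule halts_weaken)
qed

lemma comp_expr_correct: "expr_ok e \<Longrightarrow> computes d e"
proof (induction e arbitrary: d)
  case (Cst k)
  have "halts w (SetConst (10 + d) (min k 8)) 1 Q R M" if "Q (R(10 + d := min k 8)) M" for Q R M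
    using that big by (intro halts_SetConst) auto
  then show ?case unfolding computes_def by simp
next
  case NV
  have "halts w (comp_expr d NV) 1 (\<lambda>R' M'. M' = M \<and> R' (10 + d) = ev NV \<sigma> \<and> keep d R R') R M" if "regs R" for R M \<sigma>
    unfolding comp_expr.simps using that n_L L_w by (intro halts_Arith) (auto simp: regs_def)
  then show ?case unfolding computes_def ecost.simps by blast
next
  case LimE
  have "halts w (comp_expr d LimE) 1 (\<lambda>R' M'. M' = M \<and> R' (10 + d) = ev LimE \<sigma> \<and> keep d R R') R M" if "regs R" for R M \<sigma>
    unfolding comp_expr.simps using that n_L L_w by (intro halts_Arith) (auto simp: regs_def)
  then show ?case unfolding computes_def ecost.simps by blast
next
  case (Rd a e f)
  show ?case unfolding computes_def
  proof (intro allI impI)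
    fix \<sigma> R M assume R: "regs R" and m: "memr \<sigma> M"
    have "bounded \<sigma>" using m unfolding memr_def by simp
    then have le: "ev e \<sigma> \<le> L" "ev f \<sigma> \<le> L" using ev_le by auto
    note rd = memr_read[OF m le, of a]
    have "halts w (comp_expr d e ;; comp_expr (Suc d) f ;; addr a d ;; Load (10 + d) 6) (ecost e + (ecost f + (5 + 1)))
      (\<lambda>R' M'. M' = M \<and> R' (10 + d) = ev (Rd a e f) \<sigma> \<and> keep d R R') R M"
    proof (rule computes2[OF Rd.IH(1) Rd.IH(2) R m], goal_cases)
      case (3 R1)
      show ?case
      proof (rule halts_Seq, rule halts_addr[OF 3(4) _ 3(1) 3(2)], goal_cases)
        case (4 R2)
        show ?case
          using 4 3 rd cell_less[of a "ev e \<sigma>" "ev f \<sigma>"] Rd.prems le by (intro halts_Load) auto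
      qed (use Rd.prems le in auto)
    qed (use Rd.prems in auto)
    then show "halts w (comp_expr d (Rd a e f)) (ecost (Rd a e f)) (\<lambda>R' M'. M' = M \<and> R' (10 + d) = ev (Rd a e f) \<sigma> \<and> keep d R R') R M"
      by (auto intro: halts_weaken)
  qed
next
  case (Ad e f)
  show ?case unfolding computes_def
  proof (intro allI impI)
    fix \<sigma> R M assume R: "regs R" and m: "memr \<sigma> M"
    have mm: "ev e \<sigma> < n \<Longrightarrow> ev f \<sigma> < n \<Longrightarrow> M (ev e \<sigma> * n + ev f \<sigma>) = of_bool (ad (ev e \<sigma>) (ev f \<sigma>))"
      using m unfolding memr_def by blast
    have nn: "ev e \<sigma> * n + ev f \<sigma> < w" "ev e \<sigma> * n < w" if "ev e \<sigma> < n" "ev f \<sigma> < n"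
      using cell_adj[OF that, of 0 0 0] cell_less[of 0 0 0] by auto
    let ?Q = "\<lambda>R' M'. M' = M \<and> R' (10 + d) = ev (Ad e f) \<sigma> \<and> keep d R R'"
    have "halts w (comp_expr d (Ad e f)) (ecost e + (ecost f + Suc (max (Suc (max (1 + (1 + 1)) 1)) 1))) ?Q R M"
      unfolding comp_expr.simps
    proof (rule computes2[OF Ad.IH(1) Ad.IH(2) R m], goal_cases)
      case (3 R1)
      have r0: "R1 0 = n" using 3 by (simp add: regs_def)
      show ?case
      proof (rule halts_Cond, rule halts_Cond, goal_cases)
        case 1
        then have lt: "ev e \<sigma> < n" "ev f \<sigma> < n" using 3 r0 by auto
        show ?case
          using lt 3 r0 mm nn big
          by (intro halts_Seq halts_Arith halts_Load) auto
      next
        case 2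
        then show ?case using 3 r0 ad_less big by (intro halts_SetConst) auto
      next
        case 3
        then show ?case using \<open>R1 (10 + d) = ev e \<sigma>\<close> \<open>keep d R R1\<close> r0 ad_less big by (intro halts_SetConst) auto
      qed
    qed (use Ad.prems in auto)
    then show "halts w (comp_expr d (Ad e f)) (ecost (Ad e f)) ?Q R M"
      by (rule halts_weaken) auto
  qed
next
  case (Add e f)
  show ?case unfolding computes_def
  proof (intro allI impI)
    fix \<sigma> R M assume R: "regs R" and m: "memr \<sigma> M"
    have "bounded \<sigma>" using m unfolding memr_def by simp
    then have le: "ev e \<sigma> \<le> L" "ev f \<sigma> \<le> L" using ev_le by auto
    let ?Q = "\<lambda>R' M'. M' = M \<and> R' (10 + d) = ev (Add e f) \<sigma> \<and> keep d R R'"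
    have "halts w (comp_expr d (Add e f)) (ecost e + (ecost f + (1 + Suc (max 1 1)))) ?Q R M"
      unfolding comp_expr.simps
    proof (rule computes2[OF Add.IH(1) Add.IH(2) R m], goal_cases)
      case (3 R1)
      have r0: "R1 1 = L" "R1 5 = 0" using 3 by (auto simp: regs_def)
      show ?case
        using 3 r0 le big L_w by (intro halts_Seq halts_Arith halts_Cond halts_Skip) auto
    qed (use Add.prems in auto)
    then show "halts w (comp_expr d (Add e f)) (ecost (Add e f)) ?Q R M"
      by (rule halts_weaken) auto
  qed
next
  case (Sub e f)
  show ?case unfolding computes_def
  proof (intro allI impI)
    fix \<sigma> R M assume R: "regs R" and m: "memr \<sigma> M"
    have "bounded \<sigma>" using m unfolding memr_def by simp
    then have le: "ev e \<sigma> \<le> L" "ev f \<sigma> \<le> L" using ev_le by auto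
    let ?Q = "\<lambda>R' M'. M' = M \<and> R' (10 + d) = ev (Sub e f) \<sigma> \<and> keep d R R'"
    have "halts w (comp_expr d (Sub e f)) (ecost e + (ecost f + 1)) ?Q R M"
      unfolding comp_expr.simps
    proof (rule computes2[OF Sub.IH(1) Sub.IH(2) R m], goal_cases)
      case (3 R1)
      show ?case
        using 3 le L_w by (intro halts_Arith) auto
    qed (use Sub.prems in auto)
    then show "halts w (comp_expr d (Sub e f)) (ecost (Sub e f)) ?Q R M"
      by (rule halts_weaken) auto
  qed
next
  case (Eq e f)
  show ?case unfolding computes_def
  proof (intro allI impI)
    fix \<sigma> R M assume R: "regs R" and m: "memr \<sigma> M"
    let ?Q = "\<lambda>R' M'. M' = M \<and> R' (10 + d) = ev (Eq e f) \<sigma> \<and> keep d R R'"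
    have "halts w (comp_expr d (Eq e f)) (ecost e + (ecost f + Suc (max 1 1))) ?Q R M"
      unfolding comp_expr.simps
    proof (rule computes2[OF Eq.IH(1) Eq.IH(2) R m], goal_cases)
      case (3 R1)
      show ?case
        using 3 big by (intro halts_Cond halts_SetConst) auto
    qed (use Eq.prems in auto)
    then show "halts w (comp_expr d (Eq e f)) (ecost (Eq e f)) ?Q R M"
      by (rule halts_weaken) auto
  qed
next
  case (Lt e f)
  show ?case unfolding computes_def
  proof (intro allI impI)
    fix \<sigma> R M assume R: "regs R" and m: "memr \<sigma> M"
    let ?Q = "\<lambda>R' M'. M' = M \<and> R' (10 + d) = ev (Lt e f) \<sigma> \<and> keep d R R'"
    have "halts w (comp_expr d (Lt e f)) (ecost e + (ecost f + Suc (max 1 1))) ?Q R M"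
      unfolding comp_expr.simps
    proof (rule computes2[OF Lt.IH(1) Lt.IH(2) R m], goal_cases)
      case (3 R1)
      show ?case
        using 3 big by (intro halts_Cond halts_SetConst) auto
    qed (use Lt.prems in auto)
    then show "halts w (comp_expr d (Lt e f)) (ecost (Lt e f)) ?Q R M"
      by (rule halts_weaken) auto
  qed
next
  case (Ite b e f)
  show ?case unfolding computes_def
  proof (intro allI impI)
    fix \<sigma> R M assume R: "regs R" and m: "memr \<sigma> M"
    let ?Q = "\<lambda>R' M'. M' = M \<and> R' (10 + d) = ev (Ite b e f) \<sigma> \<and> keep d R R'"
    have ok: "computes d b" "computes d e" "computes d f" using Ite by auto
    have "halts w (comp_expr d (Ite b e f)) (ecost b + Suc (max (ecost f) (ecost e))) ?Q R M"
      unfolding comp_expr.simps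
    proof (rule halts_Seq, rule computesD[OF ok(1) R m], goal_cases)
      case (1 R1)
      have r5: "R1 5 = 0" using 1 by (simp add: regs_def)
      show ?case
      proof (rule halts_Cond, goal_cases)
        case 1
        then show ?case using \<open>R1 (10 + d) = ev b \<sigma>\<close> \<open>keep d R R1\<close> r5
          by (intro computesD[OF ok(3) \<open>regs R1\<close> m]) auto
      next
        case 2
        then show ?case using \<open>R1 (10 + d) = ev b \<sigma>\<close> \<open>keep d R R1\<close> r5
          by (intro computesD[OF ok(2) \<open>regs R1\<close> m]) auto
      qed
    qed
    then show "halts w (comp_expr d (Ite b e f)) (ecost (Ite b e f)) ?Q R M"
      by (rule halts_weaken) auto
  qed
next
  case (Lst x e)
  show ?case unfolding computes_def
  proof (intro allI impI)
    fix \<sigma> R M assume R: "regs R" and m: "memr \<sigma> M"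
    have ok: "computes (d + 3) e" and x: "x < 100" using Lst by auto
    let ?Q = "\<lambda>R' M'. M' = M \<and> R' (10 + d) = ev (Lst x e) \<sigma> \<and> keep d R R'"
    have rd: "M (cell x 0 0) < w" using memr_read[OF m, of 0 0 x] by simp
    have lw: "ev (Lst x e) \<sigma> < w" using le_less_trans[OF least_le L_w] by simp
    have "halts w (comp_expr d (Lst x e)) (2 + (1 + (1 + (1 + ((L - 0) * (ecost e + 10) + 2 + (2 + (1 + 1))))))) ?Q R M"
      unfolding comp_expr.simps
    proof (rule halts_Seq, rule halts_vaddr[OF R x], rule halts_Seq, rule halts_Load, goal_cases)
      case (3 R1)
      define R2 where "R2 = R1(10 + d := M (R1 6), 11 + d := 0, 12 + d := L)"
      have rr: "regs R1" "regs R2" using R 3 unfolding R2_def by (auto simp: regs_def)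
      have k2: "keep d R R2" "R2 (10 + d) = M (cell x 0 0)" using 3 unfolding R2_def by auto
      show ?case
      proof (rule halts_Seq, rule halts_SetConst, use big in simp, rule halts_Seq, rule halts_Arith, goal_cases)
        case 1
        then show ?case using rr L_w by (simp add: regs_def)
      next
        case 2
        have e2: "R1(10 + d := M (R1 6), 11 + d := 0, 12 + d := eval_op Plus ((R1(10 + d := M (R1 6), 11 + d := 0)) 1) ((R1(10 + d := M (R1 6), 11 + d := 0)) 5)) = R2"
          unfolding R2_def using rr(1) by (simp add: regs_def)
        show ?case unfolding e2
        proof (rule halts_Seq, rule halts_weaken[OF search_loop[OF ok x m, of 0 R2]], goal_cases)
          case (8 R3 M3)
          then obtain v where v: "M3 = M(cell x 0 0 := v)" by blast
          have k3: "keep (Suc d) R2 R3" and l3: "R3 (12 + d) = ev (Lst x e) \<sigma>" using 8 by auto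
          have "regs R3" using k3 rr(2) by (simp add: regs_def)
          then show ?case
          proof (intro halts_Seq halts_vaddr[OF _ x] halts_Store, goal_cases)
            case (4 R4)
            have "R4 5 = 0" "R4 (12 + d) = ev (Lst x e) \<sigma>" "R4 (10 + d) = M (cell x 0 0)" "R4 6 = cell x 0 0"
              using 4 l3 k3 k2 by (auto simp: regs_def)
            moreover have "keep d R R4" using 4 k3 k2 by auto
            ultimately show ?case using lw v by (intro halts_Arith) auto
          qed (use cell_less[OF x, of 0 0] k3 k2 rd in auto)
        qed (use rr in \<open>auto simp: R2_def intro: exI[of _ "M (cell x 0 0)"]\<close>)
      qed
    qed (use cell_less[OF x, of 0 0] rd in auto)
    then show "halts w (comp_expr d (Lst x e)) (ecost (Lst x e)) ?Q R M"
      by (rule halts_weaken) auto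
  qed
qed

definition executes :: "nat \<Rightarrow> cmd \<Rightarrow> bool" where
  "executes d c \<longleftrightarrow> (\<forall>\<sigma> R M. regs R \<longrightarrow> memr \<sigma> M \<longrightarrow>
     halts w (comp d c) (cost c \<sigma>) (\<lambda>R' M'. memr (sem c \<sigma>) M' \<and> keep d R R') R M)"

lemma executesD:
  "executes d c \<Longrightarrow> regs R \<Longrightarrow> memr \<sigma> M \<Longrightarrow> (\<And>R' M'. memr (sem c \<sigma>) M' \<Longrightarrow> keep d R R' \<Longrightarrow> regs R' \<Longrightarrow> Q R' M') \<Longrightarrow>
   halts w (comp d c) (cost c \<sigma>) Q R M"
proof -
  assume a: "executes d c" "regs R" "memr \<sigma> M"
    and Q: "\<And>R' M'. memr (sem c \<sigma>) M' \<Longrightarrow> keep d R R' \<Longrightarrow> regs R' \<Longrightarrow> Q R' M'"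
  from a have "halts w (comp d c) (cost c \<sigma>) (\<lambda>R' M'. memr (sem c \<sigma>) M' \<and> keep d R R') R M"
    unfolding executes_def by blast
  then show ?thesis by (rule halts_weaken) (use Q keep_regs[OF _ a(2)] in auto)
qed

lemma for_loop:
  assumes c: "executes (d + 2) c" and x: "x < 100"
  defines "F \<equiv> \<lambda>k \<tau>. sem c (put \<tau> x 0 0 k)"
  shows "k \<le> L \<Longrightarrow> regs R \<Longrightarrow> R (11 + d) = k \<Longrightarrow> memr (iter F k \<sigma>) M \<Longrightarrow>
    halts w (for_body d x (comp (d + 2) c))
      ((\<Sum>j = k..<L. cost c (put (iter F j \<sigma>) x 0 0 j) + 10) + 1)
      (\<lambda>R' M'. memr (iter F L \<sigma>) M' \<and> keep (Suc d) R R') R M"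
proof (induction "L - k" arbitrary: k R M)
  case 0
  then have k: "k = L" by simp
  let ?W = "for_body d x (comp (d + 2) c)"
  let ?Q = "\<lambda>R R' M'. memr (iter F L \<sigma>) M' \<and> keep (Suc d) R R'"
  have "halts w ?W 1 (?Q R) R M" using 0 k by (intro halts_WhileF) (auto simp: regs_def)
  then show ?case using k by simp
next
  case (Suc z)
  then have k: "k < L" by simp
  let ?W = "for_body d x (comp (d + 2) c)"
  let ?Q = "\<lambda>R R' M'. memr (iter F L \<sigma>) M' \<and> keep (Suc d) R R'"
  let ?\<sigma> = "put (iter F k \<sigma>) x 0 0 k"
  let ?T = "\<lambda>k. (\<Sum>j = k..<L. cost c (put (iter F j \<sigma>) x 0 0 j) + 10) + 1"
  have m': "memr ?\<sigma> (M(cell x 0 0 := k))" using memr_put[OF Suc.prems(4), of 0 0 k x] k by simp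
  have body: "halts w (Arith Plus (11 + d) (11 + d) 3) 1 (\<lambda>R1 M1. halts w ?W (?T (Suc k)) (?Q R) R1 M1) R' M'"
    if R': "memr (sem c ?\<sigma>) M'" "keep (d + 2) R R'" "regs R'" for R' M'
  proof (rule halts_Arith)
    have r: "R' (11 + d) = k" "R' 3 = 1" using R' Suc.prems by (auto simp: regs_def)
    show "eval_op Plus (R' (11 + d)) (R' 3) < w" using r k L_w by simp
    have "halts w ?W (?T (Suc k)) (?Q (R'(11 + d := Suc k))) (R'(11 + d := Suc k)) M'"
    proof (rule Suc.hyps(1))
      show "z = L - Suc k" "Suc k \<le> L" using Suc.hyps(2) k by auto
      show "regs (R'(11 + d := Suc k))" using R' by (simp add: regs_def)
      show "memr (iter F (Suc k) \<sigma>) M'" using R' by (simp add: F_def)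
    qed (use r in auto)
    then show "halts w ?W (?T (Suc k)) (?Q R) (R'(11 + d := eval_op Plus (R' (11 + d)) (R' 3))) M'"
      using r R' Suc.prems by (auto intro: halts_weaken)
  qed
  have "halts w ?W (Suc ((2 + (1 + (cost c ?\<sigma> + 1))) + ?T (Suc k))) (?Q R) R M"
  proof (rule halts_WhileT, goal_cases)
    case 1
    then show ?case using k Suc.prems by (simp add: regs_def)
  next
    case 2
    show ?case
    proof (rule halts_Seq, rule halts_vaddr[OF Suc.prems(2) x], rule halts_Seq, rule halts_Store, goal_cases)
      case (1 R1)
      then show ?case using cell_less[OF x, of 0 0] by simp
    next
      case (2 R1)
      then show ?case using Suc.prems k L_w by simp
    next
      case (3 R1)
      have "M(R1 6 := R1 (11 + d)) = M(cell x 0 0 := k)" using 3 Suc.prems by simp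
      moreover have "regs R1" using 3 Suc.prems by (simp add: regs_def)
      ultimately show ?case
        by (simp only:, intro halts_Seq executesD[OF c _ m'] body) (use 3 in auto)
    qed
  qed
  moreover have "Suc ((2 + (1 + (cost c ?\<sigma> + 1))) + ?T (Suc k)) \<le> ?T k"
    using k by (simp add: sum.atLeast_Suc_lessThan)
  ultimately show ?case by (rule halts_weaken)
qed

lemma comp_correct: "cmd_ok c \<Longrightarrow> executes d c"
proof (induction c arbitrary: d)
  case Nop
  then show ?case unfolding executes_def comp.simps cost.simps by (intro allI impI halts_Skip) simp
next
  case (Wr a e f g)
  show ?case unfolding executes_def
  proof (intro allI impI)
    fix \<sigma> R M assume R: "regs R" and m: "memr \<sigma> M"
    have ok: "computes d e" "computes (Suc d) f" "computes (d + 2) g" and a: "a < 100"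
      using Wr by (auto intro: comp_expr_correct)
    have "bounded \<sigma>" using m unfolding memr_def by simp
    then have le: "ev e \<sigma> < B" "ev f \<sigma> < B" "ev g \<sigma> \<le> L" using ev_le by (auto simp: less_Suc_eq_le)
    let ?Q = "\<lambda>R' M'. memr (sem (Wr a e f g) \<sigma>) M' \<and> keep d R R'"
    have "halts w (comp_expr d e ;; comp_expr (Suc d) f ;; comp_expr (d + 2) g ;; addr a d ;; Store 6 (12 + d))
      (ecost e + (ecost f + (ecost g + (5 + 1)))) ?Q R M"
    proof (rule computes2[OF ok(1,2) R m], rule halts_Seq, rule computesD[OF ok(3) _ m], goal_cases)
      case (2 R1 R2)
      have r: "R2 (10 + d) = ev e \<sigma>" "R2 (11 + d) = ev f \<sigma>" "R2 (12 + d) = ev g \<sigma>" "keep d R R2"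
        using 2 by (auto simp: numeral_eq_Suc)
      show ?case
      proof (rule halts_Seq, rule halts_addr[OF 2(7) a r(1,2) le(1,2)], goal_cases)
        case (1 R3)
        then show ?case
          using r cell_less[OF a le(1,2)] memr_put[OF m le, of a] le(3) L_w by (intro halts_Store) auto
      qed
    qed
    then show "halts w (comp d (Wr a e f g)) (cost (Wr a e f g) \<sigma>) ?Q R M"
      by (auto intro: halts_weaken)
  qed
next
  case (Sq c1 c2)
  then have "executes d c1" "executes d c2" by auto
  then show ?case unfolding executes_def[of d "Sq c1 c2"]
    by (auto intro!: halts_Seq executesD)
next
  case (Iff b c1 c2)
  show ?case unfolding executes_def
  proof (intro allI impI)
    fix \<sigma> R M assume R: "regs R" and m: "memr \<sigma> M"
    have ok: "computes d b" "executes d c1" "executes d c2" using Iff by (auto intro: comp_expr_correct)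
    let ?Q = "\<lambda>R' M'. memr (sem (Iff b c1 c2) \<sigma>) M' \<and> keep d R R'"
    let ?T = "if ev b \<sigma> = 0 then cost c2 \<sigma> else cost c1 \<sigma>"
    have "halts w (comp d (Iff b c1 c2)) (ecost b + Suc (max ?T ?T)) ?Q R M"
      unfolding comp.simps
    proof (rule halts_Seq, rule computesD[OF ok(1) R m], goal_cases)
      case (1 R1)
      have r5: "R1 5 = 0" using 1 by (simp add: regs_def)
      show ?case
      proof (rule halts_Cond, goal_cases)
        case 1
        then have "ev b \<sigma> = 0" using \<open>R1 (10 + d) = ev b \<sigma>\<close> r5 by simp
        then show ?case using \<open>keep d R R1\<close>
          by (simp, intro executesD[OF ok(3) \<open>regs R1\<close> m]) auto
      next
        case 2
        then have "ev b \<sigma> \<noteq> 0" using \<open>R1 (10 + d) = ev b \<sigma>\<close> r5 by simp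
        then show ?case using \<open>keep d R R1\<close>
          by (simp, intro executesD[OF ok(2) \<open>regs R1\<close> m]) auto
      qed
    qed
    then show "halts w (comp d (Iff b c1 c2)) (cost (Iff b c1 c2) \<sigma>) ?Q R M"
      by (rule halts_weaken) auto
  qed
next
  case (For x c)
  show ?case unfolding executes_def
  proof (intro allI impI)
    fix \<sigma> R M assume R: "regs R" and m: "memr \<sigma> M"
    have ok: "executes (d + 2) c" and x: "x < 100" using For by auto
    let ?Q = "\<lambda>R' M'. memr (sem (For x c) \<sigma>) M' \<and> keep d R R'"
    let ?F = "\<lambda>k \<tau>. sem c (put \<tau> x 0 0 k)"
    have rd: "M (cell x 0 0) = \<sigma> x 0 0" "\<sigma> x 0 0 < w" using memr_read[OF m, of 0 0 x] by simp_all
    have xb: "\<sigma> x 0 0 \<le> L" using m unfolding memr_def bounded_def by blast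
    have "halts w (comp d (For x c)) (2 + (1 + (1 + ((\<Sum>j = 0..<L. cost c (put (iter ?F j \<sigma>) x 0 0 j) + 10) + 1 + (2 + 1))))) ?Q R M"
      unfolding comp.simps
    proof (rule halts_Seq, rule halts_vaddr[OF R x], rule halts_Seq, rule halts_Load, goal_cases)
      case (3 R1)
      define R2 where "R2 = R1(10 + d := M (R1 6), 11 + d := 0)"
      have rr: "regs R1" "regs R2" using R 3 unfolding R2_def by (auto simp: regs_def)
      have k2: "keep d R R2" "R2 (10 + d) = \<sigma> x 0 0" using 3 rd unfolding R2_def by auto
      show ?case
      proof (rule halts_Seq, rule halts_SetConst, use big in simp, fold R2_def, rule halts_Seq, rule halts_weaken[OF for_loop[OF ok x, of 0 R2 \<sigma>]], goal_cases)
        case (6 R3 M3)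
        then have k3: "keep (Suc d) R2 R3" and m3: "memr (iter ?F L \<sigma>) M3" by auto
        have "regs R3" using k3 rr(2) by (simp add: regs_def)
        then show ?case
        proof (intro halts_Seq halts_vaddr[OF _ x] halts_Store, goal_cases)
          case (4 R4)
          have "R4 (10 + d) = \<sigma> x 0 0" "R4 6 = cell x 0 0"
            using 4 k3 k2 by auto
          moreover have "keep d R R4" using 4 k3 k2 by auto
          ultimately show ?case using memr_put[OF m3, of 0 0 "\<sigma> x 0 0" x] xb by auto
        qed (use cell_less[OF x, of 0 0] k3 k2 rd in auto)
      qed (use rr m in \<open>auto simp: R2_def\<close>)
    qed (use cell_less[OF x, of 0 0] rd in auto)
    then show "halts w (comp d (For x c)) (cost (For x c) \<sigma>) ?Q R M"
      by (rule halts_weaken) (auto simp: atLeast0LessThan)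
  qed
qed

end

section \<open>Running times from nesting depths, and rules for loops\<close>

fun edep :: "expr \<Rightarrow> nat" where
  "edep (Rd a e f) = max (edep e) (edep f)"
| "edep (Ad e f) = max (edep e) (edep f)"
| "edep (Add e f) = max (edep e) (edep f)"
| "edep (Sub e f) = max (edep e) (edep f)"
| "edep (Eq e f) = max (edep e) (edep f)"
| "edep (Lt e f) = max (edep e) (edep f)"
| "edep (Ite b e f) = max (edep b) (max (edep e) (edep f))"
| "edep (Lst x e) = Suc (edep e)"
| "edep _ = 0"

fun econst :: "expr \<Rightarrow> nat" where
  "econst (Rd a e f) = econst e + econst f + 10"
| "econst (Ad e f) = econst e + econst f + 10"
| "econst (Add e f) = econst e + econst f + 10"
| "econst (Sub e f) = econst e + econst f + 10"
| "econst (Eq e f) = econst e + econst f + 10"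
| "econst (Lt e f) = econst e + econst f + 10"
| "econst (Ite b e f) = econst b + econst e + econst f + 10"
| "econst (Lst x e) = econst e + 30"
| "econst _ = 1"

fun cdep :: "cmd \<Rightarrow> nat" where
  "cdep Nop = 0"
| "cdep (Wr a e f g) = max (edep e) (max (edep f) (edep g))"
| "cdep (Sq c d) = max (cdep c) (cdep d)"
| "cdep (Iff b c d) = max (edep b) (max (cdep c) (cdep d))"
| "cdep (For x c) = Suc (cdep c)"

fun cconst :: "cmd \<Rightarrow> nat" where
  "cconst Nop = 1"
| "cconst (Wr a e f g) = econst e + econst f + econst g + 10"
| "cconst (Sq c d) = cconst c + cconst d"
| "cconst (Iff b c d) = econst b + 10 + (cconst c + cconst d)"
| "cconst (For x c) = cconst c + 30"

definition fill :: "nat \<Rightarrow> nat \<Rightarrow> expr \<Rightarrow> expr \<Rightarrow> cmd" where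
  "fill x a c e = For x (Wr a (Rd x (Cst 0) (Cst 0)) c e)"

text \<open>Loop variables are left out because \<open>For\<close> restores them.\<close>

fun writes :: "cmd \<Rightarrow> nat set" where
  "writes Nop = {}"
| "writes (Wr a e f g) = {a}"
| "writes (Sq c d) = writes c \<union> writes d"
| "writes (Iff b c d) = writes c \<union> writes d"
| "writes (For x c) = writes c"

context prog
begin

lemma le_pow: "k \<le> c * Suc L ^ d \<Longrightarrow> d \<le> d' \<Longrightarrow> k \<le> c * Suc L ^ d'"
proof -
  assume k: "k \<le> c * Suc L ^ d" and d: "d \<le> d'"
  have "c * Suc L ^ d \<le> c * Suc L ^ d'" using d by (intro mult_le_mono2 power_increasing) auto
  then show ?thesis using k by (rule order_trans[rotated])
qed

lemma const_pow: "c \<le> c * Suc L ^ d"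
  by simp

lemma sum_pow: "k1 \<le> c1 * Suc L ^ d1 \<Longrightarrow> k2 \<le> c2 * Suc L ^ d2 \<Longrightarrow> k1 + k2 \<le> (c1 + c2) * Suc L ^ max d1 d2"
  using le_pow[of k1 c1 d1 "max d1 d2"] le_pow[of k2 c2 d2 "max d1 d2"] by (simp add: add_mult_distrib)

lemma sum_pow10: "k1 \<le> c1 * Suc L ^ d1 \<Longrightarrow> k2 \<le> c2 * Suc L ^ d2 \<Longrightarrow> k1 + k2 + 10 \<le> (c1 + c2 + 10) * Suc L ^ max d1 d2"
  using sum_pow[of k1 c1 d1 k2 c2 d2] const_pow[of 10 "max d1 d2"] unfolding add_mult_distrib by linarith

lemma ecost_le: "ecost e \<le> econst e * Suc L ^ edep e"
proof (induction e)
  case (Lst x e)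
  let ?B = "Suc L"
  have "L * (ecost e + 10) + 20 \<le> ?B * (econst e * ?B ^ edep e + 10 * ?B ^ edep e) + 20 * ?B ^ Suc (edep e)"
    by (intro add_mono mult_mono Lst const_pow) auto
  also have "\<dots> = (econst e + 30) * ?B ^ Suc (edep e)" by (simp add: algebra_simps)
  finally show ?case by simp
next
  case (Ite b e f)
  show ?case using sum_pow10[OF Ite(1) sum_pow[OF Ite(2,3)]] by (simp add: add.assoc)
next
  case (Rd a e f) show ?case using sum_pow10[OF Rd] by simp
next
  case (Ad e f) show ?case using sum_pow10[OF Ad] by simp
next
  case (Add e f) show ?case using sum_pow10[OF Add] by simp
next
  case (Sub e f) show ?case using sum_pow10[OF Sub] by simp
next
  case (Eq e f) show ?case using sum_pow10[OF Eq] by simp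
next
  case (Lt e f) show ?case using sum_pow10[OF Lt] by simp
qed auto

text \<open>Each level of nesting contributes one factor for its at most \<open>L\<close> rounds.
  Thus an exponent can be computed from the text of a program.\<close>

lemma cost_le: "cost c \<sigma> \<le> cconst c * Suc L ^ cdep c"
proof (induction c arbitrary: \<sigma>)
  case (Wr a e f g)
  show ?case using sum_pow10[OF ecost_le sum_pow[OF ecost_le ecost_le], of e f g] by (simp add: add.assoc)
next
  case (Sq c d)
  show ?case using sum_pow[OF Sq(1) Sq(2)] by simp
next
  case (Iff b c d)
  define K where "K = (if ev b \<sigma> = 0 then cost d \<sigma> else cost c \<sigma>)"
  have "K \<le> cost c \<sigma> + cost d \<sigma>" unfolding K_def by simp
  also have "\<dots> \<le> (cconst c + cconst d) * Suc L ^ max (cdep c) (cdep d)" using sum_pow[OF Iff(1) Iff(2)] .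
  finally have "ecost b + K + 10 \<le> (econst b + (cconst c + cconst d) + 10) * Suc L ^ max (edep b) (max (cdep c) (cdep d))"
    using sum_pow10[OF ecost_le[of b]] by blast
  moreover have "cost (Iff b c d) \<sigma> = ecost b + K + 10" unfolding K_def by simp
  moreover have "cconst (Iff b c d) = econst b + (cconst c + cconst d) + 10" by simp
  ultimately show ?case unfolding cdep.simps by metis
next
  case (For x c)
  let ?B = "Suc L" let ?s = "\<lambda>k. put (iter (\<lambda>k \<tau>. sem c (put \<tau> x 0 0 k)) k \<sigma>) x 0 0 k"
  have "(\<Sum>k<L. cost c (?s k) + 10) \<le> (\<Sum>k<L. cconst c * ?B ^ cdep c + 10)"
    by (intro sum_mono add_mono For) auto
  then have "cost (For x c) \<sigma> \<le> L * (cconst c * ?B ^ cdep c + 10) + 20" by simp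
  also have "\<dots> \<le> ?B * (cconst c * ?B ^ cdep c + 10 * ?B ^ cdep c) + 20 * ?B ^ Suc (cdep c)"
    by (intro add_mono mult_mono const_pow) auto
  also have "\<dots> = (cconst c + 30) * ?B ^ Suc (cdep c)" by (simp add: algebra_simps)
  finally show ?case by simp
qed auto

lemma put_other: "b \<noteq> a \<Longrightarrow> put \<sigma> a x y v b = \<sigma> b"
  unfolding put_def by simp

lemma put_same: "put \<sigma> a x y v a = (\<sigma> a)(x := (\<sigma> a x)(y := v))"
  unfolding put_def by simp

lemma put_cell [simp]: "put \<sigma> a x y v a x y = v"
  unfolding put_def by simp

text \<open>If \<open>x\<close> is not written by the body, a loop over \<open>x\<close> changes
  just the cell of \<open>x\<close>, and that cell is restored at the end.\<close>

lemma frame: "a \<notin> writes c \<Longrightarrow> sem c \<sigma> a = \<sigma> a"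
proof (induction c arbitrary: \<sigma>)
  case (For x c)
  let ?F = "\<lambda>k \<tau>. sem c (put \<tau> x 0 0 k)"
  have c: "sem c \<tau> a = \<tau> a" for \<tau> using For by simp
  have "put (iter ?F k \<sigma>) x 0 0 (\<sigma> x 0 0) a = \<sigma> a" for k
  proof (induction k)
    case 0
    then show ?case unfolding put_def by simp
  next
    case (Suc k)
    show ?case
    proof (cases "a = x")
      case True
      have cx: "sem c \<tau> x = \<tau> x" for \<tau> using c[unfolded True] .
      have st: "put (sem c (put \<tau> x 0 0 k)) x 0 0 v x = put \<tau> x 0 0 v x" for \<tau> v
        unfolding put_same[of _ x] cx by simp
      show ?thesis unfolding True iter.simps st using Suc[unfolded True] .
    next
      case False
      then show ?thesis using Suc by (simp add: c put_other)
    qed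
  qed
  then show ?case by simp
qed (auto simp: put_other)

abbreviation agree :: "nat set \<Rightarrow> store \<Rightarrow> store \<Rightarrow> bool" where
  "agree S \<sigma> \<tau> \<equiv> (\<forall>a. a \<notin> S \<longrightarrow> \<sigma> a = \<tau> a)"

lemma sem_For:
  assumes "I 0 \<sigma>" and "\<And>k \<tau>. k < L \<Longrightarrow> I k \<tau> \<Longrightarrow> I (Suc k) (sem c (put \<tau> x 0 0 k))"
    and "\<And>\<tau>. I L \<tau> \<Longrightarrow> Q (put \<tau> x 0 0 (\<sigma> x 0 0))"
  shows "Q (sem (For x c) \<sigma>)"
proof -
  let ?F = "\<lambda>k \<tau>. sem c (put \<tau> x 0 0 k)"
  have "k \<le> L \<Longrightarrow> I k (iter ?F k \<sigma>)" for k
    by (induction k) (use assms in auto)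
  then show ?thesis using assms(3) by simp
qed

text \<open>The loop acts as a simultaneous assignment to a column as long as \<open>e\<close> does
  not depend on the rows of \<open>a\<close> already overwritten; the row \<open>i\<close> itself is
  still the old one when it is computed.\<close>

lemma sem_fill:
  assumes ax: "a \<noteq> x"
    and c: "\<And>\<tau> i. agree {a, x} \<tau> \<sigma> \<Longrightarrow> ev ce (put \<tau> x 0 0 i) = c"
    and f: "\<And>\<tau> i. i < L \<Longrightarrow> agree {a, x} \<tau> \<sigma> \<Longrightarrow> \<tau> a i = \<sigma> a i \<Longrightarrow> put \<tau> x 0 0 i x = put \<sigma> x 0 0 i x \<Longrightarrow>
      ev e (put \<tau> x 0 0 i) = f i"
  shows "sem (fill x a ce e) \<sigma> = \<sigma>(a := (\<lambda>i j. if i < L \<and> j = c then f i else \<sigma> a i j))"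
  unfolding fill_def
proof (rule sem_For[where I = "\<lambda>k \<tau>. agree {a, x} \<tau> \<sigma> \<and> (\<exists>v. \<tau> x = (\<sigma> x)(0 := (\<sigma> x 0)(0 := v))) \<and>
    (\<forall>i j. \<tau> a i j = (if i < k \<and> j = c then f i else \<sigma> a i j))"], goal_cases)
  case 1
  show ?case by (auto intro!: exI[of _ "\<sigma> x 0 0"])
next
  case (2 k \<tau>)
  have "\<tau> a k = \<sigma> a k" using 2 by auto
  moreover have "put \<tau> x 0 0 k x = put \<sigma> x 0 0 k x" using 2 by (auto simp: put_same)
  ultimately have e: "ev e (put \<tau> x 0 0 k) = f k" "ev ce (put \<tau> x 0 0 k) = c" using f c 2 by blast+
  have "sem (Wr a (Rd x (Cst 0) (Cst 0)) ce e) (put \<tau> x 0 0 k) = put (put \<tau> x 0 0 k) a k c (f k)"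
    using e by simp
  then show ?case using 2 ax by (auto simp: put_def)
next
  case (3 \<tau>)
  then obtain v where v: "\<tau> x = (\<sigma> x)(0 := (\<sigma> x 0)(0 := v))" by blast
  show ?case
  proof
    fix b
    consider "b = x" | "b = a" | "b \<noteq> x" "b \<noteq> a" by blast
    then show "put \<tau> x 0 0 (\<sigma> x 0 0) b = (\<sigma>(a := (\<lambda>i j. if i < L \<and> j = c then f i else \<sigma> a i j))) b"
    proof cases
      case 1
      then show ?thesis using ax v by (simp add: put_same)
    next
      case 2
      then show ?thesis using 3 ax by (auto simp: put_other fun_eq_iff)
    next
      case 3
      then show ?thesis using \<open>agree {a, x} \<tau> \<sigma> \<and> _\<close> by (auto simp: put_other)
    qed
  qed
qed

end

definition main_com :: "cmd \<Rightarrow> com" where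
  "main_com c = SetConst 6 4 ;; Arith Times 1 0 6 ;; SetConst 6 8 ;; Arith Plus 1 1 6 ;; SetConst 3 1 ;;
     Arith Plus 2 1 3 ;; Arith Times 4 2 2 ;; comp 0 c ;; vaddr 0 ;; Load 0 6"

text \<open>\<open>102 * 25 = 2550\<close> is at most \<open>2 ^ 12\<close>, which accounts for
  twelve factors \<open>n + 2\<close>; the square takes the other two.\<close>

lemma word_bound: "102 * (Suc (lim n) * Suc (lim n)) \<le> (n + 2) ^ 14"
proof -
  have 1: "Suc (lim n) \<le> 5 * (n + 2)" unfolding lim_def by simp
  have "102 * (Suc (lim n) * Suc (lim n)) \<le> 102 * ((5 * (n + 2)) * (5 * (n + 2)))"
    by (intro mult_le_mono 1 le_refl)
  also have "\<dots> = 2550 * (n + 2) ^ 2" by (simp add: power2_eq_square algebra_simps)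
  also have "\<dots> \<le> 2 ^ 12 * (n + 2) ^ 2" by (intro mult_le_mono1) simp
  also have "\<dots> \<le> (n + 2) ^ 12 * (n + 2) ^ 2" by (intro mult_le_mono1 power_mono) auto
  also have "\<dots> = (n + 2) ^ 14" by (simp flip: power_add)
  finally show ?thesis .
qed

lemma main_runs:
  assumes g: "simple_graph {..<n} E" and ok: "cmd_ok c"
    and ans: "prog.sem n (\<lambda>u v. {u, v} \<in> E) c (\<lambda>_ _ _. 0) 0 0 0 = of_bool b"
  shows "\<exists>t. runs_on 14 (main_com c) n E t b \<and> t \<le> prog.cost n (\<lambda>u v. {u, v} \<in> E) c (\<lambda>_ _ _. 0) + 20"
proof -
  interpret machine n "\<lambda>u v. {u, v} \<in> E" "(n + 2) ^ 14"
  proof unfold_locales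
    show "u < n \<and> v < n" if "{u, v} \<in> E" for u v using g that unfolding simple_graph_def by auto
    show "102 * (Suc (lim n) * Suc (lim n)) \<le> (n + 2) ^ 14" by (rule word_bound)
  qed
  let ?w = "(n + 2) ^ 14" let ?\<sigma> = "(\<lambda>_ _ _. 0) :: store"
  define R0 :: "nat \<Rightarrow> nat" where "R0 = (\<lambda>_. 0)(0 := n)"
  define M0 where "M0 i = (if i < n * n \<and> {i div n, i mod n} \<in> E then 1 else 0 :: nat)" for i
  define R1 where "R1 = R0(6 := 4, 1 := n * 4, 6 := 8, 1 := n * 4 + 8, 3 := 1, 2 := n * 4 + 9, 4 := (n * 4 + 9) * (n * 4 + 9))"
  have inp: "adjacency_input n E = (R0, M0)" unfolding adjacency_input_def R0_def M0_def by auto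
  have regs: "regs R1" unfolding regs_def R1_def R0_def lim_def by (simp add: algebra_simps)
  have mem: "memr ?\<sigma> M0"
    unfolding memr_def
  proof (intro conjI allI impI)
    show "bounded ?\<sigma>" unfolding bounded_def by simp
    show "M0 (cell a x y) = 0" for a x y
    proof -
      have "n * n \<le> B * B" using n_L by (intro mult_le_mono) auto
      also have "B * B \<le> cell a x y" unfolding cell_def by simp
      finally show ?thesis unfolding M0_def by simp
    qed
    show "M0 (i * n + j) = of_bool ({i, j} \<in> E)" if "i < n" "j < n" for i j
    proof -
      have "i * n + j < n * n" using mult_le_mono1[of "Suc i" n n] that by simp
      then show ?thesis unfolding M0_def using divmod_unique[OF that(2), of i] by simp
    qed
  qed
  have bw: "n * 4 + 9 < ?w" "(n * 4 + 9) * (n * 4 + 9) < ?w" "(9 + n * 4) * (9 + n * 4) < ?w"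
    using B_w BB_w unfolding lim_def by (simp_all add: algebra_simps)
  have "halts ?w (main_com c) (1 + (1 + (1 + (1 + (1 + (1 + (1 + (cost c ?\<sigma> + (2 + 1))))))))) (\<lambda>R M. R 0 = of_bool b) R0 M0"
    unfolding main_com_def
    apply (rule halts_Seq, rule halts_SetConst, use big in simp)
    apply (rule halts_Seq, rule halts_Arith, use bw in \<open>simp add: R0_def\<close>)
    apply (rule halts_Seq, rule halts_SetConst, use bw in simp)
    apply (rule halts_Seq, rule halts_Arith, use bw in \<open>simp add: R0_def\<close>)
    apply (rule halts_Seq, rule halts_SetConst, use bw in simp)
    apply (rule halts_Seq, rule halts_Arith, use bw in \<open>simp add: R0_def\<close>)
    apply (rule halts_Seq, rule halts_Arith, use bw in \<open>simp add: R0_def\<close>)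
    apply (rule halts_Seq)
    apply (rule executesD[OF comp_correct[OF ok], where \<sigma> = ?\<sigma>])
    subgoal using regs unfolding R1_def R0_def by (simp add: numeral_eq_Suc)
    subgoal by (rule mem)
    subgoal premises p for R' M'
    proof (rule halts_Seq, rule halts_vaddr[OF p(3)], simp)
      fix R'' assume "R'' 6 = cell 0 0 0" "\<And>r. r \<noteq> 6 \<Longrightarrow> R'' r = R' r"
      then show "halts ?w (Load 0 6) 1 (\<lambda>R M. R 0 = of_bool b) R'' M'"
        using memr_read[OF p(1), of 0 0 0] cell_less[of 0 0 0] ans by (intro halts_Load) auto
    qed
    done
  then obtain t R M where "exec ?w (main_com c) (R0, M0) t (R, M)" "t \<le> cost c ?\<sigma> + 20" "R 0 = of_bool b"
    unfolding halts_def by auto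
  then show ?thesis unfolding runs_on_def inp by blast
qed

section \<open>Graphs outside W2\<close>

locale graph =
  fixes n :: nat and E :: "nat set set"
  assumes simple: "simple_graph {..<n} E"
begin

abbreviation ad :: "nat \<Rightarrow> nat \<Rightarrow> bool" where "ad u v \<equiv> {u, v} \<in> E"

lemma ad_less: "ad u v \<Longrightarrow> u < n \<and> v < n"
  using simple unfolding simple_graph_def by auto

lemma ad_sym: "ad u v \<longleftrightarrow> ad v u"
  by (simp add: insert_commute)

lemma ad_irrefl: "\<not> ad v v"
  using simple unfolding simple_graph_def by auto

definition ind :: "nat set \<Rightarrow> bool" where
  "ind S \<longleftrightarrow> S \<subseteq> {..<n} \<and> (\<forall>x\<in>S. \<forall>y\<in>S. \<not> ad x y)"

lemma ind_eq: "independent_set {..<n} E S \<longleftrightarrow> ind S"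
  unfolding independent_set_def ind_def ..

lemma ind_finite: "ind S \<Longrightarrow> finite S"
  unfolding ind_def using finite_subset by blast

lemma ind_card: "ind S \<Longrightarrow> card S \<le> n"
  using card_mono[of "{..<n}" S] unfolding ind_def by simp

lemma ind_insert: "ind S \<Longrightarrow> v < n \<Longrightarrow> (\<And>x. x \<in> S \<Longrightarrow> \<not> ad v x) \<Longrightarrow> ind (insert v S)"
  unfolding ind_def using ad_irrefl ad_sym by auto

lemma ind_subset: "ind S \<Longrightarrow> T \<subseteq> S \<Longrightarrow> ind T"
  unfolding ind_def by blast

definition maximal :: "nat set \<Rightarrow> bool" where
  "maximal S \<longleftrightarrow> ind S \<and> (\<forall>v<n. v \<notin> S \<longrightarrow> (\<exists>x\<in>S. ad v x))"

lemma maximal_ext: "ind S \<Longrightarrow> \<exists>T. S \<subseteq> T \<and> maximal T"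
proof -
  assume S: "ind S"
  have "\<exists>T. (ind T \<and> S \<subseteq> T) \<and> (\<forall>U. ind U \<and> S \<subseteq> U \<longrightarrow> card U \<le> card T)"
    using ex_has_greatest_nat[of "\<lambda>T. ind T \<and> S \<subseteq> T" S card "Suc n"] S ind_card by (simp add: less_Suc_eq_le)
  then obtain T where T: "ind T" "S \<subseteq> T" and mx: "\<And>U. ind U \<Longrightarrow> S \<subseteq> U \<Longrightarrow> card U \<le> card T" by blast
  have "\<exists>x\<in>T. ad v x" if "v < n" "v \<notin> T" for v
  proof (rule ccontr)
    assume "\<not> ?thesis"
    then have "ind (insert v T)" using ind_insert[OF T(1) that(1)] by blast
    then have "card (insert v T) \<le> card T" using mx T(2) by blast
    then show False using that(2) ind_finite[OF T(1)] by simp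
  qed
  then show ?thesis unfolding maximal_def using T by blast
qed

definition solvable :: "nat set \<Rightarrow> nat set \<Rightarrow> bool" where
  "solvable D T \<longleftrightarrow> (\<exists>J. ind J \<and> (\<forall>t\<in>T. t \<notin> J \<and> (\<forall>j\<in>J. \<not> ad t j)) \<and> (\<forall>x\<in>D. \<exists>j\<in>J. ad j x))"

definition far :: "nat \<Rightarrow> nat \<Rightarrow> nat \<Rightarrow> nat set" where
  "far s t1 t2 = {x. (ad t1 x \<or> ad t2 x) \<and> \<not> ad s x \<and> x \<noteq> s}"

definition induced_path :: "nat \<Rightarrow> nat \<Rightarrow> nat \<Rightarrow> bool" where
  "induced_path s t1 t2 \<longleftrightarrow> ad s t1 \<and> ad s t2 \<and> t1 \<noteq> t2 \<and> \<not> ad t1 t2"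

text \<open>The witness is \<open>S \<inter> T\<close>. A vertex of \<open>far s t1 t2\<close> is
  outside \<open>S\<close>, so by maximality it has a neighbour in \<open>S\<close>, and this is not
  \<open>s\<close>.\<close>

lemma path_witness:
  assumes S: "maximal S" and T: "maximal T" and s: "S - T = {s}" and t: "T - S = {t1, t2}" "t1 \<noteq> t2"
    and c: "ad s t1" "ad s t2"
  shows "induced_path s t1 t2 \<and> solvable (far s t1 t2) {s, t1, t2}"
proof -
  let ?J = "S \<inter> T"
  have mem: "s \<in> S" "s \<notin> T" "t1 \<in> T" "t2 \<in> T" "t1 \<notin> S" "t2 \<notin> S" using s t by auto
  have iS: "x \<in> S \<Longrightarrow> y \<in> S \<Longrightarrow> \<not> ad x y" and iT: "x \<in> T \<Longrightarrow> y \<in> T \<Longrightarrow> \<not> ad x y" for x y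
    using S T unfolding maximal_def ind_def by auto
  have J: "ind ?J" using S ind_subset unfolding maximal_def by blast
  have "\<exists>j\<in>?J. ad j x" if x: "x \<in> far s t1 t2" for x
  proof -
    have x': "ad t1 x \<or> ad t2 x" "\<not> ad s x" "x \<noteq> s" using x unfolding far_def by auto
    have "x \<notin> S"
    proof
      assume "x \<in> S"
      then have "x \<in> T" using s x' by blast
      then show False using x' iT mem by blast
    qed
    moreover have "x < n" using x' ad_less by blast
    ultimately obtain y where "y \<in> S" "ad x y" using S unfolding maximal_def by blast
    moreover have "y \<noteq> s" using x' \<open>ad x y\<close> ad_sym by blast
    ultimately show ?thesis using s ad_sym by blast
  qed
  moreover have "\<forall>u\<in>{s, t1, t2}. u \<notin> ?J \<and> (\<forall>j\<in>?J. \<not> ad u j)" using mem iS iT by auto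
  moreover have "\<not> ad t1 t2" using iT mem by blast
  ultimately show ?thesis unfolding solvable_def induced_path_def using J c t by blast
qed

end

locale claw_free_graph = graph +
  assumes claw_free: "claw_free {..<n} E"
begin

lemma claw:
  assumes "ad c x" "ad c y" "ad c z" "x \<noteq> y" "x \<noteq> z" "y \<noteq> z"
  shows "ad x y \<or> ad x z \<or> ad y z"
proof (rule ccontr)
  assume n: "\<not> ?thesis"
  define f :: "nat \<Rightarrow> nat" where "f = (\<lambda>_. c)(1 := x, 2 := y, 3 := z)"
  have f: "f 0 = c" "f 1 = x" "f 2 = y" "f 3 = z" "f (Suc 0) = x" unfolding f_def by auto
  have ne: "c \<noteq> x" "c \<noteq> y" "c \<noteq> z" using assms ad_irrefl by auto
  have 1: "inj_on f {0, 1, 2, 3}" using f assms ne by (auto simp: inj_on_def)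
  have 2: "f ` {0, 1, 2, 3} \<subseteq> {..<n}" using f assms ad_less by auto
  have 3: "{f a, f b} \<in> E \<longleftrightarrow> {a, b} \<in> {{0, 1}, {0, 2}, {0, 3}}" if "a \<in> {0, 1, 2, 3}" "b \<in> {0, 1, 2, 3}" for a b
  proof -
    have ab: "a = 0 \<or> a = 1 \<or> a = 2 \<or> a = 3" "b = 0 \<or> b = 1 \<or> b = 2 \<or> b = 3" using that by auto
    have s: "ad x c" "ad y c" "ad z c" "\<not> ad y x" "\<not> ad z x" "\<not> ad z y" using assms n ad_sym by metis+
    show ?thesis using ab(1)
      by (elim disjE; use ab(2) in \<open>elim disjE\<close>; use assms n s ad_irrefl f in \<open>simp add: doubleton_eq_iff\<close>)
  qed
  have "has_induced_copy {..<n} E {0, 1, 2, 3 :: nat} {{0, 1}, {0, 2}, {0, 3}}"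
    unfolding has_induced_copy_def by (rule exI[of _ f]) (intro conjI ballI 1 2 3)
  then show False using claw_free unfolding claw_free_def by blast
qed

text \<open>Take maximal independent sets of different sizes with largest possible intersection.
  Their differences are completely joined, so claw-freeness limits both to two vertices; being
  nonempty and of different sizes, they form an induced path on three vertices.\<close>

lemma well_covered:
  assumes nB: "\<And>s t1 t2. induced_path s t1 t2 \<Longrightarrow> \<not> solvable (far s t1 t2) {s, t1, t2}"
    and "maximal S" "maximal T"
  shows "card S = card T"
proof (rule ccontr)
  assume "card S \<noteq> card T"
  define P where "P = (\<lambda>(S, T). maximal S \<and> maximal T \<and> card S \<noteq> card T)"
  have bd: "card (S \<inter> T) \<le> n" if "P (S, T)" for S T
  proof -
    have "card (S \<inter> T) \<le> card S" using that ind_finite unfolding P_def maximal_def by (intro card_mono) auto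
    then show ?thesis using that ind_card[of S] unfolding P_def maximal_def by auto
  qed
  have "\<exists>p. P p \<and> (\<forall>q. P q \<longrightarrow> card (fst q \<inter> snd q) \<le> card (fst p \<inter> snd p))"
  proof (rule ex_has_greatest_nat[of P "(S, T)" "\<lambda>p. card (fst p \<inter> snd p)" "Suc n"])
    show "P (S, T)" using assms \<open>card S \<noteq> card T\<close> unfolding P_def by simp
    show "\<forall>p. P p \<longrightarrow> card (fst p \<inter> snd p) < Suc n" using bd by (simp add: less_Suc_eq_le split_paired_all)
  qed
  then obtain S T where P: "P (S, T)" and mx: "\<And>S' T'. P (S', T') \<Longrightarrow> card (S' \<inter> T') \<le> card (S \<inter> T)" by force
  have S: "maximal S" "ind S" "finite S" and T: "maximal T" "ind T" "finite T" and ne: "card S \<noteq> card T"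
    using P ind_finite unfolding P_def maximal_def by auto
  have iS: "x \<in> S \<Longrightarrow> y \<in> S \<Longrightarrow> \<not> ad x y" and iT: "x \<in> T \<Longrightarrow> y \<in> T \<Longrightarrow> \<not> ad x y" for x y
    using S T unfolding ind_def by auto
  \<comment> \<open>A nonadjacent pair could be added to \<open>S \<inter> T\<close> and extended to
    a maximal \<open>R\<close>. It meets both \<open>S\<close> and \<open>T\<close> in more than
    \<open>S \<inter> T\<close>, so by the choice of the pair \<open>R\<close> has the size of
    each.\<close>
  have join: "ad u v" if u: "u \<in> S - T" and v: "v \<in> T - S" for u v
  proof (rule ccontr)
    assume nuv: "\<not> ad u v"
    have "u < n" "v < n" using u v S T unfolding ind_def by auto
    have "ind (insert v (S \<inter> T))" using ind_insert[OF ind_subset[OF S(2)] \<open>v < n\<close>, of "S \<inter> T"] iT v by blast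
    then have "ind (insert u (insert v (S \<inter> T)))" using ind_insert[of "insert v (S \<inter> T)" u] \<open>u < n\<close> iS u nuv by blast
    then obtain R where R: "insert u (insert v (S \<inter> T)) \<subseteq> R" "maximal R" using maximal_ext by blast
    have "card (S \<inter> T) < card (S \<inter> R)" using R(1) u v S(3) by (intro psubset_card_mono) auto
    then have 1: "card S = card R" using mx[of S R] S R unfolding P_def by auto
    have "card (S \<inter> T) < card (T \<inter> R)" using R(1) u v T(3) by (intro psubset_card_mono) auto
    then have "card T = card R" using mx[of T R] T R unfolding P_def by auto
    then show False using 1 ne by simp
  qed
  have nsub: "S - T \<noteq> {} \<and> T - S \<noteq> {}" if "maximal S" "maximal T" "card S \<noteq> card T" for S T
  proof -
    have "X = Y" if "maximal X" "maximal Y" "X \<subseteq> Y" for X Y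
      using that unfolding maximal_def ind_def by blast
    then show ?thesis using that by blast
  qed
  have small: "card X \<le> 2" if X: "\<And>x. x \<in> X \<Longrightarrow> ad v x" "\<And>x y. x \<in> X \<Longrightarrow> y \<in> X \<Longrightarrow> \<not> ad x y" for X v
  proof (rule ccontr)
    assume "\<not> ?thesis"
    then obtain Y where "Y \<subseteq> X" "card Y = 3" using obtain_subset_with_card_n[of 3 X] by auto
    then obtain x y z where "{x, y, z} \<subseteq> X" "x \<noteq> y" "x \<noteq> z" "y \<noteq> z" by (auto simp: card_3_iff)
    then show False using claw[of v x y z] X by auto
  qed
  have S0: "card (S - T) \<le> 2" "S - T \<noteq> {}" and T0: "card (T - S) \<le> 2" "T - S \<noteq> {}"
  proof -
    show "S - T \<noteq> {}" "T - S \<noteq> {}" using nsub S T ne by blast+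
    then obtain u v where "u \<in> S - T" "v \<in> T - S" by blast
    then show "card (S - T) \<le> 2" "card (T - S) \<le> 2"
      using small[of "S - T" v] small[of "T - S" u] join iS iT ad_sym by blast+
  qed
  have cs: "card S = card (S \<inter> T) + card (S - T)" "card T = card (S \<inter> T) + card (T - S)"
    using card_Int_Diff[of S T] card_Int_Diff[of T S] S T by (simp_all add: Int_commute)
  have "card (S - T) > 0" "card (T - S) > 0" using S0 T0 S T by (simp_all add: card_gt_0_iff)
  then have "card (S - T) = 1 \<and> card (T - S) = 2 \<or> card (S - T) = 2 \<and> card (T - S) = 1"
    using S0 T0 cs ne by linarith
  then show False
  proof
    assume a: "card (S - T) = 1 \<and> card (T - S) = 2"
    obtain s where s: "S - T = {s}" using a by (auto simp: card_1_singleton_iff)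
    obtain t1 t2 where t: "T - S = {t1, t2}" "t1 \<noteq> t2" using a by (auto simp: card_2_iff)
    have "ad s t1" "ad s t2" using join s t by auto
    then show False using path_witness[OF S(1) T(1) s t] nB by blast
  next
    assume a: "card (S - T) = 2 \<and> card (T - S) = 1"
    obtain s where s: "T - S = {s}" using a by (auto simp: card_1_singleton_iff)
    obtain t1 t2 where t: "S - T = {t1, t2}" "t1 \<noteq> t2" using a by (auto simp: card_2_iff)
    have "ad t1 s" "ad t2 s" using join s t by auto
    then have "ad s t1" "ad s t2" using ad_sym by blast+
    then show False using path_witness[OF T(1) S(1) s t] nB by blast
  qed
qed

text \<open>A witness for \<open>s\<close> prevents disjoint maximum sets around \<open>J\<close>
  and \<open>{s}\<close>, since the one around \<open>J\<close> avoids all neighbours of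
  \<open>s\<close> and could be enlarged by \<open>s\<close>. A witness for a path allows
  \<open>s\<close> to be exchanged for two vertices in a maximum set. Conversely, without path
  witnesses every maximal independent set is maximum, and without vertex witnesses an intersection
  can be shrunk vertex by vertex.\<close>

lemma W2_iff: "W2 {..<n} E \<longleftrightarrow> (\<forall>s<n. \<not> solvable {x. ad s x} {s}) \<and>
    (\<forall>s t1 t2. induced_path s t1 t2 \<longrightarrow> \<not> solvable (far s t1 t2) {s, t1, t2})"
    (is "_ \<longleftrightarrow> ?A \<and> ?B")
proof
  assume W: "W2 {..<n} E"
  have max: "ind S \<and> (\<forall>T. ind T \<longrightarrow> card T \<le> card S)" if "maximum_independent_set {..<n} E S" for S
    using that unfolding maximum_independent_set_def ind_eq by blast
  have W': "\<exists>S T. maximum_independent_set {..<n} E S \<and> maximum_independent_set {..<n} E T \<and> X \<subseteq> S \<and> Y \<subseteq> T \<and> S \<inter> T = {}"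
    if "ind X" "ind Y" "X \<inter> Y = {}" for X Y
    using W that unfolding W2_def ind_eq by blast
  have A: ?A
  proof (intro allI impI notI)
    fix s assume "s < n" "solvable {x. ad s x} {s}"
    then obtain J where J: "ind J" "s \<notin> J" "\<And>x. ad s x \<Longrightarrow> \<exists>j\<in>J. ad j x" unfolding solvable_def by blast
    have "ind {s}" using \<open>s < n\<close> ad_irrefl unfolding ind_def by auto
    then obtain S T where ST: "maximum_independent_set {..<n} E S" "J \<subseteq> S" "s \<in> T" "S \<inter> T = {}"
      using W'[of J "{s}"] J by auto
    have S: "ind S" "\<And>U. ind U \<Longrightarrow> card U \<le> card S" using max[OF ST(1)] by auto
    have "\<not> ad s x" if "x \<in> S" for x
    proof
      assume "ad s x"
      then obtain j where "j \<in> S" "ad j x" using J ST by blast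
      then show False using S that unfolding ind_def by blast
    qed
    then have "ind (insert s S)" using ind_insert S \<open>s < n\<close> by blast
    moreover have "s \<notin> S" using ST by blast
    ultimately show False using S(2)[of "insert s S"] ind_finite[OF S(1)] by simp
  qed
  have B: ?B
  proof (intro allI impI notI)
    fix s t1 t2 assume p: "induced_path s t1 t2" and "solvable (far s t1 t2) {s, t1, t2}"
    then obtain J where J: "ind J" "\<And>t. t \<in> {s, t1, t2} \<Longrightarrow> t \<notin> J" "\<And>t j. t \<in> {s, t1, t2} \<Longrightarrow> j \<in> J \<Longrightarrow> \<not> ad t j"
      "\<And>x. x \<in> far s t1 t2 \<Longrightarrow> \<exists>j\<in>J. ad j x" unfolding solvable_def by blast
    have lt: "s < n" "t1 < n" "t2 < n" using p ad_less unfolding induced_path_def by blast+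
    have "ind (insert s J)" using ind_insert J lt by blast
    then obtain S where S: "maximum_independent_set {..<n} E S" "insert s J \<subseteq> S"
      using W'[of "insert s J" "{}"] unfolding ind_def by auto
    have iS: "ind S" "\<And>U. ind U \<Longrightarrow> card U \<le> card S" using max[OF S(1)] by auto
    have no: "\<not> ad t y" if "t \<in> {t1, t2}" "y \<in> S - {s}" for t y
    proof
      assume a: "ad t y"
      have "\<not> ad s y" using iS that S unfolding ind_def by blast
      then have "y \<in> far s t1 t2" using a that unfolding far_def by auto
      then obtain j where "j \<in> J" "ad j y" using J(4) by blast
      then have "j \<in> S" using S(2) by blast
      then show False using iS(1) that(2) \<open>ad j y\<close> unfolding ind_def by blast
    qed
    have nt: "t1 \<notin> S" "t2 \<notin> S" using p S iS unfolding induced_path_def ind_def by blast+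
    have "ind (insert t1 (S - {s}))" using ind_insert[OF ind_subset[OF iS(1)], of "S - {s}" t1] lt no by blast
    then have "ind (insert t2 (insert t1 (S - {s})))"
      using ind_insert[of "insert t1 (S - {s})" t2] lt no p ad_sym unfolding induced_path_def by blast
    then have le: "card (insert t2 (insert t1 (S - {s}))) \<le> card S" using iS by blast
    have f: "finite S" using ind_finite iS by blast
    have "card (insert t2 (insert t1 (S - {s}))) = Suc (Suc (card (S - {s})))"
      using f nt p unfolding induced_path_def by auto
    moreover have "Suc (card (S - {s})) = card S" using card_Suc_Diff1[OF f, of s] S(2) by simp
    ultimately show False using le by simp
  qed
  show "?A \<and> ?B" using A B by blast
next
  assume AB: "?A \<and> ?B"
  have wc: "card S = card T" if "maximal S" "maximal T" for S T using well_covered[OF _ that] AB by blast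
  have maximum: "maximum_independent_set {..<n} E S" if S: "maximal S" for S
    unfolding maximum_independent_set_def ind_eq
  proof (intro conjI allI impI)
    show "ind S" using S unfolding maximal_def by blast
    fix U assume "ind U"
    then obtain U' where U: "U \<subseteq> U'" "maximal U'" using maximal_ext by blast
    then have "card U \<le> card U'" using ind_finite unfolding maximal_def by (intro card_mono) auto
    then show "card U \<le> card S" using wc[OF U(2) S] by simp
  qed
  have "\<exists>S T. maximum_independent_set {..<n} E S \<and> maximum_independent_set {..<n} E T \<and> X \<subseteq> S \<and> Y \<subseteq> T \<and> S \<inter> T = {}"
    if XY: "ind X" "ind Y" "X \<inter> Y = {}" for X Y
  proof -
    \<comment> \<open>Among the pairs of maximal sets around \<open>X\<close> and \<open>Y\<close>,
      one with smallest intersection is chosen.\<close>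
    define Q where "Q = (\<lambda>(S, T). maximal S \<and> maximal T \<and> X \<subseteq> S \<and> Y \<subseteq> T)"
    obtain S0 where "X \<subseteq> S0" "maximal S0" using maximal_ext[OF XY(1)] by blast
    moreover obtain T0 where "Y \<subseteq> T0" "maximal T0" using maximal_ext[OF XY(2)] by blast
    ultimately have "Q (S0, T0)" unfolding Q_def by simp
    then obtain p where p: "Q p" "\<And>q. Q q \<Longrightarrow> card (fst p \<inter> snd p) \<le> card (fst q \<inter> snd q)"
      using ex_has_least_nat[of Q "(S0, T0)" "\<lambda>p. card (fst p \<inter> snd p)"] by blast
    obtain S T where "p = (S, T)" by (cases p)
    then have P: "Q (S, T)" and mn: "\<And>S' T'. Q (S', T') \<Longrightarrow> card (S \<inter> T) \<le> card (S' \<inter> T')"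
      using p by force+
    \<comment> \<open>\<open>S - {s}\<close> is no witness for \<open>s\<close>, so it leaves some
      neighbour \<open>x\<close> of \<open>s\<close> undominated, and \<open>x\<close> can replace
      \<open>s\<close>. Since \<open>s\<close> lies in \<open>T\<close>, this \<open>x\<close> does
      not.\<close>
    have swap: "\<exists>S'. maximal S' \<and> S - {s} \<subseteq> S' \<and> card (S' \<inter> T) < card (S \<inter> T)"
      if S: "maximal S" and T: "maximal T" and s: "s \<in> S \<inter> T" for S T s
    proof -
      have iS: "ind S" "ind T" "finite S" using S T ind_finite unfolding maximal_def by auto
      have sn: "s < n" using s iS unfolding ind_def by auto
      let ?J = "S - {s}"
      have J: "ind ?J" "\<forall>t\<in>{s}. t \<notin> ?J \<and> (\<forall>j\<in>?J. \<not> ad t j)" using iS s ind_subset[OF iS(1), of ?J] unfolding ind_def by auto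
      have "\<not> solvable {x. ad s x} {s}" using AB sn by blast
      then have "\<not> (\<forall>x\<in>{x. ad s x}. \<exists>j\<in>?J. ad j x)" unfolding solvable_def using J by blast
      then obtain x where x: "ad s x" "\<And>j. j \<in> ?J \<Longrightarrow> \<not> ad j x" by blast
      have xn: "x < n" "x \<notin> T" "x \<notin> S" using x(1) ad_less s iS unfolding ind_def by auto
      have "ind (insert x ?J)" using ind_insert[OF J(1) xn(1)] x(2) ad_sym by blast
      then obtain S' where S': "insert x ?J \<subseteq> S'" "maximal S'" using maximal_ext by blast
      have fS': "finite S'" using S' ind_finite unfolding maximal_def by blast
      have "card (insert x ?J) = card S" using card_Suc_Diff1[OF iS(3), of s] s xn iS(3) by simp
      then have "insert x ?J = S'" using S' wc[OF S'(2) S] fS' card_subset_eq[of S' "insert x ?J"] by simp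
      then have "S' \<inter> T = S \<inter> T - {s}" using xn by blast
      then have "card (S' \<inter> T) < card (S \<inter> T)" using s iS(3) by (metis card_Diff1_less finite_Int)
      then show ?thesis using S' by blast
    qed
    have "S \<inter> T = {}"
    proof (rule ccontr)
      assume "S \<inter> T \<noteq> {}"
      then obtain s where s: "s \<in> S \<inter> T" by blast
      show False
      proof (cases "s \<in> X")
        case False
        obtain S' where "maximal S'" "S - {s} \<subseteq> S'" "card (S' \<inter> T) < card (S \<inter> T)"
          using swap[of S T s] P s unfolding Q_def by auto
        then show False using mn[of S' T] P False unfolding Q_def by auto
      next
        case True
        then have sY: "s \<notin> Y" using XY by blast
        obtain T' where "maximal T'" "T - {s} \<subseteq> T'" "card (T' \<inter> S) < card (T \<inter> S)"
          using swap[of T S s] P s unfolding Q_def by auto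
        then show False using mn[of S T'] P sY unfolding Q_def by (auto simp: Int_commute)
      qed
    qed
    then show ?thesis using maximum P unfolding Q_def by blast
  qed
  then show "W2 {..<n} E" unfolding W2_def ind_eq by blast
qed

definition cands :: "nat set \<Rightarrow> nat set \<Rightarrow> nat set" where
  "cands D T = {w. w \<notin> T \<and> (\<forall>t\<in>T. \<not> ad t w) \<and> (\<exists>x\<in>D. ad w x)}"

text \<open>Both covering properties are instances of claw-freeness. For \<open>shared\<close>, the
  claw would have centre \<open>x\<close> and leaves \<open>v\<close>, \<open>w\<close> and a
  neighbour of \<open>x\<close> in \<open>T\<close>; for \<open>split\<close>, centre
  \<open>w\<close> and leaves \<open>v\<close>, \<open>v'\<close>, \<open>x\<close>.\<close>

lemma cands_instance:
  assumes D: "\<And>x. x \<in> D \<Longrightarrow> \<exists>t\<in>T. ad t x"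
  shows "cover_instance (cands D T) ad (\<lambda>w. {x \<in> D. ad w x})"
proof
  have "cands D T \<subseteq> {..<n}" unfolding cands_def using ad_less by blast
  then show "finite (cands D T)" using finite_subset by blast
  show "ad w v" if "ad v w" for v w using that ad_sym by blast
  show "\<not> ad v v" for v by (rule ad_irrefl)
  show "{x \<in> D. ad w x} \<noteq> {}" if "w \<in> cands D T" for w using that unfolding cands_def by blast
  show "v = w \<or> ad v w" if vw: "v \<in> cands D T" "w \<in> cands D T" "x \<in> {x \<in> D. ad v x}" "x \<in> {x \<in> D. ad w x}" for v w x
  proof -
    obtain t where t: "t \<in> T" "ad t x" using D vw by blast
    then have "\<not> ad t v" "\<not> ad t w" "t \<noteq> v" "t \<noteq> w" using vw unfolding cands_def by auto
    moreover have "ad x t" "ad x v" "ad x w" using t vw ad_sym by blast+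
    ultimately show ?thesis using claw[of x t v w] by blast
  qed
  show "{x \<in> D. ad w x} \<subseteq> {x \<in> D. ad v x} \<union> {x \<in> D. ad v' x}"
    if w: "w \<in> cands D T" "v \<in> cands D T" "v' \<in> cands D T" "ad w v" "ad w v'" "v \<noteq> v'" "\<not> ad v v'" for w v v'
  proof
    fix x assume x: "x \<in> {x \<in> D. ad w x}"
    then obtain t where t: "t \<in> T" "ad t x" using D by blast
    then have "v \<noteq> x" "v' \<noteq> x" using w t unfolding cands_def by auto
    then show "x \<in> {x \<in> D. ad v x} \<union> {x \<in> D. ad v' x}" using claw[of w v v' x] w x by blast
  qed
qed

lemma solvable_iff:
  assumes D: "\<And>x. x \<in> D \<Longrightarrow> \<exists>t\<in>T. ad t x"
  shows "solvable D T \<longleftrightarrow> (\<exists>J. cover_instance.indep (cands D T) ad J \<and> D \<subseteq> (\<Union>j\<in>J. {x \<in> D. ad j x}))"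
proof -
  interpret cover_instance "cands D T" ad "\<lambda>w. {x \<in> D. ad w x}" using cands_instance[OF D] .
  show ?thesis
  proof
    assume "solvable D T"
    then obtain J where J: "ind J" "\<forall>t\<in>T. t \<notin> J \<and> (\<forall>j\<in>J. \<not> ad t j)" "\<forall>x\<in>D. \<exists>j\<in>J. ad j x"
      unfolding solvable_def by blast
    have "indep (J \<inter> cands D T)" using J(1) unfolding indep_def ind_def by blast
    moreover have "D \<subseteq> (\<Union>j\<in>J \<inter> cands D T. {x \<in> D. ad j x})"
    proof
      fix x assume "x \<in> D"
      moreover obtain j where "j \<in> J" "ad j x" using J \<open>x \<in> D\<close> by blast
      moreover have "j \<in> cands D T" unfolding cands_def using J calculation by auto
      ultimately show "x \<in> (\<Union>j\<in>J \<inter> cands D T. {x \<in> D. ad j x})" by blast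
    qed
    ultimately show "\<exists>J. indep J \<and> D \<subseteq> (\<Union>j\<in>J. {x \<in> D. ad j x})" by blast
  next
    assume "\<exists>J. indep J \<and> D \<subseteq> (\<Union>j\<in>J. {x \<in> D. ad j x})"
    then obtain J where J: "indep J" "D \<subseteq> (\<Union>j\<in>J. {x \<in> D. ad j x})" by blast
    have JI: "J \<subseteq> cands D T" "\<forall>v\<in>J. \<forall>w\<in>J. \<not> ad v w" using J(1) unfolding indep_def by blast+
    then have "J \<subseteq> {..<n}" using ad_less unfolding cands_def by blast
    then have "ind J" using JI unfolding ind_def by blast
    moreover have "\<forall>t\<in>T. t \<notin> J \<and> (\<forall>j\<in>J. \<not> ad t j)" using JI(1) unfolding cands_def by blast
    moreover have "\<forall>x\<in>D. \<exists>j\<in>J. ad j x" using J(2) by blast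
    ultimately show "solvable D T" unfolding solvable_def by blast
  qed
qed

section \<open>Degrees and induced paths in a claw-free graph\<close>

definition nbh :: "nat \<Rightarrow> nat set" where "nbh v = {u. ad v u}"

lemma nbh: "nbh v \<subseteq> {..<n}" "finite (nbh v)"
proof -
  show "nbh v \<subseteq> {..<n}" unfolding nbh_def using ad_less by blast
  then show "finite (nbh v)" using finite_subset by blast
qed

lemma finite_E: "finite E"
proof -
  have "E \<subseteq> Pow {..<n}" using simple unfolding simple_graph_def by blast
  then show ?thesis using finite_subset by blast
qed

lemma pairs_le:
  assumes "finite S" "\<And>u v. (u, v) \<in> S \<Longrightarrow> ad u v"
  shows "card S \<le> 2 * card E"
proof -
  let ?P = "\<lambda>e. {(u, v). e = {u, v}} \<inter> S"
  have "S \<subseteq> (\<Union>e\<in>E. ?P e)" using assms by auto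
  then have "card S \<le> card (\<Union>e\<in>E. ?P e)" using finite_E assms by (intro card_mono) auto
  also have "\<dots> \<le> (\<Sum>e\<in>E. card (?P e))" using finite_E by (rule card_UN_le)
  also have "\<dots> \<le> (\<Sum>e\<in>E. 2)"
  proof (rule sum_mono)
    fix e assume "e \<in> E"
    then have "card e = 2" using simple unfolding simple_graph_def by blast
    then obtain x y where "e = {x, y}" by (auto simp: card_2_iff)
    then have "?P e \<subseteq> {(x, y), (y, x)}" by (auto simp: doubleton_eq_iff)
    then have "card (?P e) \<le> card {(x, y), (y, x)}" by (intro card_mono) auto
    also have "\<dots> \<le> 2" by (cases "x = y") auto
    finally show "card (?P e) \<le> 2" .
  qed
  finally show ?thesis by simp
qed

lemma degree_sum: "(\<Sum>v<n. card (nbh v)) \<le> 2 * card E"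
proof -
  have "(\<Sum>v<n. card (nbh v)) = card (SIGMA v:{..<n}. nbh v)" using nbh by simp
  also have "\<dots> \<le> 2 * card E" using nbh by (intro pairs_le) (auto simp: nbh_def)
  finally show ?thesis .
qed

text \<open>The non-neighbours of \<open>u\<close> inside the neighbourhood of \<open>v\<close> form a clique: either some such clique is
  large, or all degrees inside the neighbourhood are.\<close>

lemma degree_square: "(card (nbh v))\<^sup>2 \<le> 18 * card E"
proof -
  let ?N = "nbh v" let ?d = "card ?N"
  define X where "X u = {x \<in> ?N. x \<noteq> u \<and> \<not> ad u x}" for u
  have fin: "finite (X u)" for u unfolding X_def using nbh by simp
  have clique: "ad x y" if "u \<in> ?N" "x \<in> X u" "y \<in> X u" "x \<noteq> y" for u x y
    using claw[of v u x y] that unfolding X_def nbh_def by auto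
  have main: "(?d - 1)\<^sup>2 \<le> 8 * card E"
  proof (cases "\<exists>u\<in>?N. ?d - 1 \<le> 2 * card (X u)")
    case True
    then obtain u where u: "u \<in> ?N" "?d - 1 \<le> 2 * card (X u)" by blast
    \<comment> \<open>The pairs from \<open>v\<close> into the clique and the ordered pairs inside
      it add up to \<open>k + k * (k - 1)\<close>, the exact square of the clique size
      \<open>k\<close>.\<close>
    let ?S = "(\<lambda>x. (v, x)) ` X u \<union> {(x, y). x \<in> X u \<and> y \<in> X u \<and> x \<noteq> y}"
    have sub: "{(x, y). x \<in> X u \<and> y \<in> X u \<and> x \<noteq> y} = X u \<times> X u - (\<lambda>x. (x, x)) ` X u" by auto
    have c1: "card {(x, y). x \<in> X u \<and> y \<in> X u \<and> x \<noteq> y} = card (X u) * card (X u) - card (X u)"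
      unfolding sub by (subst card_Diff_subset) (auto simp: fin card_cartesian_product card_image inj_on_def)
    have c2: "card ((\<lambda>x. (v, x)) ` X u) = card (X u)" by (simp add: card_image inj_on_def)
    have fS: "finite {(x, y). x \<in> X u \<and> y \<in> X u \<and> x \<noteq> y}" unfolding sub using fin by auto
    have vX: "v \<notin> X u" unfolding X_def nbh_def using ad_irrefl by auto
    have "card ?S = card (X u) + (card (X u) * card (X u) - card (X u))"
      using vX by (subst card_Un_disjoint) (auto simp: fin fS c1 c2)
    also have "\<dots> = (card (X u))\<^sup>2" by (cases "card (X u)") (auto simp: power2_eq_square)
    finally have "card ?S = (card (X u))\<^sup>2" .
    have "(card (X u))\<^sup>2 \<le> 2 * card E"
    proof -
      have "ad v x" if "x \<in> X u" for x using that unfolding X_def nbh_def by simp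
      then have "card ?S \<le> 2 * card E" using fS fin clique[OF u(1)] by (intro pairs_le) auto
      then show ?thesis using \<open>card ?S = (card (X u))\<^sup>2\<close> by simp
    qed
    moreover have "(?d - 1)\<^sup>2 \<le> (2 * card (X u))\<^sup>2" using u by (intro power_mono) auto
    ultimately show ?thesis by (simp add: power2_eq_square)
  next
    case False
    let ?S = "SIGMA u:?N. {x \<in> ?N. ad u x}"
    \<comment> \<open>All sets of non-neighbours are small, so each vertex is adjacent to about half
      of the neighbourhood.\<close>
    have deg: "?d - 1 \<le> 2 * card {x \<in> ?N. ad u x}" if u: "u \<in> ?N" for u
    proof -
      define Y where "Y = X u \<union> {x \<in> ?N. ad u x}"
      have N: "?N = insert u Y" unfolding X_def Y_def using u by auto
      have "finite Y" unfolding Y_def using fin nbh by simp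
      then have "card (insert u Y) \<le> Suc (card Y)" by (simp add: card_insert_if)
      then have "?d \<le> Suc (card (X u \<union> {x \<in> ?N. ad u x}))" using N Y_def by metis
      also have "\<dots> \<le> Suc (card (X u) + card {x \<in> ?N. ad u x})" using card_Un_le by simp
      finally show ?thesis using False u by fastforce
    qed
    have "?d * (?d - 1) \<le> 2 * card ?S"
    proof -
      have "?d * (?d - 1) = (\<Sum>u\<in>?N. ?d - 1)" by simp
      also have "\<dots> \<le> (\<Sum>u\<in>?N. 2 * card {x \<in> ?N. ad u x})" using deg by (rule sum_mono)
      also have "\<dots> = 2 * card ?S" using nbh by (simp add: sum_distrib_left)
      finally show ?thesis .
    qed
    moreover have "card ?S \<le> 2 * card E" using nbh by (intro pairs_le) auto
    moreover have "(?d - 1)\<^sup>2 \<le> ?d * (?d - 1)" by (simp add: power2_eq_square)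
    ultimately show ?thesis by linarith
  qed
  show ?thesis
  proof (cases "?d = 0")
    case False
    then obtain u where "u \<in> ?N" using nbh by (auto simp: card_eq_0_iff)
    then have "E \<noteq> {}" unfolding nbh_def by auto
    then have m: "card E \<ge> 1" using finite_E by (simp add: Suc_leI card_gt_0_iff)
    obtain e where e: "?d = Suc e" using False by (cases ?d) auto
    have "e\<^sup>2 \<le> 8 * card E" using main e by simp
    \<comment> \<open>With \<open>e\<^sup>2\<close> at most eight times the number of edges,
      doubling gives sixteen; the summand \<open>2\<close> is paid by the existence of an edge,
      whence the factor \<open>18\<close>.\<close>
    moreover have "(Suc e)\<^sup>2 \<le> 2 * e\<^sup>2 + 2"
    proof -
      have "2 * e \<le> e\<^sup>2 + 1" by (cases e) (auto simp: power2_eq_square)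
      then show ?thesis by (simp add: power2_eq_square)
    qed
    ultimately show ?thesis unfolding e using m by linarith
  qed simp
qed

text \<open>One factor \<open>card (nbh s)\<close> is bounded by \<open>degree_square\<close>, the
  other summed by \<open>degree_sum\<close>. The constant is \<open>2 * sqrt 18\<close>, rounded up
  to \<open>2 * sqrt 25\<close>.\<close>

lemma path_count: "real (\<Sum>s<n. (card (nbh s))\<^sup>2) \<le> 10 * real (card E) powr (3/2)"
proof -
  let ?m = "real (card E)"
  have d: "real (card (nbh s)) \<le> sqrt (18 * ?m)" for s
  proof (rule real_le_rsqrt)
    show "(real (card (nbh s)))\<^sup>2 \<le> 18 * ?m" using degree_square[of s] by (metis of_nat_le_iff of_nat_mult of_nat_numeral of_nat_power)
  qed
  have "real (\<Sum>s<n. (card (nbh s))\<^sup>2) = (\<Sum>s<n. real (card (nbh s)) * real (card (nbh s)))"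
    by (simp add: power2_eq_square)
  also have "\<dots> \<le> (\<Sum>s<n. sqrt (18 * ?m) * real (card (nbh s)))"
    using d by (intro sum_mono mult_right_mono) auto
  also have "\<dots> = sqrt (18 * ?m) * real (\<Sum>s<n. card (nbh s))" by (simp add: sum_distrib_left)
  also have "\<dots> \<le> sqrt (18 * ?m) * real (2 * card E)" using degree_sum by (intro mult_left_mono of_nat_mono) auto
  also have "\<dots> = 2 * sqrt 18 * (sqrt ?m * ?m)" by (simp add: real_sqrt_mult)
  also have "sqrt ?m * ?m = ?m powr (3/2)"
  proof (cases "?m = 0")
    case False
    then have "?m powr (3/2) = ?m powr (1/2 + 1)" by simp
    also have "\<dots> = ?m powr (1/2) * ?m powr 1" by (rule powr_add)
    finally show ?thesis by (simp add: powr_half_sqrt)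
  qed simp
  also have "2 * sqrt 18 * ?m powr (3/2) \<le> 10 * ?m powr (3/2)"
  proof (intro mult_right_mono)
    have "sqrt 18 \<le> sqrt 25" by (rule real_sqrt_le_mono) simp
    then show "2 * sqrt 18 \<le> 10" by simp
  qed simp
  finally show ?thesis .
qed

end

section \<open>The algorithm\<close>

locale phase_tables = cover_phase W adj A I x0 for W :: "nat set" and adj and A and I and x0 +
  fixes n L :: nat and D :: "nat set"
  assumes W_less: "W \<subseteq> {..<n}" and adj_less: "adj u v \<Longrightarrow> u < n \<and> v < n"
    and A_eq: "A w = {x \<in> D. adj w x}" and L: "4 * n + 8 \<le> L" and x0_D: "x0 \<in> D"
begin

definition nbT :: "nat \<Rightarrow> nat \<Rightarrow> nat" where
  "nbT w b = (if b = 0 then least L (\<lambda>i. i \<in> I \<and> adj w i)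
     else least L (\<lambda>i. i \<in> I \<and> adj w i \<and> i \<noteq> least L (\<lambda>i. i \<in> I \<and> adj w i)))"

text \<open>The codes: \<open>0\<close> not an outside candidate, otherwise one more than the number
  of neighbours in \<open>I\<close>.\<close>

definition tpT :: "nat \<Rightarrow> nat" where
  "tpT w = (if w \<notin> W \<or> w \<in> I then 0 else if nbT w 0 = L then 1 else if nbT w 1 = L then 2 else 3)"

definition fullT :: "nat \<Rightarrow> nat \<Rightarrow> bool" where
  "fullT w b \<longleftrightarrow> (\<forall>x<L. x \<in> D \<and> adj (nbT w b) x \<longrightarrow> adj w x)"

definition stT :: "nat \<Rightarrow> nat \<Rightarrow> bool" where
  "stT w b \<longleftrightarrow> (\<exists>j<L. tpT j = 2 \<and> adj j x0 \<and> nbT j 0 = nbT w b \<and> \<not> adj j w)"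

definition fiT :: "nat \<Rightarrow> nat \<Rightarrow> bool" where
  "fiT w b \<longleftrightarrow> fullT w b \<or> (\<exists>v<L. tpT v = 2 \<and> \<not> adj v x0 \<and> nbT v 0 = nbT w b \<and> \<not> adj v w)"

text \<open>A partner of \<open>w\<close> for \<open>perp\<close>. Storing it separately lets
  \<open>rpT\<close> be computed with one search per vertex instead of two nested ones.\<close>

definition qT :: "nat \<Rightarrow> nat \<Rightarrow> nat" where
  "qT w b = least L (\<lambda>v. tpT v = 3 \<and> \<not> adj v w \<and> v \<noteq> w \<and>
     (nbT v 0 = nbT w b \<and> nbT v 1 \<noteq> nbT w (1 - b) \<or> nbT v 1 = nbT w b \<and> nbT v 0 \<noteq> nbT w (1 - b)))"

definition rpT :: "nat \<Rightarrow> nat" where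
  "rpT i = least L (\<lambda>w. tpT w = 3 \<and> (nbT w 0 = i \<and> qT w 0 < L \<or> nbT w 1 = i \<and> qT w 1 < L))"

definition rqT :: "nat \<Rightarrow> nat" where
  "rqT i = (if nbT (rpT i) 0 = i then qT (rpT i) 0 else qT (rpT i) 1)"

definition sameT :: "nat \<Rightarrow> nat \<Rightarrow> nat \<Rightarrow> bool" where
  "sameT w v i \<longleftrightarrow> (\<forall>x<L. x \<in> D \<and> adj i x \<longrightarrow> adj w x = adj v x)"

definition clT :: "nat \<Rightarrow> nat \<Rightarrow> nat" where
  "clT w b = (let i = nbT w b in if tpT w \<noteq> 3 then 2
     else if rpT i < L then if sameT w (rpT i) i then 0 else if sameT w (rqT i) i then 1 else 2
     else if stT w b \<or> fiT w b then 1 else 2)"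

definition rootT :: "nat \<Rightarrow> bool" where
  "rootT e \<longleftrightarrow> e < 2 * n \<and> (\<exists>w<L. clT w 0 < 2 \<and> mate n e = node n (nbT w 0) (clT w 0) \<and> stT w 0 \<or>
     clT w 1 < 2 \<and> mate n e = node n (nbT w 1) (clT w 1) \<and> stT w 1)"

definition finT :: "nat \<Rightarrow> bool" where
  "finT e \<longleftrightarrow> e < 2 * n \<and> (\<exists>w<L. clT w 0 < 2 \<and> mate n e = node n (nbT w 0) (clT w 0) \<and> fiT w 0 \<or>
     clT w 1 < 2 \<and> mate n e = node n (nbT w 1) (clT w 1) \<and> fiT w 1)"

text \<open>The list of edges with their tails; \<open>L\<close> marks an absent one. A vertex
  \<open>w\<close> of type 3 gives the entry \<open>w\<close> in one direction and
  \<open>w + n\<close> in the other. The entries from \<open>2 * n\<close> on are edges at the root,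
  listed only as leaving it.\<close>

definition XT :: "nat \<Rightarrow> nat" where
  "XT k = (if k < n then if clT k 0 < 2 \<and> clT k 1 < 2 then node n (nbT k 0) (clT k 0) else L
     else if k < 2 * n then if clT (k - n) 0 < 2 \<and> clT (k - n) 1 < 2 then node n (nbT (k - n) 1) (clT (k - n) 1) else L
     else if rootT (k - 2 * n) then 2 * n else L)"

definition YT :: "nat \<Rightarrow> nat" where
  "YT k = (if k < n then node n (nbT k 1) (clT k 1)
     else if k < 2 * n then node n (nbT (k - n) 0) (clT (k - n) 0) else k - 2 * n)"

text \<open>Whether the vertex realising the edge may end a path at the head of the edge.\<close>

definition FXT :: "nat \<Rightarrow> bool" where
  "FXT k \<longleftrightarrow> (if k < n then fiT k 1 else fiT (k - n) 0)"

lemma n_L: "n < L" "2 * n < L" "4 * n < L"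
  using L by auto

lemma W_L: "w \<in> W \<Longrightarrow> w < n" "w \<in> W \<Longrightarrow> w < L"
  using W_less n_L by auto

lemma I_L: "i \<in> I \<Longrightarrow> i < n" "i \<in> I \<Longrightarrow> i < L"
  using I_W W_L by auto

lemma x0_A: "x0 \<in> A w \<longleftrightarrow> adj w x0"
  using A_eq x0_D by auto

lemma nbT_0: "nbT w 0 < L \<longleftrightarrow> (\<exists>i\<in>I. adj w i)" "nbT w 0 < L \<Longrightarrow> nbT w 0 \<in> I \<and> adj w (nbT w 0)"
proof -
  have e: "nbT w 0 = least L (\<lambda>i. i \<in> I \<and> adj w i)" unfolding nbT_def by simp
  show "nbT w 0 < L \<longleftrightarrow> (\<exists>i\<in>I. adj w i)" unfolding e least_less using I_L(2) by blast
  show "nbT w 0 < L \<Longrightarrow> nbT w 0 \<in> I \<and> adj w (nbT w 0)"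
    using least_prop[of L "\<lambda>i. i \<in> I \<and> adj w i"] unfolding nbT_def by simp
qed

lemma nbT_1: "nbT w 1 < L \<longleftrightarrow> (\<exists>i\<in>I. adj w i \<and> i \<noteq> nbT w 0)"
  "nbT w 1 < L \<Longrightarrow> nbT w 1 \<in> I \<and> adj w (nbT w 1) \<and> nbT w 1 \<noteq> nbT w 0"
proof -
  have e: "nbT w 1 = least L (\<lambda>i. i \<in> I \<and> adj w i \<and> i \<noteq> nbT w 0)" unfolding nbT_def by simp
  show "nbT w 1 < L \<longleftrightarrow> (\<exists>i\<in>I. adj w i \<and> i \<noteq> nbT w 0)" unfolding e least_less using I_L(2) by blast
  show "nbT w 1 < L \<Longrightarrow> nbT w 1 \<in> I \<and> adj w (nbT w 1) \<and> nbT w 1 \<noteq> nbT w 0"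
    using least_prop[of L "\<lambda>i. i \<in> I \<and> adj w i \<and> i \<noteq> nbT w 0"] unfolding e by simp
qed

lemma nbT_le: "nbT w b \<le> L"
  unfolding nbT_def using least_le by simp

lemma tpT_1: "tpT w = 1 \<longleftrightarrow> w \<in> W \<and> w \<notin> I \<and> (\<forall>i\<in>I. \<not> adj w i)"
  using nbT_0(1)[of w] nbT_le[of w 0] unfolding tpT_def by auto

lemma tpT_2: "single w i \<longleftrightarrow> tpT w = 2 \<and> nbT w 0 = i"
proof
  assume s: "single w i"
  note S = singleD[OF s]
  have "nbT w 0 < L" using nbT_0(1) S by blast
  then have "nbT w 0 = i" using nbT_0(2) S(8) by blast
  moreover have "\<not> nbT w 1 < L" using nbT_1(2) S(8) calculation by blast
  ultimately show "tpT w = 2 \<and> nbT w 0 = i" using S(1,6) nbT_le[of w 1] \<open>nbT w 0 < L\<close> unfolding tpT_def by simp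
next
  assume t: "tpT w = 2 \<and> nbT w 0 = i"
  then have w: "w \<in> W" "nbT w 0 < L" "nbT w 1 = L" using nbT_le[of w 0] unfolding tpT_def by (auto split: if_splits)
  have "i \<in> I" "adj w i" using nbT_0(2)[OF w(2)] t by auto
  moreover have "j = i" if "j \<in> I" "adj w j" for j using nbT_1(1)[of w] w(3) t that by auto
  ultimately have "{j \<in> I. adj w j} = {i}" by blast
  then show "single w i" unfolding single_def using w by simp
qed

lemma tpT_3: "tpT w = 3 \<Longrightarrow> mid w (nbT w 0) (nbT w 1)"
proof -
  assume t: "tpT w = 3"
  then have w: "w \<in> W" "nbT w 0 < L" "nbT w 1 < L" using nbT_le[of w 0] nbT_le[of w 1] unfolding tpT_def by (auto split: if_splits)
  have 1: "nbT w 0 \<in> I" "adj w (nbT w 0)" "nbT w 1 \<in> I" "adj w (nbT w 1)" "nbT w 1 \<noteq> nbT w 0"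
    using nbT_0(2)[OF w(2)] nbT_1(2)[OF w(3)] by auto
  have "j = nbT w 0 \<or> j = nbT w 1" if "j \<in> I" "adj w j" for j
    using no_three[OF indep_I w(1) that(1) 1(1) 1(3)] that 1 by metis
  then have "{j \<in> I. adj w j} = {nbT w 0, nbT w 1}" using 1 by blast
  then show ?thesis unfolding mid_def using w 1 by simp
qed

lemma mid_tpT: "mid w i u \<longleftrightarrow> tpT w = 3 \<and> (i = nbT w 0 \<and> u = nbT w 1 \<or> i = nbT w 1 \<and> u = nbT w 0)"
proof
  assume m: "mid w i u"
  note M = midD[OF m]
  have 0: "nbT w 0 < L" using nbT_0(1) M by blast
  have "\<exists>j\<in>I. adj w j \<and> j \<noteq> nbT w 0" using M by metis
  then have 1: "nbT w 1 < L" using nbT_1(1) by blast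
  have "tpT w = 3" using M 0 1 unfolding tpT_def by auto
  moreover have "nbT w 0 = i \<or> nbT w 0 = u" "nbT w 1 = i \<or> nbT w 1 = u" "nbT w 1 \<noteq> nbT w 0"
    using nbT_0(2)[OF 0] nbT_1(2)[OF 1] M(14) by blast+
  ultimately show "tpT w = 3 \<and> (i = nbT w 0 \<and> u = nbT w 1 \<or> i = nbT w 1 \<and> u = nbT w 0)" by auto
next
  assume "tpT w = 3 \<and> (i = nbT w 0 \<and> u = nbT w 1 \<or> i = nbT w 1 \<and> u = nbT w 0)"
  then show "mid w i u" using tpT_3[of w] mid_sym by auto
qed

lemma tpT_W: "tpT w = 2 \<Longrightarrow> w < n" "tpT w = 3 \<Longrightarrow> w < n" "tpT w = 2 \<Longrightarrow> w < L" "tpT w = 3 \<Longrightarrow> w < L"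
  using W_L unfolding tpT_def by (auto split: if_splits)

lemma A_sub: "A i \<subseteq> A w \<longleftrightarrow> (\<forall>x<L. x \<in> D \<and> adj i x \<longrightarrow> adj w x)"
proof -
  have "x < L" if "adj i x" for x using adj_less[OF that] n_L by simp
  then show ?thesis unfolding A_eq by blast
qed

lemma fullT: "fullT w b \<longleftrightarrow> A (nbT w b) \<subseteq> A w"
  unfolding fullT_def A_sub ..

lemma stT: "stT w b \<longleftrightarrow> st w (nbT w b)"
  unfolding stT_def st_def tpT_2 x0_A using tpT_W by blast

lemma fiT: "fiT w b \<longleftrightarrow> fin w (nbT w b)"
  unfolding fiT_def fin_def tpT_2 x0_A fullT using tpT_W by blast

lemma sameT: "sameT w v i \<longleftrightarrow> tr w i = tr v i"
proof -
  have "x < L" if "adj i x" for x using adj_less[OF that] n_L by simp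
  then show ?thesis unfolding A_eq sameT_def by blast
qed

lemma perp_tpT: "b < 2 \<Longrightarrow> tpT w = 3 \<Longrightarrow> perp (nbT w b) w v \<longleftrightarrow> tpT v = 3 \<and> \<not> adj v w \<and> v \<noteq> w \<and>
     (nbT v 0 = nbT w b \<and> nbT v 1 \<noteq> nbT w (1 - b) \<or> nbT v 1 = nbT w b \<and> nbT v 0 \<noteq> nbT w (1 - b))"
proof -
  assume b: "b < 2" and w: "tpT w = 3"
  have b': "b = 0 \<or> b = 1" using b by auto
  have ne: "nbT w 0 \<noteq> nbT w 1" using tpT_3[OF w] midD(11) by blast
  have 1: "mid w (nbT w b) u \<longleftrightarrow> u = nbT w (1 - b)" for u
    using b' ne w unfolding mid_tpT by auto
  show ?thesis unfolding perp_def 1 using mid_tpT[of v "nbT w b"] adj_sym by metis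
qed

lemma qT: "b < 2 \<Longrightarrow> tpT w = 3 \<Longrightarrow> qT w b < L \<longleftrightarrow> (\<exists>v. perp (nbT w b) w v)"
  "b < 2 \<Longrightarrow> tpT w = 3 \<Longrightarrow> qT w b < L \<Longrightarrow> perp (nbT w b) w (qT w b)"
proof -
  assume b: "b < 2" "tpT w = 3"
  have e: "qT w b = least L (\<lambda>v. perp (nbT w b) w v)" unfolding qT_def perp_tpT[OF b] ..
  have "v < L" if "perp (nbT w b) w v" for v using that tpT_W unfolding perp_tpT[OF b] by blast
  then show "qT w b < L \<longleftrightarrow> (\<exists>v. perp (nbT w b) w v)" unfolding e least_less by blast
  show "qT w b < L \<Longrightarrow> perp (nbT w b) w (qT w b)" using least_prop[of L "\<lambda>v. perp (nbT w b) w v"] unfolding e .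
qed

lemma rpT: "rpT i < L \<longleftrightarrow> (\<exists>w v. perp i w v)" "rpT i < L \<Longrightarrow> perp i (rpT i) (rqT i)"
proof -
  let ?P = "\<lambda>w. tpT w = 3 \<and> (nbT w 0 = i \<and> qT w 0 < L \<or> nbT w 1 = i \<and> qT w 1 < L)"
  have P: "?P w" if p: "perp i w v" for w v
  proof -
    have t: "tpT w = 3" "i = nbT w 0 \<or> i = nbT w 1" using p mid_tpT unfolding perp_def by blast+
    then show ?thesis using qT(1)[of 0 w] qT(1)[of 1 w] p by auto
  qed
  have 2: "perp i (rpT i) (rqT i)" if "rpT i < L"
  proof -
    have *: "?P (rpT i)" using least_prop[of L ?P] that unfolding rpT_def by blast
    then have ne: "nbT (rpT i) 0 \<noteq> nbT (rpT i) 1" using tpT_3 midD(11) by blast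
    show ?thesis
    proof (cases "nbT (rpT i) 0 = i")
      case True
      then show ?thesis using * ne qT(2)[of 0 "rpT i"] unfolding rqT_def by auto
    next
      case False
      then show ?thesis using * ne qT(2)[of 1 "rpT i"] unfolding rqT_def by auto
    qed
  qed
  then show "rpT i < L \<Longrightarrow> perp i (rpT i) (rqT i)" .
  show "rpT i < L \<longleftrightarrow> (\<exists>w v. perp i w v)"
  proof
    show "rpT i < L \<Longrightarrow> \<exists>w v. perp i w v" using 2 by blast
    assume "\<exists>w v. perp i w v"
    then obtain w where "?P w" using P by blast
    then show "rpT i < L" unfolding rpT_def least_less using tpT_W by blast
  qed
qed

end

section \<open>Agreement of the tables with the node graph\<close>

locale stuck_tables = phase_tables +
  assumes no1: "\<not> (\<exists>w. tpT w = 1 \<and> adj w x0)"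
    and no2: "\<not> (\<exists>w. tpT w = 2 \<and> adj w x0 \<and> fullT w 0)"
    and no3: "\<not> (\<exists>w v. tpT w = 2 \<and> adj w x0 \<and> tpT v = 2 \<and> \<not> adj v x0 \<and> nbT v 0 = nbT w 0 \<and> \<not> adj v w)"
begin

sublocale cover_nodes W adj A I x0 "\<lambda>i. rpT i < L" rpT rqT n
proof
  show "i \<in> I \<Longrightarrow> rpT i < L \<Longrightarrow> perp i (rpT i) (rqT i)" for i using rpT(2) by blast
  show "perp i w v \<Longrightarrow> rpT i < L" for i w v using rpT(1) by blast
  show "\<exists>i\<in>I. adj w i" if "w \<in> W" "x0 \<in> A w" for w
  proof (rule ccontr)
    assume "\<not> ?thesis"
    moreover have "w \<notin> I" using that x0_uncovered by blast
    ultimately show False using no1 tpT_1 that x0_A by blast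
  qed
  show "\<not> A i \<subseteq> A j" if "single j i" "x0 \<in> A j" for j i
    using no2 that unfolding tpT_2 x0_A fullT by blast
  show "adj j v" if "single j i" "x0 \<in> A j" "single v i" "x0 \<notin> A v" for j i v
    using no3 that sym unfolding tpT_2 x0_A by metis
  show "W \<subseteq> {..<n}" by (rule W_less)
qed

lemma clT: "tpT w = 3 \<Longrightarrow> clT w b = cls w (nbT w b)" "clT w b < 2 \<Longrightarrow> tpT w = 3"
  unfolding clT_def cls_def Let_def sameT stT fiT by (auto split: if_splits)

lemma mid_lt: "mid w i u \<Longrightarrow> i < n \<and> u < n \<and> w < n \<and> w < L"
  using midD(1,2,4)[of w i u] I_L W_L by blast

lemma node_iff: "e < 2 * n \<Longrightarrow> i < n \<Longrightarrow> c < 2 \<Longrightarrow> e = node n i c \<longleftrightarrow> idx n e = i \<and> side n e = c"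
  using node_simps(1,2,5) by metis

lemma mate_iff: "e < 2 * n \<Longrightarrow> i < n \<Longrightarrow> c < 2 \<Longrightarrow> mate n e = node n i c \<longleftrightarrow> idx n e = i \<and> c = 1 - side n e"
proof -
  assume a: "e < 2 * n" "i < n" "c < 2"
  show ?thesis using node_iff[OF node_simps(7)[OF a(1)] a(2,3)] node_simps(9,10)[OF a(1)] by auto
qed

text \<open>The common pattern of \<open>rootT\<close> and \<open>finT\<close>: instead of an index
  and the opposite class, the program compares the mate of \<open>e\<close> with the node of
  \<open>w\<close>.\<close>

lemma mate_mid:
  assumes e: "e < 2 * n"
  shows "(\<exists>w<L. clT w 0 < 2 \<and> mate n e = node n (nbT w 0) (clT w 0) \<and> Q w (nbT w 0) \<or>
     clT w 1 < 2 \<and> mate n e = node n (nbT w 1) (clT w 1) \<and> Q w (nbT w 1)) \<longleftrightarrow>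
     (\<exists>w u. mid w (idx n e) u \<and> cls w (idx n e) = 1 - side n e \<and> Q w (idx n e))"
    (is "?l \<longleftrightarrow> ?r")
proof
  assume ?l
  then obtain w b where b: "b = 0 \<or> b = 1" and w: "clT w b < 2" "mate n e = node n (nbT w b) (clT w b)" "Q w (nbT w b)" by blast
  have t: "tpT w = 3" using clT(2) w by blast
  define u where "u = nbT w (1 - b)"
  have m: "mid w (nbT w b) u" unfolding u_def using tpT_3[OF t] b mid_sym by auto
  have "idx n e = nbT w b" "clT w b = 1 - side n e" using mate_iff[OF e _ w(1)] w(2) mid_lt[OF m] by auto
  then show ?r using m w clT(1)[OF t] by metis
next
  assume ?r
  then obtain w u where w: "mid w (idx n e) u" "cls w (idx n e) = 1 - side n e" "Q w (idx n e)" by blast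
  then have t: "tpT w = 3" "idx n e = nbT w 0 \<or> idx n e = nbT w 1" unfolding mid_tpT by auto
  have c: "1 - side n e < 2" by simp
  have m: "mate n e = node n (idx n e) (1 - side n e)" using mate_iff[OF e _ c] mid_lt[OF w(1)] by blast
  show ?l using t w m c mid_lt[OF w(1)] clT(1)[OF t(1)] by metis
qed

lemma rootT: "rootT e \<longleftrightarrow> rootE e"
  unfolding rootT_def rootE_def stT using mate_mid[of e st] by blast

lemma finT: "finT e \<longleftrightarrow> finE e"
  unfolding finT_def finE_def fiT using mate_mid[of e fin] by blast

lemma X_mid: "k < 2 * n \<Longrightarrow> XT k < L \<Longrightarrow> mid (if k < n then k else k - n) (idx n (XT k)) (idx n (YT k)) \<and>
   cls (if k < n then k else k - n) (idx n (XT k)) = side n (XT k) \<and> cls (if k < n then k else k - n) (idx n (YT k)) = side n (YT k) \<and>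
   XT k < 2 * n \<and> YT k < 2 * n \<and> FXT k = fin (if k < n then k else k - n) (idx n (YT k))"
proof -
  assume k: "k < 2 * n" "XT k < L"
  define w where "w = (if k < n then k else k - n)"
  define b :: nat where "b = (if k < n then 0 else 1)"
  have X: "clT w 0 < 2 \<and> clT w 1 < 2" "XT k = node n (nbT w b) (clT w b)" "YT k = node n (nbT w (1 - b)) (clT w (1 - b))"
    "FXT k = fiT w (1 - b)"
    using k unfolding XT_def YT_def FXT_def w_def b_def by (auto split: if_splits)
  have t: "tpT w = 3" using clT(2) X by blast
  have m: "mid w (nbT w b) (nbT w (1 - b))" using tpT_3[OF t] mid_sym unfolding b_def by auto
  have lt: "nbT w b < n" "nbT w (1 - b) < n" "clT w b < 2" "clT w (1 - b) < 2" using mid_lt[OF m] X(1) unfolding b_def by auto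
  show ?thesis unfolding w_def[symmetric] using m clT(1)[OF t] X(2-4) fiT node_simps(1,2,3) lt by simp
qed

lemma link_X: "e < 2 * n \<Longrightarrow> e' < 2 * n \<Longrightarrow> link w e e' \<longleftrightarrow>
   (\<exists>k<2 * n. XT k = e \<and> YT k = mate n e' \<and> w = (if k < n then k else k - n))"
proof
  assume e: "e < 2 * n" "e' < 2 * n" and "link w e e'"
  then have l: "mid w (idx n e) (idx n e')" "cls w (idx n e) = side n e" "cls w (idx n e') = 1 - side n e'"
    unfolding link_def by auto
  have t: "tpT w = 3" using l(1) unfolding mid_tpT by blast
  note lt = mid_lt[OF l(1)]
  have c: "clT w 0 < 2 \<and> clT w 1 < 2"
    using l clT(1)[OF t] node_simps(12)[of n e] unfolding mid_tpT by auto
  have m: "mate n e' = node n (idx n e') (1 - side n e')" using mate_iff[of e' "idx n e'" "1 - side n e'"] e lt by simp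
  have e1: "e = node n (idx n e) (side n e)" using node_simps(5)[OF e(1)] by simp
  consider "idx n e = nbT w 0" "idx n e' = nbT w 1" | "idx n e = nbT w 1" "idx n e' = nbT w 0"
    using l(1) unfolding mid_tpT by blast
  then show "\<exists>k<2 * n. XT k = e \<and> YT k = mate n e' \<and> w = (if k < n then k else k - n)"
  proof cases
    case 1
    then have "XT w = e" "YT w = mate n e'" using lt c l clT(1)[OF t] m e1 unfolding XT_def YT_def by auto
    then show ?thesis using lt by (intro exI[of _ w]) auto
  next
    case 2
    then have "XT (w + n) = e" "YT (w + n) = mate n e'" using lt c l clT(1)[OF t] m e1 unfolding XT_def YT_def by auto
    then show ?thesis using lt by (intro exI[of _ "w + n"]) auto
  qed
next
  assume e: "e < 2 * n" "e' < 2 * n" and "\<exists>k<2 * n. XT k = e \<and> YT k = mate n e' \<and> w = (if k < n then k else k - n)"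
  then obtain k where k: "k < 2 * n" "XT k = e" "YT k = mate n e'" "w = (if k < n then k else k - n)" by blast
  then show "link w e e'" unfolding link_def
    using X_mid[OF k(1)] e n_L node_simps(9,10)[OF e(2)] by auto
qed

lemma adjF_X: "adjF a b \<longleftrightarrow> (\<exists>k<4 * n. XT k < L \<and> (XT k = a \<and> YT k = b \<or> XT k = b \<and> YT k = a))"
proof
  assume "adjF a b"
  then consider "a = rt" "rootE b" | "b = rt" "rootE a" | "edge a b" unfolding adjF_def by blast
  then show "\<exists>k<4 * n. XT k < L \<and> (XT k = a \<and> YT k = b \<or> XT k = b \<and> YT k = a)"
  proof cases
    case 1
    then have "b < 2 * n" "rootT b" using rootT unfolding rootE_def by auto
    then show ?thesis using 1 n_L unfolding XT_def YT_def by (intro exI[of _ "b + 2 * n"]) auto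
  next
    case 2
    then have "a < 2 * n" "rootT a" using rootT unfolding rootE_def by auto
    then show ?thesis using 2 n_L unfolding XT_def YT_def by (intro exI[of _ "a + 2 * n"]) auto
  next
    case 3
    then have ab: "a < 2 * n" "b < 2 * n" unfolding edge_def by auto
    obtain w where w: "mid w (idx n a) (idx n b)" "cls w (idx n a) = side n a" "cls w (idx n b) = side n b"
      using 3 unfolding edge_def by blast
    have m: "mate n b < 2 * n" "idx n (mate n b) = idx n b" "side n (mate n b) = 1 - side n b" "mate n (mate n b) = b"
      using node_simps(6,7,9,10)[OF ab(2)] by auto
    have "link w a (mate n b)" unfolding link_def using w m node_simps(12)[of n b] by auto
    then obtain k where "k < 2 * n" "XT k = a" "YT k = b" using link_X[OF ab(1) m(1)] m(4) by metis
    then show ?thesis using ab n_L by (intro exI[of _ k]) auto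
  qed
next
  assume "\<exists>k<4 * n. XT k < L \<and> (XT k = a \<and> YT k = b \<or> XT k = b \<and> YT k = a)"
  then obtain k where k: "k < 4 * n" "XT k < L" and ab: "XT k = a \<and> YT k = b \<or> XT k = b \<and> YT k = a" by blast
  have "adjF (XT k) (YT k)"
  proof (cases "k < 2 * n")
    case True
    then show ?thesis using X_mid[OF True k(2)] unfolding adjF_def edge_def by metis
  next
    case False
    then have "XT k = 2 * n" "YT k = k - 2 * n" "rootE (k - 2 * n)"
      using k rootT unfolding XT_def YT_def by (auto split: if_splits)
    then show ?thesis unfolding adjF_def by simp
  qed
  then show "adjF a b" using ab adjF_sym by blast
qed

lemma Y_lt: "k < 4 * n \<Longrightarrow> XT k < L \<Longrightarrow> YT k < 2 * n \<and> XT k \<le> 2 * n"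
proof (cases "k < 2 * n")
  case True
  assume "k < 4 * n" "XT k < L"
  then show ?thesis using X_mid[OF True] by auto
next
  case False
  assume "k < 4 * n" "XT k < L"
  then show ?thesis using False unfolding XT_def YT_def by (auto split: if_splits)
qed

lemma X_dead: "4 * n \<le> k \<Longrightarrow> XT k = L"
  unfolding XT_def rootT_def by auto

sublocale alternating_search "{..<2 * n}" "mate n" adjF "2 * n"
proof
  show "adjF a b \<Longrightarrow> adjF b a" for a b by (rule adjF_sym)
qed (use node_simps in auto)

text \<open>Neither a blossom step nor a growing step is possible.\<close>

definition closed :: "nat set \<Rightarrow> (nat \<Rightarrow> nat) \<Rightarrow> bool" where
  "closed Z base \<longleftrightarrow> (\<forall>k<L. XT k < L \<longrightarrow> \<not> (XT k \<in> Z \<and> YT k \<in> Z \<and> base (XT k) \<noteq> base (YT k)) \<and>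
     \<not> (XT k \<in> Z \<and> YT k \<notin> Z \<and> mate n (YT k) \<notin> Z))"

lemma closed_no_cover:
  assumes i: "inv Z P base" and cl: "closed Z base" and nf: "\<And>e. e \<in> Z \<Longrightarrow> \<not> finT e"
    and J: "indep J" and cov: "D \<subseteq> \<Union> (A ` J)"
  shows False
proof (rule no_cover[where Z = Z and base = base and J = J])
  note F = inv_facts[OF i]
  show "b \<in> Z \<and> base a = base b \<or> b \<notin> Z \<and> mate n b \<in> Z" if a: "a \<in> Z" and f: "adjF a b" for a b
  proof -
    obtain k where k: "k < 4 * n" "XT k < L" "XT k = a \<and> YT k = b \<or> XT k = b \<and> YT k = a" using f adjF_X by blast
    then have kL: "k < L" using n_L by simp
    note C = cl[unfolded closed_def, rule_format, OF kL k(2)]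
    from k(3) show ?thesis
    proof
      assume *: "XT k = a \<and> YT k = b"
      then show ?thesis using C a by metis
    next
      assume *: "XT k = b \<and> YT k = a"
      have "a \<noteq> 2 * n" using Y_lt[OF k(1,2)] * by auto
      show ?thesis
      proof (cases "b \<in> Z")
        case True
        then show ?thesis using C * a by metis
      next
        case False
        then have bn: "b \<noteq> 2 * n" using F by blast
        then have "k < 2 * n" using * k unfolding XT_def by (auto split: if_splits)
        then have "edge a b" using f \<open>a \<noteq> 2 * n\<close> bn unfolding adjF_def by simp
        \<comment> \<open>The condition \<open>closed\<close> only looks at growth from the tail of
          an entry, so the entry for the opposite direction is needed. It exists because
          \<open>b\<close> is not the root, which is always even.\<close>
        then obtain k' where k': "k' < 4 * n" "XT k' < L" "XT k' = a" "YT k' = b"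
        proof -
          obtain w where w: "mid w (idx n a) (idx n b)" "cls w (idx n a) = side n a" "cls w (idx n b) = side n b" "a < 2 * n" "b < 2 * n"
            using \<open>edge a b\<close> unfolding edge_def by blast
          have m: "mate n b < 2 * n" "idx n (mate n b) = idx n b" "side n (mate n b) = 1 - side n b" "mate n (mate n b) = b"
            using node_simps(6,7,9,10)[OF w(5)] by auto
          have "link w a (mate n b)" unfolding link_def using w m node_simps(12)[of n b] by auto
          then obtain k where "k < 2 * n" "XT k = a" "YT k = b" using link_X[OF w(4) m(1)] m(4) by metis
          then show thesis using that[of k] w n_L by simp
        qed
        then have "k' < L" using n_L by simp
        then show ?thesis using cl[unfolded closed_def, rule_format, OF \<open>k' < L\<close> k'(2)] k' a False by metis
      qed
    qed
  qed
  show "base v = v" if "v \<in> Z" "v \<noteq> 2 * n" "mate n v \<notin> Z" for v using inv_pure_base[OF i that] .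
  show "base (mate n v) = base v" if "v \<in> Z" "v \<noteq> 2 * n" "mate n v \<in> Z" for v using inv_mate_base[OF i that] .
  show "2 * n \<in> Z" "base (2 * n) = 2 * n" using F by auto
  show "\<not> finE e" if "e \<in> Z" for e using nf[OF that] finT by blast
  show "indep J" by (rule J)
  show "A i \<subseteq> \<Union> (A ` J)" for i using cov A_eq by blast
  show "x0 \<in> \<Union> (A ` J)" using cov x0_D by blast
qed

context
  fixes Z P base f
  assumes i: "inv Z P base" and f: "f \<in> Z" "finT f"
begin

abbreviation (input) pf :: "nat list" where "pf \<equiv> P f"

lemma pf_facts: "f \<noteq> 2 * n" "length pf > 0" "last pf = f" "\<And>k. k < length pf \<Longrightarrow> pf ! k < 2 * n"
  "\<And>k l. k < length pf \<Longrightarrow> l < length pf \<Longrightarrow> idx n (pf ! k) = idx n (pf ! l) \<Longrightarrow> k = l"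
  "adjF (2 * n) (mate n (pf ! 0))" "\<And>k. Suc k < length pf \<Longrightarrow> adjF (pf ! k) (mate n (pf ! Suc k))"
  "finE (pf ! (length pf - 1))"
proof -
  have fe: "finE f" using f finT by blast
  then show fr: "f \<noteq> 2 * n" unfolding finE_def by auto
  note G = inv_good[OF i f(1) fr] and Q = inv_path[OF i f(1)]
  show l: "length pf > 0" "last pf = f" using G by auto
  show lt: "pf ! k < 2 * n" if "k < length pf" for k using Q(2) that nth_mem by blast
  show "k = m" if k: "k < length pf" "m < length pf" and e: "idx n (pf ! k) = idx n (pf ! m)" for k m
  proof -
    have "pf ! k = pf ! m \<or> pf ! k = mate n (pf ! m)" using idx_eq[OF lt[OF k(1)] lt[OF k(2)] e] .
    moreover have "pf ! k \<noteq> mate n (pf ! m)" using Q(5)[of "pf ! m"] k by (metis nth_mem)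
    ultimately show ?thesis using Q(4) k nth_eq_iff_index_eq by blast
  qed
  have ch: "chain (2 * n) pf" by (rule Q(6))
  have C: "chain r xs \<Longrightarrow> Suc k < length xs \<Longrightarrow> adjF (xs ! k) (mate n (xs ! Suc k))" for r xs k
  proof (induction xs arbitrary: r k)
    case (Cons x xs)
    then show ?case by (cases k; cases xs) auto
  qed simp
  show "adjF (2 * n) (mate n (pf ! 0))" using ch l by (cases pf) auto
  show "Suc k < length pf \<Longrightarrow> adjF (pf ! k) (mate n (pf ! Suc k))" for k using C ch by blast
  show "finE (pf ! (length pf - 1))" using fe l last_conv_nth[of pf] by auto
qed

text \<open>An edge of the last step that permits finishing must be selected, whence the condition on \<open>FXT\<close>.\<close>

definition JT :: "nat \<Rightarrow> nat" where
  "JT k = (let j = least L (\<lambda>j. j < 2 * n \<and> XT j = pf ! k \<and> YT j = mate n (pf ! Suc k) \<and> (Suc (Suc k) < length pf \<or> FXT j))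
     in if j < n then j else j - n)"

definition j0T :: nat where
  "j0T = least L (\<lambda>j. tpT j = 2 \<and> adj j x0 \<and> nbT j 0 = idx n (pf ! 0) \<and> \<not> adj j (JT 0))"

definition fT :: bool where
  "fT \<longleftrightarrow> (\<forall>x<L. x \<in> D \<and> adj (idx n (pf ! (length pf - 1))) x \<longrightarrow> adj (JT (length pf - 2)) x)"

text \<open>\<open>L\<close> stands for "no further vertex": the last step already covers everything
  at the last node.\<close>

definition vT :: nat where
  "vT = (if fT then L else least L (\<lambda>v. tpT v = 2 \<and> \<not> adj v x0 \<and> nbT v 0 = idx n (pf ! (length pf - 1)) \<and>
     \<not> adj v (JT (length pf - 2))))"

definition newI :: "nat set" where
  "newI = {w. (\<exists>k. Suc k < length pf \<and> JT k = w) \<or> w = j0T \<or> w = vT \<and> vT < L \<or>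
     w \<in> I \<and> \<not> (\<exists>k<length pf. idx n (pf ! k) = w)}"

lemma newI: "indep newI \<and> \<Union> (A ` I) \<subseteq> \<Union> (A ` newI) \<and> x0 \<in> \<Union> (A ` newI)"
proof -
  note H = refl pf_facts(2,4-8)
  have r2: "length pf \<ge> 2" by (rule path_long[OF H])
  have J: "link (JT k) (pf ! k) (pf ! Suc k) \<and> (Suc (Suc k) = length pf \<longrightarrow> fin (JT k) (idx n (pf ! Suc k)))"
    if k: "Suc k < length pf" for k
  proof -
    let ?P = "\<lambda>j. j < 2 * n \<and> XT j = pf ! k \<and> YT j = mate n (pf ! Suc k) \<and> (Suc (Suc k) < length pf \<or> FXT j)"
    have lt: "pf ! k < 2 * n" "pf ! Suc k < 2 * n" using pf_facts(4) k by auto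
    have "\<exists>w. link w (pf ! k) (pf ! Suc k) \<and> (Suc (Suc k) = length pf \<longrightarrow> fin w (idx n (pf ! Suc k)))"
    proof (cases "Suc (Suc k) = length pf")
      case True
      then show ?thesis using path_last[OF H] by (metis Suc_1 diff_Suc_1 diff_Suc_Suc)
    next
      case False
      then show ?thesis using path_link[OF H k] by blast
    qed
    then obtain w where w: "link w (pf ! k) (pf ! Suc k)" "Suc (Suc k) = length pf \<longrightarrow> fin w (idx n (pf ! Suc k))" by blast
    obtain j where j: "j < 2 * n" "XT j = pf ! k" "YT j = mate n (pf ! Suc k)" "w = (if j < n then j else j - n)"
      using link_X[OF lt] w(1) by blast
    have fx: "FXT j' = fin (if j' < n then j' else j' - n) (idx n (pf ! Suc k))" if "j' < 2 * n" "XT j' = pf ! k" "YT j' = mate n (pf ! Suc k)" for j'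
      using X_mid[OF that(1)] that lt n_L node_simps(9)[OF lt(2)] by simp
    have "?P j" using j w(2) fx[OF j(1-3)] k by (auto simp: le_less_Suc_eq)
    moreover have "j < L" using j(1) n_L(2) by simp
    ultimately have "least L ?P < L" unfolding least_less by blast
    then have P: "?P (least L ?P)" by (rule least_prop)
    have JTe: "JT k = (if least L ?P < n then least L ?P else least L ?P - n)" unfolding JT_def Let_def ..
    show ?thesis
    proof
      show "link (JT k) (pf ! k) (pf ! Suc k)" unfolding link_X[OF lt] JTe using P by blast
      show "Suc (Suc k) = length pf \<longrightarrow> fin (JT k) (idx n (pf ! Suc k))" unfolding JTe using P fx[of "least L ?P"] by auto
    qed
  qed
  have k0: "Suc 0 < length pf" using r2 by simp
  have "link (JT 0) (pf ! 0) (pf ! 1)" using J[OF k0] by simp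
  then have "st (JT 0) (idx n (pf ! 0))" using path_start[OF H] by blast
  then obtain j where "tpT j = 2" "nbT j 0 = idx n (pf ! 0)" "adj j x0" "\<not> adj j (JT 0)" unfolding st_def tpT_2 x0_A by blast
  then have jL: "j0T < L" unfolding j0T_def least_less using tpT_W by blast
  then have j0: "single j0T (idx n (pf ! 0))" "x0 \<in> A j0T" "\<not> adj j0T (JT 0)"
    using least_prop[of L "\<lambda>j. tpT j = 2 \<and> adj j x0 \<and> nbT j 0 = idx n (pf ! 0) \<and> \<not> adj j (JT 0)"]
    unfolding tpT_2 x0_A j0T_def by auto
  have l: "Suc (length pf - 2) < length pf" "Suc (Suc (length pf - 2)) = length pf" "Suc (length pf - 2) = length pf - 1" using r2 by auto
  have fl: "fin (JT (length pf - 2)) (idx n (pf ! (length pf - 1)))" using J[OF l(1)] l by simp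
  define X where "X = (if vT < L then {vT} else {})"
  have X: "X = {} \<and> A (idx n (pf ! (length pf - 1))) \<subseteq> A (JT (length pf - 2)) \<or>
      (\<exists>v. X = {v} \<and> single v (idx n (pf ! (length pf - 1))) \<and> x0 \<notin> A v \<and> \<not> adj v (JT (length pf - 2)))"
  proof (cases fT)
    case True
    then show ?thesis unfolding X_def vT_def A_sub fT_def by simp
  next
    case False
    let ?P = "\<lambda>v. tpT v = 2 \<and> \<not> adj v x0 \<and> nbT v 0 = idx n (pf ! (length pf - 1)) \<and> \<not> adj v (JT (length pf - 2))"
    have "\<exists>v. ?P v" using fl False unfolding fin_def fT_def A_sub tpT_2 x0_A by blast
    then have "least L ?P < L" unfolding least_less using tpT_W by blast
    then have "?P vT" "vT < L" using least_prop[of L ?P] False unfolding vT_def by auto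
    then show ?thesis unfolding X_def tpT_2 x0_A by auto
  qed
  have "newI = I - (\<lambda>k. idx n (pf ! k)) ` {..<length pf} \<union> insert j0T (JT ` {..<length pf - 1} \<union> X)"
  proof -
    have "JT ` {..<length pf - 1} = {w. \<exists>k. Suc k < length pf \<and> JT k = w}" by (auto simp: less_diff_conv)
    moreover have "(\<lambda>k. idx n (pf ! k)) ` {..<length pf} = {w. \<exists>k<length pf. idx n (pf ! k) = w}" by auto
    moreover have "X = {w. w = vT \<and> vT < L}" unfolding X_def by auto
    ultimately show ?thesis unfolding newI_def by blast
  qed
  then show ?thesis using augment[OF H, of JT j0T X newI] J j0 X by blast
qed

end

end

text \<open>Truth values are handled as \<open>= 0\<close> and \<open>\<noteq> 0\<close>; rewriting
  the latter to \<open>0 < _\<close> would hide them from the rules below.\<close>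

declare neq0_conv [iff del]

section \<open>Programs that fill the tables of a phase\<close>

definition Neg :: "expr \<Rightarrow> expr" where "Neg b = Eq b (Cst 0)"
definition Conj :: "expr \<Rightarrow> expr \<Rightarrow> expr" where "Conj b c = Ite b (Ite c (Cst 1) (Cst 0)) (Cst 0)"
definition Disj :: "expr \<Rightarrow> expr \<Rightarrow> expr" where "Disj b c = Ite b (Cst 1) (Ite c (Cst 1) (Cst 0))"
definition Exi :: "nat \<Rightarrow> expr \<Rightarrow> expr" where "Exi x e = Lt (Lst x e) LimE"
definition Univ :: "nat \<Rightarrow> expr \<Rightarrow> expr \<Rightarrow> expr" where "Univ x b c = Neg (Exi x (Conj b (Neg c)))"

abbreviation Var :: "nat \<Rightarrow> expr" where "Var x \<equiv> Rd x (Cst 0) (Cst 0)"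
abbreviation At :: "nat \<Rightarrow> expr \<Rightarrow> expr" where "At a e \<equiv> Rd a e (Cst 0)"
abbreviation Set :: "nat \<Rightarrow> expr \<Rightarrow> cmd" where "Set x e \<equiv> Wr x (Cst 0) (Cst 0) e"
abbreviation two_n :: expr where "two_n \<equiv> Add NV NV"

definition mateE :: "expr \<Rightarrow> expr" where "mateE e = Ite (Lt e NV) (Add e NV) (Sub e NV)"
definition idxE :: "expr \<Rightarrow> expr" where "idxE e = Ite (Lt e NV) e (Sub e NV)"
definition nodeE :: "expr \<Rightarrow> expr \<Rightarrow> expr" where "nodeE i c = Ite c (Add i NV) i"

fun block :: "cmd list \<Rightarrow> cmd" where
  "block [] = Nop"
| "block (c # cs) = Sq c (block cs)"

text \<open>As a congruence rule it passes on \<open>k < L'\<close>, the range in which the contents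
  of the tables are known.\<close>

lemma least_cong [cong]: "L = L' \<Longrightarrow> (\<And>k. k < L' \<Longrightarrow> P k = Q k) \<Longrightarrow> least L P = least L' Q"
proof -
  assume L: "L = L'" and e: "\<And>k. k < L' \<Longrightarrow> P k = Q k"
  show ?thesis
  proof (cases "\<exists>k<L. P k")
    case True
    then have "least L P < L" using least_less by blast
    moreover have "\<not> Q j" if "j < least L P" for j
    proof -
      have "j < L" using that calculation by simp
      moreover have "least L P = (LEAST k. P k)" unfolding least_def using True by simp
      then have "\<not> P j" using that not_less_Least[of j P] by simp
      ultimately show ?thesis using e L by blast
    qed
    ultimately show ?thesis using least_eq[of "least L P" L' Q] least_prop[of L P] L e by metis
  next
    case False
    then show ?thesis using L e unfolding least_def by auto
  qed
qed

context prog
begin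

lemma ev_simps [simp]:
  "ev (Neg b) \<sigma> = of_bool (ev b \<sigma> = 0)"
  "ev (Conj b c) \<sigma> = of_bool (ev b \<sigma> \<noteq> 0 \<and> ev c \<sigma> \<noteq> 0)"
  "ev (Disj b c) \<sigma> = of_bool (ev b \<sigma> \<noteq> 0 \<or> ev c \<sigma> \<noteq> 0)"
  "ev (Exi x e) \<sigma> = of_bool (\<exists>k<L. ev e (put \<sigma> x 0 0 k) \<noteq> 0)"
  "ev (Univ x e f) \<sigma> = of_bool (\<forall>k<L. ev e (put \<sigma> x 0 0 k) \<noteq> 0 \<longrightarrow> ev f (put \<sigma> x 0 0 k) \<noteq> 0)"
  unfolding Neg_def Conj_def Disj_def Exi_def Univ_def by (auto simp: least_less)

lemma ev_node [simp]:
  "ev (mateE e) \<sigma> = (if ev e \<sigma> < n then min (ev e \<sigma> + n) L else ev e \<sigma> - n)"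
  "ev (idxE e) \<sigma> = idx n (ev e \<sigma>)"
  "ev (nodeE i c) \<sigma> = (if ev c \<sigma> = 0 then ev i \<sigma> else min (ev i \<sigma> + n) L)"
  unfolding mateE_def idxE_def nodeE_def idx_def by auto

lemma sem_block_append: "sem (block (cs @ ds)) \<sigma> = sem (block ds) (sem (block cs) \<sigma>)"
  by (induction cs arbitrary: \<sigma>) auto

lemma fill_col:
  assumes ax: "a \<noteq> x" and k: "k \<le> 8"
    and f: "\<And>\<tau> i. i < L \<Longrightarrow> agree {a, x} \<tau> \<sigma> \<Longrightarrow> \<tau> a i = \<sigma> a i \<Longrightarrow> ev e (put \<tau> x 0 0 i) = f i"
  shows "sem (fill x a (Cst k) e) \<sigma> = \<sigma>(a := (\<lambda>i j. if i < L \<and> j = k then f i else \<sigma> a i j))"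
  by (rule sem_fill[OF ax]) (use k f in auto)

lemma lim_ge: "4 * n + 8 \<le> L" "n < L" "2 * n < L" "8 \<le> L"
  unfolding lim_def by auto

end

text \<open>Tables: 0 answer; 1--3 the seed \<open>s, t\<^sub>1, t\<^sub>2\<close>; 4 the element to be covered; 5--8 bound variables; 10 \<open>D\<close>;
  11 \<open>W\<close>; 12 \<open>I\<close>; 13 success flag; 14--16 \<open>nbT, tpT, fullT\<close>; 17--20 direct exchanges; 21--29 \<open>stT, fiT, qT, rpT, rqT,
  clT, XT, YT, FXT\<close>; 30 \<open>rootT\<close>; 31 \<open>finT\<close>. A set is stored as the support of a table.\<close>

abbreviation nbE :: "expr \<Rightarrow> nat \<Rightarrow> expr" where "nbE w b \<equiv> Rd 14 w (Cst b)"
abbreviation tpE :: "expr \<Rightarrow> expr" where "tpE w \<equiv> At 15 w"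
abbreviation fullE :: "expr \<Rightarrow> nat \<Rightarrow> expr" where "fullE w b \<equiv> Rd 16 w (Cst b)"
abbreviation clE :: "expr \<Rightarrow> nat \<Rightarrow> expr" where "clE w b \<equiv> Rd 26 w (Cst b)"

definition p_nb :: "cmd list" where
  "p_nb = [
    fill 5 14 (Cst 0) (Lst 6 (Conj (At 12 (Var 6)) (Ad (Var 5) (Var 6)))),
    fill 5 14 (Cst 1) (Lst 6 (Conj (At 12 (Var 6)) (Conj (Ad (Var 5) (Var 6)) (Neg (Eq (Var 6) (nbE (Var 5) 0)))))),
    fill 5 15 (Cst 0) (Ite (Disj (Neg (At 11 (Var 5))) (At 12 (Var 5))) (Cst 0)
      (Ite (Eq (nbE (Var 5) 0) LimE) (Cst 1) (Ite (Eq (nbE (Var 5) 1) LimE) (Cst 2) (Cst 3)))),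
    fill 5 16 (Cst 0) (Univ 6 (Conj (At 10 (Var 6)) (Ad (nbE (Var 5) 0) (Var 6))) (Ad (Var 5) (Var 6))),
    fill 5 16 (Cst 1) (Univ 6 (Conj (At 10 (Var 6)) (Ad (nbE (Var 5) 1) (Var 6))) (Ad (Var 5) (Var 6)))]"

abbreviation startE :: "expr \<Rightarrow> expr" where "startE j \<equiv> Conj (Eq (tpE j) (Cst 2)) (Ad j (Var 4))"
abbreviation endE :: "expr \<Rightarrow> expr" where "endE v \<equiv> Conj (Eq (tpE v) (Cst 2)) (Neg (Ad v (Var 4)))"
abbreviation at_nonadj :: "expr \<Rightarrow> expr \<Rightarrow> expr \<Rightarrow> expr" where
  "at_nonadj j i w \<equiv> Conj (Eq (nbE j 0) i) (Neg (Ad j w))"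

definition p_st :: "nat \<Rightarrow> cmd" where
  "p_st b = fill 5 21 (Cst b) (Exi 6 (Conj (startE (Var 6)) (at_nonadj (Var 6) (nbE (Var 5) b) (Var 5))))"
definition p_fi :: "nat \<Rightarrow> cmd" where
  "p_fi b = fill 5 22 (Cst b) (Disj (fullE (Var 5) b) (Exi 6 (Conj (endE (Var 6)) (at_nonadj (Var 6) (nbE (Var 5) b) (Var 5)))))"
definition p_q :: "nat \<Rightarrow> cmd" where
  "p_q b = fill 5 23 (Cst b) (Lst 6 (Conj (Eq (tpE (Var 6)) (Cst 3)) (Conj (Neg (Ad (Var 6) (Var 5))) (Conj (Neg (Eq (Var 6) (Var 5)))
     (Disj (Conj (Eq (nbE (Var 6) 0) (nbE (Var 5) b)) (Neg (Eq (nbE (Var 6) 1) (nbE (Var 5) (1 - b)))))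
       (Conj (Eq (nbE (Var 6) 1) (nbE (Var 5) b)) (Neg (Eq (nbE (Var 6) 0) (nbE (Var 5) (1 - b))))))))))"
definition p_rp :: cmd where
  "p_rp = fill 5 24 (Cst 0) (Lst 6 (Conj (Eq (tpE (Var 6)) (Cst 3))
     (Disj (Conj (Eq (nbE (Var 6) 0) (Var 5)) (Lt (Rd 23 (Var 6) (Cst 0)) LimE))
       (Conj (Eq (nbE (Var 6) 1) (Var 5)) (Lt (Rd 23 (Var 6) (Cst 1)) LimE)))))"
definition p_rq :: cmd where
  "p_rq = fill 5 25 (Cst 0) (Ite (Eq (nbE (At 24 (Var 5)) 0) (Var 5)) (Rd 23 (At 24 (Var 5)) (Cst 0)) (Rd 23 (At 24 (Var 5)) (Cst 1)))"
abbreviation sameE :: "expr \<Rightarrow> expr \<Rightarrow> expr \<Rightarrow> expr" where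
  "sameE w v i \<equiv> Univ 6 (Conj (At 10 (Var 6)) (Ad i (Var 6))) (Eq (Ad w (Var 6)) (Ad v (Var 6)))"
definition p_cl :: "nat \<Rightarrow> cmd" where
  "p_cl b = fill 5 26 (Cst b) (Ite (Neg (Eq (tpE (Var 5)) (Cst 3))) (Cst 2)
     (Ite (Lt (At 24 (nbE (Var 5) b)) LimE)
       (Ite (sameE (Var 5) (At 24 (nbE (Var 5) b)) (nbE (Var 5) b)) (Cst 0)
         (Ite (sameE (Var 5) (At 25 (nbE (Var 5) b)) (nbE (Var 5) b)) (Cst 1) (Cst 2)))
       (Ite (Disj (Rd 21 (Var 5) (Cst b)) (Rd 22 (Var 5) (Cst b))) (Cst 1) (Cst 2))))"
abbreviation dartE :: "nat \<Rightarrow> nat \<Rightarrow> expr" where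
  "dartE a b \<equiv> Conj (Lt (clE (Var 6) b) (Cst 2)) (Conj (Eq (mateE (Var 5)) (nodeE (nbE (Var 6) b) (clE (Var 6) b))) (Rd a (Var 6) (Cst b)))"
definition p_mark :: "nat \<Rightarrow> nat \<Rightarrow> cmd" where
  "p_mark t a = fill 5 t (Cst 0) (Conj (Lt (Var 5) two_n) (Exi 6 (Disj (dartE a 0) (dartE a 1))))"
abbreviation liveE :: "expr \<Rightarrow> expr" where "liveE w \<equiv> Conj (Lt (clE w 0) (Cst 2)) (Lt (clE w 1) (Cst 2))"
definition p_X :: cmd where
  "p_X = fill 5 27 (Cst 0) (Ite (Lt (Var 5) NV) (Ite (liveE (Var 5)) (nodeE (nbE (Var 5) 0) (clE (Var 5) 0)) LimE)
     (Ite (Lt (Var 5) two_n) (Ite (liveE (Sub (Var 5) NV)) (nodeE (nbE (Sub (Var 5) NV) 1) (clE (Sub (Var 5) NV) 1)) LimE)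
       (Ite (At 30 (Sub (Var 5) two_n)) two_n LimE)))"
definition p_Y :: cmd where
  "p_Y = fill 5 28 (Cst 0) (Ite (Lt (Var 5) NV) (nodeE (nbE (Var 5) 1) (clE (Var 5) 1))
     (Ite (Lt (Var 5) two_n) (nodeE (nbE (Sub (Var 5) NV) 0) (clE (Sub (Var 5) NV) 0)) (Sub (Var 5) two_n)))"
definition p_FX :: cmd where
  "p_FX = fill 5 29 (Cst 0) (Ite (Lt (Var 5) NV) (Rd 22 (Var 5) (Cst 1)) (Rd 22 (Sub (Var 5) NV) (Cst 0)))"

definition p_edges :: "cmd list" where
  "p_edges = [p_st 0, p_st 1, p_fi 0, p_fi 1, p_q 0, p_q 1, p_rp, p_rq, p_cl 0, p_cl 1, p_mark 30 21, p_mark 31 22, p_X, p_Y, p_FX]"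

locale prog_tables = prog n ad + phase_tables W ad A I x0 n "lim n" D for n ad W A I x0 D
begin

definition input :: "store \<Rightarrow> bool" where
  "input \<sigma> \<longleftrightarrow> (\<forall>i<L. (\<sigma> 10 i 0 = 0) = (i \<notin> D)) \<and> (\<forall>i<L. (\<sigma> 11 i 0 = 0) = (i \<notin> W)) \<and>
     (\<forall>i<L. (\<sigma> 12 i 0 = 0) = (i \<notin> I)) \<and> \<sigma> 4 0 0 = x0"

definition tab1 :: "store \<Rightarrow> bool" where
  "tab1 \<sigma> \<longleftrightarrow> input \<sigma> \<and> (\<forall>w<L. \<sigma> 14 w 0 = nbT w 0) \<and> (\<forall>w<L. \<sigma> 14 w 1 = nbT w 1) \<and> (\<forall>w<L. \<sigma> 15 w 0 = tpT w) \<and>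
     (\<forall>w<L. (\<sigma> 16 w 0 = 0) = (\<not> fullT w 0)) \<and> (\<forall>w<L. (\<sigma> 16 w 1 = 0) = (\<not> fullT w 1))"

text \<open>Heads are required only for edges that are present, since for absent ones the program
  stores the result of meaningless lookups.\<close>

definition tab2 :: "store \<Rightarrow> bool" where
  "tab2 \<sigma> \<longleftrightarrow> tab1 \<sigma> \<and> (\<forall>k<L. \<sigma> 27 k 0 = XT k) \<and> (\<forall>k<L. XT k < L \<longrightarrow> \<sigma> 28 k 0 = YT k) \<and>
     (\<forall>k<2 * n. (\<sigma> 29 k 0 = 0) = (\<not> FXT k)) \<and> (\<forall>e<L. (\<sigma> 31 e 0 = 0) = (\<not> finT e))"

lemma nbT_1_eq: "nbT w (Suc 0) = least L (\<lambda>i. i \<in> I \<and> ad w i \<and> i \<noteq> nbT w 0)"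
  unfolding nbT_def by simp

lemma sem_nb: "input \<sigma> \<Longrightarrow> tab1 (sem (block p_nb) \<sigma>)"
proof -
  assume i: "input \<sigma>"
  note I = i[unfolded input_def]
  define s1 where "s1 = \<sigma>(14 := (\<lambda>i j. if i < L \<and> j = 0 then nbT i 0 else \<sigma> 14 i j))"
  have 1: "sem (fill 5 14 (Cst 0) (Lst 6 (Conj (At 12 (Var 6)) (Ad (Var 5) (Var 6))))) \<sigma> = s1"
    unfolding s1_def by (rule fill_col) (use I in \<open>auto simp: put_def nbT_def\<close>)
  define s2 where "s2 = s1(14 := (\<lambda>i j. if i < L \<and> j = 1 then nbT i 1 else s1 14 i j))"
  have 2: "sem (fill 5 14 (Cst 1) (Lst 6 (Conj (At 12 (Var 6)) (Conj (Ad (Var 5) (Var 6)) (Neg (Eq (Var 6) (nbE (Var 5) 0))))))) s1 = s2"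
    unfolding s2_def by (rule fill_col) (use I in \<open>auto simp: put_def s1_def nbT_1_eq conj_left_commute\<close>)
  define s3 where "s3 = s2(15 := (\<lambda>i j. if i < L \<and> j = 0 then tpT i else s2 15 i j))"
  have 3: "sem (fill 5 15 (Cst 0) (Ite (Disj (Neg (At 11 (Var 5))) (At 12 (Var 5))) (Cst 0)
      (Ite (Eq (nbE (Var 5) 0) LimE) (Cst 1) (Ite (Eq (nbE (Var 5) 1) LimE) (Cst 2) (Cst 3))))) s2 = s3"
    unfolding s3_def by (rule fill_col) (use I in \<open>auto simp: put_def tpT_def s1_def s2_def\<close>)
  define s4 where "s4 = s3(16 := (\<lambda>i j. if i < L \<and> j = 0 then of_bool (fullT i 0) else s3 16 i j))"
  have 4: "sem (fill 5 16 (Cst 0) (Univ 6 (Conj (At 10 (Var 6)) (Ad (nbE (Var 5) 0) (Var 6))) (Ad (Var 5) (Var 6)))) s3 = s4"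
    unfolding s4_def by (rule fill_col) (use I in \<open>auto simp: put_def fullT_def s1_def s2_def s3_def\<close>)
  define s5 where "s5 = s4(16 := (\<lambda>i j. if i < L \<and> j = 1 then of_bool (fullT i 1) else s4 16 i j))"
  have 5: "sem (fill 5 16 (Cst 1) (Univ 6 (Conj (At 10 (Var 6)) (Ad (nbE (Var 5) 1) (Var 6))) (Ad (Var 5) (Var 6)))) s4 = s5"
    unfolding s5_def by (rule fill_col) (use I in \<open>auto simp: put_def fullT_def s1_def s2_def s3_def s4_def\<close>)
  have "sem (block p_nb) \<sigma> = s5" unfolding p_nb_def using 1 2 3 4 5 by simp
  then show ?thesis unfolding tab1_def input_def using I by (auto simp: s1_def s2_def s3_def s4_def s5_def)
qed

end

locale prog_stuck = prog_tables + stuck_tables W ad A I x0 n "lim n" D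
begin

lemma sem_edges: "tab1 \<sigma> \<Longrightarrow> tab2 (sem (block p_edges) \<sigma>)"
proof -
  assume t: "tab1 \<sigma>"
  note T = t[unfolded tab1_def input_def]
  have clL: "clT w b < 2 \<Longrightarrow> b < 2 \<Longrightarrow> nbT w b < n \<and> w < L" for w b
  proof -
    assume "clT w b < 2" "b < 2"
    then have "tpT w = 3" "b = 0 \<or> b = 1" using clT(2) by auto
    then show ?thesis using tpT_3[of w] mid_lt by auto
  qed
  have nb3: "tpT w = 3 \<Longrightarrow> nbT w 0 < L \<and> nbT w 1 < L" for w
    using tpT_3[of w] mid_lt[of w "nbT w 0" "nbT w 1"] lim_ge by auto
  note B = put_def
  define S where "S \<tau> b = (\<forall>w<L. (\<tau> 21 w b = 0) = (\<not> stT w b))" for \<tau> :: store and b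
  define FI where "FI \<tau> b = (\<forall>w<L. (\<tau> 22 w b = 0) = (\<not> fiT w b))" for \<tau> :: store and b
  define Q where "Q \<tau> b = (\<forall>w<L. \<tau> 23 w b = qT w b)" for \<tau> :: store and b
  define C where "C \<tau> b = (\<forall>w<L. \<tau> 26 w b = clT w b)" for \<tau> :: store and b
  define RP where "RP \<tau> = (\<forall>w<L. \<tau> 24 w 0 = rpT w)" for \<tau> :: store
  define RQ where "RQ \<tau> = (\<forall>w<L. rpT w < L \<longrightarrow> \<tau> 25 w 0 = rqT w)" for \<tau> :: store
  define RA where "RA \<tau> = (\<forall>w<L. (\<tau> 30 w 0 = 0) = (\<not> rootT w))" for \<tau> :: store
  define FA where "FA \<tau> = (\<forall>w<L. (\<tau> 31 w 0 = 0) = (\<not> finT w))" for \<tau> :: store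
  note defs = S_def FI_def Q_def C_def RP_def RQ_def RA_def FA_def
  have t1: "tab1 \<sigma>' = tab1 \<sigma>''" if "\<And>a. a < 20 \<Longrightarrow> \<sigma>' a = \<sigma>'' a" for \<sigma>' \<sigma>''
    unfolding tab1_def input_def by (simp add: that)
  have st: "sem (p_st b) \<tau> = \<tau>(21 := (\<lambda>i j. if i < L \<and> j = b then of_bool (stT i b) else \<tau> 21 i j))" if "tab1 \<tau>" "b = 0 \<or> b = 1" for \<tau> b
    unfolding p_st_def by (rule fill_col) (use that(2) that(1)[unfolded tab1_def input_def] in \<open>auto simp: B stT_def\<close>)
  have fi: "sem (p_fi b) \<tau> = \<tau>(22 := (\<lambda>i j. if i < L \<and> j = b then of_bool (fiT i b) else \<tau> 22 i j))" if "tab1 \<tau>" "b = 0 \<or> b = 1" for \<tau> b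
    unfolding p_fi_def by (rule fill_col) (use that(2) that(1)[unfolded tab1_def input_def] in \<open>auto simp: B fiT_def\<close>)
  have q: "sem (p_q b) \<tau> = \<tau>(23 := (\<lambda>i j. if i < L \<and> j = b then qT i b else \<tau> 23 i j))" if "tab1 \<tau>" "b = 0 \<or> b = 1" for \<tau> b
    unfolding p_q_def by (rule fill_col) (use that(2) that(1)[unfolded tab1_def input_def] in \<open>auto simp: B qT_def\<close>)
  have rp: "sem p_rp \<tau> = \<tau>(24 := (\<lambda>i j. if i < L \<and> j = 0 then rpT i else \<tau> 24 i j))" if "tab1 \<tau>" "Q \<tau> 0" "Q \<tau> 1" for \<tau>
    unfolding p_rp_def by (rule fill_col) (use that(2,3) that(1)[unfolded tab1_def input_def] in \<open>auto simp: B rpT_def defs\<close>)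
  \<comment> \<open>What the program really stores; it is \<open>rqT\<close> only where a reference
    vertex exists.\<close>
  define g where "g \<tau> i = (if \<tau> 14 (\<tau> 24 i 0) 0 = i then \<tau> 23 (\<tau> 24 i 0) 0 else \<tau> 23 (\<tau> 24 i 0) 1)" for \<tau> :: store and i
  have rqs: "sem p_rq \<tau> = \<tau>(25 := (\<lambda>i j. if i < L \<and> j = 0 then g \<tau> i else \<tau> 25 i j))" for \<tau>
    unfolding p_rq_def g_def by (rule fill_col) (auto simp: B)
  have gr: "g \<tau> i = rqT i" if "tab1 \<tau>" "Q \<tau> 0" "Q \<tau> 1" "RP \<tau>" "i < L" "rpT i < L" for \<tau> i
    using that unfolding g_def rqT_def defs tab1_def by auto
  have cl: "sem (p_cl b) \<tau> = \<tau>(26 := (\<lambda>i j. if i < L \<and> j = b then clT i b else \<tau> 26 i j))"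
    if "tab1 \<tau>" "b = 0 \<or> b = 1" "S \<tau> b" "FI \<tau> b" "RP \<tau>" "RQ \<tau>" for \<tau> b
    unfolding p_cl_def
  proof (rule fill_col)
    fix \<tau>' i assume i: "i < L" and ag: "agree {26, 5} \<tau>' \<tau>"
    note t1 = that(1)[unfolded tab1_def input_def]
    have nb: "\<tau> 14 i b = nbT i b" using t1 that(2) i by auto
    have b8: "min b 8 = b" using that(2) by auto
    show "ev (Ite (Neg (Eq (tpE (Var 5)) (Cst 3))) (Cst 2)
     (Ite (Lt (At 24 (nbE (Var 5) b)) LimE)
       (Ite (sameE (Var 5) (At 24 (nbE (Var 5) b)) (nbE (Var 5) b)) (Cst 0)
         (Ite (sameE (Var 5) (At 25 (nbE (Var 5) b)) (nbE (Var 5) b)) (Cst 1) (Cst 2)))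
       (Ite (Disj (Rd 21 (Var 5) (Cst b)) (Rd 22 (Var 5) (Cst b))) (Cst 1) (Cst 2)))) (put \<tau>' 5 0 0 i) = clT i b"
    proof (cases "tpT i = 3")
      case False
      then show ?thesis using i ag t1 by (simp add: B clT_def)
    next
      case True
      then have nL: "nbT i b < L" using nb3[OF True] that(2) by auto
      have r: "\<tau> 24 (nbT i b) 0 = rpT (nbT i b)" "rpT (nbT i b) < L \<Longrightarrow> \<tau> 25 (nbT i b) 0 = rqT (nbT i b)"
        using that(5,6) nL unfolding defs by auto
      have sf: "(\<tau> 21 i b = 0) = (\<not> stT i b)" "(\<tau> 22 i b = 0) = (\<not> fiT i b)" using that(3,4) i unfolding defs by auto
      have id: "k < L \<Longrightarrow> (\<tau> 10 k 0 = 0) = (k \<notin> D)" "\<tau> 15 i 0 = 3" for k using t1 i True by auto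
      have same: "ev (sameE (Var 5) (At t (nbE (Var 5) b)) (nbE (Var 5) b)) (put \<tau>' 5 0 0 i) = of_bool (sameT i v (nbT i b))"
        if "\<tau> t (nbT i b) 0 = v" "t = 24 \<or> t = 25" for t v
      proof -
        have "\<tau>' t = \<tau> t" "t \<noteq> 5" "t \<noteq> 6" "\<tau>' 14 = \<tau> 14" "\<tau>' 10 = \<tau> 10" using that(2) ag by auto
        then show ?thesis using that(1) nb b8 id(1) by (simp add: B sameT_def) blast
      qed
      show ?thesis
      proof (cases "rpT (nbT i b) < L")
        case rp: True
        show ?thesis unfolding ev.simps(10) same[OF r(1) disjI1[OF refl]] same[OF r(2)[OF rp] disjI2[OF refl]]
          using ag nb b8 id(2) r(1) rp True by (simp add: B clT_def Let_def)
      next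
        case False
        then show ?thesis using ag nb b8 id(2) r(1) sf True by (simp add: B clT_def Let_def)
      qed
    qed
  qed (use that in auto)
  have dart: "ev (dartE a b) (put (put \<tau>' 5 0 0 i) 6 0 0 k) =
      of_bool (clT k b < 2 \<and> mate n i = node n (nbT k b) (clT k b) \<and> \<tau> a k b \<noteq> 0)"
    if "tab1 \<tau>" "C \<tau> b" and b: "b = 0 \<or> b = 1" and k: "k < L" "i < 2 * n" and ag: "agree {t, 5} \<tau>' \<tau>"
      and ta: "a = 21 \<or> a = 22" "t = 30 \<or> t = 31" for \<tau> \<tau>' t a b k i
  proof -
    have nb: "\<tau> 14 k b = nbT k b" "\<tau> 26 k b = clT k b" using that(1)[unfolded tab1_def] that(2)[unfolded defs] b k by auto
    have b8: "min b 8 = b" using b by auto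
    have ag': "\<tau>' 14 = \<tau> 14" "\<tau>' 26 = \<tau> 26" "\<tau>' a = \<tau> a" using ag ta by auto
    have a: "a \<noteq> 5" "a \<noteq> 6" using ta by auto
    show ?thesis
    proof (cases "clT k b < 2")
      case True
      then have lt: "nbT k b < n" using clL[of k b] b by auto
      show ?thesis using True lt lim_ge k a b8 nb ag' by (auto simp: B mate_def node_def min_absorb1)
    next
      case False
      then show ?thesis using a b8 nb ag' by (simp add: B)
    qed
  qed
  have mark: "sem (p_mark t a) \<tau> = \<tau>(t := (\<lambda>i j. if i < L \<and> j = 0 then of_bool (i < 2 * n \<and>
       (\<exists>k<L. clT k 0 < 2 \<and> mate n i = node n (nbT k 0) (clT k 0) \<and> \<tau> a k 0 \<noteq> 0 \<or>
          clT k 1 < 2 \<and> mate n i = node n (nbT k 1) (clT k 1) \<and> \<tau> a k 1 \<noteq> 0)) else \<tau> t i j))"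
    if a: "tab1 \<tau>" "C \<tau> 0" "C \<tau> 1" and t: "a = 21 \<or> a = 22" "t = 30 \<or> t = 31" for \<tau> t a
    unfolding p_mark_def
  proof (rule fill_col)
    fix \<tau>' i assume i: "i < L" and ag: "agree {t, 5} \<tau>' \<tau>"
    note d = dart[OF a(1) _ _ _ _ ag t]
    show "ev (Conj (Lt (Var 5) two_n) (Exi 6 (Disj (dartE a 0) (dartE a 1)))) (put \<tau>' 5 0 0 i) = of_bool (i < 2 * n \<and>
       (\<exists>k<L. clT k 0 < 2 \<and> mate n i = node n (nbT k 0) (clT k 0) \<and> \<tau> a k 0 \<noteq> 0 \<or>
          clT k 1 < 2 \<and> mate n i = node n (nbT k 1) (clT k 1) \<and> \<tau> a k 1 \<noteq> 0))"
    proof (cases "i < 2 * n")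
      case True
      define h where "h k = ev (Disj (dartE a 0) (dartE a 1)) (put (put \<tau>' 5 0 0 i) 6 0 0 k)" for k
      have "h k =
        of_bool (clT k 0 < 2 \<and> mate n i = node n (nbT k 0) (clT k 0) \<and> \<tau> a k 0 \<noteq> 0 \<or>
          clT k 1 < 2 \<and> mate n i = node n (nbT k 1) (clT k 1) \<and> \<tau> a k 1 \<noteq> 0)" if "k < L" for k
        unfolding h_def ev_simps(3) d[OF a(2) disjI1[OF refl] that True] d[OF a(3) disjI2[OF refl] that True] by simp
      then have "(\<exists>k<L. h k \<noteq> 0) \<longleftrightarrow> (\<exists>k<L. clT k 0 < 2 \<and> mate n i = node n (nbT k 0) (clT k 0) \<and> \<tau> a k 0 \<noteq> 0 \<or>
          clT k 1 < 2 \<and> mate n i = node n (nbT k 1) (clT k 1) \<and> \<tau> a k 1 \<noteq> 0)" by (intro ex_cong1 conj_cong refl) (simp only: of_bool_eq_0_iff not_not)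
      moreover have "ev (Lt (Var 5) two_n) (put \<tau>' 5 0 0 i) = 1" using True lim_ge by simp
      ultimately show ?thesis unfolding ev_simps(2,4) h_def using True by (simp only:) simp
    next
      case False
      then have "ev (Lt (Var 5) two_n) (put \<tau>' 5 0 0 i) = 0" using lim_ge by simp
      then show ?thesis unfolding ev_simps(2) using False by simp
    qed
  qed (use t in auto)
  have X: "sem p_X \<tau> = \<tau>(27 := (\<lambda>i j. if i < L \<and> j = 0 then XT i else \<tau> 27 i j))"
    if a: "tab1 \<tau>" "C \<tau> 0" "C \<tau> 1" "RA \<tau>" for \<tau>
    unfolding p_X_def
  proof (rule fill_col)
    fix \<tau>' i assume i: "i < L" and ag: "agree {27, 5} \<tau>' \<tau>"
    have c: "clT i 0 < 2 \<Longrightarrow> nbT i 0 < n" "clT (i - n) 1 < 2 \<Longrightarrow> nbT (i - n) 1 < n" using clL by auto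
    have lt: "i - n < L" "i - 2 * n < L" "i - (n + n) < L" using i by auto
    show "ev (Ite (Lt (Var 5) NV) (Ite (liveE (Var 5)) (nodeE (nbE (Var 5) 0) (clE (Var 5) 0)) LimE)
     (Ite (Lt (Var 5) two_n) (Ite (liveE (Sub (Var 5) NV)) (nodeE (nbE (Sub (Var 5) NV) 1) (clE (Sub (Var 5) NV) 1)) LimE)
       (Ite (At 30 (Sub (Var 5) two_n)) two_n LimE))) (put \<tau>' 5 0 0 i) = XT i"
    proof -
      have ag': "\<tau>' 14 = \<tau> 14" "\<tau>' 26 = \<tau> 26" "\<tau>' 30 = \<tau> 30" using ag by auto
      have T: "k < L \<Longrightarrow> \<tau> 14 k 0 = nbT k 0" "k < L \<Longrightarrow> \<tau> 14 k (Suc 0) = nbT k 1" "k < L \<Longrightarrow> \<tau> 26 k 0 = clT k 0"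
        "k < L \<Longrightarrow> \<tau> 26 k (Suc 0) = clT k 1" "k < L \<Longrightarrow> (\<tau> 30 k 0 = 0) = (\<not> rootT k)" for k
        using a(1)[unfolded tab1_def] a(2-)[unfolded defs] by auto
      consider "i < n" | "\<not> i < n" "i < 2 * n" | "\<not> i < n" "\<not> i < 2 * n" by blast
      then show ?thesis
      proof cases
        case 1
        then show ?thesis using i c lim_ge by (cases "clT i 0 < 2") (simp_all add: B ag' T XT_def node_def min_absorb1)
      next
        case 2
        then show ?thesis using i lt c lim_ge by (cases "clT (i - n) 1 < 2") (simp_all add: B ag' T XT_def node_def min_absorb1)
      next
        case 3
        then show ?thesis using i lt lim_ge by (simp add: B ag' T XT_def min_absorb1 mult_2)
      qed
    qed
  qed auto
  \<comment> \<open>The computed head, with saturated additions; it agrees with \<open>YT\<close> at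
    all edges that are present.\<close>
  define y where "y k = (if k < n then if clT k 1 = 0 then nbT k 1 else min (nbT k 1 + n) L
     else if k < 2 * n then if clT (k - n) 0 = 0 then nbT (k - n) 0 else min (nbT (k - n) 0 + n) L else k - 2 * n)" for k
  have yY: "y k = YT k" if "XT k < L" for k
    using clL[of k 1] clL[of "k - n" 0] lim_ge that unfolding XT_def YT_def node_def y_def by (auto simp: min_def split: if_splits)
  have Y: "sem p_Y \<tau> = \<tau>(28 := (\<lambda>i j. if i < L \<and> j = 0 then y i else \<tau> 28 i j))"
    if a: "tab1 \<tau>" "C \<tau> 0" "C \<tau> 1" for \<tau>
    unfolding p_Y_def
  proof (rule fill_col)
    fix \<tau>' i assume i: "i < L" and ag: "agree {28, 5} \<tau>' \<tau>"
    have lt: "i - n < L" "i - 2 * n < L" using i by auto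
    have ag': "\<tau>' 14 = \<tau> 14" "\<tau>' 26 = \<tau> 26" using ag by auto
    have T: "k < L \<Longrightarrow> \<tau> 14 k 0 = nbT k 0" "k < L \<Longrightarrow> \<tau> 14 k (Suc 0) = nbT k 1" "k < L \<Longrightarrow> \<tau> 26 k 0 = clT k 0"
      "k < L \<Longrightarrow> \<tau> 26 k (Suc 0) = clT k 1" for k
      using a(1)[unfolded tab1_def] a(2-)[unfolded defs] by auto
    show "ev (Ite (Lt (Var 5) NV) (nodeE (nbE (Var 5) 1) (clE (Var 5) 1))
      (Ite (Lt (Var 5) two_n) (nodeE (nbE (Sub (Var 5) NV) 0) (clE (Sub (Var 5) NV) 0)) (Sub (Var 5) two_n))) (put \<tau>' 5 0 0 i) = y i"
      using i lt lim_ge by (simp add: B ag' T y_def min_absorb1 mult_2)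
  qed auto
  define z where "z \<tau> i = (if i < n then \<tau> 22 i 1 else \<tau> 22 (i - n) 0)" for \<tau> :: store and i
  have FX: "sem p_FX \<tau> = \<tau>(29 := (\<lambda>i j. if i < L \<and> j = 0 then z \<tau> i else \<tau> 29 i j))" for \<tau>
    unfolding p_FX_def z_def by (rule fill_col) (auto simp: B)
  have zF: "\<forall>i<L. (z \<tau> i = 0) = (\<not> FXT i)" if "FI \<tau> 0" "FI \<tau> 1" for \<tau>
    using that unfolding FXT_def z_def defs by auto
  define s1 where "s1 = sem (p_st 1) (sem (p_st 0) \<sigma>)"
  have s0: "tab1 (sem (p_st 0) \<sigma>)" using t t1[of "sem (p_st 0) \<sigma>" \<sigma>] st[OF t] by simp
  have s1: "tab1 s1 \<and> S s1 0 \<and> S s1 1"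
    using s0 t1[of s1 "sem (p_st 0) \<sigma>"] st[OF t] st[OF s0] unfolding s1_def defs by simp
  define s2 where "s2 = sem (p_fi 1) (sem (p_fi 0) s1)"
  have s0: "tab1 (sem (p_fi 0) s1)" using s1 t1[of "sem (p_fi 0) s1" s1] fi[of s1 0] by simp
  have s2: "tab1 s2 \<and> S s2 0 \<and> S s2 1 \<and> FI s2 0 \<and> FI s2 1"
    using s1 s0 t1[of s2 "sem (p_fi 0) s1"] fi[of s1 0] fi[OF s0, of 1] unfolding s2_def defs by simp
  define s3 where "s3 = sem (p_q 1) (sem (p_q 0) s2)"
  have s0: "tab1 (sem (p_q 0) s2)" using s2 t1[of "sem (p_q 0) s2" s2] q[of s2 0] by simp
  have s3: "tab1 s3 \<and> S s3 0 \<and> S s3 1 \<and> FI s3 0 \<and> FI s3 1 \<and> Q s3 0 \<and> Q s3 1"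
    using s2 s0 t1[of s3 "sem (p_q 0) s2"] q[of s2 0] q[OF s0, of 1] unfolding s3_def defs by simp
  define s4 where "s4 = sem p_rp s3"
  have s4: "tab1 s4 \<and> S s4 0 \<and> S s4 1 \<and> FI s4 0 \<and> FI s4 1 \<and> Q s4 0 \<and> Q s4 1 \<and> RP s4"
    using s3 t1[of s4 s3] rp[of s3] unfolding s4_def defs by simp
  define s5 where "s5 = sem p_rq s4"
  have s5: "tab1 s5 \<and> S s5 0 \<and> S s5 1 \<and> FI s5 0 \<and> FI s5 1 \<and> RP s5 \<and> RQ s5"
    using s4 t1[of s5 s4] rqs[of s4] gr[of s4] unfolding s5_def defs by simp
  define s6 where "s6 = sem (p_cl 1) (sem (p_cl 0) s5)"
  have s0: "tab1 (sem (p_cl 0) s5) \<and> S (sem (p_cl 0) s5) 1 \<and> FI (sem (p_cl 0) s5) 1 \<and> RP (sem (p_cl 0) s5) \<and> RQ (sem (p_cl 0) s5)"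
    using s5 t1[of "sem (p_cl 0) s5" s5] cl[of s5 0] unfolding defs by simp
  have s6: "tab1 s6 \<and> S s6 0 \<and> S s6 1 \<and> FI s6 0 \<and> FI s6 1 \<and> C s6 0 \<and> C s6 1"
    using s5 s0 t1[of s6 "sem (p_cl 0) s5"] cl[of s5 0] cl[of "sem (p_cl 0) s5" 1] unfolding s6_def defs by simp
  define s7 where "s7 = sem (p_mark 30 21) s6"
  have s7: "tab1 s7 \<and> FI s7 0 \<and> FI s7 1 \<and> C s7 0 \<and> C s7 1 \<and> RA s7"
    using s6 t1[of s7 s6] mark[of s6 21 30] unfolding s7_def defs rootT_def by simp
  define s8 where "s8 = sem (p_mark 31 22) s7"
  have s8: "tab1 s8 \<and> FI s8 0 \<and> FI s8 1 \<and> C s8 0 \<and> C s8 1 \<and> RA s8 \<and> FA s8"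
    using s7 t1[of s8 s7] mark[of s7 22 31] unfolding s8_def defs finT_def by simp
  define s9 where "s9 = sem p_FX (sem p_Y (sem p_X s8))"
  define sx where "sx = sem p_X s8"
  have sx: "tab1 sx \<and> FI sx 0 \<and> FI sx 1 \<and> C sx 0 \<and> C sx 1 \<and> FA sx \<and> (\<forall>k<L. sx 27 k 0 = XT k)"
    using s8 t1[of sx s8] X[of s8] unfolding sx_def defs by simp
  define sy where "sy = sem p_Y sx"
  have sy: "tab1 sy \<and> FI sy 0 \<and> FI sy 1 \<and> FA sy \<and> (\<forall>k<L. sy 27 k 0 = XT k) \<and> (\<forall>k<L. XT k < L \<longrightarrow> sy 28 k 0 = YT k)"
    using sx t1[of sy sx] Y[of sx] yY unfolding sy_def defs by simp
  have s9: "tab1 s9 \<and> FA s9 \<and> (\<forall>k<L. s9 27 k 0 = XT k) \<and> (\<forall>k<L. XT k < L \<longrightarrow> s9 28 k 0 = YT k) \<and> (\<forall>k<L. (s9 29 k 0 = 0) = (\<not> FXT k))"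
    using sy t1[of s9 sy] FX[of sy] zF[of sy] unfolding s9_def sx_def[symmetric] sy_def[symmetric] defs by simp
  have "sem (block p_edges) \<sigma> = s9"
    unfolding p_edges_def s9_def s8_def s7_def s6_def s5_def s4_def s3_def s2_def s1_def by simp
  then show ?thesis using s9 lim_ge unfolding tab2_def defs by auto
qed

end

section \<open>Paths in tables\<close>

definition scatter :: "nat \<Rightarrow> nat \<Rightarrow> nat \<Rightarrow> nat \<Rightarrow> cmd" where
  "scatter x t p l = For x (Iff (Lt (Var x) (Var l)) (Wr t (At p (Var x)) (Cst 0) (Add (Var x) (Cst 1))) Nop)"

text \<open>One more than the index, so that \<open>0\<close> can mean absence and the table doubles
  as a membership test.\<close>

definition pos :: "nat list \<Rightarrow> nat \<Rightarrow> nat" where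
  "pos xs e = (if e \<in> set xs then Suc (length (takeWhile (\<lambda>y. y \<noteq> e) xs)) else 0)"

lemma takeWhile_index: "distinct xs \<Longrightarrow> k < length xs \<Longrightarrow> length (takeWhile (\<lambda>y. y \<noteq> xs ! k) xs) = k"
proof (induction xs arbitrary: k)
  case (Cons x xs)
  then show ?case by (cases k) (auto simp: nth_Cons)
qed simp

lemma pos_nth: "distinct xs \<Longrightarrow> k < length xs \<Longrightarrow> pos xs (xs ! k) = Suc k"
  unfolding pos_def using takeWhile_index by simp

lemma length_dropWhile_pos: "e \<in> set xs \<Longrightarrow> length (dropWhile (\<lambda>y. y \<noteq> e) xs) = length xs - (pos xs e - 1)"
  unfolding pos_def dropWhile_eq_drop by simp

lemma least_before: "j < least L P \<Longrightarrow> \<not> P j"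
proof
  assume j: "j < least L P" "P j"
  then have "\<exists>k<L. P k" using least_le[of L P] by (intro exI[of _ j]) simp
  then have "least L P = (LEAST k. P k)" unfolding least_def by simp
  then show False using j not_less_Least[of j P] by simp
qed

text \<open>The base of a blossom is the last element of a filtered path; the program finds it as
  the first hit of a search from the back.\<close>

lemma last_filter:
  "length xs < L \<Longrightarrow> last (r # filter Q xs) =
     (let j = least L (\<lambda>j. j < length xs \<and> Q (xs ! (length xs - 1 - j))) in if j < L then xs ! (length xs - 1 - j) else r)"
  unfolding Let_def
proof (induction xs rule: rev_induct)
  case Nil
  have "least L (\<lambda>j. j < length [] \<and> Q ([] ! (length [] - 1 - j))) = L" by (rule least_none) simp
  then show ?case by simp
next
  case (snoc x xs)
  let ?P = "\<lambda>xs j. j < length xs \<and> Q (xs ! (length xs - 1 - j))"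
  show ?case
  proof (cases "Q x")
    case True
    have "least L (?P (xs @ [x])) = 0" by (rule least_eq) (use True snoc in auto)
    then show ?thesis using True snoc by simp
  next
    case False
    have S: "?P (xs @ [x]) (Suc j) = ?P xs j" for j by (auto simp: nth_append)
    have Z: "\<not> ?P (xs @ [x]) 0" using False by simp
    show ?thesis
    proof (cases "least L (?P xs) < L")
      case True
      define i where "i = least L (?P xs)"
      have i: "?P xs i" "\<And>j. j < i \<Longrightarrow> \<not> ?P xs j" using least_prop[OF True] least_before
        unfolding i_def by blast+
      have "least L (?P (xs @ [x])) = Suc i"
      proof (rule least_eq)
        show "Suc i < L" using i(1) snoc by simp
        show "?P (xs @ [x]) (Suc i)" using i(1) S[of i] by blast
        show "\<not> ?P (xs @ [x]) j" if "j < Suc i" for j using that S[of "j - 1"] Z i(2)[of "j - 1"] by (cases j) auto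
      qed
      then show ?thesis using snoc False True i unfolding i_def[symmetric] by (auto simp: nth_append)
    next
      case F: False
      then have "\<not> ?P xs j" if "j < L" for j using that least_less by blast
      then have N: "\<not> ?P (xs @ [x]) j" if "j < L" for j using that S[of "j - 1"] Z by (cases j) auto
      have "least L (?P (xs @ [x])) = L" by (rule least_none) (use N in blast)
      then show ?thesis using snoc False F by simp
    qed
  qed
qed

fun reads :: "expr \<Rightarrow> nat set" where
  "reads (Rd a e f) = insert a (reads e \<union> reads f)"
| "reads (Ad e f) = reads e \<union> reads f"
| "reads (Add e f) = reads e \<union> reads f"
| "reads (Sub e f) = reads e \<union> reads f"
| "reads (Eq e f) = reads e \<union> reads f"
| "reads (Lt e f) = reads e \<union> reads f"
| "reads (Ite b e f) = reads b \<union> reads e \<union> reads f"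
| "reads (Lst x e) = reads e"
| "reads _ = {}"

definition p_pos :: "nat \<Rightarrow> nat \<Rightarrow> nat \<Rightarrow> cmd" where
  "p_pos t p l = Sq (fill 5 t (Cst 0) (Cst 0)) (scatter 5 t p l)"

context prog
begin

declare ev_node(1) [simp del]

lemma ev_mate: "ev e \<sigma> < 2 * n \<Longrightarrow> ev (mateE e) \<sigma> = mate n (ev e \<sigma>)"
  unfolding ev_node mate_def using lim_ge by (auto simp: min_def)

lemma restore:
  assumes "agree {a, x} \<tau> \<sigma>" "\<tau> x = (\<sigma> x)(0 := (\<sigma> x 0)(0 := v))" "a \<noteq> x"
  shows "put \<tau> x 0 0 (\<sigma> x 0 0) = \<sigma>(a := \<tau> a)"
  using assms by (auto simp: put_def fun_eq_iff)

lemma fill_self: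
  assumes ax: "a \<noteq> x"
    and c: "\<And>\<tau> i. agree {a, x} \<tau> \<sigma> \<Longrightarrow> ev ce (put \<tau> x 0 0 i) = c"
    and f: "\<And>\<tau> i. agree {a, x} \<tau> \<sigma> \<Longrightarrow> \<tau> a i = \<sigma> a i \<Longrightarrow> put \<tau> x 0 0 i x = put \<sigma> x 0 0 i x \<Longrightarrow>
      ev e (put \<tau> x 0 0 i) = ev e (put \<sigma> x 0 0 i)"
  shows "sem (fill x a ce e) \<sigma> = \<sigma>(a := (\<lambda>i j. if i < L \<and> j = c then ev e (put \<sigma> x 0 0 i) else \<sigma> a i j))"
  by (rule sem_fill[OF ax c f])

lemma ev_reads: "\<forall>a\<in>reads e. \<sigma> a = \<tau> a \<Longrightarrow> ev e \<sigma> = ev e \<tau>"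
proof (induction e arbitrary: \<sigma> \<tau>)
  case (Lst x e)
  have "ev e (put \<sigma> x 0 0 k) = ev e (put \<tau> x 0 0 k)" for k
    by (rule Lst.IH) (use Lst.prems in \<open>auto simp: put_def\<close>)
  then show ?case by simp
next
  case (Ite b e f)
  show ?case using Ite.IH[of \<sigma> \<tau>] Ite.prems by simp
next
  case (Rd a e f)
  show ?case using Rd.IH[of \<sigma> \<tau>] Rd.prems by simp
next
  case (Ad e f)
  show ?case using Ad.IH[of \<sigma> \<tau>] Ad.prems by simp
next
  case (Add e f)
  show ?case using Add.IH[of \<sigma> \<tau>] Add.prems by simp
next
  case (Sub e f)
  show ?case using Sub.IH[of \<sigma> \<tau>] Sub.prems by simp
next
  case (Eq e f)
  show ?case using Eq.IH[of \<sigma> \<tau>] Eq.prems by simp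
next
  case (Lt e f)
  show ?case using Lt.IH[of \<sigma> \<tau>] Lt.prems by simp
qed auto

text \<open>The form of an update that retains old entries under the guard \<open>g\<close> and
  computes the others: it reads the table being written only in the current row.\<close>

lemma fill_keep:
  assumes u: "u \<noteq> x" "u \<noteq> g" "g \<noteq> x" "u \<notin> reads e"
  shows "sem (fill x u (Cst 0) (Ite (At g (Var x)) (At u (Var x)) e)) \<sigma> =
    \<sigma>(u := (\<lambda>i j. if i < L \<and> j = 0 then ev (Ite (At g (Var x)) (At u (Var x)) e) (put \<sigma> x 0 0 i) else \<sigma> u i j))"
proof (rule fill_self[OF u(1)])
  show "ev (Cst 0) (put \<tau> x 0 0 i) = 0" for \<tau> i by simp
  fix \<tau> i assume ag: "agree {u, x} \<tau> \<sigma>" and row: "\<tau> u i = \<sigma> u i" and x: "put \<tau> x 0 0 i x = put \<sigma> x 0 0 i x"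
  have "ev e (put \<tau> x 0 0 i) = ev e (put \<sigma> x 0 0 i)"
  proof (rule ev_reads, rule ballI)
    show "put \<tau> x 0 0 i a = put \<sigma> x 0 0 i a" if "a \<in> reads e" for a
      using x ag u(4) that by (cases "a = x") (auto simp: put_other)
  qed
  then show "ev (Ite (At g (Var x)) (At u (Var x)) e) (put \<tau> x 0 0 i) = ev (Ite (At g (Var x)) (At u (Var x)) e) (put \<sigma> x 0 0 i)"
    using ag row u by (simp add: put_other)
qed

lemma sem_scatter:
  assumes d: "t \<noteq> x" "p \<noteq> x" "l \<noteq> x" "p \<noteq> t" "l \<noteq> t" and xs: "distinct xs" "length xs < L"
    and l: "\<sigma> l 0 0 = length xs" and p: "\<And>k. k < length xs \<Longrightarrow> \<sigma> p k 0 = xs ! k"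
  shows "\<exists>g. sem (scatter x t p l) \<sigma> = \<sigma>(t := g) \<and> (\<forall>k<length xs. g (xs ! k) 0 = Suc k) \<and> (\<forall>i. i \<notin> set xs \<longrightarrow> g i 0 = \<sigma> t i 0)"
  unfolding scatter_def
proof (rule sem_For[where I = "\<lambda>k \<tau>. agree {t, x} \<tau> \<sigma> \<and> (\<exists>v. \<tau> x = (\<sigma> x)(0 := (\<sigma> x 0)(0 := v))) \<and>
    (\<forall>j<length xs. j < k \<longrightarrow> \<tau> t (xs ! j) 0 = Suc j) \<and> (\<forall>i. i \<notin> set xs \<longrightarrow> \<tau> t i 0 = \<sigma> t i 0)"], goal_cases)
  case 1
  show ?case by (auto intro!: exI[of _ "\<sigma> x 0 0"])
next
  case (2 k \<tau>)
  then obtain v where v: "\<tau> x = (\<sigma> x)(0 := (\<sigma> x 0)(0 := v))" by blast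
  have ag: "\<tau> l = \<sigma> l" "\<tau> p = \<sigma> p" using 2 d by auto
  define \<tau>' where "\<tau>' = sem (Iff (Lt (Var x) (Var l)) (Wr t (At p (Var x)) (Cst 0) (Add (Var x) (Cst 1))) Nop) (put \<tau> x 0 0 k)"
  have \<tau>': "\<tau>' = (if k < length xs then put (put \<tau> x 0 0 k) t (xs ! k) 0 (Suc k) else put \<tau> x 0 0 k)"
  proof (cases "k < length xs")
    case True
    then have "Suc k \<le> L" using xs by simp
    then show ?thesis using True ag d l p[OF True] unfolding \<tau>'_def by (simp add: put_other)
  next
    case False
    then show ?thesis using ag d l unfolding \<tau>'_def by (simp add: put_other)
  qed
  have "agree {t, x} \<tau>' \<sigma>" using 2 unfolding \<tau>' by (auto simp: put_def)
  moreover have "\<tau>' x = (\<sigma> x)(0 := (\<sigma> x 0)(0 := k))" using v d unfolding \<tau>' by (auto simp: put_def)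
  moreover have "\<tau>' t (xs ! j) 0 = Suc j" if "j < length xs" "j < Suc k" for j
    using 2 that d nth_eq_iff_index_eq[OF xs(1), of j k] unfolding \<tau>' by (cases "j = k") (auto simp: put_def)
  moreover have "\<tau>' t i 0 = \<sigma> t i 0" if "i \<notin> set xs" for i
    using 2 that d unfolding \<tau>' by (auto simp: put_def)
  ultimately show ?case unfolding \<tau>'_def by blast
next
  case (3 \<tau>)
  then obtain v where "\<tau> x = (\<sigma> x)(0 := (\<sigma> x 0)(0 := v))" by blast
  then have "put \<tau> x 0 0 (\<sigma> x 0 0) = \<sigma>(t := \<tau> t)" using 3 d by (intro restore) auto
  then show ?case using 3 xs(2) by (intro exI[of _ "\<tau> t"]) auto
qed

lemma sem_pos:
  assumes d: "t \<noteq> 5" "p \<noteq> 5" "l \<noteq> 5" "p \<noteq> t" "l \<noteq> t" and xs: "distinct xs" "length xs < L" "set xs \<subseteq> {..<L}"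
    and l: "\<sigma> l 0 0 = length xs" and p: "\<And>k. k < length xs \<Longrightarrow> \<sigma> p k 0 = xs ! k"
  shows "\<exists>g. sem (p_pos t p l) \<sigma> = \<sigma>(t := g) \<and> (\<forall>i<L. g i 0 = pos xs i)"
proof -
  have 1: "sem (fill 5 t (Cst 0) (Cst 0)) \<sigma> = \<sigma>(t := (\<lambda>i j. if i < L \<and> j = 0 then 0 else \<sigma> t i j))" (is "_ = ?s")
    by (rule fill_col) (use d in auto)
  obtain g where g: "sem (scatter 5 t p l) ?s = ?s(t := g)" "\<forall>k<length xs. g (xs ! k) 0 = Suc k"
      "\<forall>i. i \<notin> set xs \<longrightarrow> g i 0 = ?s t i 0"
    using sem_scatter[OF d xs(1,2), of ?s] l p d by auto
  have "g i 0 = pos xs i" if "i < L" for i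
  proof (cases "i \<in> set xs")
    case True
    then obtain k where "k < length xs" "i = xs ! k" by (metis in_set_conv_nth)
    then show ?thesis using g(2) pos_nth[OF xs(1)] by simp
  next
    case False
    then show ?thesis using g(3) that unfolding pos_def by simp
  qed
  then show ?thesis unfolding p_pos_def using 1 g(1) by auto
qed

end

text \<open>Tables of the search: 32 \<open>Z\<close>; 33 the bases; the path of a node has length 34 and is stored in column
  35 of table 37 or 38, selected by 36. The step number is kept in 45.\<close>

abbreviation pathE :: "expr \<Rightarrow> expr \<Rightarrow> expr" where
  "pathE e k \<equiv> Ite (At 36 e) (Rd 38 k (At 35 e)) (Rd 37 k (At 35 e))"

definition newE :: "nat \<Rightarrow> nat \<Rightarrow> expr \<Rightarrow> expr" where
  "newE a b e = Conj (At a e) (Conj (Neg (At b e)) (Neg (At 32 (mateE e))))"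

text \<open>Entry number 5 of the path in \<open>q\<close> followed by the mates of the path in
  \<open>p\<close> in reverse order; tables \<open>l\<close> and \<open>m\<close> hold the two
  lengths.\<close>

definition turnE :: "nat \<Rightarrow> nat \<Rightarrow> nat \<Rightarrow> nat \<Rightarrow> expr" where
  "turnE p l q m = Ite (Lt (Var 5) (Var m)) (At q (Var 5))
     (mateE (At p (Sub (Sub (Var l) (Cst 1)) (Sub (Var 5) (Var m)))))"

definition p_ends :: "cmd list" where
  "p_ends = [Set 41 (At 27 (Var 44)), Set 42 (At 28 (Var 44)), Set 53 (At 34 (Var 41)), Set 54 (At 34 (Var 42)),
     fill 5 51 (Cst 0) (pathE (Var 41) (Var 5)), fill 5 52 (Cst 0) (pathE (Var 42) (Var 5)),
     p_pos 39 51 53, p_pos 40 52 54]"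

definition p_turn :: "cmd list" where
  "p_turn = [Set 55 (Lst 6 (Conj (Lt (Var 6) (Var 53)) (Conj (At 40 (At 51 (Sub (Sub (Var 53) (Cst 1)) (Var 6))))
       (Neg (At 32 (mateE (At 51 (Sub (Sub (Var 53) (Cst 1)) (Var 6))))))))),
     Set 43 (Ite (Lt (Var 55) LimE) (At 51 (Sub (Sub (Var 53) (Cst 1)) (Var 55))) two_n),
     fill 5 37 (Var 45) (turnE 51 53 52 54),
     fill 5 38 (Var 45) (turnE 52 54 51 53)]"

definition p_update :: "cmd list" where
  "p_update = [fill 5 33 (Cst 0) (Ite (Conj (At 32 (Var 5)) (Neg (Disj (newE 39 40 (At 33 (Var 5))) (newE 40 39 (At 33 (Var 5))))))
       (At 33 (Var 5)) (Var 43)),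
     fill 5 34 (Cst 0) (Ite (At 32 (Var 5)) (At 34 (Var 5)) (Ite (newE 39 40 (mateE (Var 5)))
       (Add (Var 54) (Sub (Var 53) (Sub (At 39 (mateE (Var 5))) (Cst 1))))
       (Add (Var 53) (Sub (Var 54) (Sub (At 40 (mateE (Var 5))) (Cst 1)))))),
     fill 5 35 (Cst 0) (Ite (At 32 (Var 5)) (At 35 (Var 5)) (Var 45)),
     fill 5 36 (Cst 0) (Ite (At 32 (Var 5)) (At 36 (Var 5)) (Ite (newE 39 40 (mateE (Var 5))) (Cst 0) (Cst 1))),
     fill 5 32 (Cst 0) (Disj (At 32 (Var 5)) (Conj (Lt (Var 5) two_n) (Disj (newE 39 40 (mateE (Var 5))) (newE 40 39 (mateE (Var 5))))))]"

definition p_grow :: "cmd list" where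
  "p_grow = [Set 41 (At 27 (Var 44)), Set 42 (mateE (At 28 (Var 44))), Set 53 (At 34 (Var 41)),
     fill 5 51 (Cst 0) (pathE (Var 41) (Var 5)),
     fill 5 37 (Var 45) (Ite (Lt (Var 5) (Var 53)) (At 51 (Var 5)) (Var 42)),
     Wr 33 (Var 42) (Cst 0) (Var 42), Wr 34 (Var 42) (Cst 0) (Add (Var 53) (Cst 1)), Wr 35 (Var 42) (Cst 0) (Var 45),
     Wr 36 (Var 42) (Cst 0) (Cst 0), Wr 32 (Var 42) (Cst 0) (Cst 1)]"

definition pathv :: "store \<Rightarrow> nat \<Rightarrow> nat \<Rightarrow> nat" where
  "pathv \<sigma> e k = (if \<sigma> 36 e 0 = 0 then \<sigma> 37 k (\<sigma> 35 e 0) else \<sigma> 38 k (\<sigma> 35 e 0))"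

context prog_stuck
begin

text \<open>Paths recorded before step \<open>t\<close> lie in columns below \<open>t\<close>. A
  step writes column \<open>t\<close> only, so it cannot damage them.\<close>

definition state :: "nat \<Rightarrow> store \<Rightarrow> nat set \<Rightarrow> (nat \<Rightarrow> nat list) \<Rightarrow> (nat \<Rightarrow> nat) \<Rightarrow> bool" where
  "state t \<sigma> Z P base \<longleftrightarrow> tab2 \<sigma> \<and> inv Z P base \<and> (\<forall>e<L. (\<sigma> 32 e 0 = 0) = (e \<notin> Z)) \<and>
     (\<forall>e\<in>Z. \<sigma> 33 e 0 = base e \<and> \<sigma> 34 e 0 = length (P e) \<and> (P e \<noteq> [] \<longrightarrow> \<sigma> 35 e 0 < t) \<and>
       (\<forall>k<length (P e). pathv \<sigma> e k = P e ! k))"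

lemma tab2_cong: "(\<And>a. a < 32 \<Longrightarrow> \<sigma>' a = \<sigma> a) \<Longrightarrow> tab2 \<sigma>' = tab2 \<sigma>"
  unfolding tab2_def tab1_def input_def by simp

lemma stateD:
  assumes s: "state t \<sigma> Z P base"
  shows "tab2 \<sigma>" "inv Z P base" "e < L \<Longrightarrow> (\<sigma> 32 e 0 = 0) = (e \<notin> Z)"
    "e \<in> Z \<Longrightarrow> \<sigma> 33 e 0 = base e" "e \<in> Z \<Longrightarrow> \<sigma> 34 e 0 = length (P e)" "e \<in> Z \<Longrightarrow> P e \<noteq> [] \<Longrightarrow> \<sigma> 35 e 0 < t"
    "e \<in> Z \<Longrightarrow> k < length (P e) \<Longrightarrow> pathv \<sigma> e k = P e ! k"
  using s unfolding state_def by simp_all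

lemma state_bounds:
  assumes s: "state t \<sigma> Z P base" and e: "e \<in> Z"
  shows "e \<le> 2 * n" "e < L" "length (P e) \<le> 2 * n" "distinct (P e)" "x \<in> set (P e) \<Longrightarrow> x < 2 * n"
proof -
  note i = stateD(2)[OF s]
  show "e \<le> 2 * n" using inv_facts(2)[OF i] e by auto
  then show "e < L" using lim_ge by simp
  show d: "distinct (P e)" using inv_path(4)[OF i e] .
  have x: "set (P e) \<subseteq> {..<2 * n}" using inv_path(2)[OF i e] .
  then show "x \<in> set (P e) \<Longrightarrow> x < 2 * n" by auto
  have "length (P e) = card (set (P e))" using distinct_card[OF d] by simp
  also have "\<dots> \<le> card {..<2 * n}" using x by (intro card_mono) auto
  finally show "length (P e) \<le> 2 * n" by simp
qed

lemma grow_step: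
  assumes s: "state t \<sigma> Z P base" and k: "\<sigma> 44 0 0 = k" "\<sigma> 45 0 0 = t" "k < L" "XT k < L" and a: "XT k \<in> Z"
    and b: "YT k \<notin> Z" "mate n (YT k) \<notin> Z"
  defines "c \<equiv> mate n (YT k)"
  shows "state (Suc t) (sem (block p_grow) \<sigma>) (insert c Z) (P(c := P (XT k) @ [c])) (base(c := c))"
proof -
  note S = stateD[OF s]
  have k4: "k < 4 * n" using X_dead[of k] k by (cases "k < 4 * n") auto
  have Y: "YT k < 2 * n" using Y_lt[OF k4 k(4)] by simp
  then have c: "c < 2 * n" unfolding c_def using node_simps(7) by blast
  have F: "adjF (XT k) (YT k)" unfolding adjF_X using k4 k(4) by blast
  let ?la = "length (P (XT k))"
  have T: "\<sigma> 27 k 0 = XT k" "\<sigma> 28 k 0 = YT k" using S(1) k unfolding tab2_def by auto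
  have la: "\<sigma> 34 (XT k) 0 = ?la" "?la \<le> 2 * n" using S(5) state_bounds(3)[OF s] a by auto
  define s1 where "s1 = sem (block [Set 41 (At 27 (Var 44)), Set 42 (mateE (At 28 (Var 44))), Set 53 (At 34 (Var 41))]) \<sigma>"
  have s1: "s1 41 0 0 = XT k" "s1 42 0 0 = c" "s1 53 0 0 = ?la" "\<And>a. a \<noteq> 41 \<Longrightarrow> a \<noteq> 42 \<Longrightarrow> a \<noteq> 53 \<Longrightarrow> s1 a = \<sigma> a"
    unfolding s1_def using k(1) T la Y unfolding c_def by (simp_all add: put_def ev_mate)
  define s2 where "s2 = s1(51 := (\<lambda>i j. if i < L \<and> j = 0 then pathv \<sigma> (XT k) i else s1 51 i j))"
  have 2: "sem (fill 5 51 (Cst 0) (pathE (Var 41) (Var 5))) s1 = s2"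
    unfolding s2_def by (rule fill_col) (auto simp: put_def s1 pathv_def)
  define s3 where "s3 = s2(37 := (\<lambda>i j. if i < L \<and> j = t then if i < ?la then P (XT k) ! i else c else s2 37 i j))"
  have 3: "sem (fill 5 37 (Var 45) (Ite (Lt (Var 5) (Var 53)) (At 51 (Var 5)) (Var 42))) s2 = s3"
    unfolding s3_def
  proof (rule sem_fill)
    fix \<tau> i assume ag: "agree {37, 5} \<tau> s2"
    show "ev (Var 45) (put \<tau> 5 0 0 i) = t" using ag k(2) by (simp add: put_def s2_def s1)
    assume i: "i < L"
    show "ev (Ite (Lt (Var 5) (Var 53)) (At 51 (Var 5)) (Var 42)) (put \<tau> 5 0 0 i) = (if i < ?la then P (XT k) ! i else c)"
      using ag i S(7)[OF a] by (simp add: put_def s2_def s1)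
  qed simp
  define s4 where "s4 = sem (block p_grow) \<sigma>"
  have s4: "s4 = put (put (put (put (put s3 33 c 0 c) 34 c 0 (Suc ?la)) 35 c 0 t) 36 c 0 0) 32 c 0 1"
  proof -
    have "s4 = sem (block [Wr 33 (Var 42) (Cst 0) (Var 42), Wr 34 (Var 42) (Cst 0) (Add (Var 53) (Cst 1)), Wr 35 (Var 42) (Cst 0) (Var 45),
     Wr 36 (Var 42) (Cst 0) (Cst 0), Wr 32 (Var 42) (Cst 0) (Cst 1)]) s3"
      using 2 3 unfolding s4_def p_grow_def s1_def by simp
    moreover have "s3 42 0 0 = c" "s3 53 0 0 = ?la" "s3 45 0 0 = t" using k(2) by (simp_all add: s3_def s2_def s1)
    ultimately show ?thesis using la lim_ge by (simp add: put_other min_absorb1)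
  qed
  have old: "s4 u = \<sigma> u" if "u < 32" for u unfolding s4 using that by (auto simp: put_other s3_def s2_def s1)
  have "tab2 s4" using tab2_cong[of s4 \<sigma>] old S(1) by blast
  moreover have "inv (insert c Z) (P(c := P (XT k) @ [c])) (base(c := c))"
    unfolding c_def by (rule inv_grow[OF S(2) a F]) (use Y b in auto)
  moreover have "(s4 32 e 0 = 0) = (e \<notin> insert c Z)" if "e < L" for e
    unfolding s4 using S(3)[OF that] by (simp add: put_def s3_def s2_def s1)
  moreover have "s4 33 e 0 = (base(c := c)) e \<and> s4 34 e 0 = length ((P(c := P (XT k) @ [c])) e) \<and>
      ((P(c := P (XT k) @ [c])) e \<noteq> [] \<longrightarrow> s4 35 e 0 < Suc t) \<and>
      (\<forall>l<length ((P(c := P (XT k) @ [c])) e). pathv s4 e l = (P(c := P (XT k) @ [c])) e ! l)" if e: "e \<in> insert c Z" for e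
  proof (cases "e = c")
    case True
    have "pathv s4 c l = (P (XT k) @ [c]) ! l" if "l < Suc ?la" for l
    proof -
      have "l < L" using that la lim_ge by simp
      then show ?thesis using that unfolding pathv_def s4 by (simp add: put_def s3_def nth_append)
    qed
    moreover have "s4 33 c 0 = c" "s4 34 c 0 = Suc ?la" "s4 35 c 0 = t" unfolding s4 by (simp_all add: put_def)
    ultimately show ?thesis using True by simp
  next
    case False
    then have eZ: "e \<in> Z" using e by simp
    have v: "s4 33 e 0 = \<sigma> 33 e 0" "s4 34 e 0 = \<sigma> 34 e 0" "s4 35 e 0 = \<sigma> 35 e 0" "s4 36 e 0 = \<sigma> 36 e 0"
      using False unfolding s4 by (simp_all add: put_def s3_def s2_def s1)
    have "pathv s4 e l = P e ! l" if "l < length (P e)" for l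
    proof -
      have "P e \<noteq> []" using that by auto
      then have "\<sigma> 35 e 0 \<noteq> t" using S(6)[OF eZ] by simp
      then have "pathv s4 e l = pathv \<sigma> e l" unfolding pathv_def v unfolding s4 by (simp add: put_def s3_def s2_def s1)
      then show ?thesis using S(7)[OF eZ that] by simp
    qed
    then show ?thesis using False v S(4,5)[OF eZ] S(6)[OF eZ] by auto
  qed
  ultimately show ?thesis unfolding state_def s4_def by blast
qed

text \<open>Every new path is a prefix of the path of \<open>b\<close> followed by the turned path
  of \<open>a\<close>, or of the same with \<open>a\<close> and \<open>b\<close> exchanged. Both
  sequences are written once into column \<open>t\<close>, and a new node merely stores which one it
  uses and a length, so the step takes linear time.\<close>

lemma blossom_step:
  assumes s: "state t \<sigma> Z P base" and k: "\<sigma> 44 0 0 = k" "\<sigma> 45 0 0 = t" "k < L" "XT k < L" and aZ: "XT k \<in> Z" and bZ: "YT k \<in> Z"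
  defines "a \<equiv> XT k" and "b \<equiv> YT k"
  shows "state (Suc t) (sem (block (p_ends @ p_turn @ p_update)) \<sigma>) (bZ Z P a b) (bP Z P a b) (bbase Z P base a b)"
proof -
  note S = stateD[OF s]
  note i = S(2)
  have a: "a \<in> Z" and b: "b \<in> Z" using aZ bZ unfolding a_def b_def by auto
  have k4: "k < 4 * n" using X_dead[of k] k by (cases "k < 4 * n") auto
  have F: "adjF a b" unfolding adjF_X a_def b_def using k4 k(4) by blast
  define la lb where "la = length (P a)" and "lb = length (P b)"
  have T: "\<sigma> 27 k 0 = a" "\<sigma> 28 k 0 = b" using S(1) k unfolding tab2_def a_def b_def by auto
  have la: "\<sigma> 34 a 0 = la" "la \<le> 2 * n" "\<sigma> 34 b 0 = lb" "lb \<le> 2 * n"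
    using S(5) state_bounds(3)[OF s] a b unfolding la_def lb_def by auto
  note Pa = state_bounds(4,5)[OF s a] and Pb = state_bounds(4,5)[OF s b]
  have Pan: "P a ! l < 2 * n" if "l < la" for l using Pa(2) that unfolding la_def by simp
  have Pbn: "P b ! l < 2 * n" if "l < lb" for l using Pb(2) that unfolding lb_def by simp
  define s1 where "s1 = sem (block [Set 41 (At 27 (Var 44)), Set 42 (At 28 (Var 44)), Set 53 (At 34 (Var 41)), Set 54 (At 34 (Var 42))]) \<sigma>"
  have s1: "s1 41 0 0 = a" "s1 42 0 0 = b" "s1 53 0 0 = la" "s1 54 0 0 = lb"
    "\<And>u. u \<noteq> 41 \<Longrightarrow> u \<noteq> 42 \<Longrightarrow> u \<noteq> 53 \<Longrightarrow> u \<noteq> 54 \<Longrightarrow> s1 u = \<sigma> u"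
    unfolding s1_def using k(1) T la by (simp_all add: put_def)
  define s2 where "s2 = s1(51 := (\<lambda>i j. if i < L \<and> j = 0 then pathv \<sigma> a i else s1 51 i j))"
  have 2: "sem (fill 5 51 (Cst 0) (pathE (Var 41) (Var 5))) s1 = s2"
    unfolding s2_def by (rule fill_col) (auto simp: put_def s1 pathv_def)
  define s3 where "s3 = s2(52 := (\<lambda>i j. if i < L \<and> j = 0 then pathv \<sigma> b i else s2 52 i j))"
  have 3: "sem (fill 5 52 (Cst 0) (pathE (Var 42) (Var 5))) s2 = s3"
    unfolding s3_def by (rule fill_col) (auto simp: put_def s2_def s1 pathv_def)
  have lL: "la < L" "lb < L" using la lim_ge by auto
  have sub: "set (P a) \<subseteq> {..<L}" "set (P b) \<subseteq> {..<L}" using Pa(2) Pb(2) lim_ge by force+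
  have pa: "s3 51 l 0 = P a ! l" if "l < la" for l
    using S(7)[OF a, of l] that lL unfolding s3_def s2_def la_def by simp
  have pb: "s3 52 l 0 = P b ! l" if "l < lb" for l
    using S(7)[OF b, of l] that lL unfolding s3_def lb_def by simp
  have l3: "s3 53 0 0 = la" "s3 54 0 0 = lb" unfolding s3_def s2_def by (simp_all add: s1)
  have "\<exists>g. sem (p_pos 39 51 53) s3 = s3(39 := g) \<and> (\<forall>i<L. g i 0 = pos (P a) i)"
    by (rule sem_pos) (use pa l3 lL Pa sub in \<open>auto simp: la_def\<close>)
  then obtain gA where gA: "sem (p_pos 39 51 53) s3 = s3(39 := gA)" "\<forall>i<L. gA i 0 = pos (P a) i" by blast
  define s4 where "s4 = s3(39 := gA)"
  have "\<exists>g. sem (p_pos 40 52 54) s4 = s4(40 := g) \<and> (\<forall>i<L. g i 0 = pos (P b) i)"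
    by (rule sem_pos) (use pb l3 lL Pb sub in \<open>auto simp: lb_def s4_def\<close>)
  then obtain gB where gB: "sem (p_pos 40 52 54) s4 = s4(40 := gB)" "\<forall>i<L. gB i 0 = pos (P b) i" by blast
  define s5 where "s5 = s4(40 := gB)"
  have 5: "sem (block p_ends) \<sigma> = s5"
    unfolding p_ends_def s5_def using 2 3 gA(1) gB(1) unfolding s4_def[symmetric] s1_def by simp
  have old5: "s5 u = \<sigma> u" if "u < 39 \<or> u = 45" for u
    using that unfolding s5_def s4_def s3_def s2_def by (auto simp: s1)
  have pa5: "s5 51 l 0 = P a ! l" if "l < la" for l using pa[OF that] unfolding s5_def s4_def by simp
  have pb5: "s5 52 l 0 = P b ! l" if "l < lb" for l using pb[OF that] unfolding s5_def s4_def by simp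
  have l5: "s5 53 0 0 = la" "s5 54 0 0 = lb" "s5 45 0 0 = t" using l3 old5[of 45] k(2) unfolding s5_def s4_def by simp_all
  have on: "e < L \<Longrightarrow> s5 39 e 0 = pos (P a) e" "e < L \<Longrightarrow> s5 40 e 0 = pos (P b) e" for e
    using gA gB unfolding s5_def s4_def by simp_all
  have Z5: "e < L \<Longrightarrow> (s5 32 e 0 = 0) = (e \<notin> Z)" for e using S(3) old5[of 32] by simp
  define \<pi> where "\<pi> = common Z P a b"
  \<comment> \<open>The distance of the blossom base from the end of the path of
    \<open>a\<close>.\<close>
  define j where "j = least L (\<lambda>j. j < la \<and> mate n (P a ! (la - 1 - j)) \<notin> Z \<and> P a ! (la - 1 - j) \<in> set (P b))"
  have \<pi>: "\<pi> = (if j < L then P a ! (la - 1 - j) else 2 * n)"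
    unfolding \<pi>_def common_def[OF i] using last_filter[of "P a" L "2 * n" "\<lambda>e. mate n e \<notin> Z \<and> e \<in> set (P b)"] lL
    unfolding la_def[symmetric] Let_def j_def by simp
  have jla: "j < L \<Longrightarrow> j < la" using least_prop[of L "\<lambda>j. j < la \<and> mate n (P a ! (la - 1 - j)) \<notin> Z \<and> P a ! (la - 1 - j) \<in> set (P b)"]
    unfolding j_def by blast
  have ZnL: "e < 2 * n \<Longrightarrow> mate n e < L" for e using node_simps(7)[of e n] lim_ge by simp
  have eLst: "ev (Lst 6 (Conj (Lt (Var 6) (Var 53)) (Conj (At 40 (At 51 (Sub (Sub (Var 53) (Cst 1)) (Var 6))))
       (Neg (At 32 (mateE (At 51 (Sub (Sub (Var 53) (Cst 1)) (Var 6))))))))) s5 = j"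
  proof -
    have "(ev (Conj (Lt (Var 6) (Var 53)) (Conj (At 40 (At 51 (Sub (Sub (Var 53) (Cst 1)) (Var 6))))
       (Neg (At 32 (mateE (At 51 (Sub (Sub (Var 53) (Cst 1)) (Var 6)))))))) (put s5 6 0 0 m) \<noteq> 0) =
      (m < la \<and> mate n (P a ! (la - 1 - m)) \<notin> Z \<and> P a ! (la - 1 - m) \<in> set (P b))" for m
    proof (cases "m < la")
      case True
      have *: "P a ! (la - 1 - m) < 2 * n" "la - 1 - m < la" using Pan[of "la - 1 - m"] True by auto
      have "P a ! (la - 1 - m) < L" using * lim_ge by simp
      then have "s5 40 (P a ! (la - 1 - m)) 0 = pos (P b) (P a ! (la - 1 - m))" using on(2) by simp
      moreover have "s5 51 (la - 1 - m) 0 = P a ! (la - 1 - m)" using pa5 * by simp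
      moreover have "(s5 32 (mate n (P a ! (la - 1 - m))) 0 = 0) = (mate n (P a ! (la - 1 - m)) \<notin> Z)" using Z5 ZnL * by blast
      ultimately show ?thesis using True * l5(1) by (auto simp: put_def ev_mate pos_def)
    next
      case False
      then show ?thesis using l5 by (simp add: put_def)
    qed
    then show ?thesis unfolding j_def by simp
  qed
  define s6 where "s6 = sem (block [Set 55 (Lst 6 (Conj (Lt (Var 6) (Var 53)) (Conj (At 40 (At 51 (Sub (Sub (Var 53) (Cst 1)) (Var 6))))
       (Neg (At 32 (mateE (At 51 (Sub (Sub (Var 53) (Cst 1)) (Var 6))))))))),
     Set 43 (Ite (Lt (Var 55) LimE) (At 51 (Sub (Sub (Var 53) (Cst 1)) (Var 55))) two_n)]) s5"
  have s6: "s6 43 0 0 = \<pi>" "u \<noteq> 55 \<Longrightarrow> u \<noteq> 43 \<Longrightarrow> s6 u = s5 u" for u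
  proof -
    have e: "s6 = put (put s5 55 0 0 j) 43 0 0 (if j < L then s5 51 (la - 1 - j) 0 else 2 * n)"
      unfolding s6_def block.simps sem.simps eLst using l5 lim_ge by (simp add: put_other mult_2 min_absorb1)
    show "s6 43 0 0 = \<pi>" unfolding e \<pi> using pa5[of "la - 1 - j"] jla by auto
    show "u \<noteq> 55 \<Longrightarrow> u \<noteq> 43 \<Longrightarrow> s6 u = s5 u" unfolding e by (simp add: put_other)
  qed
  have turn: "ev (turnE p l q m) (put \<tau> 5 0 0 e) = (ys @ map (mate n) (rev xs)) ! e"
    if ag: "\<tau> p = s5 p" "\<tau> l = s5 l" "\<tau> q = s5 q" "\<tau> m = s5 m" and d: "p \<noteq> 5" "q \<noteq> 5" "l \<noteq> 5" "m \<noteq> 5"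
      and x: "s5 l 0 0 = length xs" "s5 m 0 0 = length ys" "\<And>k. k < length xs \<Longrightarrow> s5 p k 0 = xs ! k" "\<And>k. k < length ys \<Longrightarrow> s5 q k 0 = ys ! k"
        "\<And>k. k < length xs \<Longrightarrow> xs ! k < 2 * n" and e: "e < length xs + length ys"
    for p l q m \<tau> e and xs ys :: "nat list"
  proof (cases "e < length ys")
    case True
    then show ?thesis unfolding turnE_def using ag d x by (simp add: put_def nth_append)
  next
    case False
    define r where "r = length xs - 1 - (e - length ys)"
    have r: "r < length xs" "length xs - Suc (e - length ys) = r" "length xs - Suc 0 - (e - length ys) = r" using False e unfolding r_def by auto
    have "(ys @ map (mate n) (rev xs)) ! e = mate n (xs ! r)"
      using False e r by (simp add: nth_append rev_nth)
    moreover have "ev (turnE p l q m) (put \<tau> 5 0 0 e) = ev (mateE (At p (Sub (Sub (Var l) (Cst 1)) (Sub (Var 5) (Var m))))) (put \<tau> 5 0 0 e)"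
      unfolding turnE_def using False ag d x by (simp add: put_other)
    moreover have "ev (At p (Sub (Sub (Var l) (Cst 1)) (Sub (Var 5) (Var m)))) (put \<tau> 5 0 0 e) = xs ! r"
      using ag d x r by (simp add: put_other)
    ultimately show ?thesis using ev_mate x(5)[OF r(1)] by simp
  qed
  define s7 where "s7 = s6(37 := (\<lambda>i j. if i < L \<and> j = t then ev (turnE 51 53 52 54) (put s6 5 0 0 i) else s6 37 i j))"
  have 7: "sem (fill 5 37 (Var 45) (turnE 51 53 52 54)) s6 = s7"
    unfolding s7_def by (rule fill_self) (auto simp: put_other turnE_def ev_node s6(2) l5)
  define s8 where "s8 = s7(38 := (\<lambda>i j. if i < L \<and> j = t then ev (turnE 52 54 51 53) (put s7 5 0 0 i) else s7 38 i j))"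
  have 8: "sem (fill 5 38 (Var 45) (turnE 52 54 51 53)) s7 = s8"
    unfolding s8_def by (rule fill_self) (auto simp: put_other turnE_def ev_node s7_def s6(2) l5)
  have t8: "sem (block p_turn) s5 = s8"
    unfolding p_turn_def using 7 8 unfolding s6_def by simp
  have old8: "s8 u = \<sigma> u" if "u < 37 \<or> u = 45" for u
    using that old5[of u] unfolding s8_def s7_def by (auto simp: s6(2))
  have on8: "s8 39 = s5 39" "s8 40 = s5 40" "s8 32 = s5 32" "s8 43 0 0 = \<pi>" "s8 53 0 0 = la" "s8 54 0 0 = lb" "s8 45 0 0 = t"
    using l5 unfolding s8_def s7_def by (simp_all add: s6)
  have rows: "s8 37 l t = (P b @ map (mate n) (rev (P a))) ! l" "s8 38 l t = (P a @ map (mate n) (rev (P b))) ! l"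
    if "l < la + lb" for l
  proof -
    have lL: "l < L" using that la lim_ge by simp
    have "ev (turnE 51 53 52 54) (put s6 5 0 0 l) = (P b @ map (mate n) (rev (P a))) ! l"
      by (rule turn) (use that l5 pa5 pb5 Pan in \<open>auto simp: s6(2) la_def lb_def\<close>)
    then show "s8 37 l t = (P b @ map (mate n) (rev (P a))) ! l" unfolding s8_def s7_def using lL by simp
    have "ev (turnE 52 54 51 53) (put s7 5 0 0 l) = (P a @ map (mate n) (rev (P b))) ! l"
      by (rule turn) (use that l5 pa5 pb5 Pbn in \<open>auto simp: s7_def s6(2) la_def lb_def\<close>)
    then show "s8 38 l t = (P a @ map (mate n) (rev (P b))) ! l" unfolding s8_def using lL by simp
  qed
  have cols: "s8 37 l u = \<sigma> 37 l u" "s8 38 l u = \<sigma> 38 l u" if "u \<noteq> t" for l u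
    using that old5[of 37] old5[of 38] unfolding s8_def s7_def by (simp_all add: s6(2))
  let ?new = "new Z P"
  have newD: "?new x y e \<longleftrightarrow> e \<in> set (P x) \<and> e \<notin> set (P y) \<and> mate n e \<notin> Z" for x y e
    unfolding new_def[OF i] by simp
  have newE: "(ev (newE p q e) \<rho> \<noteq> 0) = ?new x y (ev e \<rho>)"
    if "\<rho> 39 = s5 39" "\<rho> 40 = s5 40" "\<rho> 32 (mate n (ev e \<rho>)) 0 = s5 32 (mate n (ev e \<rho>)) 0" "ev e \<rho> < L" "p = 39 \<and> q = 40 \<and> x = a \<and> y = b \<or> p = 40 \<and> q = 39 \<and> x = b \<and> y = a"
    for \<rho> e p q x y
  proof (cases "ev e \<rho> \<in> set (P x)")
    case True
    then have lt: "ev e \<rho> < 2 * n" using that(5) Pa Pb by auto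
    have m: "ev (mateE e) \<rho> = mate n (ev e \<rho>)" by (rule ev_mate[OF lt])
    have "(s5 32 (mate n (ev e \<rho>)) 0 = 0) = (mate n (ev e \<rho>) \<notin> Z)" using Z5[OF ZnL[OF lt]] .
    then show ?thesis using that True on[OF that(4)] m unfolding newD newE_def by (auto simp: pos_def)
  next
    case False
    then have "\<rho> p (ev e \<rho>) 0 = 0" using that(1,2,5) on[OF that(4)] unfolding pos_def by auto
    then show ?thesis using False unfolding newD newE_def by simp
  qed
  have base: "base e \<le> 2 * n" if "e \<in> Z" for e
    using inv_base_lp[OF i that] lp_cases[of Z "P e"] state_bounds(5)[OF s that, of "base e"] by auto
  define E33 E34 E35 E36 E32 where
    "E33 = Ite (Conj (At 32 (Var 5)) (Neg (Disj (newE 39 40 (At 33 (Var 5))) (newE 40 39 (At 33 (Var 5)))))) (At 33 (Var 5)) (Var 43)"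
    and "E34 = Ite (At 32 (Var 5)) (At 34 (Var 5)) (Ite (newE 39 40 (mateE (Var 5)))
       (Add (Var 54) (Sub (Var 53) (Sub (At 39 (mateE (Var 5))) (Cst 1))))
       (Add (Var 53) (Sub (Var 54) (Sub (At 40 (mateE (Var 5))) (Cst 1)))))"
    and "E35 = Ite (At 32 (Var 5)) (At 35 (Var 5)) (Var 45)"
    and "E36 = Ite (At 32 (Var 5)) (At 36 (Var 5)) (Ite (newE 39 40 (mateE (Var 5))) (Cst 0) (Cst 1))"
    and "E32 = Disj (At 32 (Var 5)) (Conj (Lt (Var 5) two_n) (Disj (newE 39 40 (mateE (Var 5))) (newE 40 39 (mateE (Var 5)))))"
  note E = E33_def E34_def E35_def E36_def E32_def
  have F33: "sem (fill 5 33 (Cst 0) E33) \<rho> = \<rho>(33 := (\<lambda>i j. if i < L \<and> j = 0 then ev E33 (put \<rho> 5 0 0 i) else \<rho> 33 i j))" for \<rho>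
    by (rule fill_self) (simp_all add: E put_other ev_node newE_def)
  have F34: "sem (fill 5 34 (Cst 0) E34) \<rho> = \<rho>(34 := (\<lambda>i j. if i < L \<and> j = 0 then ev E34 (put \<rho> 5 0 0 i) else \<rho> 34 i j))" for \<rho>
    unfolding E34_def by (rule fill_keep) (simp_all add: newE_def mateE_def Conj_def Neg_def)
  have F35: "sem (fill 5 35 (Cst 0) E35) \<rho> = \<rho>(35 := (\<lambda>i j. if i < L \<and> j = 0 then ev E35 (put \<rho> 5 0 0 i) else \<rho> 35 i j))" for \<rho>
    unfolding E35_def by (rule fill_keep) (simp_all add: newE_def mateE_def Conj_def Neg_def)
  have F36: "sem (fill 5 36 (Cst 0) E36) \<rho> = \<rho>(36 := (\<lambda>i j. if i < L \<and> j = 0 then ev E36 (put \<rho> 5 0 0 i) else \<rho> 36 i j))" for \<rho>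
    unfolding E36_def by (rule fill_keep) (simp_all add: newE_def mateE_def Conj_def Neg_def)
  define r1 where "r1 = s8(33 := (\<lambda>i j. if i < L \<and> j = 0 then ev E33 (put s8 5 0 0 i) else s8 33 i j))"
  define r2 where "r2 = r1(34 := (\<lambda>i j. if i < L \<and> j = 0 then ev E34 (put r1 5 0 0 i) else r1 34 i j))"
  define r3 where "r3 = r2(35 := (\<lambda>i j. if i < L \<and> j = 0 then ev E35 (put r2 5 0 0 i) else r2 35 i j))"
  define r4 where "r4 = r3(36 := (\<lambda>i j. if i < L \<and> j = 0 then ev E36 (put r3 5 0 0 i) else r3 36 i j))"
  let ?Z = "bZ Z P a b" and ?P = "bP Z P a b" and ?base = "bbase Z P base a b"
  have inZ: "e \<in> ?Z \<longleftrightarrow> e \<in> Z \<or> e < 2 * n \<and> (?new a b (mate n e) \<or> ?new b a (mate n e))" for e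
  proof -
    define Q where "Q e' \<longleftrightarrow> ?new a b e' \<or> ?new b a e'" for e'
    have "e' < 2 * n" if "Q e'" for e' using that Pa(2) Pb(2) unfolding Q_def newD by blast
    then have "e \<in> mate n ` {e'. Q e'} \<longleftrightarrow> e < 2 * n \<and> Q (mate n e)"
      using node_simps(6,7) by (metis (no_types, lifting) image_iff mem_Collect_eq)
    then show ?thesis unfolding bZ_def[OF i] Q_def by blast
  qed
  have mL: "ev (mateE (Var 5)) (put \<rho> 5 0 0 e) = mate n e" "mate n e < L" if "e < 2 * n" for e \<rho>
    using that ev_mate[of "Var 5" "put \<rho> 5 0 0 e"] ZnL by auto
  have newM: "(ev (newE p q (mateE (Var 5))) (put \<rho> 5 0 0 e) \<noteq> 0) = ?new x y (mate n e)"
    if "\<rho> 39 = s5 39" "\<rho> 40 = s5 40" "\<rho> 32 e 0 = s5 32 e 0" "e < 2 * n" "p = 39 \<and> q = 40 \<and> x = a \<and> y = b \<or> p = 40 \<and> q = 39 \<and> x = b \<and> y = a"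
    for \<rho> e p q x y
  proof -
    have "(ev (newE p q (mateE (Var 5))) (put \<rho> 5 0 0 e) \<noteq> 0) = ?new x y (ev (mateE (Var 5)) (put \<rho> 5 0 0 e))"
      by (rule newE) (use that mL[OF that(4)] node_simps(6)[OF that(4)] in \<open>simp_all add: put_other\<close>)
    then show ?thesis unfolding mL(1)[OF that(4)] .
  qed
  define r5 where "r5 = r4(32 := (\<lambda>i j. if i < L \<and> j = 0 then of_bool (i \<in> ?Z) else r4 32 i j))"
  have F32: "sem (fill 5 32 (Cst 0) E32) r4 = r5"
    unfolding r5_def
  proof (rule fill_col)
    fix \<tau> e assume e: "e < L" and ag: "agree {32, 5} \<tau> r4" and row: "\<tau> 32 e = r4 32 e"
    have r4: "\<tau> 39 = s5 39" "\<tau> 40 = s5 40" "\<tau> 32 e 0 = s5 32 e 0"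
      using ag row unfolding r4_def r3_def r2_def r1_def by (simp_all add: on8)
    have 32: "(ev (At 32 (Var 5)) (put \<tau> 5 0 0 e) = 0) = (e \<notin> Z)" using Z5[OF e] r4 by (simp add: put_other)
    note d = conjI[OF refl conjI[OF refl conjI[OF refl refl]]]
    show "ev E32 (put \<tau> 5 0 0 e) = of_bool (e \<in> ?Z)"
    proof (cases "e < 2 * n")
      case True
      have l: "ev (Lt (Var 5) two_n) (put \<tau> 5 0 0 e) = 1" using True lim_ge by simp
      show ?thesis unfolding E ev_simps(2,3) l of_bool_eq_0_iff not_not newM[OF r4 True disjI1[OF d]]
        newM[OF r4 True disjI2[OF d]] 32 inZ using True by simp
    next
      case False
      have l: "ev (Lt (Var 5) two_n) (put \<tau> 5 0 0 e) = 0" using False lim_ge by simp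
      show ?thesis unfolding E ev_simps(2,3) l of_bool_eq_0_iff not_not 32 inZ using False by simp
    qed
  qed auto
  have "sem (block p_update) s8 = r5"
    unfolding p_update_def block.simps sem.simps E[symmetric] F33 r1_def[symmetric] F34 r2_def[symmetric]
      F35 r3_def[symmetric] F36 r4_def[symmetric] F32 ..
  then have sem: "sem (block (p_ends @ p_turn @ p_update)) \<sigma> = r5" unfolding sem_block_append 5 t8 .
  have keep: "r5 u = s8 u" if "u \<noteq> 32" "u \<noteq> 33" "u \<noteq> 34" "u \<noteq> 35" "u \<noteq> 36" for u
    using that unfolding r5_def r4_def r3_def r2_def r1_def by simp
  have tab: "tab2 r5" using tab2_cong[of r5 \<sigma>] keep old8 S(1) by simp
  have inv: "inv ?Z ?P ?base" by (rule inv_blossom[OF i a b F])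
  have in32: "(r5 32 e 0 = 0) = (e \<notin> ?Z)" if "e < L" for e
    unfolding r5_def using that by simp
  have rest: "r5 33 e 0 = ?base e \<and> r5 34 e 0 = length (?P e) \<and> (?P e \<noteq> [] \<longrightarrow> r5 35 e 0 < Suc t) \<and>
      (\<forall>l<length (?P e). pathv r5 e l = ?P e ! l)" if e: "e \<in> ?Z" for e
  proof (cases "e \<in> Z")
    case True
    have eL: "e < L" using state_bounds(2)[OF s True] .
    have 32: "s8 32 e 0 \<noteq> 0" "r1 32 = s8 32" "r2 32 = s8 32" "r3 32 = s8 32" using Z5[OF eL] True on8(3)
      unfolding r3_def r2_def r1_def by simp_all
    have b33: "s8 33 e 0 = base e" using S(4)[OF True] old8[of 33] by simp
    have bL: "ev (At 33 (Var 5)) (put s8 5 0 0 e) = base e" "base e < L" using b33 base[OF True] lim_ge by (simp_all add: put_other)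
    have n8: "(ev (newE p q (At 33 (Var 5))) (put s8 5 0 0 e) \<noteq> 0) = ?new x y (base e)"
      if "p = 39 \<and> q = 40 \<and> x = a \<and> y = b \<or> p = 40 \<and> q = 39 \<and> x = b \<and> y = a" for p q x y
    proof -
      have "(ev (newE p q (At 33 (Var 5))) (put s8 5 0 0 e) \<noteq> 0) = ?new x y (ev (At 33 (Var 5)) (put s8 5 0 0 e))"
        by (rule newE) (use that bL on8 in \<open>simp_all add: put_other\<close>)
      then show ?thesis unfolding bL(1) .
    qed
    have a32: "ev (At 32 (Var 5)) (put s8 5 0 0 e) \<noteq> 0" using 32 by (simp add: put_other)
    have "ev E33 (put s8 5 0 0 e) = ?base e"
      unfolding bbase_def[OF i] E ev.simps(10) ev_simps(1,2,3) of_bool_eq_0_iff not_not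
        n8[OF disjI1[OF conjI[OF refl conjI[OF refl conjI[OF refl refl]]]]] n8[OF disjI2[OF conjI[OF refl conjI[OF refl conjI[OF refl refl]]]]]
      using True a32 bL(1) on8(4) unfolding \<pi>_def[symmetric] by (simp add: put_other)
    then have v33: "r5 33 e 0 = ?base e" unfolding r5_def r4_def r3_def r2_def r1_def using eL by simp
    have v: "r5 34 e 0 = \<sigma> 34 e 0" "r5 35 e 0 = \<sigma> 35 e 0" "r5 36 e 0 = \<sigma> 36 e 0"
      using 32 old8[of 34] old8[of 35] old8[of 36] unfolding r5_def r4_def r3_def r2_def r1_def E by (simp_all add: put_other)
    have "pathv r5 e l = P e ! l" if "l < length (P e)" for l
    proof -
      have "P e \<noteq> []" using that by auto
      then have "\<sigma> 35 e 0 \<noteq> t" using S(6)[OF True] by simp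
      then have "pathv r5 e l = pathv \<sigma> e l" unfolding pathv_def v using cols[of "\<sigma> 35 e 0" l] keep[of 37] keep[of 38] by simp
      then show ?thesis using S(7)[OF True that] by simp
    qed
    then show ?thesis using True v33 v S(5,6)[OF True] unfolding bP_def[OF i] by auto
  next
    case False
    then have e2: "e < 2 * n" and nw: "?new a b (mate n e) \<or> ?new b a (mate n e)" using e inZ by auto
    have eL: "e < L" using e2 lim_ge by simp
    have 32: "s8 32 e 0 = 0" "r1 32 = s8 32" "r2 32 = s8 32" "r3 32 = s8 32" using Z5[OF eL] False on8(3)
      unfolding r3_def r2_def r1_def by simp_all
    have r: "r1 39 = s5 39" "r1 40 = s5 40" "r1 32 e 0 = s5 32 e 0" "r3 39 = s5 39" "r3 40 = s5 40" "r3 32 e 0 = s5 32 e 0"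
      "r1 53 0 0 = la" "r1 54 0 0 = lb" "r2 45 0 0 = t"
      unfolding r3_def r2_def r1_def using on8 by simp_all
    note m = mL[OF e2]
    note d1 = disjI1[OF conjI[OF refl conjI[OF refl conjI[OF refl refl]]]]
    have n1: "(ev (newE 39 40 (mateE (Var 5))) (put r1 5 0 0 e) = 0) = (\<not> ?new a b (mate n e))"
      and n3: "(ev (newE 39 40 (mateE (Var 5))) (put r3 5 0 0 e) = 0) = (\<not> ?new a b (mate n e))"
      using newM[OF r(1-3) e2 d1] newM[OF r(4-6) e2 d1] by blast+
    have a32: "ev (At 32 (Var 5)) (put s8 5 0 0 e) = 0" "ev (At 32 (Var 5)) (put r1 5 0 0 e) = 0"
      "ev (At 32 (Var 5)) (put r2 5 0 0 e) = 0" "ev (At 32 (Var 5)) (put r3 5 0 0 e) = 0" using 32 by (simp_all add: put_other)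
    have "r5 33 e 0 = ev E33 (put s8 5 0 0 e)" unfolding r5_def r4_def r3_def r2_def r1_def using eL by simp
    also have "\<dots> = \<pi>" unfolding E ev.simps(10) ev_simps(2) a32 using on8(4) by (simp add: put_other)
    finally have v33: "r5 33 e 0 = ?base e" unfolding bbase_def[OF i] \<pi>_def using False by simp
    have v35: "r5 35 e 0 = t" unfolding r5_def r4_def r3_def E using eL a32(3) r(9) by (simp add: put_other)
    have v36: "r5 36 e 0 = (if ?new a b (mate n e) then 0 else 1)"
    proof -
      have "r5 36 e 0 = ev E36 (put r3 5 0 0 e)" unfolding r5_def r4_def using eL by simp
      also have "\<dots> = (if ?new a b (mate n e) then 0 else 1)" unfolding E ev.simps(10) a32 n3 by simp
      finally show ?thesis .
    qed
    define h where "h x y = P y @ map (mate n) (rev (dropWhile (\<lambda>z. z \<noteq> mate n e) (P x)))" for x y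
    have lh: "length (h x y) = length (P y) + (length (P x) - (pos (P x) (mate n e) - 1))" if "?new x y (mate n e)" for x y
      unfolding h_def using length_dropWhile_pos that unfolding newD by simp
    \<comment> \<open>Dropping a beginning of one path cuts off the end of the turned sequence, so
      the new path is a prefix of the shared one.\<close>
    have hn: "h x y ! l = (P y @ map (mate n) (rev (P x))) ! l" if "l < length (h x y)" for x y l
    proof -
      have "rev (P x) = rev (dropWhile (\<lambda>z. z \<noteq> mate n e) (P x)) @ rev (takeWhile (\<lambda>z. z \<noteq> mate n e) (P x))"
        by (metis rev_append takeWhile_dropWhile_id)
      then have "P y @ map (mate n) (rev (P x)) = h x y @ map (mate n) (rev (takeWhile (\<lambda>z. z \<noteq> mate n e) (P x)))"
        unfolding h_def by (metis append.assoc map_append)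
      then show ?thesis using that by (simp add: nth_append)
    qed
    have hl: "length (h x y) \<le> length (P x) + length (P y)" for x y
      unfolding h_def using length_dropWhile_le[of "\<lambda>z. z \<noteq> mate n e" "P x"] by simp
    have on1: "r1 39 (mate n e) 0 = pos (P a) (mate n e)" "r1 40 (mate n e) 0 = pos (P b) (mate n e)" using on[OF m(2)] r(1,2) by auto
    have 34: "r5 34 e 0 = ev E34 (put r1 5 0 0 e)" unfolding r5_def r4_def r3_def r2_def using eL by simp
    have lL: "la + lb < L" using la lim_ge by simp
    show ?thesis
    proof (cases "?new a b (mate n e)")
      case True
      have P: "?P e = h a b" unfolding bP_def[OF i] h_def using False True by simp
      have "ev E34 (put r1 5 0 0 e) = ev (Add (Var 54) (Sub (Var 53) (Sub (At 39 (mateE (Var 5))) (Cst 1)))) (put r1 5 0 0 e)"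
        unfolding E ev.simps(10) a32 n1 using True by simp
      also have "\<dots> = min (lb + (la - (pos (P a) (mate n e) - 1))) L"
        using m(1) on1 r by (simp add: put_other)
      also have "\<dots> = length (h a b)" using lh[OF True] lL hl[of a b] unfolding la_def lb_def by simp
      finally have v34: "r5 34 e 0 = length (h a b)" using 34 by simp
      have "pathv r5 e l = h a b ! l" if "l < length (h a b)" for l
      proof -
        have "pathv r5 e l = s8 37 l t" unfolding pathv_def v35 v36 using True keep[of 37] by simp
        also have "\<dots> = h a b ! l" using rows(1)[of l] hn[OF that] that hl[of a b] unfolding la_def lb_def by simp
        finally show ?thesis .
      qed
      then show ?thesis using P v33 v34 v35 by simp
    next
      case F1: False
      then have nw': "?new b a (mate n e)" using nw by simp
      have P: "?P e = h b a" unfolding bP_def[OF i] h_def using False F1 by simp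
      have "ev E34 (put r1 5 0 0 e) = ev (Add (Var 53) (Sub (Var 54) (Sub (At 40 (mateE (Var 5))) (Cst 1)))) (put r1 5 0 0 e)"
        unfolding E ev.simps(10) a32 n1 using F1 by simp
      also have "\<dots> = min (la + (lb - (pos (P b) (mate n e) - 1))) L"
        using m(1) on1 r by (simp add: put_other)
      also have "\<dots> = length (h b a)" using lh[OF nw'] lL hl[of b a] unfolding la_def lb_def by simp
      finally have v34: "r5 34 e 0 = length (h b a)" using 34 by simp
      have "pathv r5 e l = h b a ! l" if "l < length (h b a)" for l
      proof -
        have "pathv r5 e l = s8 38 l t" unfolding pathv_def v35 v36 using F1 keep[of 38] by simp
        also have "\<dots> = h b a ! l" using rows(2)[of l] hn[OF that] that hl[of b a] unfolding la_def lb_def by simp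
        finally show ?thesis .
      qed
      then show ?thesis using P v33 v34 v35 by simp
    qed
  qed
  show ?thesis unfolding state_def sem using tab inv in32 rest by blast
qed

end

section \<open>The search loop and the augmentation as programs\<close>

abbreviation XE :: expr where "XE \<equiv> At 27 (Var 6)"
abbreviation YE :: expr where "YE \<equiv> At 28 (Var 6)"

definition blossomE :: expr where
  "blossomE = Conj (Lt XE LimE) (Conj (At 32 XE) (Conj (At 32 YE) (Neg (Eq (At 33 XE) (At 33 YE)))))"
definition growE :: expr where
  "growE = Conj (Lt XE LimE) (Conj (At 32 XE) (Conj (Neg (At 32 YE)) (Neg (At 32 (mateE YE)))))"

definition p_step :: cmd where
  "p_step = Sq (Set 44 (Lst 6 blossomE)) (Iff (Lt (Var 44) LimE) (block (p_ends @ p_turn @ p_update))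
     (Sq (Set 44 (Lst 6 growE)) (Iff (Lt (Var 44) LimE) (block p_grow) Nop)))"

definition p_search :: cmd where
  "p_search = block [fill 5 32 (Cst 0) (Eq (Var 5) two_n), Wr 33 two_n (Cst 0) two_n, Wr 34 two_n (Cst 0) (Cst 0), For 45 p_step]"

definition p_augment :: "cmd list" where
  "p_augment = [Set 47 (At 34 (Var 46)), fill 5 51 (Cst 0) (pathE (Var 46) (Var 5)),
     fill 5 58 (Cst 0) (Lst 6 (Conj (Lt (Var 6) two_n) (Conj (Eq XE (At 51 (Var 5)))
       (Conj (Eq YE (mateE (At 51 (Add (Var 5) (Cst 1))))) (Disj (Lt (Add (Var 5) (Cst 2)) (Var 47)) (At 29 (Var 6))))))),
     fill 5 48 (Cst 0) (Ite (Lt (At 58 (Var 5)) NV) (At 58 (Var 5)) (Sub (At 58 (Var 5)) NV)),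
     Set 49 (Lst 6 (Conj (startE (Var 6)) (Conj (Eq (nbE (Var 6) 0) (idxE (At 51 (Cst 0)))) (Neg (Ad (Var 6) (At 48 (Cst 0))))))),
     Set 60 (idxE (At 51 (Sub (Var 47) (Cst 1)))), Set 61 (At 48 (Sub (Var 47) (Cst 2))),
     Set 59 (Univ 6 (Conj (At 10 (Var 6)) (Ad (Var 60) (Var 6))) (Ad (Var 61) (Var 6))),
     Set 50 (Ite (Var 59) LimE (Lst 6 (Conj (endE (Var 6)) (Conj (Eq (nbE (Var 6) 0) (Var 60)) (Neg (Ad (Var 6) (Var 61))))))),
     fill 5 12 (Cst 0) (Disj (Exi 6 (Conj (Lt (Add (Var 6) (Cst 1)) (Var 47)) (Eq (At 48 (Var 6)) (Var 5)))) (Disj (Eq (Var 5) (Var 49))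
       (Disj (Eq (Var 5) (Var 50)) (Conj (At 12 (Var 5)) (Neg (Exi 6 (Conj (Lt (Var 6) (Var 47)) (Eq (idxE (At 51 (Var 6))) (Var 5))))))))) ]"

context prog_stuck
begin

lemma state_cong:
  assumes "state t \<sigma> Z P base" "\<And>a. a < 39 \<Longrightarrow> \<sigma>' a = \<sigma> a" "t \<le> t'"
  shows "state t' \<sigma>' Z P base"
proof -
  have "tab2 \<sigma>'" using tab2_cong[of \<sigma>' \<sigma>] assms stateD(1) by simp
  moreover have "pathv \<sigma>' e k = pathv \<sigma> e k" for e k unfolding pathv_def using assms(2) by simp
  ultimately show ?thesis using assms unfolding state_def by fastforce
qed

lemma state_finite: "state t \<sigma> Z P base \<Longrightarrow> finite Z" "state t \<sigma> Z P base \<Longrightarrow> card Z \<le> 2 * n + 1"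
proof -
  assume "state t \<sigma> Z P base"
  then have s: "Z \<subseteq> {..2 * n}" using state_bounds(1) by auto
  then show "finite Z" using finite_subset by blast
  show "card Z \<le> 2 * n + 1" using card_mono[OF _ s] by simp
qed

lemma ev_edge:
  assumes s: "state t \<sigma> Z P base" and k: "k < L"
  shows "(ev blossomE (put \<sigma> 6 0 0 k) \<noteq> 0) = (XT k < L \<and> XT k \<in> Z \<and> YT k \<in> Z \<and> base (XT k) \<noteq> base (YT k))"
    "(ev growE (put \<sigma> 6 0 0 k) \<noteq> 0) = (XT k < L \<and> XT k \<in> Z \<and> YT k \<notin> Z \<and> mate n (YT k) \<notin> Z)"
proof -
  note S = stateD[OF s]
  have X: "\<sigma> 27 k 0 = XT k" using S(1) k unfolding tab2_def by blast
  have "(ev blossomE (put \<sigma> 6 0 0 k) \<noteq> 0) = (XT k < L \<and> XT k \<in> Z \<and> YT k \<in> Z \<and> base (XT k) \<noteq> base (YT k)) \<and>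
    (ev growE (put \<sigma> 6 0 0 k) \<noteq> 0) = (XT k < L \<and> XT k \<in> Z \<and> YT k \<notin> Z \<and> mate n (YT k) \<notin> Z)"
  proof (cases "XT k < L")
    case F: False
    have "ev (Lt XE LimE) (put \<sigma> 6 0 0 k) = 0" using X F by (simp add: put_other)
    then show ?thesis unfolding blossomE_def growE_def ev_simps(2) using F by simp
  next
    case T: True
    have k4: "k < 4 * n" using X_dead[of k] T k by (cases "k < 4 * n") auto
    have Y: "\<sigma> 28 k 0 = YT k" "YT k < 2 * n" "XT k \<le> 2 * n" using S(1) k T Y_lt[OF k4 T] unfolding tab2_def by blast+
    have l: "YT k < L" "mate n (YT k) < L" using Y lim_ge node_simps(7)[OF Y(2)] by auto
    note z = S(3)[OF T] S(3)[OF l(1)] S(3)[OF l(2)]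
    have "(ev blossomE (put \<sigma> 6 0 0 k) \<noteq> 0) = (XT k < L \<and> XT k \<in> Z \<and> YT k \<in> Z \<and> base (XT k) \<noteq> base (YT k))"
      unfolding blossomE_def using X Y T z S(4) by (auto simp: put_other)
    moreover have "(ev growE (put \<sigma> 6 0 0 k) \<noteq> 0) = (XT k < L \<and> XT k \<in> Z \<and> YT k \<notin> Z \<and> mate n (YT k) \<notin> Z)"
      unfolding growE_def using X Y T z by (auto simp: put_other ev_mate)
    ultimately show ?thesis by blast
  qed
  then show "(ev blossomE (put \<sigma> 6 0 0 k) \<noteq> 0) = (XT k < L \<and> XT k \<in> Z \<and> YT k \<in> Z \<and> base (XT k) \<noteq> base (YT k))"
    "(ev growE (put \<sigma> 6 0 0 k) \<noteq> 0) = (XT k < L \<and> XT k \<in> Z \<and> YT k \<notin> Z \<and> mate n (YT k) \<notin> Z)" by blast+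
qed

text \<open>Every step on a search that is not closed strictly enlarges the set of even nodes; on a
  closed one it changes nothing that matters, so the loop may go on for a fixed number of
  rounds.\<close>

lemma step:
  assumes s: "state t \<sigma> Z P base" and t: "\<sigma> 45 0 0 = t"
  shows "\<exists>Z' P' base'. state (Suc t) (sem p_step \<sigma>) Z' P' base' \<and> (closed Z base \<and> Z' = Z \<and> base' = base \<or> \<not> closed Z base \<and> card Z < card Z')"
proof -
  define k where "k = ev (Lst 6 blossomE) \<sigma>"
  define \<sigma>1 where "\<sigma>1 = put \<sigma> 44 0 0 k"
  have 1: "state t \<sigma>1 Z P base" "\<sigma>1 44 0 0 = k" "\<sigma>1 45 0 0 = t" unfolding \<sigma>1_def using state_cong[OF s, of _ t] t
    by (simp_all add: put_other)
  define k2 where "k2 = ev (Lst 6 growE) \<sigma>1"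
  define \<sigma>2 where "\<sigma>2 = put \<sigma>1 44 0 0 k2"
  have 2: "state t \<sigma>2 Z P base" "\<sigma>2 44 0 0 = k2" "\<sigma>2 45 0 0 = t" unfolding \<sigma>2_def using state_cong[OF 1(1), of _ t] 1(3)
    by (simp_all add: put_other)
  have sem: "sem p_step \<sigma> = (if k < L then sem (block (p_ends @ p_turn @ p_update)) \<sigma>1 else if k2 < L then sem (block p_grow) \<sigma>2 else \<sigma>2)"
    unfolding p_step_def sem.simps k_def[symmetric] by (simp add: \<sigma>1_def \<sigma>2_def k2_def)
  note i = stateD(2)[OF s]
  have kk: "k = least L (\<lambda>k. XT k < L \<and> XT k \<in> Z \<and> YT k \<in> Z \<and> base (XT k) \<noteq> base (YT k))"
    unfolding k_def ev.simps(11) by (rule least_cong[OF refl ev_edge(1)[OF s]])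
  have kk2: "k2 = least L (\<lambda>k. XT k < L \<and> XT k \<in> Z \<and> YT k \<notin> Z \<and> mate n (YT k) \<notin> Z)"
    unfolding k2_def ev.simps(11) by (rule least_cong[OF refl ev_edge(2)[OF 1(1)]])
  consider "k < L" | "\<not> k < L" "k2 < L" | "\<not> k < L" "\<not> k2 < L" by blast
  then show ?thesis
  proof cases
    case a: 1
    let ?a = "XT k" and ?b = "YT k"
    have K: "XT k < L" "?a \<in> Z" "?b \<in> Z" "base ?a \<noteq> base ?b"
      using least_prop[of L "\<lambda>k. XT k < L \<and> XT k \<in> Z \<and> YT k \<in> Z \<and> base (XT k) \<noteq> base (YT k)"] a unfolding kk[symmetric] by blast+
    have b: "state (Suc t) (sem p_step \<sigma>) (bZ Z P ?a ?b) (bP Z P ?a ?b) (bbase Z P base ?a ?b)"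
      using blossom_step[OF 1 a K(1-3)] a unfolding sem by simp
    obtain e where e: "new Z P ?a ?b e \<or> new Z P ?b ?a e" using blossom_progress[OF i K(2-4)] by blast
    then have "mate n e \<in> bZ Z P ?a ?b" "mate n e \<notin> Z" unfolding bZ_def[OF i] new_def[OF i] by blast+
    moreover have "Z \<subseteq> bZ Z P ?a ?b" unfolding bZ_def[OF i] by blast
    ultimately have "Z \<subset> bZ Z P ?a ?b" by blast
    then have "card Z < card (bZ Z P ?a ?b)" using psubset_card_mono state_finite(1)[OF b] by blast
    moreover have "\<not> closed Z base" unfolding closed_def using a K by blast
    ultimately show ?thesis using b by blast
  next
    case a: 2
    have K: "XT k2 < L" "XT k2 \<in> Z" "YT k2 \<notin> Z" "mate n (YT k2) \<notin> Z"
      using least_prop[of L "\<lambda>k. XT k < L \<and> XT k \<in> Z \<and> YT k \<notin> Z \<and> mate n (YT k) \<notin> Z"] a unfolding kk2[symmetric] by blast+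
    let ?c = "mate n (YT k2)"
    have b: "state (Suc t) (sem p_step \<sigma>) (insert ?c Z) (P(?c := P (XT k2) @ [?c])) (base(?c := ?c))"
      using grow_step[OF 2 a(2) K] a unfolding sem by simp
    have "card Z < card (insert ?c Z)" using K(4) state_finite(1)[OF s] by simp
    moreover have "\<not> closed Z base" unfolding closed_def using a K by blast
    ultimately show ?thesis using b by blast
  next
    case a: 3
    have "closed Z base" unfolding closed_def
      using a least_less[of L "\<lambda>k. XT k < L \<and> XT k \<in> Z \<and> YT k \<in> Z \<and> base (XT k) \<noteq> base (YT k)"]
        least_less[of L "\<lambda>k. XT k < L \<and> XT k \<in> Z \<and> YT k \<notin> Z \<and> mate n (YT k) \<notin> Z"]
      unfolding kk[symmetric] kk2[symmetric] by blast
    moreover have "state (Suc t) (sem p_step \<sigma>) Z P base" using state_cong[OF 2(1), of \<sigma>2 "Suc t"] a unfolding sem by simp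
    ultimately show ?thesis by blast
  qed
qed

lemma search:
  assumes t: "tab2 \<sigma>"
  shows "\<exists>Z P base. state L (sem p_search \<sigma>) Z P base \<and> closed Z base"
proof -
  define s1 where "s1 = \<sigma>(32 := (\<lambda>i j. if i < L \<and> j = 0 then of_bool (i = 2 * n) else \<sigma> 32 i j))"
  have 1: "sem (fill 5 32 (Cst 0) (Eq (Var 5) two_n)) \<sigma> = s1"
    unfolding s1_def using lim_ge by (intro fill_col) (auto simp: mult_2 min_absorb1)
  define s2 where "s2 = put (put s1 33 (2 * n) 0 (2 * n)) 34 (2 * n) 0 0"
  have 2: "sem p_search \<sigma> = sem (For 45 p_step) s2"
    unfolding p_search_def s2_def using 1 lim_ge by (simp add: mult_2 min_absorb1)
  have "state 0 s2 {2 * n} (\<lambda>_. []) (\<lambda>_. 2 * n)"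
    unfolding state_def
  proof (intro conjI allI impI ballI)
    show "tab2 s2" using tab2_cong[of s2 \<sigma>] t unfolding s2_def s1_def by (simp add: put_other)
    show "inv {2 * n} (\<lambda>_. []) (\<lambda>_. 2 * n)" by (rule inv_init)
  qed (simp_all add: s2_def s1_def put_def)
  then have s0: "\<exists>Z P base. state 0 s2 Z P base \<and> (closed Z base \<or> 0 < card Z)"
    using state_finite(1) by (intro exI[of _ "{2 * n}"]) auto
  \<comment> \<open>After \<open>k\<close> rounds the search is closed or has more than
    \<open>k\<close> even nodes. There are at most \<open>2 * n + 1\<close> of them, fewer than the
    \<open>L\<close> rounds.\<close>
  have "\<exists>Z P base. state L (sem (For 45 p_step) s2) Z P base \<and> closed Z base"
  proof (rule sem_For[where I = "\<lambda>k \<tau>. \<exists>Z P base. state k \<tau> Z P base \<and> (closed Z base \<or> k < card Z)", OF s0], goal_cases)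
    case (1 k \<tau>)
    then obtain Z P base where s: "state k \<tau> Z P base" "closed Z base \<or> k < card Z" by blast
    let ?\<tau> = "put \<tau> 45 0 0 k"
    have "state k ?\<tau> Z P base" using state_cong[OF s(1), of ?\<tau> k] by (simp add: put_other)
    from step[OF this] obtain Z' P' base' where *: "state (Suc k) (sem p_step ?\<tau>) Z' P' base'"
      "closed Z base \<and> Z' = Z \<and> base' = base \<or> \<not> closed Z base \<and> card Z < card Z'" by auto
    then have "closed Z' base' \<or> Suc k < card Z'" using s(2) by auto
    then show ?case using *(1) by blast
  next
    case (2 \<tau>)
    then obtain Z P base where s: "state L \<tau> Z P base" "closed Z base \<or> L < card Z" by blast
    have "state L (put \<tau> 45 0 0 (s2 45 0 0)) Z P base" using state_cong[OF s(1), of _ L] by (simp add: put_other)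
    moreover have "closed Z base" using s(2) state_finite(2)[OF s(1)] lim_ge by auto
    ultimately show ?case by blast
  qed
  then show ?thesis unfolding 2 .
qed

lemma augment:
  assumes s: "state t \<sigma> Z P base" and f: "\<sigma> 46 0 0 = f" "f \<in> Z" "finT f"
  shows "\<exists>I'. indep I' \<and> \<Union> (A ` I) \<subseteq> \<Union> (A ` I') \<and> x0 \<in> \<Union> (A ` I') \<and>
    (\<forall>i<L. (sem (block p_augment) \<sigma> 12 i 0 = 0) = (i \<notin> I'))"
proof -
  note S = stateD[OF s]
  note i = S(2)
  note G = pf_facts[OF i f(2,3)]
  define xs where "xs = P f"
  define r where "r = length xs"
  note T = S(1)[unfolded tab2_def tab1_def input_def]
  have r: "\<sigma> 34 f 0 = r" "r \<le> 2 * n" using S(5)[OF f(2)] state_bounds(3)[OF s f(2)] unfolding r_def xs_def by auto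
  \<comment> \<open>The program adds \<open>1\<close> and \<open>2\<close> to positions on the path;
    this bound keeps the sums from being saturated.\<close>
  have rL: "Suc (Suc r) < L" using r lim_ge unfolding lim_def by simp
  have x2: "xs ! k < 2 * n" if "k < r" for k using G(4) that unfolding r_def xs_def by blast
  have r2: "r \<ge> 2" using path_long[OF refl G(2,4-8)] unfolding r_def xs_def .
  define s1 where "s1 = put \<sigma> 47 0 0 r"
  define s2 where "s2 = s1(51 := (\<lambda>i j. if i < L \<and> j = 0 then pathv \<sigma> f i else s1 51 i j))"
  have 2: "sem (fill 5 51 (Cst 0) (pathE (Var 46) (Var 5))) s1 = s2"
    unfolding s2_def by (rule fill_col) (use f(1) in \<open>auto simp: put_def s1_def pathv_def\<close>)
  have p2: "s2 51 k 0 = xs ! k" if "k < r" for k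
    using S(7)[OF f(2), of k] that rL unfolding s2_def r_def xs_def by simp
  have o2: "u < 46 \<Longrightarrow> s2 u = \<sigma> u" "s2 47 0 0 = r" for u unfolding s2_def s1_def by (simp_all add: put_other)
  define e3 where "e3 = Lst 6 (Conj (Lt (Var 6) two_n) (Conj (Eq XE (At 51 (Var 5)))
       (Conj (Eq YE (mateE (At 51 (Add (Var 5) (Cst 1))))) (Disj (Lt (Add (Var 5) (Cst 2)) (Var 47)) (At 29 (Var 6))))))"
  define s3 where "s3 = s2(58 := (\<lambda>i j. if i < L \<and> j = 0 then ev e3 (put s2 5 0 0 i) else s2 58 i j))"
  have 3: "sem (fill 5 58 (Cst 0) e3) s2 = s3"
    unfolding s3_def
  proof (rule fill_self)
    fix \<tau> i assume "agree {58, 5} \<tau> s2" "put \<tau> 5 0 0 i 5 = put s2 5 0 0 i 5"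
    then show "ev e3 (put \<tau> 5 0 0 i) = ev e3 (put s2 5 0 0 i)"
      by (intro ev_reads) (auto simp: e3_def Conj_def Disj_def mateE_def put_other)
  qed auto
  define s4 where "s4 = s3(48 := (\<lambda>i j. if i < L \<and> j = 0 then if s3 58 i 0 < n then s3 58 i 0 else s3 58 i 0 - n else s3 48 i j))"
  have 4: "sem (fill 5 48 (Cst 0) (Ite (Lt (At 58 (Var 5)) NV) (At 58 (Var 5)) (Sub (At 58 (Var 5)) NV))) s3 = s4"
    unfolding s4_def by (rule fill_col) (auto simp: put_other)
  have o4: "u < 46 \<Longrightarrow> s4 u = \<sigma> u" "s4 47 0 0 = r" "k < r \<Longrightarrow> s4 51 k 0 = xs ! k" for u k
    unfolding s4_def s3_def using o2 p2 by simp_all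
  have J: "s4 48 k 0 = JT P f k" if k: "Suc k < r" for k
  proof -
    have lt: "xs ! k < 2 * n" "xs ! Suc k < 2 * n" using x2 k by auto
    have kL: "k < L" "min (Suc k) L = Suc k" "min (Suc (Suc k)) L = Suc (Suc k)" using k rL by auto
    have "ev e3 (put s2 5 0 0 k) = least L (\<lambda>j. j < 2 * n \<and> XT j = xs ! k \<and> YT j = mate n (xs ! Suc k) \<and> (Suc (Suc k) < r \<or> FXT j))"
      unfolding e3_def ev.simps(11)
    proof (rule least_cong[OF refl])
      fix j assume j: "j < L"
      let ?\<rho> = "put (put s2 5 0 0 k) 6 0 0 j"
      have m: "ev (mateE (At 51 (Add (Var 5) (Cst 1)))) ?\<rho> = mate n (xs ! Suc k)"
        using ev_mate[of "At 51 (Add (Var 5) (Cst 1))" ?\<rho>] lt p2[OF k] kL by (simp add: put_other)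
      have X: "s2 27 j 0 = XT j" using T j o2(1)[of 27] by simp
      show "(ev (Conj (Lt (Var 6) two_n) (Conj (Eq XE (At 51 (Var 5)))
       (Conj (Eq YE (mateE (At 51 (Add (Var 5) (Cst 1))))) (Disj (Lt (Add (Var 5) (Cst 2)) (Var 47)) (At 29 (Var 6)))))) ?\<rho> \<noteq> 0) =
        (j < 2 * n \<and> XT j = xs ! k \<and> YT j = mate n (xs ! Suc k) \<and> (Suc (Suc k) < r \<or> FXT j))"
      proof (cases "j < 2 * n \<and> XT j = xs ! k")
        case True
        then have "XT j < L" using lt lim_ge by simp
        then have "s2 28 j 0 = YT j" "(s2 29 j 0 = 0) = (\<not> FXT j)" using T j True o2(1)[of 28] o2(1)[of 29] by auto
        then show ?thesis using True X m p2[of k] k kL lim_ge o2(2) by (auto simp: put_other mult_2 min_absorb1)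
      next
        case False
        then show ?thesis using X p2[of k] k kL lim_ge by (auto simp: put_other mult_2 min_absorb1)
      qed
    qed
    then show ?thesis unfolding JT_def[OF i f(2,3)] Let_def s4_def s3_def using kL(1) unfolding r_def xs_def by simp
  qed
  have J0: "s4 48 0 0 = JT P f 0" "s4 48 (r - 2) 0 = JT P f (r - 2)" using J[of 0] J[of "r - 2"] r2 by auto
  define last where "last = idx n (xs ! (r - 1))"
  have tp: "w < L \<Longrightarrow> s4 15 w 0 = tpT w" "w < L \<Longrightarrow> s4 14 w 0 = nbT w 0" "s4 4 0 0 = x0" "w < L \<Longrightarrow> (s4 10 w 0 = 0) = (w \<notin> D)" for w
    using T o4(1)[of 15] o4(1)[of 14] o4(1)[of 4] o4(1)[of 10] by simp_all
  have 5: "ev (Lst 6 (Conj (startE (Var 6)) (Conj (Eq (nbE (Var 6) 0) (idxE (At 51 (Cst 0)))) (Neg (Ad (Var 6) (At 48 (Cst 0))))))) s4 = j0T P f"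
    unfolding j0T_def[OF i f(2,3)] ev.simps(11)
    by (rule least_cong[OF refl]) (use tp J0 o4(3)[of 0] r2 in \<open>auto simp: put_other xs_def\<close>)
  define s5 where "s5 = put (put (put s4 49 0 0 (j0T P f)) 60 0 0 last) 61 0 0 (JT P f (r - 2))"
  have 5: "sem (block [Set 49 (Lst 6 (Conj (startE (Var 6)) (Conj (Eq (nbE (Var 6) 0) (idxE (At 51 (Cst 0)))) (Neg (Ad (Var 6) (At 48 (Cst 0))))))),
     Set 60 (idxE (At 51 (Sub (Var 47) (Cst 1)))), Set 61 (At 48 (Sub (Var 47) (Cst 2)))]) s4 = s5"
    unfolding block.simps sem.simps 5 s5_def last_def using o4(2,3) J0 r2 by (simp add: put_other)
  have o5: "u < 46 \<or> u = 51 \<or> u = 47 \<or> u = 48 \<Longrightarrow> s5 u = s4 u" "s5 60 0 0 = last" "s5 61 0 0 = JT P f (r - 2)" "s5 49 0 0 = j0T P f" for u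
    unfolding s5_def by (auto simp: put_other)
  have 6: "(ev (Univ 6 (Conj (At 10 (Var 6)) (Ad (Var 60) (Var 6))) (Ad (Var 61) (Var 6))) s5 \<noteq> 0) = fT P f"
    unfolding fT_def[OF i f(2,3)] using tp o5 unfolding last_def r_def xs_def by (auto simp: put_other)
  define F where "F = ev (Univ 6 (Conj (At 10 (Var 6)) (Ad (Var 60) (Var 6))) (Ad (Var 61) (Var 6))) s5"
  define s6 where "s6 = put s5 59 0 0 F"
  have 7: "ev (Ite (Var 59) LimE (Lst 6 (Conj (endE (Var 6)) (Conj (Eq (nbE (Var 6) 0) (Var 60)) (Neg (Ad (Var 6) (Var 61))))))) s6 = vT P f"
  proof -
    have q: "ev (Lst 6 (Conj (endE (Var 6)) (Conj (Eq (nbE (Var 6) 0) (Var 60)) (Neg (Ad (Var 6) (Var 61)))))) s6 =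
      least L (\<lambda>v. tpT v = 2 \<and> \<not> ad v x0 \<and> nbT v 0 = last \<and> \<not> ad v (JT P f (r - 2)))"
      unfolding ev.simps(11) by (rule least_cong[OF refl]) (use tp o5 in \<open>auto simp: put_other s6_def\<close>)
    have F: "ev (Var 59) s6 = F" "ev LimE s6 = L" unfolding s6_def by simp_all
    have "vT P f = (if fT P f then L else least L (\<lambda>v. tpT v = 2 \<and> \<not> ad v x0 \<and> nbT v 0 = last \<and> \<not> ad v (JT P f (r - 2))))"
      unfolding vT_def[OF i f(2,3)] last_def r_def xs_def ..
    then show ?thesis using 6 unfolding ev.simps(10) F q F_def[symmetric] by (cases "fT P f") simp_all
  qed
  define s7 where "s7 = put s6 50 0 0 (vT P f)"
  have o7: "u < 46 \<or> u = 51 \<or> u = 47 \<or> u = 48 \<Longrightarrow> s7 u = s4 u" "s7 49 0 0 = j0T P f" "s7 50 0 0 = vT P f" for u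
    using o5(1)[of u] o5(4) unfolding s7_def s6_def by (auto simp: put_other)
  let ?N = "newI P f"
  define s8 where "s8 = s7(12 := (\<lambda>i j. if i < L \<and> j = 0 then of_bool (i \<in> ?N) else s7 12 i j))"
  have 8: "sem (fill 5 12 (Cst 0) (Disj (Exi 6 (Conj (Lt (Add (Var 6) (Cst 1)) (Var 47)) (Eq (At 48 (Var 6)) (Var 5)))) (Disj (Eq (Var 5) (Var 49))
       (Disj (Eq (Var 5) (Var 50)) (Conj (At 12 (Var 5)) (Neg (Exi 6 (Conj (Lt (Var 6) (Var 47)) (Eq (idxE (At 51 (Var 6))) (Var 5)))))))))) s7 = s8"
    unfolding s8_def
  proof (rule fill_col)
    fix \<tau> w assume w: "w < L" and ag: "agree {12, 5} \<tau> s7" and row: "\<tau> 12 w = s7 12 w"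
    let ?\<rho> = "put \<tau> 5 0 0 w"
    have \<tau>: "\<tau> 47 0 0 = r" "k < r \<Longrightarrow> \<tau> 51 k 0 = xs ! k" "Suc k < r \<Longrightarrow> \<tau> 48 k 0 = JT P f k" "\<tau> 49 0 0 = j0T P f" "\<tau> 50 0 0 = vT P f" for k
      using ag o7 o4 J by simp_all
    have I: "(\<tau> 12 w 0 = 0) = (w \<notin> I)" using row o7(1)[of 12] o4(1)[of 12] T w by simp
    have a: "(ev (Exi 6 (Conj (Lt (Add (Var 6) (Cst 1)) (Var 47)) (Eq (At 48 (Var 6)) (Var 5)))) ?\<rho> \<noteq> 0) = (\<exists>k. Suc k < r \<and> JT P f k = w)"
    proof -
      have "(ev (Conj (Lt (Add (Var 6) (Cst 1)) (Var 47)) (Eq (At 48 (Var 6)) (Var 5))) (put ?\<rho> 6 0 0 k) \<noteq> 0) = (Suc k < r \<and> JT P f k = w)"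
        if "k < L" for k using that \<tau>(1) \<tau>(3)[of k] rL by (auto simp: put_other)
      moreover have "k < L" if "Suc k < r" for k using that rL by simp
      ultimately show ?thesis unfolding ev_simps(4) by (simp only: of_bool_eq_0_iff not_not) blast
    qed
    have b: "(ev (Exi 6 (Conj (Lt (Var 6) (Var 47)) (Eq (idxE (At 51 (Var 6))) (Var 5)))) ?\<rho> \<noteq> 0) = (\<exists>k<r. idx n (xs ! k) = w)"
    proof -
      have "(ev (Conj (Lt (Var 6) (Var 47)) (Eq (idxE (At 51 (Var 6))) (Var 5))) (put ?\<rho> 6 0 0 k) \<noteq> 0) = (k < r \<and> idx n (xs ! k) = w)"
        if "k < L" for k using that \<tau>(1) \<tau>(2)[of k] by (auto simp: put_other)
      moreover have "k < L" if "k < r" for k using that rL by simp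
      ultimately show ?thesis unfolding ev_simps(4) by (simp only: of_bool_eq_0_iff not_not) blast
    qed
    have c: "(ev (Eq (Var 5) (Var 49)) ?\<rho> \<noteq> 0) = (w = j0T P f)" "(ev (Eq (Var 5) (Var 50)) ?\<rho> \<noteq> 0) = (w = vT P f)"
      "(ev (At 12 (Var 5)) ?\<rho> \<noteq> 0) = (w \<in> I)"
      using \<tau> I by (simp_all add: put_other)
    have N: "w \<in> ?N \<longleftrightarrow> (\<exists>k. Suc k < r \<and> JT P f k = w) \<or> w = j0T P f \<or> w = vT P f \<or> w \<in> I \<and> \<not> (\<exists>k<r. idx n (xs ! k) = w)"
      unfolding newI_def[OF i f(2,3)] r_def xs_def using w by auto
    show "ev (Disj (Exi 6 (Conj (Lt (Add (Var 6) (Cst 1)) (Var 47)) (Eq (At 48 (Var 6)) (Var 5)))) (Disj (Eq (Var 5) (Var 49))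
       (Disj (Eq (Var 5) (Var 50)) (Conj (At 12 (Var 5)) (Neg (Exi 6 (Conj (Lt (Var 6) (Var 47)) (Eq (idxE (At 51 (Var 6))) (Var 5))))))))) ?\<rho> =
       of_bool (w \<in> ?N)"
      unfolding ev_simps(1,2,3) N a[symmetric] b[symmetric] c[symmetric] of_bool_eq_0_iff not_not ..
  qed auto
  have "sem (block p_augment) \<sigma> = s8"
  proof -
    let ?A = "[Set 47 (At 34 (Var 46)), fill 5 51 (Cst 0) (pathE (Var 46) (Var 5)), fill 5 58 (Cst 0) e3,
     fill 5 48 (Cst 0) (Ite (Lt (At 58 (Var 5)) NV) (At 58 (Var 5)) (Sub (At 58 (Var 5)) NV))]"
    let ?B = "[Set 49 (Lst 6 (Conj (startE (Var 6)) (Conj (Eq (nbE (Var 6) 0) (idxE (At 51 (Cst 0)))) (Neg (Ad (Var 6) (At 48 (Cst 0))))))),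
     Set 60 (idxE (At 51 (Sub (Var 47) (Cst 1)))), Set 61 (At 48 (Sub (Var 47) (Cst 2)))]"
    have A: "sem (block ?A) \<sigma> = s4"
    proof -
      have "sem (Set 47 (At 34 (Var 46))) \<sigma> = s1" unfolding s1_def using f(1) r(1) by simp
      then show ?thesis by (simp only: block.simps sem.simps(1,3) 2 3 4)
    qed
    have z: "ev (Cst 0) \<tau> = 0" for \<tau> by simp
    have "p_augment = ?A @ ?B @ drop 7 p_augment" unfolding p_augment_def e3_def by simp
    moreover have "sem (block xs) \<sigma> = sem (block zs) s5" if "xs = ?A @ ys @ zs" "sem (block ys) s4 = s5" for xs ys zs
      unfolding that(1) sem_block_append A that(2) ..
    ultimately have "sem (block p_augment) \<sigma> = sem (block (drop 7 p_augment)) s5" using 5 by blast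
    also have "\<dots> = s8"
    proof -
      have "drop 7 p_augment = [Set 59 (Univ 6 (Conj (At 10 (Var 6)) (Ad (Var 60) (Var 6))) (Ad (Var 61) (Var 6))),
        Set 50 (Ite (Var 59) LimE (Lst 6 (Conj (endE (Var 6)) (Conj (Eq (nbE (Var 6) 0) (Var 60)) (Neg (Ad (Var 6) (Var 61))))))),
        fill 5 12 (Cst 0) (Disj (Exi 6 (Conj (Lt (Add (Var 6) (Cst 1)) (Var 47)) (Eq (At 48 (Var 6)) (Var 5)))) (Disj (Eq (Var 5) (Var 49))
         (Disj (Eq (Var 5) (Var 50)) (Conj (At 12 (Var 5)) (Neg (Exi 6 (Conj (Lt (Var 6) (Var 47)) (Eq (idxE (At 51 (Var 6))) (Var 5)))))))))]"
        unfolding p_augment_def by simp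
      then show ?thesis
        by (simp only: block.simps sem.simps(1,2,3) z F_def[symmetric] s6_def[symmetric] 7 s7_def[symmetric] 8)
    qed
    finally show ?thesis .
  qed
  then have "\<forall>i<L. (sem (block p_augment) \<sigma> 12 i 0 = 0) = (i \<notin> ?N)" unfolding s8_def by simp
  then show ?thesis using newI[OF i f(2,3)] by blast
qed

end

section \<open>One phase: covering one more element\<close>

definition p_search_phase :: cmd where
  "p_search_phase = block [block p_edges, p_search, Set 46 (Lst 6 (Conj (At 32 (Var 6)) (At 31 (Var 6)))),
     Iff (Lt (Var 46) LimE) (block p_augment) (Set 13 (Cst 0))]"

definition p_swap_two :: cmd where
  "p_swap_two = block [fill 5 19 (Cst 0) (Lst 6 (Conj (endE (Var 6)) (at_nonadj (Var 6) (nbE (Var 5) 0) (Var 5)))),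
     Set 20 (Lst 6 (Conj (startE (Var 6)) (Lt (At 19 (Var 6)) LimE))),
     Iff (Lt (Var 20) LimE) (block [Wr 12 (nbE (Var 20) 0) (Cst 0) (Cst 0), Wr 12 (Var 20) (Cst 0) (Cst 1),
       Wr 12 (At 19 (Var 20)) (Cst 0) (Cst 1)]) p_search_phase]"

definition p_swap_full :: cmd where
  "p_swap_full = Sq (Set 18 (Lst 6 (Conj (startE (Var 6)) (fullE (Var 6) 0))))
     (Iff (Lt (Var 18) LimE) (block [Wr 12 (nbE (Var 18) 0) (Cst 0) (Cst 0), Wr 12 (Var 18) (Cst 0) (Cst 1)]) p_swap_two)"

definition p_phase :: cmd where
  "p_phase = block [block p_nb, Set 17 (Lst 6 (Conj (Eq (tpE (Var 6)) (Cst 1)) (Ad (Var 6) (Var 4)))),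
     Iff (Lt (Var 17) LimE) (Wr 12 (Var 17) (Cst 0) (Cst 1)) p_swap_full]"

context prog_tables
begin

definition progress :: "store \<Rightarrow> bool" where
  "progress \<sigma> \<longleftrightarrow> \<sigma> 13 0 0 \<noteq> 0 \<and> (\<exists>I'. indep I' \<and> \<Union> (A ` I) \<subseteq> \<Union> (A ` I') \<and> x0 \<in> \<Union> (A ` I') \<and>
    (\<forall>i<L. (\<sigma> 12 i 0 = 0) = (i \<notin> I'))) \<or>
   \<sigma> 13 0 0 = 0 \<and> \<not> (\<exists>J. indep J \<and> D \<subseteq> \<Union> (A ` J))"

lemma progressI:
  assumes "\<sigma> 13 0 0 \<noteq> 0" "indep I'" "\<Union> (A ` I) \<subseteq> \<Union> (A ` I')" "i \<in> I'" "ad i x0" "\<And>i. i < L \<Longrightarrow> (\<sigma> 12 i 0 = 0) = (i \<notin> I')"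
  shows "progress \<sigma>"
  unfolding progress_def using assms x0_A[of i] by blast

lemma progressD: "progress \<sigma> \<Longrightarrow> \<sigma> 13 0 0 \<noteq> 0 \<Longrightarrow> \<exists>I'. indep I' \<and> \<Union> (A ` I) \<subseteq> \<Union> (A ` I') \<and> x0 \<in> \<Union> (A ` I') \<and>
    (\<forall>i<L. (\<sigma> 12 i 0 = 0) = (i \<notin> I'))"
  unfolding progress_def by blast

lemma ok_writes: "13 \<notin> writes (block p_nb)" "13 \<notin> writes (block p_edges)" "13 \<notin> writes p_search" "13 \<notin> writes (block p_augment)"
  unfolding p_nb_def p_edges_def p_search_def p_augment_def p_step_def p_ends_def p_turn_def p_update_def p_grow_def p_pos_def scatter_def
    p_st_def p_fi_def p_q_def p_rp_def p_rq_def p_cl_def p_mark_def p_X_def p_Y_def p_FX_def fill_def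
  by simp_all

text \<open>The four kinds of exchange are tried in turn. The failures of the first three are
  exactly the extra assumptions of \<open>stuck_tables\<close>, under which the classes make sense
  and the search is meaningful.\<close>

lemma phase:
  assumes i: "input \<sigma>" and ok: "\<sigma> 13 0 0 \<noteq> 0"
  shows "progress (sem p_phase \<sigma>)"
proof -
  define s1 where "s1 = sem (block p_nb) \<sigma>"
  have t1: "tab1 s1" unfolding s1_def by (rule sem_nb[OF i])
  have o1: "s1 13 0 0 \<noteq> 0" unfolding s1_def frame[OF ok_writes(1)] by (rule ok)
  note T = t1[unfolded tab1_def input_def]
  define k1 where "k1 = ev (Lst 6 (Conj (Eq (tpE (Var 6)) (Cst 1)) (Ad (Var 6) (Var 4)))) s1"
  have k1: "k1 = least L (\<lambda>w. tpT w = 1 \<and> ad w x0)"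
    unfolding k1_def ev.simps(11) by (rule least_cong[OF refl]) (use T in \<open>auto simp: put_other\<close>)
  define s2 where "s2 = put s1 17 0 0 k1"
  have p: "sem p_phase \<sigma> = (if k1 < L then put s2 12 k1 0 1 else sem p_swap_full s2)"
    unfolding p_phase_def block.simps sem.simps s1_def[symmetric] k1_def[symmetric] by (simp add: s2_def)
  have o2: "s2 u = s1 u" if "u \<noteq> 17" for u unfolding s2_def using that by (simp add: put_other)
  show ?thesis
  proof (cases "k1 < L")
    case True
    then have w: "tpT k1 = 1" "ad k1 x0" using least_prop[of L "\<lambda>w. tpT w = 1 \<and> ad w x0"] k1 by auto
    then have "k1 \<in> W" "\<And>i. i \<in> I \<Longrightarrow> \<not> ad k1 i" using tpT_1 by blast+
    then have ind: "indep (insert k1 I)" by (rule add_free)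
    show ?thesis
      by (rule progressI[where i = k1, OF _ ind]) (use w o1 o2 T True p in \<open>auto simp: put_def\<close>)
  next
    case g1: False
    then have n1: "\<not> (\<exists>w. tpT w = 1 \<and> ad w x0)" using k1 least_less[of L "\<lambda>w. tpT w = 1 \<and> ad w x0"] tpT_1 W_L(2) by blast
    define k2 where "k2 = ev (Lst 6 (Conj (startE (Var 6)) (fullE (Var 6) 0))) s2"
    have k2: "k2 = least L (\<lambda>w. tpT w = 2 \<and> ad w x0 \<and> fullT w 0)"
      unfolding k2_def ev.simps(11) by (rule least_cong[OF refl]) (use T o2 in \<open>auto simp: put_other\<close>)
    define s3 where "s3 = put s2 18 0 0 k2"
    have o3: "s3 u = s1 u" if "u \<noteq> 17" "u \<noteq> 18" for u unfolding s3_def using that o2 by (simp add: put_other)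
    have p2: "sem p_swap_full s2 = (if k2 < L then put (put s3 12 (s3 14 k2 0) 0 0) 12 k2 0 1 else sem p_swap_two s3)"
      unfolding p_swap_full_def block.simps sem.simps k2_def[symmetric] by (simp add: s3_def put_other)
    show ?thesis
    proof (cases "k2 < L")
      case True
      then have w: "tpT k2 = 2" "ad k2 x0" "fullT k2 0" using least_prop[of L "\<lambda>w. tpT w = 2 \<and> ad w x0 \<and> fullT w 0"] k2 by auto
      have s: "single k2 (nbT k2 0)" "A (nbT k2 0) \<subseteq> A k2" using w tpT_2 fullT by blast+
      have "s3 14 k2 0 = nbT k2 0" using True T o3[of 14] by simp
      then show ?thesis
        by (intro progressI[where i = k2, OF _ swap_full[OF s]]) (use w o1 o3 T True g1 p p2 in \<open>auto simp: put_def\<close>)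
    next
      case g2: False
      then have n2: "\<not> (\<exists>w. tpT w = 2 \<and> ad w x0 \<and> fullT w 0)"
        using k2 least_less[of L "\<lambda>w. tpT w = 2 \<and> ad w x0 \<and> fullT w 0"] tpT_W(3) by blast
      define vv where "vv w = least L (\<lambda>v. tpT v = 2 \<and> \<not> ad v x0 \<and> nbT v 0 = nbT w 0 \<and> \<not> ad v w)" for w
      define s4 where "s4 = s3(19 := (\<lambda>i j. if i < L \<and> j = 0 then vv i else s3 19 i j))"
      have 4: "sem (fill 5 19 (Cst 0) (Lst 6 (Conj (endE (Var 6)) (at_nonadj (Var 6) (nbE (Var 5) 0) (Var 5))))) s3 = s4"
        unfolding s4_def
      proof (rule fill_col)
        fix \<tau> w assume w: "w < L" and ag: "agree {19, 5} \<tau> s3"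
        have \<tau>: "\<tau> 4 = s1 4" "\<tau> 14 = s1 14" "\<tau> 15 = s1 15" using ag o3 by auto
        show "ev (Lst 6 (Conj (endE (Var 6)) (at_nonadj (Var 6) (nbE (Var 5) 0) (Var 5)))) (put \<tau> 5 0 0 w) = vv w"
          unfolding vv_def ev.simps(11) by (rule least_cong[OF refl]) (use T w in \<open>auto simp: put_other \<tau>\<close>)
      qed auto
      define k3 where "k3 = ev (Lst 6 (Conj (startE (Var 6)) (Lt (At 19 (Var 6)) LimE))) s4"
      have k3: "k3 = least L (\<lambda>w. tpT w = 2 \<and> ad w x0 \<and> vv w < L)"
        unfolding k3_def ev.simps(11) by (rule least_cong[OF refl]) (use T o3 in \<open>auto simp: put_other s4_def\<close>)
      define s5 where "s5 = put s4 20 0 0 k3"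
      have o5: "s5 u = s1 u" if "u \<noteq> 17" "u \<noteq> 18" "u \<noteq> 19" "u \<noteq> 20" for u
        unfolding s5_def s4_def using that o3 by (simp add: put_other)
      have p3: "sem p_swap_two s3 = (if k3 < L then put (put (put s5 12 (s5 14 k3 0) 0 0) 12 k3 0 1) 12 (s5 19 k3 0) 0 1 else sem p_search_phase s5)"
        unfolding p_swap_two_def block.simps sem.simps 4 k3_def[symmetric] by (simp add: s5_def put_other)
      show ?thesis
      proof (cases "k3 < L")
        case True
        then have w: "tpT k3 = 2" "ad k3 x0" "vv k3 < L" using least_prop[of L "\<lambda>w. tpT w = 2 \<and> ad w x0 \<and> vv w < L"] k3 by auto
        let ?v = "vv k3"
        have v: "tpT ?v = 2" "\<not> ad ?v x0" "nbT ?v 0 = nbT k3 0" "\<not> ad ?v k3"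
          using least_prop[of L "\<lambda>v. tpT v = 2 \<and> \<not> ad v x0 \<and> nbT v 0 = nbT k3 0 \<and> \<not> ad v k3"] w(3) unfolding vv_def by auto
        have s: "single k3 (nbT k3 0)" "single ?v (nbT k3 0)" using w v tpT_2 by auto
        have ne: "k3 \<noteq> ?v" "\<not> ad k3 ?v" using w v adj_sym by auto
        have tb: "s5 14 k3 0 = nbT k3 0" "s5 19 k3 0 = ?v" using True T o5[of 14] unfolding s5_def s4_def by (simp_all add: put_other)
        show ?thesis
          by (intro progressI[where i = k3, OF _ swap_two[OF s ne]]) (use w o1 o5 T True g1 g2 p p2 p3 tb ne in \<open>auto simp: put_def\<close>)
      next
        case g3: False
        have n3: "\<not> (\<exists>w v. tpT w = 2 \<and> ad w x0 \<and> tpT v = 2 \<and> \<not> ad v x0 \<and> nbT v 0 = nbT w 0 \<and> \<not> ad v w)"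
        proof
          assume "\<exists>w v. tpT w = 2 \<and> ad w x0 \<and> tpT v = 2 \<and> \<not> ad v x0 \<and> nbT v 0 = nbT w 0 \<and> \<not> ad v w"
          then obtain w v where wv: "tpT w = 2" "ad w x0" "tpT v = 2 \<and> \<not> ad v x0 \<and> nbT v 0 = nbT w 0 \<and> \<not> ad v w" by blast
          then have "vv w < L" unfolding vv_def least_less using tpT_W(3) by blast
          then have "k3 < L" unfolding k3 least_less using wv tpT_W(3) by blast
          then show False using g3 by blast
        qed
        \<comment> \<open>From here on the node graph is available for the current
          \<open>I\<close>.\<close>
        interpret prog_stuck n ad W A I x0 D
          by unfold_locales (use n1 n2 n3 in auto)
        have t5: "tab1 s5" unfolding tab1_def input_def using T o5 by simp
        define s6 where "s6 = sem (block p_edges) s5"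
        have t6: "tab2 s6" unfolding s6_def by (rule sem_edges[OF t5])
        obtain Z P base where Z: "state L (sem p_search s6) Z P base" "closed Z base" using search[OF t6] by blast
        define s7 where "s7 = sem p_search s6"
        note S = stateD[OF Z(1)[folded s7_def]]
        have o7: "s7 13 0 0 \<noteq> 0" unfolding s7_def s6_def frame[OF ok_writes(3)] frame[OF ok_writes(2)] using o5[of 13] o1 by simp
        define f where "f = ev (Lst 6 (Conj (At 32 (Var 6)) (At 31 (Var 6)))) s7"
        have f: "f = least L (\<lambda>e. e \<in> Z \<and> finT e)"
          unfolding f_def ev.simps(11) by (rule least_cong[OF refl]) (use S(1,3) in \<open>auto simp: put_other tab2_def\<close>)
        define s8 where "s8 = put s7 46 0 0 f"
        have p4: "sem p_search_phase s5 = (if f < L then sem (block p_augment) s8 else put s8 13 0 0 0)"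
          unfolding p_search_phase_def block.simps sem.simps s6_def[symmetric] s7_def[symmetric] f_def[symmetric]
          by (simp add: s8_def)
        have o8: "s8 13 0 0 \<noteq> 0" using o7 unfolding s8_def by (simp add: put_other)
        show ?thesis
        proof (cases "f < L")
          case True
          then have fZ: "f \<in> Z" "finT f" using least_prop[of L "\<lambda>e. e \<in> Z \<and> finT e"] f by auto
          have s8: "state L s8 Z P base" using state_cong[OF Z(1)[folded s7_def], of s8 L] unfolding s8_def by (simp add: put_other)
          have "s8 46 0 0 = f" unfolding s8_def by simp
          then have "\<exists>I'. indep I' \<and> \<Union> (A ` I) \<subseteq> \<Union> (A ` I') \<and> x0 \<in> \<Union> (A ` I') \<and>
            (\<forall>i<L. (sem (block p_augment) s8 12 i 0 = 0) = (i \<notin> I'))" using augment[OF s8 _ fZ] by blast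
          moreover have "sem (block p_augment) s8 13 0 0 \<noteq> 0" unfolding frame[OF ok_writes(4)] by (rule o8)
          moreover have "sem p_phase \<sigma> = sem (block p_augment) s8" using g1 g2 g3 True p p2 p3 p4 by simp
          ultimately show ?thesis unfolding progress_def by simp
        next
          case False
          then have "\<not> finT e" if "e \<in> Z" for e using that state_bounds(2)[OF Z(1)] least_less[of L "\<lambda>e. e \<in> Z \<and> finT e"] f by blast
          then have "\<not> (\<exists>J. indep J \<and> D \<subseteq> \<Union> (A ` J))" using closed_no_cover[OF S(2) Z(2)] by blast
          moreover have "sem p_phase \<sigma> = put s8 13 0 0 0" using g1 g2 g3 False p p2 p3 p4 by simp
          ultimately show ?thesis unfolding progress_def by simp
        qed
      qed
    qed
  qed
qed

end

section \<open>Covering all elements of an instance\<close>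

definition p_solve :: cmd where
  "p_solve = block [fill 5 12 (Cst 0) (Cst 0), Set 13 (Cst 1),
     For 4 (Iff (Conj (At 10 (Var 4)) (Conj (Var 13) (Neg (Exi 6 (Conj (At 12 (Var 6)) (Ad (Var 6) (Var 4))))))) p_phase Nop)]"

lemma writes_phase: "writes p_phase \<inter> {0, 1, 2, 3, 10, 11} = {}"
  unfolding p_phase_def p_swap_full_def p_swap_two_def p_search_phase_def
    p_nb_def p_edges_def p_search_def p_augment_def p_step_def p_ends_def p_turn_def p_update_def p_grow_def p_pos_def scatter_def
    p_st_def p_fi_def p_q_def p_rp_def p_rq_def p_cl_def p_mark_def p_X_def p_Y_def p_FX_def fill_def
  by simp

lemma writes_solve: "writes p_solve \<inter> {0, 1, 2, 3, 10, 11} = {}"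
  using writes_phase unfolding p_solve_def fill_def by simp

context prog
begin

text \<open>Elements covered once stay covered, since an exchange never loses any; so a single pass
  over \<open>D\<close> is enough.\<close>

lemma solve:
  assumes c: "cover_instance W ad (\<lambda>w. {x \<in> D. ad w x})" and W: "W \<subseteq> {..<n}" and D: "D \<subseteq> {..<n}"
    and T: "\<And>i. i < L \<Longrightarrow> (\<sigma> 10 i 0 = 0) = (i \<notin> D)" "\<And>i. i < L \<Longrightarrow> (\<sigma> 11 i 0 = 0) = (i \<notin> W)"
  shows "(sem p_solve \<sigma> 13 0 0 \<noteq> 0) = (\<exists>J. cover_instance.indep W ad J \<and> D \<subseteq> (\<Union>j\<in>J. {x \<in> D. ad j x}))"
proof -
  interpret cover_instance W ad "\<lambda>w. {x \<in> D. ad w x}" by (rule c)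
  let ?A = "\<lambda>w. {x \<in> D. ad w x}"
  define Sol where "Sol \<longleftrightarrow> (\<exists>J. indep J \<and> D \<subseteq> (\<Union>j\<in>J. ?A j))"
  define inp where "inp \<tau> \<longleftrightarrow> (\<forall>i<L. (\<tau> 10 i 0 = 0) = (i \<notin> D)) \<and> (\<forall>i<L. (\<tau> 11 i 0 = 0) = (i \<notin> W))" for \<tau> :: store
  define s1 where "s1 = put (\<sigma>(12 := (\<lambda>i j. if i < L \<and> j = 0 then 0 else \<sigma> 12 i j))) 13 0 0 1"
  define body where "body = Iff (Conj (At 10 (Var 4)) (Conj (Var 13) (Neg (Exi 6 (Conj (At 12 (Var 6)) (Ad (Var 6) (Var 4))))))) p_phase Nop"
  have "sem (fill 5 12 (Cst 0) (Cst 0)) \<sigma> = \<sigma>(12 := (\<lambda>i j. if i < L \<and> j = 0 then 0 else \<sigma> 12 i j))"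
    by (rule fill_col) auto
  then have sem: "sem p_solve \<sigma> = sem (For 4 body) s1" unfolding p_solve_def s1_def body_def by simp
  define Cov where "Cov k \<tau> I \<longleftrightarrow> indep I \<and> (\<forall>i<L. (\<tau> 12 i 0 = 0) = (i \<notin> I)) \<and> (\<forall>x\<in>D. x < k \<longrightarrow> x \<in> (\<Union>j\<in>I. ?A j))"
    for k and \<tau> :: store and I
  \<comment> \<open>A flag that has become \<open>0\<close> may stay so: a failing phase refutes
    every cover of the whole of \<open>D\<close>, not only an extension of the current one.\<close>
  define Inv where "Inv k \<tau> \<longleftrightarrow> inp \<tau> \<and> (\<tau> 13 0 0 \<noteq> 0 \<and> (\<exists>I. Cov k \<tau> I) \<or> \<tau> 13 0 0 = 0 \<and> \<not> Sol)" for k \<tau>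
  have "(sem (For 4 body) s1 13 0 0 \<noteq> 0) = Sol"
  proof (rule sem_For[where I = Inv])
    have "indep {}" unfolding indep_def by simp
    then have "Cov 0 s1 {}" unfolding Cov_def s1_def by (auto simp: put_def)
    moreover have "inp s1" "s1 13 0 0 \<noteq> 0" unfolding inp_def s1_def using T by (auto simp: put_def)
    ultimately show "Inv 0 s1" unfolding Inv_def by blast
    show "(put \<tau> 4 0 0 (s1 4 0 0) 13 0 0 \<noteq> 0) = Sol" if l: "Inv L \<tau>" for \<tau>
    proof (cases "\<tau> 13 0 0 = 0")
      case True
      then show ?thesis using l unfolding Inv_def by (simp add: put_other)
    next
      case False
      then obtain I where I: "indep I" "\<forall>x\<in>D. x < L \<longrightarrow> x \<in> (\<Union>j\<in>I. ?A j)" using l unfolding Inv_def Cov_def by (elim conjE disjE exE) simp_all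
      have "D \<subseteq> (\<Union>j\<in>I. ?A j)" using I(2) D lim_ge by fastforce
      then have Sol unfolding Sol_def using I(1) by blast
      then show ?thesis using False by (simp add: put_other)
    qed
    fix k \<tau> assume k: "k < L" and Ik: "Inv k \<tau>"
    let ?\<rho> = "put \<tau> 4 0 0 k"
    define \<tau>' where "\<tau>' = sem body ?\<rho>"
    have ip: "inp ?\<rho>" using Ik unfolding Inv_def inp_def by (simp add: put_other)
    have fr: "\<tau>' 10 = \<tau> 10" "\<tau>' 11 = \<tau> 11" unfolding \<tau>'_def body_def using writes_phase by (simp_all add: frame put_other)
    have inp': "inp \<tau>'" using Ik fr unfolding Inv_def inp_def by simp
    have v13: "?\<rho> 13 = \<tau> 13" "?\<rho> 12 = \<tau> 12" "?\<rho> 10 = \<tau> 10" by (simp_all add: put_other)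
    show "Inv (Suc k) \<tau>'"
    proof (cases "\<tau> 13 0 0 = 0")
      case True
      then have "\<tau>' = ?\<rho>" unfolding \<tau>'_def body_def by (simp add: put_other)
      then show ?thesis using Ik True inp' unfolding Inv_def by (simp add: put_other)
    next
      case ok: False
      then obtain I where I: "indep I" "\<forall>i<L. (\<tau> 12 i 0 = 0) = (i \<notin> I)" "\<forall>x\<in>D. x < k \<longrightarrow> x \<in> (\<Union>j\<in>I. ?A j)"
        using Ik unfolding Inv_def Cov_def by (elim conjE disjE exE) simp_all
      have IL: "i < L" if "i \<in> I" for i using I(1) W that lim_ge unfolding indep_def by fastforce
      have cond: "(ev (Conj (At 10 (Var 4)) (Conj (Var 13) (Neg (Exi 6 (Conj (At 12 (Var 6)) (Ad (Var 6) (Var 4))))))) ?\<rho> \<noteq> 0) =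
        (k \<in> D \<and> \<not> (\<exists>i\<in>I. ad i k))"
        using ok Ik k I(2) IL unfolding Inv_def inp_def by (auto simp: put_other)
      show ?thesis
      proof (cases "k \<in> D \<and> \<not> (\<exists>i\<in>I. ad i k)")
        case False
        then have e: "\<tau>' = ?\<rho>" unfolding \<tau>'_def body_def sem.simps using cond by simp
        have "\<forall>x\<in>D. x < Suc k \<longrightarrow> x \<in> (\<Union>j\<in>I. ?A j)" using I(3) False by (auto simp: less_Suc_eq)
        then have "Cov (Suc k) \<tau>' I" unfolding Cov_def e v13 using I by blast
        moreover have "\<tau>' 13 0 0 \<noteq> 0" unfolding e v13 using ok .
        ultimately show ?thesis using inp' unfolding Inv_def by blast
      next
        case True
        then have e: "\<tau>' = sem p_phase ?\<rho>" unfolding \<tau>'_def body_def sem.simps using cond by simp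
        interpret ph: prog_tables n ad W ?A I k D
        proof unfold_locales
          show "u < n \<and> v < n" if "ad u v" for u v using ad_less[OF that] .
          show "4 * n + 8 \<le> L" by (rule lim_ge(1))
        qed (use I(1) True W in auto)
        have "ph.input ?\<rho>" unfolding ph.input_def using ip I(2) unfolding inp_def by (simp add: put_other)
        then have pr: "ph.progress \<tau>'" unfolding e by (rule ph.phase) (use ok in \<open>simp add: put_other\<close>)
        show ?thesis
        proof (cases "\<tau>' 13 0 0 = 0")
          case True
          then have "\<not> Sol" using pr unfolding ph.progress_def Sol_def by blast
          then show ?thesis using inp' True unfolding Inv_def by blast
        next
          case False
          then obtain I' where I': "indep I'" "\<Union> (?A ` I) \<subseteq> \<Union> (?A ` I')" "k \<in> \<Union> (?A ` I')" "\<forall>i<L. (\<tau>' 12 i 0 = 0) = (i \<notin> I')"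
            using ph.progressD[OF pr False] by (elim exE conjE)
          have "\<forall>x\<in>D. x < Suc k \<longrightarrow> x \<in> (\<Union>j\<in>I'. ?A j)" using I(3) I'(2,3) by (metis (no_types, lifting) less_Suc_eq subsetD)
          then have "Cov (Suc k) \<tau>' I'" unfolding Cov_def using I'(1,4) by blast
          then show ?thesis using inp' False unfolding Inv_def by blast
        qed
      qed
    qed
  qed
  then show ?thesis unfolding sem Sol_def .
qed

end

section \<open>Enumeration of the seeds\<close>

definition p_cands :: cmd where
  "p_cands = fill 5 11 (Cst 0) (Conj (Neg (Eq (Var 5) (Var 1))) (Conj (Neg (Eq (Var 5) (Var 2))) (Conj (Neg (Eq (Var 5) (Var 3)))
     (Conj (Neg (Ad (Var 1) (Var 5))) (Conj (Neg (Ad (Var 2) (Var 5))) (Conj (Neg (Ad (Var 3) (Var 5)))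
       (Exi 6 (Conj (At 10 (Var 6)) (Ad (Var 5) (Var 6))))))))))"

definition p_check :: "expr \<Rightarrow> cmd" where
  "p_check d = block [fill 5 10 (Cst 0) d, p_cands, p_solve, Iff (Var 13) (Set 0 (Cst 0)) Nop]"

abbreviation nbhE :: expr where "nbhE \<equiv> Ad (Var 1) (Var 5)"
abbreviation farE :: expr where
  "farE \<equiv> Conj (Disj (Ad (Var 2) (Var 5)) (Ad (Var 3) (Var 5))) (Conj (Neg (Ad (Var 1) (Var 5))) (Neg (Eq (Var 5) (Var 1))))"

definition p_ends2 :: cmd where
  "p_ends2 = For 3 (Iff (Conj (Ad (Var 1) (Var 3)) (Conj (Neg (Eq (Var 2) (Var 3))) (Neg (Ad (Var 2) (Var 3))))) (p_check farE) Nop)"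
definition p_paths :: cmd where
  "p_paths = For 2 (Iff (Ad (Var 1) (Var 2)) p_ends2 Nop)"
text \<open>Setting \<open>t1 = t2 = s\<close> lets the same check treat the seed
  \<open>{s}\<close>.\<close>

definition p_seeds :: cmd where
  "p_seeds = For 1 (Iff (Lt (Var 1) NV) (block [Set 2 (Var 1), Set 3 (Var 1), p_check nbhE, p_paths]) Nop)"
text \<open>An isolated vertex settles the answer at once. Without this exit, the outer loop could
  cost more than the number of edges allows.\<close>

definition isolatedE :: expr where
  "isolatedE = Exi 6 (Conj (Lt (Var 6) NV) (Neg (Exi 7 (Ad (Var 6) (Var 7)))))"
definition p_main :: cmd where
  "p_main = Sq (Set 0 (Cst 1)) (Iff isolatedE (Set 0 (Cst 0)) p_seeds)"

lemma writes_check: "writes (p_check d) \<inter> {1, 2, 3} = {}"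
  using writes_solve unfolding p_check_def p_cands_def fill_def by auto

lemma ok_main: "cmd_ok p_main"
  unfolding p_main_def p_seeds_def p_paths_def p_ends2_def isolatedE_def p_check_def p_cands_def p_solve_def
    p_phase_def p_swap_full_def p_swap_two_def p_search_phase_def blossomE_def growE_def turnE_def newE_def
    p_nb_def p_edges_def p_search_def p_augment_def p_step_def p_ends_def p_turn_def p_update_def p_grow_def p_pos_def scatter_def
    p_st_def p_fi_def p_q_def p_rp_def p_rq_def p_cl_def p_mark_def p_X_def p_Y_def p_FX_def fill_def
    mateE_def idxE_def nodeE_def Conj_def Disj_def Exi_def Univ_def Neg_def
  by simp

text \<open>A phase is quadratic: the search loop has linearly many rounds of linear cost, and no
  table is filled by more than one search per entry.\<close>

lemma dep_phase: "cdep p_phase \<le> 2"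
  unfolding p_phase_def p_swap_full_def p_swap_two_def p_search_phase_def blossomE_def growE_def turnE_def newE_def
    p_nb_def p_edges_def p_search_def p_augment_def p_step_def p_ends_def p_turn_def p_update_def p_grow_def p_pos_def scatter_def
    p_st_def p_fi_def p_q_def p_rp_def p_rq_def p_cl_def p_mark_def p_X_def p_Y_def p_FX_def fill_def
    mateE_def idxE_def nodeE_def Conj_def Disj_def Exi_def Univ_def Neg_def
  by simp

lemma dep_check: "edep d = 0 \<Longrightarrow> cdep (p_check d) \<le> 3"
  using dep_phase unfolding p_check_def p_cands_def p_solve_def fill_def Conj_def Exi_def Neg_def by simp

context prog
begin

text \<open>In contrast to \<open>cost_le\<close> the bound may vary with the round. This is needed
  for the outer loops, where only neighbours of \<open>s\<close> lead to an expensive round.\<close>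

lemma cost_For_le:
  assumes "\<And>k \<tau>. k < L \<Longrightarrow> (\<And>a. a \<notin> writes c \<Longrightarrow> a \<noteq> x \<Longrightarrow> \<tau> a = \<sigma> a) \<Longrightarrow> cost c (put \<tau> x 0 0 k) \<le> g k"
  shows "cost (For x c) \<sigma> \<le> (\<Sum>k<L. g k) + 10 * L + 20"
proof -
  let ?i = "\<lambda>k. iter (\<lambda>k \<tau>. sem c (put \<tau> x 0 0 k)) k \<sigma>"
  have "?i k a = \<sigma> a" if "a \<notin> writes c" "a \<noteq> x" for k a
    using that by (induction k) (simp_all add: frame put_other)
  then have "(\<Sum>k<L. cost c (put (?i k) x 0 0 k) + 10) \<le> (\<Sum>k<L. g k + 10)"
    by (intro sum_mono add_mono le_refl assms) auto
  then show ?thesis by (simp add: sum.distrib)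
qed

end

context graph
begin

sublocale ram: prog n ad
  by unfold_locales (rule ad_less)

lemma check:
  assumes c: "\<sigma> 1 0 0 = s" "\<sigma> 2 0 0 = t1" "\<sigma> 3 0 0 = t2"
    and d: "\<And>\<tau> x. \<tau> 1 0 0 = s \<Longrightarrow> \<tau> 2 0 0 = t1 \<Longrightarrow> \<tau> 3 0 0 = t2 \<Longrightarrow> ram.ev d (put \<tau> 5 0 0 x) = of_bool (x \<in> D)"
    and cf: "claw_free {..<n} E" and dom: "\<And>x. x \<in> D \<Longrightarrow> \<exists>t\<in>{s, t1, t2}. ad t x"
  shows "ram.sem (p_check d) \<sigma> 0 0 0 = (if solvable D {s, t1, t2} then 0 else \<sigma> 0 0 0)"
proof -
  interpret claw_free_graph n E by unfold_locales (rule cf)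
  let ?T = "{s, t1, t2}"
  let ?W = "cands D ?T"
  have Dn: "D \<subseteq> {..<n}" using dom ad_less by blast
  have Wn: "?W \<subseteq> {..<n}" unfolding cands_def using ad_less by blast
  define s1 where "s1 = \<sigma>(10 := (\<lambda>i j. if i < ram.L \<and> j = 0 then of_bool (i \<in> D) else \<sigma> 10 i j))"
  have 1: "ram.sem (fill 5 10 (Cst 0) d) \<sigma> = s1"
    unfolding s1_def by (rule ram.fill_col) (use c d in auto)
  define s2 where "s2 = s1(11 := (\<lambda>i j. if i < ram.L \<and> j = 0 then of_bool (i \<in> ?W) else s1 11 i j))"
  have 2: "ram.sem p_cands s1 = s2"
    unfolding p_cands_def s2_def
  proof (rule ram.fill_col)
    fix \<tau> w assume w: "w < ram.L" and ag: "ram.agree {11, 5} \<tau> s1"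
    have \<tau>: "\<tau> 1 0 0 = s" "\<tau> 2 0 0 = t1" "\<tau> 3 0 0 = t2" "i < ram.L \<Longrightarrow> (\<tau> 10 i 0 = 0) = (i \<notin> D)" for i
      using ag c unfolding s1_def by simp_all
    have "x < ram.L" if "ad w x" for x using ad_less[OF that] ram.lim_ge by simp
    then have "(\<exists>x<ram.L. x \<in> D \<and> ad w x) = (\<exists>x\<in>D. ad w x)" by blast
    moreover have "(\<exists>k<ram.L. \<tau> 10 k 0 \<noteq> 0 \<and> ad w k) = (\<exists>x<ram.L. x \<in> D \<and> ad w x)"
      by (intro ex_cong1 conj_cong refl) (simp add: \<tau>(4))
    ultimately show "ram.ev (Conj (Neg (Eq (Var 5) (Var 1))) (Conj (Neg (Eq (Var 5) (Var 2))) (Conj (Neg (Eq (Var 5) (Var 3)))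
     (Conj (Neg (Ad (Var 1) (Var 5))) (Conj (Neg (Ad (Var 2) (Var 5))) (Conj (Neg (Ad (Var 3) (Var 5)))
       (Exi 6 (Conj (At 10 (Var 6)) (Ad (Var 5) (Var 6)))))))))) (put \<tau> 5 0 0 w) = of_bool (w \<in> ?W)"
      using \<tau>(1-3) unfolding cands_def by (simp add: ram.put_other)
  qed auto
  have "(ram.sem p_solve s2 13 0 0 \<noteq> 0) = (\<exists>J. cover_instance.indep ?W ad J \<and> D \<subseteq> (\<Union>j\<in>J. {x \<in> D. ad j x}))"
  proof (rule ram.solve[OF cands_instance[OF dom] Wn Dn])
    show "i < ram.L \<Longrightarrow> (s2 10 i 0 = 0) = (i \<notin> D)" for i unfolding s2_def s1_def by simp
    show "i < ram.L \<Longrightarrow> (s2 11 i 0 = 0) = (i \<notin> ?W)" for i unfolding s2_def by simp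
  qed
  also have "\<dots> = solvable D ?T" by (rule solvable_iff[OF dom, symmetric])
  finally have "(ram.sem p_solve s2 13 0 0 \<noteq> 0) = solvable D ?T" .
  moreover have "ram.sem p_solve s2 0 = \<sigma> 0"
    using ram.frame[of 0 p_solve s2] writes_solve unfolding s2_def s1_def by auto
  moreover have "ram.sem (p_check d) \<sigma> = (if ram.sem p_solve s2 13 0 0 = 0 then ram.sem p_solve s2 else put (ram.sem p_solve s2) 0 0 0 0)"
    unfolding p_check_def using 1 2 by simp
  ultimately show ?thesis by auto
qed

lemma far_dom: "induced_path s t1 t2 \<Longrightarrow> x \<in> far s t1 t2 \<Longrightarrow> \<exists>t\<in>{s, t1, t2}. ad t x"
  unfolding far_def by auto

text \<open>\<Phi> is the verdict on all earlier seeds: the answer is only ever lowered to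
  \<open>0\<close>.\<close>

lemma ends2:
  assumes cf: "claw_free {..<n} E" and c: "\<sigma> 1 0 0 = s" "\<sigma> 2 0 0 = t1" "\<sigma> 0 0 0 = of_bool \<Phi>" "ad s t1"
  shows "ram.sem p_ends2 \<sigma> 0 0 0 = of_bool (\<Phi> \<and> (\<forall>t2. induced_path s t1 t2 \<longrightarrow> \<not> solvable (far s t1 t2) {s, t1, t2}))"
  unfolding p_ends2_def
proof (rule ram.sem_For[where I = "\<lambda>k \<tau>. \<tau> 1 0 0 = s \<and> \<tau> 2 0 0 = t1 \<and>
    \<tau> 0 0 0 = of_bool (\<Phi> \<and> (\<forall>t2<k. induced_path s t1 t2 \<longrightarrow> \<not> solvable (far s t1 t2) {s, t1, t2}))"])
  show "\<sigma> 1 0 0 = s \<and> \<sigma> 2 0 0 = t1 \<and> \<sigma> 0 0 0 = of_bool (\<Phi> \<and> (\<forall>t2<0. induced_path s t1 t2 \<longrightarrow> \<not> solvable (far s t1 t2) {s, t1, t2}))"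
    using c by simp
next
  fix \<tau> :: store assume I: "\<tau> 1 0 0 = s \<and> \<tau> 2 0 0 = t1 \<and> \<tau> 0 0 0 = of_bool (\<Phi> \<and> (\<forall>t2<ram.L. induced_path s t1 t2 \<longrightarrow> \<not> solvable (far s t1 t2) {s, t1, t2}))"
  have "t2 < ram.L" if "induced_path s t1 t2" for t2 using that ad_less[of s t2] ram.lim_ge unfolding induced_path_def by simp
  then have "(\<forall>t2<ram.L. induced_path s t1 t2 \<longrightarrow> \<not> solvable (far s t1 t2) {s, t1, t2}) = (\<forall>t2. induced_path s t1 t2 \<longrightarrow> \<not> solvable (far s t1 t2) {s, t1, t2})"
    by blast
  then show "put \<tau> 3 0 0 (\<sigma> 3 0 0) 0 0 0 = of_bool (\<Phi> \<and> (\<forall>t2. induced_path s t1 t2 \<longrightarrow> \<not> solvable (far s t1 t2) {s, t1, t2}))"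
    using I by (simp add: ram.put_other)
next
  fix k and \<tau> :: store assume "k < ram.L" and I: "\<tau> 1 0 0 = s \<and> \<tau> 2 0 0 = t1 \<and> \<tau> 0 0 0 = of_bool (\<Phi> \<and> (\<forall>t2<k. induced_path s t1 t2 \<longrightarrow> \<not> solvable (far s t1 t2) {s, t1, t2}))"
  let ?\<rho> = "put \<tau> 3 0 0 k"
  let ?\<tau> = "ram.sem (Iff (Conj (Ad (Var 1) (Var 3)) (Conj (Neg (Eq (Var 2) (Var 3))) (Neg (Ad (Var 2) (Var 3))))) (p_check farE) Nop) ?\<rho>"
  have \<rho>: "?\<rho> 1 0 0 = s" "?\<rho> 2 0 0 = t1" "?\<rho> 3 0 0 = k" "?\<rho> 0 = \<tau> 0" using I by (simp_all add: ram.put_other)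
  have cond: "(ram.ev (Conj (Ad (Var 1) (Var 3)) (Conj (Neg (Eq (Var 2) (Var 3))) (Neg (Ad (Var 2) (Var 3))))) ?\<rho> = 0) = (\<not> induced_path s t1 k)"
    unfolding induced_path_def using \<rho> c(4) by simp
  have keep: "?\<tau> 1 = ?\<rho> 1" "?\<tau> 2 = ?\<rho> 2" using writes_check[of farE] by (auto simp: ram.frame)
  have "?\<tau> 0 0 0 = of_bool (\<Phi> \<and> (\<forall>t2<Suc k. induced_path s t1 t2 \<longrightarrow> \<not> solvable (far s t1 t2) {s, t1, t2}))"
  proof (cases "induced_path s t1 k")
    case True
    have "ram.sem (p_check farE) ?\<rho> 0 0 0 = (if solvable (far s t1 k) {s, t1, k} then 0 else ?\<rho> 0 0 0)"
    proof (rule check[where \<sigma> = ?\<rho> and s = s, OF \<rho>(1-3) _ cf far_dom[OF True]])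
      show "ram.ev farE (put \<tau> 5 0 0 x) = of_bool (x \<in> far s t1 k)" if "\<tau> 1 0 0 = s" "\<tau> 2 0 0 = t1" "\<tau> 3 0 0 = k" for \<tau> x
        using that unfolding far_def by (simp add: ram.put_other)
    qed
    then show ?thesis using cond True I \<rho>(4) by (auto simp: less_Suc_eq)
  next
    case False
    then show ?thesis using cond I \<rho>(4) by (auto simp: less_Suc_eq)
  qed
  then show "?\<tau> 1 0 0 = s \<and> ?\<tau> 2 0 0 = t1 \<and> ?\<tau> 0 0 0 = of_bool (\<Phi> \<and> (\<forall>t2<Suc k. induced_path s t1 t2 \<longrightarrow> \<not> solvable (far s t1 t2) {s, t1, t2}))"
    using keep \<rho> by simp
qed

lemma writes_paths: "1 \<notin> writes p_ends2" "2 \<notin> writes p_ends2" "1 \<notin> writes p_paths"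
  using writes_check[of farE] unfolding p_paths_def p_ends2_def by auto

lemma paths:
  assumes cf: "claw_free {..<n} E" and c: "\<sigma> 1 0 0 = s" "\<sigma> 0 0 0 = of_bool \<Phi>"
  shows "ram.sem p_paths \<sigma> 0 0 0 = of_bool (\<Phi> \<and> (\<forall>t1 t2. induced_path s t1 t2 \<longrightarrow> \<not> solvable (far s t1 t2) {s, t1, t2}))"
  unfolding p_paths_def
proof (rule ram.sem_For[where I = "\<lambda>k \<tau>. \<tau> 1 0 0 = s \<and>
    \<tau> 0 0 0 = of_bool (\<Phi> \<and> (\<forall>t1<k. \<forall>t2. induced_path s t1 t2 \<longrightarrow> \<not> solvable (far s t1 t2) {s, t1, t2}))"])
  show "\<sigma> 1 0 0 = s \<and> \<sigma> 0 0 0 = of_bool (\<Phi> \<and> (\<forall>t1<0. \<forall>t2. induced_path s t1 t2 \<longrightarrow> \<not> solvable (far s t1 t2) {s, t1, t2}))"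
    using c by simp
next
  fix \<tau> :: store assume I: "\<tau> 1 0 0 = s \<and> \<tau> 0 0 0 = of_bool (\<Phi> \<and> (\<forall>t1<ram.L. \<forall>t2. induced_path s t1 t2 \<longrightarrow> \<not> solvable (far s t1 t2) {s, t1, t2}))"
  have "t1 < ram.L" if "induced_path s t1 t2" for t1 t2 using that ad_less[of s t1] ram.lim_ge unfolding induced_path_def by simp
  then have "(\<forall>t1<ram.L. \<forall>t2. induced_path s t1 t2 \<longrightarrow> \<not> solvable (far s t1 t2) {s, t1, t2}) = (\<forall>t1 t2. induced_path s t1 t2 \<longrightarrow> \<not> solvable (far s t1 t2) {s, t1, t2})"
    by blast
  then show "put \<tau> 2 0 0 (\<sigma> 2 0 0) 0 0 0 = of_bool (\<Phi> \<and> (\<forall>t1 t2. induced_path s t1 t2 \<longrightarrow> \<not> solvable (far s t1 t2) {s, t1, t2}))"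
    using I by (simp add: ram.put_other)
next
  fix k and \<tau> :: store assume "k < ram.L" and I: "\<tau> 1 0 0 = s \<and> \<tau> 0 0 0 = of_bool (\<Phi> \<and> (\<forall>t1<k. \<forall>t2. induced_path s t1 t2 \<longrightarrow> \<not> solvable (far s t1 t2) {s, t1, t2}))"
  let ?\<rho> = "put \<tau> 2 0 0 k"
  let ?\<tau> = "ram.sem (Iff (Ad (Var 1) (Var 2)) p_ends2 Nop) ?\<rho>"
  have \<rho>: "?\<rho> 1 0 0 = s" "?\<rho> 2 0 0 = k" "?\<rho> 0 = \<tau> 0" using I by (simp_all add: ram.put_other)
  have cond: "(ram.ev (Ad (Var 1) (Var 2)) ?\<rho> = 0) = (\<not> ad s k)" using \<rho> by simp
  have keep: "?\<tau> 1 = ?\<rho> 1" using writes_paths by (auto simp: ram.frame)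
  have "?\<tau> 0 0 0 = of_bool (\<Phi> \<and> (\<forall>t1<Suc k. \<forall>t2. induced_path s t1 t2 \<longrightarrow> \<not> solvable (far s t1 t2) {s, t1, t2}))"
  proof (cases "ad s k")
    case True
    have "ram.sem p_ends2 ?\<rho> 0 0 0 = of_bool ((\<Phi> \<and> (\<forall>t1<k. \<forall>t2. induced_path s t1 t2 \<longrightarrow> \<not> solvable (far s t1 t2) {s, t1, t2})) \<and>
        (\<forall>t2. induced_path s k t2 \<longrightarrow> \<not> solvable (far s k t2) {s, k, t2}))"
      by (rule ends2[where \<sigma> = ?\<rho> and s = s, OF cf \<rho>(1,2) _ True]) (use I \<rho>(3) in simp)
    then show ?thesis using cond True by (auto simp: less_Suc_eq)
  next
    case False
    then have "\<not> induced_path s k t2" for t2 unfolding induced_path_def by blast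
    then have "(\<forall>t1<Suc k. \<forall>t2. induced_path s t1 t2 \<longrightarrow> \<not> solvable (far s t1 t2) {s, t1, t2}) =
        (\<forall>t1<k. \<forall>t2. induced_path s t1 t2 \<longrightarrow> \<not> solvable (far s t1 t2) {s, t1, t2})" by (auto simp: less_Suc_eq)
    moreover have "?\<tau> = ?\<rho>" using cond False by simp
    ultimately show ?thesis using I \<rho>(3) by (simp only:)
  qed
  then show "?\<tau> 1 0 0 = s \<and> ?\<tau> 0 0 0 = of_bool (\<Phi> \<and> (\<forall>t1<Suc k. \<forall>t2. induced_path s t1 t2 \<longrightarrow> \<not> solvable (far s t1 t2) {s, t1, t2}))"
    using keep \<rho> by simp
qed

definition seed_ok :: "nat \<Rightarrow> bool" where
  "seed_ok s \<longleftrightarrow> \<not> solvable {x. ad s x} {s} \<and> (\<forall>t1 t2. induced_path s t1 t2 \<longrightarrow> \<not> solvable (far s t1 t2) {s, t1, t2})"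

lemma seeds:
  assumes cf: "claw_free {..<n} E" and c: "\<sigma> 0 0 0 = 1"
  shows "ram.sem p_seeds \<sigma> 0 0 0 = of_bool (\<forall>s<n. seed_ok s)"
  unfolding p_seeds_def
proof (rule ram.sem_For[where I = "\<lambda>k \<tau>. \<tau> 0 0 0 = of_bool (\<forall>s<min k n. seed_ok s)"])
  show "\<sigma> 0 0 0 = of_bool (\<forall>s<min 0 n. seed_ok s)" using c by simp
  show "put \<tau> 1 0 0 (\<sigma> 1 0 0) 0 0 0 = of_bool (\<forall>s<n. seed_ok s)" if "\<tau> 0 0 0 = of_bool (\<forall>s<min ram.L n. seed_ok s)" for \<tau> :: store
    using that ram.lim_ge by (simp add: ram.put_other min_absorb2)
  fix k and \<tau> :: store assume I: "\<tau> 0 0 0 = of_bool (\<forall>s<min k n. seed_ok s)"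
  let ?\<rho> = "put \<tau> 1 0 0 k"
  define \<rho>1 where "\<rho>1 = put (put ?\<rho> 2 0 0 k) 3 0 0 k"
  have \<rho>1: "\<rho>1 1 0 0 = k" "\<rho>1 2 0 0 = k" "\<rho>1 3 0 0 = k" "\<rho>1 0 = \<tau> 0" unfolding \<rho>1_def by (simp_all add: ram.put_other)
  have sem: "ram.sem (Iff (Lt (Var 1) NV) (block [Set 2 (Var 1), Set 3 (Var 1), p_check nbhE, p_paths]) Nop) ?\<rho> =
    (if k < n then ram.sem p_paths (ram.sem (p_check nbhE) \<rho>1) else ?\<rho>)"
    unfolding \<rho>1_def by (simp add: ram.put_other)
  show "ram.sem (Iff (Lt (Var 1) NV) (block [Set 2 (Var 1), Set 3 (Var 1), p_check nbhE, p_paths]) Nop) ?\<rho> 0 0 0 =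
    of_bool (\<forall>s<min (Suc k) n. seed_ok s)"
  proof (cases "k < n")
    case True
    have "ram.sem (p_check nbhE) \<rho>1 0 0 0 = (if solvable {x. ad k x} {k, k, k} then 0 else \<rho>1 0 0 0)"
    proof (rule check[where \<sigma> = \<rho>1 and s = k, OF \<rho>1(1-3) _ cf])
      show "ram.ev nbhE (put \<tau> 5 0 0 x) = of_bool (x \<in> {x. ad k x})" if "\<tau> 1 0 0 = k" for \<tau> x
        using that by (simp add: ram.put_other)
    qed auto
    then have 0: "ram.sem (p_check nbhE) \<rho>1 0 0 0 = of_bool ((\<forall>s<k. seed_ok s) \<and> \<not> solvable {x. ad k x} {k})"
      using I \<rho>1(4) True by (simp add: min_absorb1)
    have 1: "ram.sem (p_check nbhE) \<rho>1 1 0 0 = k" using ram.frame[of 1 "p_check nbhE" \<rho>1] writes_check[of nbhE] \<rho>1(1) by auto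
    have "(\<forall>s<min (Suc k) n. seed_ok s) = ((\<forall>s<k. seed_ok s) \<and> seed_ok k)" using True by (auto simp: min_def less_Suc_eq)
    then show ?thesis unfolding sem using True paths[where s = k and \<sigma> = "ram.sem (p_check nbhE) \<rho>1", OF cf 1 0] unfolding seed_ok_def by simp
  next
    case False
    then have "min (Suc k) n = n" "min k n = n" by auto
    then show ?thesis unfolding sem using False I by (simp add: ram.put_other)
  qed
qed

end

section \<open>Correctness and running time of the whole program\<close>

context claw_free_graph
begin

lemma isolated: "(ram.ev isolatedE \<sigma> \<noteq> 0) = (\<exists>s<n. nbh s = {})"
proof -
  have "x < ram.L" if "ad w x" for w x using ad_less[OF that] ram.lim_ge by simp
  then have "(\<exists>x<ram.L. ad w x) = (nbh w \<noteq> {})" for w unfolding nbh_def by blast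
  then have "(\<exists>k<ram.L. k < n \<and> \<not> (\<exists>x<ram.L. ad k x)) = (\<exists>s<n. nbh s = {})"
    using ram.lim_ge(2) by (metis less_trans)
  then show ?thesis unfolding isolatedE_def by (simp add: ram.put_other)
qed

lemma main:
  "ram.sem p_main (\<lambda>_ _ _. 0) 0 0 0 = of_bool (W2 {..<n} E)"
proof -
  have W: "W2 {..<n} E \<longleftrightarrow> (\<forall>s<n. seed_ok s)"
  proof -
    have "induced_path s t1 t2 \<Longrightarrow> s < n" for s t1 t2 unfolding induced_path_def using ad_less by blast
    then show ?thesis unfolding W2_iff seed_ok_def by blast
  qed
  let ?s = "put (\<lambda>_ _ _. 0) 0 0 0 (1::nat)"
  have iso: "(ram.ev isolatedE ?s \<noteq> 0) = (\<exists>s<n. nbh s = {})" by (rule isolated)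
  have "ram.sem (Set 0 (Cst 1)) (\<lambda>_ _ _. 0) = ?s" by simp
  then have sem: "ram.sem p_main (\<lambda>_ _ _. 0) = (if ram.ev isolatedE ?s = 0 then ram.sem p_seeds ?s else put ?s 0 0 0 0)"
    unfolding p_main_def ram.sem.simps(3,4) by simp
  show ?thesis
  proof (cases "\<exists>s<n. nbh s = {}")
    case True
    then obtain s where s: "s < n" "nbh s = {}" by blast
    have "ind {}" unfolding ind_def by simp
    then have "solvable {x. ad s x} {s}" unfolding solvable_def using s(2) unfolding nbh_def by (intro exI[of _ "{}"]) simp
    then have "\<not> W2 {..<n} E" unfolding W seed_ok_def using s(1) by blast
    then show ?thesis using iso True unfolding sem by simp
  next
    case False
    then have "ram.ev isolatedE ?s = 0" using iso by blast
    moreover have "ram.sem p_seeds ?s 0 0 0 = of_bool (\<forall>s<n. seed_ok s)" by (rule seeds[OF claw_free]) simp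
    ultimately show ?thesis unfolding sem W by (simp only: if_True simp_thms)
  qed
qed

definition check_cost :: nat where
  "check_cost = (cconst (p_check nbhE) + cconst (p_check farE)) * Suc ram.L ^ 3"

lemma cost_check: "d = nbhE \<or> d = farE \<Longrightarrow> ram.cost (p_check d) \<sigma> \<le> check_cost"
proof -
  assume d: "d = nbhE \<or> d = farE"
  then have "edep d = 0" by (auto simp: Conj_def Disj_def Neg_def)
  then have "cconst (p_check d) * Suc ram.L ^ cdep (p_check d) \<le> cconst (p_check d) * Suc ram.L ^ 3"
    using dep_check by (intro mult_le_mono2 power_increasing) auto
  also have "\<dots> \<le> check_cost" unfolding check_cost_def using d by (intro mult_le_mono1) auto
  finally show ?thesis using ram.cost_le[of "p_check d" \<sigma>] by simp
qed

lemma sum_nbh: "(\<Sum>k<ram.L. c + of_bool (ad s k) * C) = ram.L * c + card (nbh s) * (C::nat)"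
proof -
  have "u < ram.L" if "ad s u" for u using ad_less[OF that] ram.lim_ge by simp
  then have "{k. k < ram.L \<and> ad s k} = nbh s" unfolding nbh_def by blast
  moreover have "(\<Sum>k<ram.L. of_bool (ad s k) :: nat) = card ({..<ram.L} \<inter> {k. ad s k})" by simp
  moreover have "{..<ram.L} \<inter> {k. ad s k} = {k. k < ram.L \<and> ad s k}" by auto
  ultimately show ?thesis by (simp add: sum.distrib flip: sum_distrib_right)
qed

lemma cost_ends2: "\<sigma> 1 0 0 = s \<Longrightarrow> ram.cost p_ends2 \<sigma> \<le> 1010 * Suc ram.L + card (nbh s) * check_cost"
proof -
  assume s: "\<sigma> 1 0 0 = s"
  \<comment> \<open>\<open>900\<close> exceeds the cost of the test and of skipping; the cubic check
    is charged only to neighbours of \<open>s\<close>.\<close>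
  have "ram.cost p_ends2 \<sigma> \<le> (\<Sum>k<ram.L. 900 + of_bool (ad s k) * check_cost) + 10 * ram.L + 20"
    unfolding p_ends2_def
  proof (rule ram.cost_For_le)
    fix k and \<tau> :: store assume fr: "\<And>a. a \<notin> writes (Iff (Conj (Ad (Var 1) (Var 3)) (Conj (Neg (Eq (Var 2) (Var 3))) (Neg (Ad (Var 2) (Var 3))))) (p_check farE) Nop) \<Longrightarrow> a \<noteq> 3 \<Longrightarrow> \<tau> a = \<sigma> a"
    have 1: "\<tau> 1 = \<sigma> 1" using fr[of 1] writes_check[of farE] by auto
    let ?b = "Conj (Ad (Var 1) (Var 3)) (Conj (Neg (Eq (Var 2) (Var 3))) (Neg (Ad (Var 2) (Var 3))))"
    have b: "ram.ecost ?b \<le> 800" unfolding Conj_def Neg_def by simp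
    have "ram.ev ?b (put \<tau> 3 0 0 k) = 0" if "\<not> ad s k" using that 1 s by (simp add: ram.put_other)
    then show "ram.cost (Iff ?b (p_check farE) Nop) (put \<tau> 3 0 0 k) \<le> 900 + of_bool (ad s k) * check_cost"
      using b cost_check[of farE "put \<tau> 3 0 0 k"] by (cases "ad s k") auto
  qed
  then show ?thesis unfolding sum_nbh by simp
qed

lemma cost_paths: "\<sigma> 1 0 0 = s \<Longrightarrow> ram.cost p_paths \<sigma> \<le> 110 * Suc ram.L + card (nbh s) * (1010 * Suc ram.L + card (nbh s) * check_cost)"
proof -
  assume s: "\<sigma> 1 0 0 = s"
  let ?C = "1010 * Suc ram.L + card (nbh s) * check_cost"
  have "ram.cost p_paths \<sigma> \<le> (\<Sum>k<ram.L. 90 + of_bool (ad s k) * ?C) + 10 * ram.L + 20"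
    unfolding p_paths_def
  proof (rule ram.cost_For_le)
    fix k and \<tau> :: store assume fr: "\<And>a. a \<notin> writes (Iff (Ad (Var 1) (Var 2)) p_ends2 Nop) \<Longrightarrow> a \<noteq> 2 \<Longrightarrow> \<tau> a = \<sigma> a"
    have 1: "\<tau> 1 = \<sigma> 1" using fr[of 1] writes_paths by auto
    have b: "ram.ecost (Ad (Var 1) (Var 2)) \<le> 50" by simp
    have "ram.ev (Ad (Var 1) (Var 2)) (put \<tau> 2 0 0 k) = of_bool (ad s k)" using 1 s by (simp add: ram.put_other)
    moreover have "ram.cost p_ends2 (put \<tau> 2 0 0 k) \<le> ?C" by (rule cost_ends2) (use 1 s in \<open>simp add: ram.put_other\<close>)
    ultimately show "ram.cost (Iff (Ad (Var 1) (Var 2)) p_ends2 Nop) (put \<tau> 2 0 0 k) \<le> 90 + of_bool (ad s k) * ?C"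
      using b by (cases "ad s k") auto
  qed
  then show ?thesis unfolding sum_nbh by simp
qed

lemma cost_seeds: "ram.cost p_seeds \<sigma> \<le> 110 * Suc ram.L + (\<Sum>s<n. 200 + check_cost + 110 * Suc ram.L +
   card (nbh s) * (1010 * Suc ram.L + card (nbh s) * check_cost))"
proof -
  let ?C = "\<lambda>s. 200 + check_cost + 110 * Suc ram.L + card (nbh s) * (1010 * Suc ram.L + card (nbh s) * check_cost)"
  have "ram.cost p_seeds \<sigma> \<le> (\<Sum>k<ram.L. 90 + of_bool (k < n) * ?C k) + 10 * ram.L + 20"
    unfolding p_seeds_def
  proof (rule ram.cost_For_le)
    fix k and \<tau> :: store
    let ?\<rho> = "put \<tau> 1 0 0 k"
    define \<rho>1 where "\<rho>1 = put (put ?\<rho> 2 0 0 k) 3 0 0 k"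
    have 1: "ram.sem (p_check nbhE) \<rho>1 1 0 0 = k"
      using ram.frame[of 1 "p_check nbhE" \<rho>1] writes_check[of nbhE] unfolding \<rho>1_def by (auto simp: ram.put_other)
    have "ram.cost (block [Set 2 (Var 1), Set 3 (Var 1), p_check nbhE, p_paths]) ?\<rho> \<le>
        100 + ram.cost (p_check nbhE) \<rho>1 + ram.cost p_paths (ram.sem (p_check nbhE) \<rho>1)"
      unfolding \<rho>1_def by (simp add: ram.put_other)
    moreover have "ram.cost (p_check nbhE) \<rho>1 \<le> check_cost" by (rule cost_check) simp
    moreover note cost_paths[where s = k and \<sigma> = "ram.sem (p_check nbhE) \<rho>1", OF 1]
    ultimately have "ram.cost (block [Set 2 (Var 1), Set 3 (Var 1), p_check nbhE, p_paths]) ?\<rho> \<le> ?C k" by linarith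
    then show "ram.cost (Iff (Lt (Var 1) NV) (block [Set 2 (Var 1), Set 3 (Var 1), p_check nbhE, p_paths]) Nop) ?\<rho> \<le> 90 + of_bool (k < n) * ?C k"
      by (cases "k < n") (simp_all add: ram.put_other)
  qed
  moreover have "(\<Sum>k<ram.L. 90 + of_bool (k < n) * ?C k) = 90 * ram.L + (\<Sum>s<n. ?C s)"
  proof -
    have "(\<Sum>k<ram.L. of_bool (k < n) * ?C k) = (\<Sum>k\<in>{..<ram.L} \<inter> {k. k < n}. ?C k)"
      unfolding sum.inter_restrict[OF finite_lessThan] by (intro sum.cong) auto
    also have "{..<ram.L} \<inter> {k. k < n} = {..<n}" using ram.lim_ge by auto
    finally show ?thesis by (simp add: sum.distrib)
  qed
  ultimately show ?thesis by simp
qed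

lemma sqrt_bounds: "real m \<le> real (max 1 m) powr (3/2)" "1 \<le> real (max 1 m) powr (3/2)"
proof -
  have 1: "1 \<le> real (max 1 m)" by simp
  have "real (max 1 m) powr 1 \<le> real (max 1 m) powr (3/2)" using 1 by (intro powr_mono) auto
  then show "real m \<le> real (max 1 m) powr (3/2)" "1 \<le> real (max 1 m) powr (3/2)" using 1 by auto
qed

text \<open>The number of cubic checks is at most the number of vertices plus the sum of the squared
  degrees. The former is linear in the number of edges when nothing is isolated, the latter is
  bounded by \<open>path_count\<close>; the surrounding loops contribute lower-order terms.\<close>

lemma cost_main:
  "real (ram.cost p_main (\<lambda>_ _ _. 0)) \<le> real (10000 + 20 * (cconst (p_check nbhE) + cconst (p_check farE)) + econst isolatedE) *
     (real (Suc ram.L ^ 3) * real (max 1 (card E)) powr (3/2))"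
proof -
  let ?s = "put (\<lambda>_ _ _. 0) 0 0 0 (1::nat)"
  define B where "B = Suc ram.L"
  define K where "K = cconst (p_check nbhE) + cconst (p_check farE)"
  define T where "T = real (max 1 (card E)) powr (3/2)"
  have T: "real (card E) \<le> T" "1 \<le> T" unfolding T_def using sqrt_bounds by auto
  have cc: "check_cost = K * B ^ 3" unfolding check_cost_def K_def B_def ..
  have B: "1 \<le> B" unfolding B_def by simp
  have pw: "B ^ i \<le> B ^ 3" if "i \<le> 3" for i using that B by (intro power_increasing) auto
  have B1: "B \<le> B ^ 3" "1 \<le> B ^ 3" "B ^ 2 \<le> B ^ 3" using pw[of 1] pw[of 0] pw[of 2] by auto
  have e: "ram.ecost isolatedE \<le> econst isolatedE * B ^ 3"
  proof -
    have "edep isolatedE = 2" unfolding isolatedE_def Exi_def Conj_def Neg_def by simp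
    then have "ram.ecost isolatedE \<le> econst isolatedE * B ^ 2" using ram.ecost_le[of isolatedE] unfolding B_def by simp
    also have "\<dots> \<le> econst isolatedE * B ^ 3" using B1 by simp
    finally show ?thesis .
  qed
  have iso: "(ram.ev isolatedE ?s \<noteq> 0) = (\<exists>s<n. nbh s = {})" by (rule isolated)
  have sem: "ram.sem (Set 0 (Cst 1)) (\<lambda>_ _ _. 0) = ?s" by simp
  have "ram.cost p_main (\<lambda>_ _ _. 0) = 13 + (ram.ecost isolatedE + 10 + (if ram.ev isolatedE ?s = 0 then ram.cost p_seeds ?s else 13))"
    unfolding p_main_def ram.cost.simps(3,4) sem by simp
  also have "real \<dots> \<le> real (10000 + 20 * K + econst isolatedE) * (real (B ^ 3) * T)"
  proof (cases "\<exists>s<n. nbh s = {}")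
    case True
    then have "13 + (ram.ecost isolatedE + 10 + (if ram.ev isolatedE ?s = 0 then ram.cost p_seeds ?s else 13)) = ram.ecost isolatedE + 36"
      using iso by simp
    also have "\<dots> \<le> (36 + econst isolatedE) * B ^ 3" using e B1(2) by (simp add: add_mult_distrib)
    also have "\<dots> \<le> (10000 + 20 * K + econst isolatedE) * B ^ 3" by (intro mult_le_mono1) simp
    finally have "real (13 + (ram.ecost isolatedE + 10 + (if ram.ev isolatedE ?s = 0 then ram.cost p_seeds ?s else 13))) \<le>
        real ((10000 + 20 * K + econst isolatedE) * B ^ 3)" by (rule of_nat_mono)
    also have "\<dots> = real (10000 + 20 * K + econst isolatedE) * real (B ^ 3)" by (rule of_nat_mult)
    also have "\<dots> \<le> real (10000 + 20 * K + econst isolatedE) * (real (B ^ 3) * T)"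
      using T(2) by (intro mult_left_mono) (simp_all add: mult_le_cancel_left1)
    finally show ?thesis .
  next
    case False
    \<comment> \<open>All degrees are positive, so the degree sum bounds the number of
      vertices.\<close>
    then have "card (nbh s) \<ge> 1" if "s < n" for s using that nbh(2)[of s] by (auto simp: Suc_le_eq card_gt_0_iff)
    then have "(\<Sum>s<n. 1) \<le> (\<Sum>s<n. card (nbh s))" by (intro sum_mono) auto
    then have n: "n \<le> 2 * card E" using degree_sum by simp
    have "ram.cost p_seeds ?s \<le> 110 * B + (\<Sum>s<n. 200 + K * B ^ 3 + 110 * B + card (nbh s) * (1010 * B + card (nbh s) * (K * B ^ 3)))"
      using cost_seeds unfolding cc B_def .
    also have "\<dots> = 110 * B + n * (200 + K * B ^ 3 + 110 * B) + (\<Sum>s<n. card (nbh s)) * (1010 * B) + (\<Sum>s<n. (card (nbh s))\<^sup>2) * (K * B ^ 3)"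
      by (simp add: sum.distrib add_mult_distrib2 sum_distrib_right power2_eq_square mult.assoc)
    also have "\<dots> \<le> 110 * B ^ 3 + n * (200 * B ^ 3 + K * B ^ 3 + 110 * B ^ 3) + (2 * card E) * (1010 * B ^ 3) + (\<Sum>s<n. (card (nbh s))\<^sup>2) * (K * B ^ 3)"
      using B1 degree_sum by (intro add_mono mult_le_mono le_refl) auto
    also have "\<dots> \<le> 110 * B ^ 3 + (2 * card E) * (200 * B ^ 3 + K * B ^ 3 + 110 * B ^ 3) + (2 * card E) * (1010 * B ^ 3) + (\<Sum>s<n. (card (nbh s))\<^sup>2) * (K * B ^ 3)"
      using n by (intro add_mono mult_le_mono1 le_refl)
    finally have c: "ram.cost p_seeds ?s \<le> (110 + card E * (2640 + 2 * K) + (\<Sum>s<n. (card (nbh s))\<^sup>2) * K) * B ^ 3"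
      by (simp add: algebra_simps)
    define S where "S = (\<Sum>s<n. (card (nbh s))\<^sup>2)"
    have S: "real S \<le> 10 * T"
    proof -
      have "real (card E) powr (3/2) \<le> T" unfolding T_def by (intro powr_mono2) auto
      then show ?thesis using path_count unfolding S_def by linarith
    qed
    have "13 + (ram.ecost isolatedE + 10 + ram.cost p_seeds ?s) \<le> (133 + econst isolatedE + card E * (2640 + 2 * K) + S * K) * B ^ 3"
      using e c B1(2) unfolding S_def add_mult_distrib by linarith
    then have "real (13 + (ram.ecost isolatedE + 10 + ram.cost p_seeds ?s)) \<le>
        real ((133 + econst isolatedE + card E * (2640 + 2 * K) + S * K) * B ^ 3)" by (rule of_nat_mono)
    also have "\<dots> = (133 + real (econst isolatedE) + real (card E) * (2640 + 2 * real K) + real S * real K) * real (B ^ 3)" by simp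
    also have "\<dots> \<le> (133 * T + real (econst isolatedE) * T + T * (2640 + 2 * real K) + (10 * T) * real K) * real (B ^ 3)"
      using T S by (intro mult_right_mono add_mono) (simp_all add: mult_le_cancel_left1)
    also have "\<dots> = (2773 + real (econst isolatedE) + 12 * real K) * (real (B ^ 3) * T)" by (simp add: algebra_simps)
    also have "\<dots> \<le> real (10000 + 20 * K + econst isolatedE) * (real (B ^ 3) * T)"
      using T by (intro mult_right_mono) auto
    finally show ?thesis using iso False by simp
  qed
  finally show ?thesis unfolding K_def B_def T_def .
qed

end

theorem theorem4p3:
  "\<exists>p. decides_in_bigo p claw_free W2 (\<lambda>n m. real m powr (3/2) * real n ^ 3)"
proof -
  define C where "C = real (10000 + 20 * (cconst (p_check nbhE) + cconst (p_check farE)) + econst isolatedE)"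
  have "\<exists>t. runs_on 14 (main_com p_main) n E t (W2 {..<n} E) \<and>
      real t \<le> (20 + C * 2197) * (real (max 1 (card E)) powr (3/2) * real (max 1 n) ^ 3)"
    if g: "simple_graph {..<n} E" and cf: "claw_free {..<n} E" for n and E :: "nat set set"
  proof -
    interpret claw_free_graph n E by unfold_locales (rule g cf)+
    obtain t where t: "runs_on 14 (main_com p_main) n E t (W2 {..<n} E)" "t \<le> ram.cost p_main (\<lambda>_ _ _. 0) + 20"
      using main_runs[OF g ok_main main] by blast
    define T where "T = real (max 1 (card E)) powr (3/2)"
    define N where "N = real (max 1 n)"
    have T: "1 \<le> T" unfolding T_def using sqrt_bounds(2) .
    have N: "1 \<le> N" unfolding N_def by simp
    \<comment> \<open>\<open>Suc ram.L\<close> is \<open>4 * n + 9\<close>, at most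
      \<open>13\<close> times \<open>max 1 n\<close>; the cube of \<open>13\<close> is
      \<open>2197\<close>.\<close>
    have "real (Suc ram.L) \<le> 13 * N" unfolding lim_def N_def by simp
    then have "real (Suc ram.L) ^ 3 \<le> (13 * N) ^ 3" by (intro power_mono) auto
    then have B: "real (Suc ram.L ^ 3) \<le> 2197 * N ^ 3" by (simp add: power_mult_distrib)
    have C: "0 \<le> C" unfolding C_def by simp
    have "real t \<le> 20 + C * (real (Suc ram.L ^ 3) * T)" using t(2) cost_main unfolding C_def T_def by linarith
    also have "\<dots> \<le> 20 * (T * N ^ 3) + C * ((2197 * N ^ 3) * T)"
    proof (intro add_mono mult_left_mono mult_right_mono B C)
      have "1 * 1 \<le> T * N ^ 3" using T N by (intro mult_mono one_le_power) auto
      then show "20 \<le> 20 * (T * N ^ 3)" by simp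
    qed (use T in simp)
    also have "\<dots> = (20 + C * 2197) * (T * N ^ 3)" by (simp add: algebra_simps)
    finally show ?thesis using t(1) unfolding T_def N_def by blast
  qed
  then show ?thesis unfolding decides_in_bigo_def by blast
qed

end
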